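(* Let $1<p_i<2$ for all $i=1,\dots,N$ and let $u$ be a non-negative local weak solution in $\Omega_T$ to $\partial_t u-\operatorname{div}A(x,t,u,Du)=B(x,t,u,Du)$ under the structure conditions with constants $C_o,C_1>0$, $C\ge 0$. There exists a positive constant $\gamma$ depending only on the data $\{N,p_i,C_o,C_1\}$ such that the following holds. Let $t,\rho>0$ be such that $\mathcal K_{2\rho}(t)\times[0,t]\subset\Omega_T$, and set $\nu=\left(\frac{t}{\rho^p}\right)^{\frac1{2-p}}$ and $\lambda=N(p-2)+p$. Then either there exists an index $i\in\{1,\dots,N\}$ for which $$C^{p_i}\rho^p>\min\{1,\nu^{p-p_i},\nu^p\},$$ or $$\sup_{0\le\tau\le t}\int_{\mathcal K_\rho(t)}u(x,\tau)\,dx\le\gamma\inf_{0\le\tau\le t}\int_{\mathcal K_{2\rho}(t)}u(x,\tau)\,dx+\gamma\left(\frac{t}{\rho^\lambda}\right)^{\frac1{2-p}}.$$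
   Context: Setting. $\Omega\subset\mathbb R^N$ is open and bounded, $T>0$, $\Omega_T=\Omega\times[0,T]$. Exponents $1<p_1\le\dots\le p_N<2$; $p=N/\big(\sum_{i=1}^N 1/p_i\big)$ is their harmonic mean, with $p<N$. Equation. $\partial_t u-\operatorname{div}A(x,t,u,Du)=B(x,t,u,Du)$ in $\Omega_T$, where $A=(A_1,\dots,A_N):\Omega_T\times\mathbb R^{N+1}\to\mathbb R^N$ and $B:\Omega_T\times\mathbb R^{N+1}\to\mathbb R$ are Carathéodory functions satisfying, for a.e. $(x,t)\in\Omega_T$, all $(s,\xi)\in\mathbb R\times\mathbb R^N$ and all $i$, the structure conditions $A_i(x,t,s,\xi)\xi_i\ge C_o|\xi_i|^{p_i}-C^{p_i}$, $|A_i(x,t,s,\xi)|\le C_1|\xi_i|^{p_i-1}+C^{p_i-1}$, $|B(x,t,s,\xi)|\le\sum_{i=1}^N C(|\xi_i|^{p_i-1}+C^{p_i-1})$, with constants $C_o,C_1>0$, $C\ge0$. Function spaces. $W^{1,\mathbf p}_{o}(\Omega)=\{u\in W^{1,1}_o(\Omega):\partial_iu\in L^{p_i}_{loc}(\Omega)\}$ and $W^{1,\mathbf p}_{loc}(\Omega)=\{u\in W^{1,1}_{loc}(\Omega):\partial_iu\in L^{p_i}_{loc}(\Omega)\}$; $L^{\mathbf p}_{loc}(0,T;W^{1,\mathbf p}_{loc}(\Omega))$ (resp. with $W^{1,\mathbf p}_o$) is the set of $u\in L^1_{loc}(0,T;W^{1,1}_{loc}(\Omega))$ (resp. $W^{1,1}_o$)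 with $\partial_iu\in L^{p_i}_{loc}(0,T;L^{p_i}_{loc}(\Omega))$ for all $i$. Weak solutions. A local weak sub(super)-solution is $u\in C(0,T;L^2_{loc}(\Omega))\cap L^{\mathbf p}_{loc}(0,T;W^{1,\mathbf p}_{loc}(\Omega))$ (continuity understood as a map $[0,T]\to L^2_{loc}(\Omega)$) such that for all $0\le t_1\le t_2\le T$ and all compact $K\subset\subset\Omega$, $$\int_K u\varphi\,dx\Big|_{t_1}^{t_2}+\int_{t_1}^{t_2}\!\!\int_K\Big\{-u\,\partial_\tau\varphi+\sum_iA_i(x,\tau,u,Du)\,\partial_i\varphi\Big\}dx\,d\tau\le(\ge)\int_{t_1}^{t_2}\!\!\int_KB(x,\tau,u,Du)\varphi\,dx\,d\tau$$ for all non-negative $\varphi\in W^{1,2}_{loc}(0,T;L^2_{loc}(K))\cap L^{\mathbf p}_{loc}(0,T;W^{1,\mathbf p}_o(K))$. A local weak solution is both a sub- and a super-solution. Intrinsic cubes. For $a,\rho,t>0$, $\mathcal K_{a\rho}(t)=\prod_{i=1}^N\big\{|x_i|<a\,\rho^{\frac{p(2-p_i)}{p_i(2-p)}}\,t^{\frac{p_i-p}{(2-p)p_i}}\big\}$ (the factor $a$ multiplies each side; $|\mathcal K_\rho(t)|=(2\rho)^N$). *)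

theory Defs
  imports "HOL-Analysis.Analysis"
begin

section \<open>Lebesgue and Sobolev spaces\<close>

definition Lp_on :: "real \<Rightarrow> 'a::euclidean_space set \<Rightarrow> ('a \<Rightarrow> real) \<Rightarrow> bool" where
  "Lp_on q S f \<longleftrightarrow>
     set_borel_measurable lebesgue S f \<and> set_integrable lebesgue S (\<lambda>x. \<bar>f x\<bar> powr q)"

text \<open>For compact \<open>S\<close> this is the same as \<^const>\<open>Lp_on\<close>.\<close>

definition Lp_loc :: "real \<Rightarrow> 'a::euclidean_space set \<Rightarrow> ('a \<Rightarrow> real) \<Rightarrow> bool" where
  "Lp_loc q S f \<longleftrightarrow> (\<forall>K. compact K \<and> K \<subseteq> S \<longrightarrow> Lp_on q K f)"

definition dir_deriv :: "'a::euclidean_space \<Rightarrow> ('a \<Rightarrow> real) \<Rightarrow> 'a \<Rightarrow> real" where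
  "dir_deriv v f x = frechet_derivative f (at x) v"

primrec C_k :: "nat \<Rightarrow> ('a::euclidean_space \<Rightarrow> real) \<Rightarrow> bool" where
  "C_k 0 f \<longleftrightarrow> continuous_on UNIV f"
| "C_k (Suc k) f \<longleftrightarrow> (\<forall>x. f differentiable (at x)) \<and> (\<forall>b\<in>Basis. C_k k (dir_deriv b f))"

definition C_c_inf :: "'a::euclidean_space set \<Rightarrow> ('a \<Rightarrow> real) \<Rightarrow> bool" where
  "C_c_inf U \<phi> \<longleftrightarrow>
     (\<forall>k. C_k k \<phi>) \<and> compact (closure {x. \<phi> x \<noteq> 0}) \<and> closure {x. \<phi> x \<noteq> 0} \<subseteq> U"

text \<open>\<open>g\<close> is the weak derivative of \<open>f\<close> in the direction \<open>v\<close> on the open set \<open>U\<close>.\<close>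

definition weak_deriv ::
    "'a::euclidean_space \<Rightarrow> 'a set \<Rightarrow> ('a \<Rightarrow> real) \<Rightarrow> ('a \<Rightarrow> real) \<Rightarrow> bool" where
  "weak_deriv v U f g \<longleftrightarrow> Lp_loc 1 U f \<and> Lp_loc 1 U g \<and>
     (\<forall>\<phi>. C_c_inf U \<phi> \<longrightarrow>
        (LINT x:U|lebesgue. f x * dir_deriv v \<phi> x) = - (LINT x:U|lebesgue. g x * \<phi> x))"

text \<open>\<open>f \<in> W\<^sup>1\<^sup>,\<^sup>1\<^sub>l\<^sub>o\<^sub>c(\<Omega>)\<close> with weak gradient \<open>g\<close>.\<close>

definition W11_loc ::
    "(real^'n) set \<Rightarrow> (real^'n \<Rightarrow> real) \<Rightarrow> (real^'n \<Rightarrow> real^'n) \<Rightarrow> bool" where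
  "W11_loc \<Omega> f g \<longleftrightarrow> (\<forall>i. weak_deriv (axis i 1) \<Omega> f (\<lambda>x. g x $ i))"

text \<open>
  \<open>f \<in> W\<^sup>1\<^sup>,\<^sup>1\<^sub>o(S)\<close> with weak gradient \<open>g\<close>: the closure of \<open>C\<^sub>c\<^sup>\<infinity>\<close> in the \<open>W\<^sup>1\<^sup>,\<^sup>1\<close> norm. It is also
  needed for compact \<open>S\<close>, where the approximating functions are supported in the interior;
  as the norms are taken over all of \<open>S\<close>, both \<open>f\<close> and \<open>g\<close> then vanish almost everywhere on
  the boundary of \<open>S\<close> even if it has positive measure.
\<close>

definition W11_o ::
    "(real^'n) set \<Rightarrow> (real^'n \<Rightarrow> real) \<Rightarrow> (real^'n \<Rightarrow> real^'n) \<Rightarrow> bool" where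
  "W11_o S f g \<longleftrightarrow> Lp_on 1 S f \<and> (\<forall>i. Lp_on 1 S (\<lambda>x. g x $ i)) \<and>
     (\<exists>\<phi> :: nat \<Rightarrow> real^'n \<Rightarrow> real. (\<forall>n. C_c_inf (interior S) (\<phi> n)) \<and>
        (\<lambda>n. LINT x:S|lebesgue. \<bar>f x - \<phi> n x\<bar>) \<longlonglongrightarrow> 0 \<and>
        (\<forall>i. (\<lambda>n. LINT x:S|lebesgue. \<bar>g x $ i - dir_deriv (axis i 1) (\<phi> n) x\<bar>) \<longlonglongrightarrow> 0))"

section \<open>Function spaces on the space-time cylinder\<close>

text \<open>
  Functions of space and time are represented by jointly measurable \<open>u x t\<close>. By Fubini,
  \<open>L\<^sup>q\<^sub>l\<^sub>o\<^sub>c(0,T; L\<^sup>q\<^sub>l\<^sub>o\<^sub>c(\<Omega>))\<close> is \<open>L\<^sup>q\<^sub>l\<^sub>o\<^sub>c(\<Omega> \<times> (0,T))\<close>, where local in time refers to compact subintervals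
  of the open interval \<open>(0,T)\<close>, and an element of \<open>L\<^sup>1\<^sub>l\<^sub>o\<^sub>c(0,T; X)\<close> for a Sobolev space \<open>X\<close> is
  given by a function and a spatial gradient which are locally integrable in space-time and whose
  slices at almost every time are in \<open>X\<close>. The gradient is an explicit argument; it
  is unique up to null sets.
\<close>

definition Lp_W1p_loc ::
    "('n \<Rightarrow> real) \<Rightarrow> (real^'n) set \<Rightarrow> real \<Rightarrow> (real^'n \<Rightarrow> real \<Rightarrow> real) \<Rightarrow>
     (real^'n \<Rightarrow> real \<Rightarrow> real^'n) \<Rightarrow> bool" where
  "Lp_W1p_loc p \<Omega> T u Du \<longleftrightarrow>
     Lp_loc 1 (\<Omega> \<times> {0<..<T}) (\<lambda>(x, t). u x t) \<and>
     (\<forall>i. Lp_loc 1 (\<Omega> \<times> {0<..<T}) (\<lambda>(x, t). Du x t $ i)) \<and>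
     (AE t in lebesgue. t \<in> {0<..<T} \<longrightarrow> W11_loc \<Omega> (\<lambda>x. u x t) (\<lambda>x. Du x t)) \<and>
     (\<forall>i. Lp_loc (p i) (\<Omega> \<times> {0<..<T}) (\<lambda>(x, t). Du x t $ i))"

definition Lp_W1p_o ::
    "('n \<Rightarrow> real) \<Rightarrow> (real^'n) set \<Rightarrow> real \<Rightarrow> (real^'n \<Rightarrow> real \<Rightarrow> real) \<Rightarrow>
     (real^'n \<Rightarrow> real \<Rightarrow> real^'n) \<Rightarrow> bool" where
  "Lp_W1p_o p S T u Du \<longleftrightarrow>
     Lp_loc 1 (S \<times> {0<..<T}) (\<lambda>(x, t). u x t) \<and>
     (\<forall>i. Lp_loc 1 (S \<times> {0<..<T}) (\<lambda>(x, t). Du x t $ i)) \<and>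
     (AE t in lebesgue. t \<in> {0<..<T} \<longrightarrow> W11_o S (\<lambda>x. u x t) (\<lambda>x. Du x t)) \<and>
     (\<forall>i. Lp_loc (p i) (S \<times> {0<..<T}) (\<lambda>(x, t). Du x t $ i))"

text \<open>\<open>\<phi> \<in> W\<^sup>1\<^sup>,\<^sup>2\<^sub>l\<^sub>o\<^sub>c(0,T; L\<^sup>2\<^sub>l\<^sub>o\<^sub>c(S))\<close> with weak time derivative \<open>\<phi>\<^sub>t\<close>.\<close>

definition W12_L2_loc ::
    "(real^'n) set \<Rightarrow> real \<Rightarrow> (real^'n \<Rightarrow> real \<Rightarrow> real) \<Rightarrow> (real^'n \<Rightarrow> real \<Rightarrow> real) \<Rightarrow> bool" where
  "W12_L2_loc S T \<phi> \<phi>\<^sub>t \<longleftrightarrow>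
     Lp_loc 2 (S \<times> {0<..<T}) (\<lambda>(x, t). \<phi> x t) \<and>
     Lp_loc 2 (S \<times> {0<..<T}) (\<lambda>(x, t). \<phi>\<^sub>t x t) \<and>
     (AE x in lebesgue. x \<in> S \<longrightarrow> weak_deriv 1 {0<..<T} (\<lambda>t. \<phi> x t) (\<lambda>t. \<phi>\<^sub>t x t))"

definition C_L2_loc :: "real set \<Rightarrow> (real^'n) set \<Rightarrow> (real^'n \<Rightarrow> real \<Rightarrow> real) \<Rightarrow> bool" where
  "C_L2_loc I S u \<longleftrightarrow> (\<forall>t\<in>I. Lp_loc 2 S (\<lambda>x. u x t)) \<and>
     (\<forall>K. compact K \<and> K \<subseteq> S \<longrightarrow>
        (\<forall>t\<^sub>0\<in>I. ((\<lambda>t. LINT x:K|lebesgue. (u x t - u x t\<^sub>0)\<^sup>2) \<longlongrightarrow> 0) (at t\<^sub>0 within I)))"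

section \<open>The equation\<close>

definition caratheodory ::
    "((real^'n) \<times> real) set \<Rightarrow>
     (real^'n \<Rightarrow> real \<Rightarrow> real \<Rightarrow> real^'n \<Rightarrow> 'b::real_normed_vector) \<Rightarrow> bool" where
  "caratheodory Q F \<longleftrightarrow>
     (\<forall>s \<xi>. set_borel_measurable lebesgue Q (\<lambda>(x, t). F x t s \<xi>)) \<and>
     (AE (x, t) in lebesgue. (x, t) \<in> Q \<longrightarrow> continuous_on UNIV (\<lambda>(s, \<xi>). F x t s \<xi>))"

definition structure_conditions ::
    "('n \<Rightarrow> real) \<Rightarrow> real \<Rightarrow> real \<Rightarrow> real \<Rightarrow> ((real^'n) \<times> real) set \<Rightarrow>
     (real^'n \<Rightarrow> real \<Rightarrow> real \<Rightarrow> real^'n \<Rightarrow> real^'n) \<Rightarrow>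
     (real^'n \<Rightarrow> real \<Rightarrow> real \<Rightarrow> real^'n \<Rightarrow> real) \<Rightarrow> bool" where
  "structure_conditions p C\<^sub>o C\<^sub>1 C Q A B \<longleftrightarrow>
     (AE (x, t) in lebesgue. (x, t) \<in> Q \<longrightarrow>
        (\<forall>s \<xi>.
          (\<forall>i. A x t s \<xi> $ i * \<xi> $ i \<ge> C\<^sub>o * \<bar>\<xi> $ i\<bar> powr p i - C powr p i) \<and>
          (\<forall>i. \<bar>A x t s \<xi> $ i\<bar> \<le> C\<^sub>1 * \<bar>\<xi> $ i\<bar> powr (p i - 1) + C powr (p i - 1)) \<and>
          \<bar>B x t s \<xi>\<bar> \<le> (\<Sum>i\<in>UNIV. C * (\<bar>\<xi> $ i\<bar> powr (p i - 1) + C powr (p i - 1)))))"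

text \<open>
  Test functions are only local in the open interval \<open>(0,T)\<close>, while the weak inequality is
  required on all \<open>[t\<^sub>1, t\<^sub>2] \<subseteq> [0,T]\<close>. The last five conditions ensure that its terms make sense:
  \<open>\<phi>\<close> is the representative which is continuous in time on \<open>[t\<^sub>1, t\<^sub>2]\<close>, so that the boundary
  terms are well defined, and the integrands are integrable. For \<open>0 < t\<^sub>1\<close> and \<open>t\<^sub>2 < T\<close> such a
  representative always exists and, for \<open>1 < p i < 2\<close>, integrability follows from the structure
  conditions.
\<close>

definition admissible_test ::
    "('n \<Rightarrow> real) \<Rightarrow> (real^'n \<Rightarrow> real \<Rightarrow> real \<Rightarrow> real^'n \<Rightarrow> real^'n) \<Rightarrow>
     (real^'n \<Rightarrow> real \<Rightarrow> real \<Rightarrow> real^'n \<Rightarrow> real) \<Rightarrow> real \<Rightarrow>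
     (real^'n \<Rightarrow> real \<Rightarrow> real) \<Rightarrow> (real^'n \<Rightarrow> real \<Rightarrow> real^'n) \<Rightarrow>
     (real^'n) set \<Rightarrow> real \<Rightarrow> real \<Rightarrow>
     (real^'n \<Rightarrow> real \<Rightarrow> real) \<Rightarrow> (real^'n \<Rightarrow> real \<Rightarrow> real) \<Rightarrow> (real^'n \<Rightarrow> real \<Rightarrow> real^'n) \<Rightarrow> bool" where
  "admissible_test p A B T u Du K t\<^sub>1 t\<^sub>2 \<phi> \<phi>\<^sub>t D\<phi> \<longleftrightarrow>
     W12_L2_loc K T \<phi> \<phi>\<^sub>t \<and> Lp_W1p_o p K T \<phi> D\<phi> \<and>
     (AE (x, t) in lebesgue. (x, t) \<in> K \<times> {0<..<T} \<longrightarrow> 0 \<le> \<phi> x t) \<and>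
     C_L2_loc {t\<^sub>1..t\<^sub>2} K \<phi> \<and>
     set_integrable lebesgue (K \<times> {t\<^sub>1..t\<^sub>2}) (\<lambda>(x, t). u x t * \<phi>\<^sub>t x t) \<and>
     (\<forall>i. set_integrable lebesgue (K \<times> {t\<^sub>1..t\<^sub>2})
            (\<lambda>(x, t). A x t (u x t) (Du x t) $ i * D\<phi> x t $ i)) \<and>
     set_integrable lebesgue (K \<times> {t\<^sub>1..t\<^sub>2}) (\<lambda>(x, t). B x t (u x t) (Du x t) * \<phi> x t)"

definition weak_lhs ::
    "(real^'n \<Rightarrow> real \<Rightarrow> real \<Rightarrow> real^'n \<Rightarrow> real^'n) \<Rightarrow>
     (real^'n \<Rightarrow> real \<Rightarrow> real) \<Rightarrow> (real^'n \<Rightarrow> real \<Rightarrow> real^'n) \<Rightarrow>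
     (real^'n) set \<Rightarrow> real \<Rightarrow> real \<Rightarrow>
     (real^'n \<Rightarrow> real \<Rightarrow> real) \<Rightarrow> (real^'n \<Rightarrow> real \<Rightarrow> real) \<Rightarrow> (real^'n \<Rightarrow> real \<Rightarrow> real^'n) \<Rightarrow> real" where
  "weak_lhs A u Du K t\<^sub>1 t\<^sub>2 \<phi> \<phi>\<^sub>t D\<phi> =
     (LINT x:K|lebesgue. u x t\<^sub>2 * \<phi> x t\<^sub>2) - (LINT x:K|lebesgue. u x t\<^sub>1 * \<phi> x t\<^sub>1) +
     (LINT (x, t):K \<times> {t\<^sub>1..t\<^sub>2}|lebesgue.
        - u x t * \<phi>\<^sub>t x t + (\<Sum>i\<in>UNIV. A x t (u x t) (Du x t) $ i * D\<phi> x t $ i))"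

definition weak_rhs ::
    "(real^'n \<Rightarrow> real \<Rightarrow> real \<Rightarrow> real^'n \<Rightarrow> real) \<Rightarrow>
     (real^'n \<Rightarrow> real \<Rightarrow> real) \<Rightarrow> (real^'n \<Rightarrow> real \<Rightarrow> real^'n) \<Rightarrow>
     (real^'n) set \<Rightarrow> real \<Rightarrow> real \<Rightarrow> (real^'n \<Rightarrow> real \<Rightarrow> real) \<Rightarrow> real" where
  "weak_rhs B u Du K t\<^sub>1 t\<^sub>2 \<phi> =
     (LINT (x, t):K \<times> {t\<^sub>1..t\<^sub>2}|lebesgue. B x t (u x t) (Du x t) * \<phi> x t)"

definition local_weak_subsolution ::
    "('n \<Rightarrow> real) \<Rightarrow> (real^'n \<Rightarrow> real \<Rightarrow> real \<Rightarrow> real^'n \<Rightarrow> real^'n) \<Rightarrow>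
     (real^'n \<Rightarrow> real \<Rightarrow> real \<Rightarrow> real^'n \<Rightarrow> real) \<Rightarrow> (real^'n) set \<Rightarrow> real \<Rightarrow>
     (real^'n \<Rightarrow> real \<Rightarrow> real) \<Rightarrow> bool" where
  "local_weak_subsolution p A B \<Omega> T u \<longleftrightarrow> C_L2_loc {0..T} \<Omega> u \<and>
     (\<exists>Du. Lp_W1p_loc p \<Omega> T u Du \<and>
        (\<forall>K t\<^sub>1 t\<^sub>2 \<phi> \<phi>\<^sub>t D\<phi>.
           compact K \<and> K \<subseteq> \<Omega> \<and> 0 \<le> t\<^sub>1 \<and> t\<^sub>1 \<le> t\<^sub>2 \<and> t\<^sub>2 \<le> T \<and>
           admissible_test p A B T u Du K t\<^sub>1 t\<^sub>2 \<phi> \<phi>\<^sub>t D\<phi> \<longrightarrow>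
           weak_lhs A u Du K t\<^sub>1 t\<^sub>2 \<phi> \<phi>\<^sub>t D\<phi> \<le> weak_rhs B u Du K t\<^sub>1 t\<^sub>2 \<phi>))"

definition local_weak_supersolution ::
    "('n \<Rightarrow> real) \<Rightarrow> (real^'n \<Rightarrow> real \<Rightarrow> real \<Rightarrow> real^'n \<Rightarrow> real^'n) \<Rightarrow>
     (real^'n \<Rightarrow> real \<Rightarrow> real \<Rightarrow> real^'n \<Rightarrow> real) \<Rightarrow> (real^'n) set \<Rightarrow> real \<Rightarrow>
     (real^'n \<Rightarrow> real \<Rightarrow> real) \<Rightarrow> bool" where
  "local_weak_supersolution p A B \<Omega> T u \<longleftrightarrow> C_L2_loc {0..T} \<Omega> u \<and>
     (\<exists>Du. Lp_W1p_loc p \<Omega> T u Du \<and>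
        (\<forall>K t\<^sub>1 t\<^sub>2 \<phi> \<phi>\<^sub>t D\<phi>.
           compact K \<and> K \<subseteq> \<Omega> \<and> 0 \<le> t\<^sub>1 \<and> t\<^sub>1 \<le> t\<^sub>2 \<and> t\<^sub>2 \<le> T \<and>
           admissible_test p A B T u Du K t\<^sub>1 t\<^sub>2 \<phi> \<phi>\<^sub>t D\<phi> \<longrightarrow>
           weak_lhs A u Du K t\<^sub>1 t\<^sub>2 \<phi> \<phi>\<^sub>t D\<phi> \<ge> weak_rhs B u Du K t\<^sub>1 t\<^sub>2 \<phi>))"

definition local_weak_solution ::
    "('n \<Rightarrow> real) \<Rightarrow> (real^'n \<Rightarrow> real \<Rightarrow> real \<Rightarrow> real^'n \<Rightarrow> real^'n) \<Rightarrow>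
     (real^'n \<Rightarrow> real \<Rightarrow> real \<Rightarrow> real^'n \<Rightarrow> real) \<Rightarrow> (real^'n) set \<Rightarrow> real \<Rightarrow>
     (real^'n \<Rightarrow> real \<Rightarrow> real) \<Rightarrow> bool" where
  "local_weak_solution p A B \<Omega> T u \<longleftrightarrow>
     local_weak_subsolution p A B \<Omega> T u \<and> local_weak_supersolution p A B \<Omega> T u"

section \<open>Intrinsic geometry\<close>

definition hmean :: "('n::finite \<Rightarrow> real) \<Rightarrow> real" where
  "hmean p = real CARD('n) / (\<Sum>i\<in>UNIV. 1 / p i)"

text \<open>\<open>intrinsic_cube p a \<rho> t\<close> is \<open>\<K>\<^bsub>a\<rho>\<^esub>(t)\<close>: the factor \<open>a\<close> multiplies the sides and is not
  subject to the powers of \<open>\<rho>\<close>.\<close>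

definition intrinsic_cube :: "('n::finite \<Rightarrow> real) \<Rightarrow> real \<Rightarrow> real \<Rightarrow> real \<Rightarrow> (real^'n) set" where
  "intrinsic_cube p a \<rho> t =
     {x. \<forall>i. \<bar>x $ i\<bar> < a * \<rho> powr (hmean p * (2 - p i) / (p i * (2 - hmean p)))
                       * t powr ((p i - hmean p) / ((2 - hmean p) * p i))}"

end

theory Submission
  imports Defs
begin

text \<open>
  Put \<open>\<nu> = (t / \<rho> powr p) powr (1 / (2 - p))\<close>. The half-sides \<open>L i\<close> of the intrinsic cube satisfy
  \<open>L i powr (- p i) = \<nu> powr (2 - p i) / t\<close>, and failure of the first alternative means
  \<open>C * L i \<le> min 1 \<nu>\<close>. Let \<open>\<zeta>\<close> be a cutoff between the two cubes. Testing the equation with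
  \<open>\<zeta>\<close> bounds the oscillation of the mass \<open>\<integral> u \<zeta>\<close> over time by the integral of
  \<open>\<Sum>i. \<bar>A i\<bar> \<bar>\<partial>i \<zeta>\<bar> + \<bar>B\<bar> \<zeta>\<close>. This is controlled pointwise by a multiple of
  \<open>B \<phi> - A \<cdot> D\<phi>\<close> for \<open>\<phi> = (u + \<nu>) powr (- \<alpha>) * \<zeta>\<close> with small \<open>\<alpha>\<close>, up to an error
  \<open>(\<delta> (u + \<nu>) \<zeta> + \<Gamma> \<nu>) / t\<close>; testing with \<open>\<phi>\<close> in turn gives the increment of
  \<open>\<integral> (u + \<nu>) powr (1 - \<alpha>) \<zeta> / (1 - \<alpha>)\<close>, which grows sublinearly in \<open>u\<close>. Hence the
  oscillation of the mass is at most half of its maximum \<open>m\<close> plus a multiple of \<open>\<nu> \<rho>\<^sup>N\<close>, and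
  the term \<open>m / 2\<close> is absorbed.

  As \<open>\<phi>\<close> need not have a weak time derivative, the equation is tested with the time-independent
  functions \<open>\<phi>(\<cdot>, \<tau>)\<close> on \<open>[\<tau> - h, \<tau>]\<close>, averaged over \<open>\<tau>\<close>, and \<open>h\<close> tends to \<open>0\<close>.
\<close>

section \<open>Pointwise estimates\<close>

text \<open>With this \<nu> all lower order terms and all interpolation errors have the common size
  \<nu> / t, which over the cylinder adds up to a multiple of \<nu> \<rho>^N. The negative power in
  \<phi> gives \<open>- A \<cdot> D\<phi>\<close> the sign that yields a gradient energy, weighted
  by \<open>(u + \<nu>) powr (- \<alpha> - 1)\<close>. Undoing the weight with Young's inequality
  costs \<open>(u + \<nu>) powr ((1 + \<alpha>) * (p i - 1))\<close>, and \<open>p i < 2\<close> is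
  what permits an \<alpha> > 0 with exponent below one. The same inequality loses powers of \<zeta>,
  so \<zeta> has to be a high power of a simpler function.

  The rest is shaped by weak regularity. Integrability is local in the open interval (0,T), so
  estimates live on compact subintervals and reach the endpoints only by continuity of the mass. The
  data are measurable only for the completed measure, so Borel representatives are introduced before
  Fubini and translations are used.\<close>

lemma powr_young:
  fixes x y \<epsilon> q :: real
  assumes "0 \<le> x" "0 \<le> y" "0 < \<epsilon>" "1 < q"
  shows "x powr (q - 1) * y \<le> \<epsilon> * x powr q + \<epsilon> powr (1 - q) * y powr q"
\<comment> \<open>Whichever of \<open>y\<close> and \<open>\<epsilon> * x\<close> is larger, one
  term on the right already dominates alone; the constants are therefore plain powers of
  \<epsilon>.\<close>
proof (cases "y \<le> \<epsilon> * x")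
  case True
  have "x powr (q - 1) * y \<le> x powr (q - 1) * (\<epsilon> * x)"
    using True by (intro mult_left_mono) auto
  also have "\<dots> = \<epsilon> * x powr q"
    using powr_add[of x "q - 1" 1] \<open>0 \<le> x\<close> by simp
  finally show ?thesis by (smt (verit) assms(3) powr_ge_zero mult_nonneg_nonneg)
next
  case False
  then have "x \<le> y / \<epsilon>" using assms by (simp add: field_simps)
  then have "x powr (q - 1) * y \<le> (y / \<epsilon>) powr (q - 1) * y"
    using assms by (intro mult_right_mono powr_mono2) auto
  also have "\<dots> = \<epsilon> powr (1 - q) * (y powr (q - 1) * y powr 1)"
    using assms by (simp add: powr_divide powr_diff field_simps)
  also have "\<dots> = \<epsilon> powr (1 - q) * y powr q"
    by (subst powr_add[symmetric]) simp
  finally show ?thesis by (smt (verit) assms(3) powr_ge_zero mult_nonneg_nonneg)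
qed

lemma powr_interpolation:
  fixes a b \<delta> \<theta> :: real
  assumes "0 \<le> a" "0 \<le> b" "0 < \<delta>" "0 < \<theta>" "\<theta> < 1"
  shows "a powr \<theta> * b powr (1 - \<theta>) \<le> \<delta> * a + \<delta> powr (- \<theta> / (1 - \<theta>)) * b"
proof -
  \<comment> \<open>The threshold ratio: at \<open>b = s * a\<close> the left side equals
    \<open>\<delta> * a\<close>. Below it the first term suffices, above it the second.\<close>
  define s where "s = \<delta> powr (1 / (1 - \<theta>))"
  have s: "s > 0" "s powr (1 - \<theta>) = \<delta>" "s powr (- \<theta>) = \<delta> powr (- \<theta> / (1 - \<theta>))"
    using assms by (auto simp: s_def powr_powr)
  have split: "c powr \<theta> * c powr (1 - \<theta>) = c" if "0 \<le> c" for c :: real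
    using that by (subst powr_add[symmetric]) simp
  show ?thesis
  proof (cases "b \<le> s * a")
    case True
    have "a powr \<theta> * b powr (1 - \<theta>) \<le> a powr \<theta> * (s * a) powr (1 - \<theta>)"
      using True assms by (intro mult_left_mono powr_mono2) auto
    also have "\<dots> = \<delta> * a"
      using split[of a] assms s by (simp add: powr_mult mult.left_commute)
    finally show ?thesis by (smt (verit) assms powr_ge_zero mult_nonneg_nonneg)
  next
    case False
    then have "a \<le> b / s" using s by (simp add: field_simps)
    then have "a powr \<theta> * b powr (1 - \<theta>) \<le> (b / s) powr \<theta> * b powr (1 - \<theta>)"
      using assms by (intro mult_right_mono powr_mono2) auto
    also have "\<dots> = s powr (- \<theta>) * b"
      using split[of b] assms s by (simp add: powr_divide powr_minus field_simps)
    finally show ?thesis using s by (smt (verit) assms mult_nonneg_nonneg)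
  qed
qed

text \<open>Young's inequality with the weight \<open>c\<close> carried by the gradient energy. The
  loss \<open>z powr (- \<kappa> * q)\<close> caused by the cutoff gradient is paid by the factor
  \<open>z\<close> in \<open>c\<close>, and the scaling identity turns \<open>L powr (- q)\<close>
  into a power of \<nu> over \<open>t\<close>.\<close>

lemma gradient_term_bound:
  fixes x z w \<nu> L t \<kappa> \<alpha> q :: real
  assumes "0 \<le> x" "0 \<le> z" "z \<le> 1" "0 < w" "0 < \<nu>" "0 < L" "0 < t" "1 < q"
    and "\<kappa> < 1" "(1 + \<alpha>) * (q - 1) \<le> 1 - q * \<kappa>"
    and scale: "L powr (- q) = \<nu> powr (2 - q) / t"
  shows "x powr (q - 1) * z powr (1 - \<kappa>) / L
    \<le> \<nu> powr \<alpha> * w powr (- \<alpha> - 1) * z * x powr q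
      + (w * z) powr ((1 + \<alpha>) * (q - 1)) * \<nu> powr (1 - (1 + \<alpha>) * (q - 1)) / t"
proof (cases "z = 0")
  case True
  then show ?thesis by simp
next
  case False
  with assms have z: "0 < z" by simp
  \<comment> \<open>\<open>y\<close> is fixed by \<open>c * y = z powr (1 - \<kappa>) / L\<close>,
    so that Young's inequality is applied to \<open>x powr (q - 1) * y\<close> and then multiplied
    by \<open>c\<close>.\<close>
  define c y where "c = \<nu> powr \<alpha> * w powr (- \<alpha> - 1) * z"
    and "y = \<nu> powr (- \<alpha>) * w powr (\<alpha> + 1) * z powr (- \<kappa>) / L"
  have "c > 0" using assms z by (simp add: c_def)
  have cy: "c * y = z powr (1 - \<kappa>) / L"
    using assms z by (simp add: c_def y_def powr_diff powr_minus powr_add field_simps)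
  have yq: "y powr q = \<nu> powr (- \<alpha> * q) * w powr ((\<alpha> + 1) * q) * z powr (- \<kappa> * q) * (\<nu> powr (2 - q) / t)"
  proof -
    have "y powr q = \<nu> powr (- \<alpha> * q) * w powr ((\<alpha> + 1) * q) * z powr (- \<kappa> * q) * (1 / L powr q)"
      using assms z by (simp add: y_def powr_mult powr_divide powr_powr)
    then show ?thesis using scale unfolding powr_minus_divide by metis
  qed
  have "c * y powr q = (\<nu> powr \<alpha> * \<nu> powr (- \<alpha> * q) * \<nu> powr (2 - q))
      * (w powr (- \<alpha> - 1) * w powr ((\<alpha> + 1) * q)) * (z powr 1 * z powr (- \<kappa> * q)) / t"
    using z by (simp add: c_def yq mult_ac)
  also have "\<dots> = \<nu> powr (1 - (1 + \<alpha>) * (q - 1)) * w powr ((1 + \<alpha>) * (q - 1)) * z powr (1 - q * \<kappa>) / t"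
    unfolding powr_add[symmetric] by (intro arg_cong2[where f = "(/)"] arg_cong2[where f = "(*)"] arg_cong2[where f = "(powr)"]) (auto simp: algebra_simps)
  also have "\<dots> \<le> \<nu> powr (1 - (1 + \<alpha>) * (q - 1)) * w powr ((1 + \<alpha>) * (q - 1)) * z powr ((1 + \<alpha>) * (q - 1)) / t"
    using assms z by (intro divide_right_mono mult_left_mono powr_mono') auto
  also have "\<dots> = (w * z) powr ((1 + \<alpha>) * (q - 1)) * \<nu> powr (1 - (1 + \<alpha>) * (q - 1)) / t"
    using assms z by (simp add: powr_mult mult_ac)
  finally have second: "c * y powr q \<le> \<dots>" .
  have "x powr (q - 1) * z powr (1 - \<kappa>) / L = c * (x powr (q - 1) * y)"
    using arg_cong[OF cy, of "\<lambda>s. x powr (q - 1) * s"] by (simp add: mult_ac)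
  also have "\<dots> \<le> c * (1 * x powr q + 1 powr (1 - q) * y powr q)"
    using \<open>c > 0\<close> assms z by (intro mult_left_mono powr_young) (auto simp: y_def)
  also have "\<dots> = c * x powr q + c * y powr q" by (simp add: distrib_left)
  finally show ?thesis using second by (simp add: c_def)
qed

text \<open>The companion estimate for the part of the test gradient that falls on the cutoff, which
  carries the factor \<open>\<nu> powr \<alpha> * w powr (- \<alpha>)\<close> from the start. Here
  \<open>q < 2\<close> enters through \<open>w powr (q - 2) \<le> \<nu> powr (q - 2)\<close>, and
  \<epsilon> stays free so that the energy can be absorbed.\<close>

lemma weighted_gradient_term_bound:
  fixes x z w \<nu> L t \<kappa> \<alpha> q \<epsilon> :: real
  assumes "0 \<le> x" "0 \<le> z" "z \<le> 1" "\<nu> \<le> w" "0 < \<nu>" "0 < L" "0 < t" "1 < q" "q < 2"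
    and "\<kappa> < 1" "1 - \<alpha> \<le> 1 - q * \<kappa>" "0 < \<epsilon>"
    and scale: "L powr (- q) = \<nu> powr (2 - q) / t"
  shows "\<nu> powr \<alpha> * w powr (- \<alpha>) * (x powr (q - 1) * z powr (1 - \<kappa>) / L)
    \<le> \<epsilon> * (\<nu> powr \<alpha> * w powr (- \<alpha> - 1) * z * x powr q)
      + \<epsilon> powr (1 - q) * ((w * z) powr (1 - \<alpha>) * \<nu> powr \<alpha>) / t"
proof (cases "z = 0")
  case True
  then show ?thesis by simp
next
  case False
  with assms have z: "0 < z" and w: "0 < w" by auto
  define c y where "c = \<nu> powr \<alpha> * w powr (- \<alpha> - 1) * z" and "y = w * z powr (- \<kappa>) / L"
  have "c > 0" using assms z w by (simp add: c_def)
  have cy: "c * y = \<nu> powr \<alpha> * w powr (- \<alpha>) * z powr (1 - \<kappa>) / L"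
    using assms z w by (simp add: c_def y_def powr_diff powr_minus powr_add field_simps)
  have yq: "y powr q = w powr q * z powr (- \<kappa> * q) * (\<nu> powr (2 - q) / t)"
  proof -
    have "y powr q = w powr q * z powr (- \<kappa> * q) * (1 / L powr q)"
      using assms z w by (simp add: y_def powr_mult powr_divide powr_powr)
    then show ?thesis using scale unfolding powr_minus_divide by metis
  qed
  have "c * y powr q = \<nu> powr \<alpha> * \<nu> powr (2 - q)
      * (w powr (- \<alpha> - 1) * w powr q) * (z powr 1 * z powr (- \<kappa> * q)) / t"
    using z by (simp add: c_def yq mult_ac)
  also have "\<dots> = \<nu> powr \<alpha> * \<nu> powr (2 - q) * (w powr (1 - \<alpha>) * w powr (q - 2)) * z powr (1 - q * \<kappa>) / t"
    unfolding powr_add[symmetric] by (intro arg_cong2[where f = "(/)"] arg_cong2[where f = "(*)"] arg_cong2[where f = "(powr)"]) (auto simp: algebra_simps)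
  also have "\<dots> \<le> \<nu> powr \<alpha> * \<nu> powr (2 - q) * (w powr (1 - \<alpha>) * \<nu> powr (q - 2)) * z powr (1 - \<alpha>) / t"
    using assms z w by (intro divide_right_mono mult_mono order.refl powr_mono'[of _ _ z] powr_mono2'[of _ \<nu>]) auto
  also have "\<dots> = (\<nu> powr (2 - q) * \<nu> powr (q - 2)) * ((w * z) powr (1 - \<alpha>) * \<nu> powr \<alpha>) / t"
    using z w by (simp add: powr_mult mult_ac)
  also have "\<nu> powr (2 - q) * \<nu> powr (q - 2) = 1"
    using assms by (subst powr_add[symmetric]) simp
  finally have second: "c * y powr q \<le> (w * z) powr (1 - \<alpha>) * \<nu> powr \<alpha> / t" by simp
  have "\<nu> powr \<alpha> * w powr (- \<alpha>) * (x powr (q - 1) * z powr (1 - \<kappa>) / L) = c * (x powr (q - 1) * y)"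
    using arg_cong[OF cy, of "\<lambda>s. x powr (q - 1) * s"] by (simp add: mult_ac)
  also have "\<dots> \<le> c * (\<epsilon> * x powr q + \<epsilon> powr (1 - q) * y powr q)"
    using \<open>c > 0\<close> assms z w by (intro mult_left_mono powr_young) (auto simp: y_def)
  also have "\<dots> = \<epsilon> * (c * x powr q) + \<epsilon> powr (1 - q) * (c * y powr q)" by (simp add: algebra_simps)
  also have "\<dots> \<le> \<epsilon> * (c * x powr q) + \<epsilon> powr (1 - q) * ((w * z) powr (1 - \<alpha>) * \<nu> powr \<alpha> / t)"
    using second by (intro add_left_mono mult_left_mono) auto
  finally show ?thesis by (simp add: c_def)
qed


text \<open>Writing \<open>C powr (q - 1) / L\<close> as
  \<open>(C * L) powr (q - 1) * L powr (- q)\<close> lets the powers of \<nu> collapse to \<nu> / t.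
  The third bound keeps one more \<nu>, to be spent later against
  \<open>1 / w \<le> 1 / \<nu>\<close>.\<close>

lemma lower_order_bounds:
  fixes C L \<nu> t q :: real
  assumes "0 \<le> C" "0 < \<nu>" "0 < L" "0 < t" "1 < q" "q < 2"
    and small: "C * L \<le> 1" "C * L \<le> \<nu>"
    and scale: "L powr (- q) = \<nu> powr (2 - q) / t"
  shows "C powr (q - 1) / L \<le> \<nu> / t" and "C * C powr (q - 1) \<le> \<nu> / t" and "C powr q \<le> \<nu>\<^sup>2 / t"
proof -
  have Lq: "L powr q = L * L powr (q - 1)"
    using assms powr_add[of L 1 "q - 1"] by simp
  have "C powr (q - 1) / L = (C * L) powr (q - 1) * L powr (- q)"
    using assms by (simp add: powr_minus powr_mult Lq field_simps)
  also have "\<dots> \<le> \<nu> powr (q - 1) * (\<nu> powr (2 - q) / t)"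
    unfolding scale using assms by (intro mult_right_mono powr_mono2) auto
  also have "\<dots> = \<nu> / t"
    using assms by (simp flip: powr_add)
  finally show 1: "C powr (q - 1) / L \<le> \<nu> / t" .
  have "C * C powr (q - 1) = (C * L) * (C powr (q - 1) / L)"
    using assms by simp
  also have "\<dots> \<le> 1 * (C powr (q - 1) / L)"
    using assms by (intro mult_right_mono) auto
  finally show "C * C powr (q - 1) \<le> \<nu> / t" using 1 by simp
  have "C powr q = (C * L) * (C powr (q - 1) / L)"
    using assms powr_add[of C 1 "q - 1"] by simp
  also have "\<dots> \<le> \<nu> * (\<nu> / t)"
    using assms 1 by (intro mult_mono) auto
  finally show "C powr q \<le> \<nu>\<^sup>2 / t" by (simp add: power2_eq_square)
qed

text \<open>Since \<open>C \<le> 1 / L i\<close> and \<open>z \<le> z powr (1 - \<kappa>)\<close>,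
  the gradient growth of the source takes the same form as the flux paired with the cutoff gradient.
  What does not involve the gradient is of size \<nu> / t.\<close>

lemma flux_bound:
  fixes p :: "'n::finite \<Rightarrow> real"
  assumes p: "\<And>i. 1 < p i" "\<And>i. p i < 2" and \<kappa>: "0 < \<kappa>" "\<kappa> < 1"
    and pos: "C\<^sub>1 > 0" "M > 0"
    and z: "0 \<le> z" "z \<le> 1" and w: "0 < \<nu>" "0 < t" "\<And>i. 0 < L i"
    and scale: "\<And>i. L i powr (- p i) = \<nu> powr (2 - p i) / t"
    and C: "0 \<le> C" "\<And>i. C * L i \<le> 1" "\<And>i. C * L i \<le> \<nu>"
    and a: "\<And>i. \<bar>a i\<bar> \<le> C\<^sub>1 * \<bar>\<xi> i\<bar> powr (p i - 1) + C powr (p i - 1)"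
    and b: "\<bar>b\<bar> \<le> (\<Sum>i\<in>UNIV. C * (\<bar>\<xi> i\<bar> powr (p i - 1) + C powr (p i - 1)))"
    and d: "\<And>i. \<bar>d i\<bar> \<le> M / L i * z powr (1 - \<kappa>)"
  shows "(\<Sum>i\<in>UNIV. \<bar>a i\<bar> * \<bar>d i\<bar>) + \<bar>b\<bar> * z
    \<le> (\<Sum>i\<in>UNIV. (C\<^sub>1 * M + 1) * (\<bar>\<xi> i\<bar> powr (p i - 1) * z powr (1 - \<kappa>) / L i) + (M + 1) * \<nu> / t)"
proof -
  have low: "C powr (p i - 1) / L i \<le> \<nu> / t" "C * C powr (p i - 1) \<le> \<nu> / t" for i
    using lower_order_bounds[of C \<nu> "L i" t "p i"] assms by auto
  have z1: "z powr (1 - \<kappa>) \<le> 1" and z2: "z \<le> z powr (1 - \<kappa>)"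
    using powr_mono'[of "1 - \<kappa>" 1 z] z \<kappa> by (auto intro: powr_le1)
  have "\<bar>a i\<bar> * \<bar>d i\<bar> + C * (\<bar>\<xi> i\<bar> powr (p i - 1) + C powr (p i - 1)) * z
    \<le> (C\<^sub>1 * M + 1) * (\<bar>\<xi> i\<bar> powr (p i - 1) * z powr (1 - \<kappa>) / L i) + (M + 1) * \<nu> / t" for i
  proof -
    let ?x = "\<bar>\<xi> i\<bar> powr (p i - 1)" and ?y = "C powr (p i - 1)"
    have "\<bar>a i\<bar> * \<bar>d i\<bar> \<le> (C\<^sub>1 * ?x + ?y) * (M / L i * z powr (1 - \<kappa>))"
      using a[of i] d[of i] pos by (intro mult_mono) auto
    also have "\<dots> = C\<^sub>1 * M * (?x * z powr (1 - \<kappa>) / L i) + M * (?y / L i) * z powr (1 - \<kappa>)"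
      by (simp add: algebra_simps add_divide_distrib)
    also have "M * (?y / L i) * z powr (1 - \<kappa>) \<le> M * (\<nu> / t) * 1"
      using low[of i] z1 pos w by (intro mult_mono) (auto intro!: divide_nonneg_pos)
    finally have 1: "\<bar>a i\<bar> * \<bar>d i\<bar> \<le> C\<^sub>1 * M * (?x * z powr (1 - \<kappa>) / L i) + M * (\<nu> / t) * 1" by simp
    have "C \<le> 1 / L i" using C(2)[of i] w(3)[of i] by (simp add: field_simps)
    then have "C * (?x * z) \<le> 1 / L i * (?x * z powr (1 - \<kappa>))"
      using z2 z C w(3)[of i] by (intro mult_mono) auto
    moreover have "C * ?y * z \<le> \<nu> / t * 1"
      using low[of i] z C w by (intro mult_mono) auto
    ultimately show ?thesis using 1 by (simp add: algebra_simps add_divide_distrib)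
  qed
  moreover have "\<bar>b\<bar> * z \<le> (\<Sum>i\<in>UNIV. C * (\<bar>\<xi> i\<bar> powr (p i - 1) + C powr (p i - 1))) * z"
    using b z(1) by (rule mult_right_mono)
  then have "(\<Sum>i\<in>UNIV. \<bar>a i\<bar> * \<bar>d i\<bar>) + \<bar>b\<bar> * z
    \<le> (\<Sum>i\<in>UNIV. \<bar>a i\<bar> * \<bar>d i\<bar> + C * (\<bar>\<xi> i\<bar> powr (p i - 1) + C powr (p i - 1)) * z)"
    by (simp add: sum.distrib sum_distrib_right)
  ultimately show ?thesis by (meson order_trans sum_mono)
qed

text \<open>The exponents satisfy \<open>(1 + \<alpha>) (p i - 1) < 1\<close>, so the gradient term is sublinear in \<open>w z\<close>
  and its contribution can be made as small as desired.\<close>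

lemma coercivity_bound:
  fixes p :: "'n::finite \<Rightarrow> real"
  assumes p: "\<And>i. 1 < p i" "\<And>i. p i < 2"
    and \<alpha>: "0 < \<alpha>" "\<alpha> < 1" and \<kappa>: "0 < \<kappa>" "2 * \<kappa> \<le> \<alpha>"
    and \<beta>: "\<And>i. (1 + \<alpha>) * (p i - 1) \<le> 1 - 2 * \<kappa>"
    and pos: "C\<^sub>o > 0" "C\<^sub>1 > 0" "M > 0" "\<delta> > 0"
  obtains \<Gamma> where "0 < \<Gamma>"
    and "\<And>z w \<nu> t C b (L :: 'n \<Rightarrow> real) a d \<xi>.
      \<lbrakk> 0 \<le> z; z \<le> 1; \<nu> \<le> w; 0 < \<nu>; 0 < t; \<And>i. 0 < L i;
        \<And>i. L i powr (- p i) = \<nu> powr (2 - p i) / t;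
        0 \<le> C; \<And>i. C * L i \<le> 1; \<And>i. C * L i \<le> \<nu>;
        \<And>i. C\<^sub>o * \<bar>\<xi> i\<bar> powr p i - C powr p i \<le> a i * \<xi> i;
        \<And>i. \<bar>a i\<bar> \<le> C\<^sub>1 * \<bar>\<xi> i\<bar> powr (p i - 1) + C powr (p i - 1);
        \<bar>b\<bar> \<le> (\<Sum>i\<in>UNIV. C * (\<bar>\<xi> i\<bar> powr (p i - 1) + C powr (p i - 1)));
        \<And>i. \<bar>d i\<bar> \<le> M / L i * z powr (1 - \<kappa>) \<rbrakk>
      \<Longrightarrow> (\<Sum>i\<in>UNIV. \<bar>a i\<bar> * \<bar>d i\<bar>) + \<bar>b\<bar> * z
        \<le> 2 * (C\<^sub>1 * M + 1) / (\<alpha> * C\<^sub>o) * \<nu> powr \<alpha> *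
            (b * (w powr (- \<alpha>) * z)
             - (\<Sum>i\<in>UNIV. a i * (- \<alpha> * w powr (- \<alpha> - 1) * \<xi> i * z + w powr (- \<alpha>) * d i)))
          + (\<delta> * (w * z) + \<Gamma> * \<nu>) / t"
proof -
  \<comment> \<open>The constants are tied by \<open>\<Lambda> * c * \<epsilon> = c\<close> and
    \<open>\<Lambda> * \<alpha> * C\<^sub>o = 2 * c\<close>. Coercivity thus yields the energy with
    factor \<open>2 * c\<close>, of which one \<open>c\<close> pays for the flux and the other for
    the cutoff part of the test gradient.\<close>
  define c \<Lambda> \<epsilon> where "c = C\<^sub>1 * M + 1" and "\<Lambda> = 2 * c / (\<alpha> * C\<^sub>o)" and "\<epsilon> = \<alpha> * C\<^sub>o / (2 * c)"
  define \<beta>f where "\<beta>f i = (1 + \<alpha>) * (p i - 1)" for i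
  \<comment> \<open>\<open>\<eta>\<close> distributes \<delta> over all interpolation errors;
    \<open>\<Gamma>\<close> collects every coefficient of \<nu> that arises below.\<close>
  define \<eta> where "\<eta> = \<delta> / (\<Sum>i\<in>UNIV. c + \<Lambda> * c * \<epsilon> powr (1 - p i))"
  define \<Gamma> where "\<Gamma> = (\<Sum>i\<in>UNIV. c * \<eta> powr (- \<beta>f i / (1 - \<beta>f i)) + (M + 1) + \<Lambda> * \<alpha>
      + \<Lambda> * c * \<epsilon> powr (1 - p i) * \<eta> powr (- (1 - \<alpha>) / (1 - (1 - \<alpha>))) + \<Lambda> * (M + 1))"
  have cpos: "c > 0" using pos by (simp add: c_def add_pos_pos)
  then have Lpos: "\<Lambda> > 0" and epos: "\<epsilon> > 0" using pos \<alpha> by (auto simp: \<Lambda>_def \<epsilon>_def)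
  have \<Lambda>\<epsilon>: "\<Lambda> * c * \<epsilon> = c" "\<Lambda> * \<alpha> * C\<^sub>o = 2 * c" using cpos pos \<alpha> by (auto simp: \<Lambda>_def \<epsilon>_def)
  have spos: "(\<Sum>i\<in>(UNIV :: 'n set). c + \<Lambda> * c * \<epsilon> powr (1 - p i)) > 0"
    using cpos Lpos by (intro sum_pos) (auto intro!: add_pos_nonneg)
  then have \<eta>pos: "\<eta> > 0" using pos by (simp add: \<eta>_def)
  have \<Gamma>pos: "\<Gamma> > 0"
    unfolding \<Gamma>_def using cpos Lpos pos \<alpha> by (intro sum_pos) (auto intro!: add_pos_nonneg add_nonneg_pos mult_nonneg_nonneg)
  show ?thesis
  proof (rule that[OF \<Gamma>pos])
    fix z w \<nu> t C b :: real and L a d \<xi> :: "'n \<Rightarrow> real"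
    assume z: "0 \<le> z" "z \<le> 1" and w: "\<nu> \<le> w" "0 < \<nu>" "0 < t" "\<And>i. 0 < L i"
      and scale: "\<And>i. L i powr (- p i) = \<nu> powr (2 - p i) / t"
      and C: "0 \<le> C" "\<And>i. C * L i \<le> 1" "\<And>i. C * L i \<le> \<nu>"
      and co: "\<And>i. C\<^sub>o * \<bar>\<xi> i\<bar> powr p i - C powr p i \<le> a i * \<xi> i"
      and a: "\<And>i. \<bar>a i\<bar> \<le> C\<^sub>1 * \<bar>\<xi> i\<bar> powr (p i - 1) + C powr (p i - 1)"
      and b: "\<bar>b\<bar> \<le> (\<Sum>i\<in>UNIV. C * (\<bar>\<xi> i\<bar> powr (p i - 1) + C powr (p i - 1)))"
      and d: "\<And>i. \<bar>d i\<bar> \<le> M / L i * z powr (1 - \<kappa>)"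
    have wpos: "0 < w" using w by linarith
    have k1: "\<kappa> < 1" using \<kappa> \<alpha> by linarith
    define X E where "X i = \<bar>\<xi> i\<bar> powr (p i - 1) * z powr (1 - \<kappa>) / L i"
      and "E i = \<nu> powr \<alpha> * w powr (- \<alpha> - 1) * z * \<bar>\<xi> i\<bar> powr p i" for i
    define H where "H = (\<Sum>i\<in>UNIV. \<bar>a i\<bar> * \<bar>d i\<bar>) + \<bar>b\<bar> * z"
    define P where "P = b * (w powr (- \<alpha>) * z)
             - (\<Sum>i\<in>UNIV. a i * (- \<alpha> * w powr (- \<alpha> - 1) * \<xi> i * z + w powr (- \<alpha>) * d i))"
    have H: "H \<le> (\<Sum>i\<in>UNIV. c * X i + (M + 1) * \<nu> / t)"
      unfolding H_def X_def c_def by (rule flux_bound[OF p \<kappa>(1) k1 pos(2,3) z w(2-4) scale C a b d])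
    have pk: "p i * \<kappa> \<le> 2 * \<kappa>" for i using p(2)[of i] \<kappa> by simp
    have pk': "p i * \<kappa> \<le> \<alpha>" for i using pk[of i] \<kappa> by linarith
    have X1: "X i \<le> E i + (\<eta> * (w * z) + \<eta> powr (- \<beta>f i / (1 - \<beta>f i)) * \<nu>) / t" for i
    proof -
      have "X i \<le> E i + (w * z) powr \<beta>f i * \<nu> powr (1 - \<beta>f i) / t"
        unfolding X_def E_def \<beta>f_def using z w wpos p scale k1 \<beta>[of i] pk[of i]
        by (intro gradient_term_bound) auto
      also have "(w * z) powr \<beta>f i * \<nu> powr (1 - \<beta>f i) \<le> \<eta> * (w * z) + \<eta> powr (- \<beta>f i / (1 - \<beta>f i)) * \<nu>"
        using wpos z w \<eta>pos \<beta>[of i] \<kappa> \<alpha> p(1)[of i] by (intro powr_interpolation) (auto simp: \<beta>f_def)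
      finally show ?thesis using w by (simp add: divide_right_mono)
    qed
    have X2: "\<nu> powr \<alpha> * w powr (- \<alpha>) * X i \<le> \<epsilon> * E i
        + \<epsilon> powr (1 - p i) * (\<eta> * (w * z) + \<eta> powr (- (1 - \<alpha>) / (1 - (1 - \<alpha>))) * \<nu>) / t" for i
    proof -
      have "\<nu> powr \<alpha> * w powr (- \<alpha>) * X i
          \<le> \<epsilon> * E i + \<epsilon> powr (1 - p i) * ((w * z) powr (1 - \<alpha>) * \<nu> powr \<alpha>) / t"
        unfolding X_def E_def using z w p scale k1 epos pk'
        by (intro weighted_gradient_term_bound) auto
      also have "(w * z) powr (1 - \<alpha>) * \<nu> powr \<alpha> \<le> \<eta> * (w * z) + \<eta> powr (- (1 - \<alpha>) / (1 - (1 - \<alpha>))) * \<nu>"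
        using wpos z w \<eta>pos \<alpha> powr_interpolation[of "w * z" \<nu> \<eta> "1 - \<alpha>"] by simp
      finally show ?thesis using w by (simp add: divide_right_mono mult_left_mono)
    qed
    have w1: "\<nu> powr \<alpha> * w powr (- \<alpha>) \<le> 1"
    proof -
      have "\<nu> powr \<alpha> \<le> w powr \<alpha>" using w \<alpha> by (intro powr_mono2) auto
      then show ?thesis using wpos by (simp add: powr_minus field_simps)
    qed
    \<comment> \<open>One factor \<open>1 / w \<le> 1 / \<nu>\<close> reduces the bound
      \<open>\<nu>\<^sup>2 / t\<close> for \<open>C powr p i\<close> to \<nu> / t.\<close>
    have w2: "\<nu> powr \<alpha> * w powr (- \<alpha> - 1) * z * C powr p i \<le> \<nu> / t" for i
    proof -
      have "w powr (- \<alpha> - 1) = w powr (- \<alpha>) / w" using wpos by (simp add: powr_diff)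
      then have "\<nu> powr \<alpha> * w powr (- \<alpha> - 1) * z * C powr p i
          = (\<nu> powr \<alpha> * w powr (- \<alpha>)) * (1 / w) * z * C powr p i" by simp
      also have "\<dots> \<le> 1 * (1 / \<nu>) * 1 * (\<nu>\<^sup>2 / t)"
        using w1 w wpos z lower_order_bounds(3)[of C \<nu> "L i" t "p i"] C p scale
        by (intro mult_mono frac_le) auto
      also have "\<dots> = \<nu> / t" using w by (simp add: power2_eq_square)
      finally show ?thesis .
    qed
    \<comment> \<open>The summand with \<open>- \<alpha> * w powr (- \<alpha> - 1)\<close> enters
      \<open>P\<close> with a positive sign, so coercivity applies to it. The cutoff and source
      parts are bounded by \<open>H\<close> itself, weighted with
      \<open>w powr (- \<alpha>)\<close>.\<close>
    have P1: "\<nu> powr \<alpha> * P \<ge> (\<Sum>i\<in>UNIV. \<alpha> * C\<^sub>o * E i - \<alpha> * (\<nu> / t)) - \<nu> powr \<alpha> * w powr (- \<alpha>) * H"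
    proof -
      let ?W = "\<nu> powr \<alpha> * w powr (- \<alpha> - 1) * z"
      let ?V = "\<nu> powr \<alpha> * w powr (- \<alpha>)"
      have eq: "\<nu> powr \<alpha> * P = (\<Sum>i\<in>UNIV. \<alpha> * ?W * (a i * \<xi> i)) - ?V * ((\<Sum>i\<in>UNIV. a i * d i) - b * z)"
        unfolding P_def by (simp add: algebra_simps sum_distrib_left sum.distrib sum_subtractf sum_negf)
      have "(\<Sum>i\<in>UNIV. a i * d i) \<le> (\<Sum>i\<in>UNIV. \<bar>a i\<bar> * \<bar>d i\<bar>)"
        by (intro sum_mono) (metis abs_ge_self abs_mult)
      moreover have "- (b * z) \<le> \<bar>b\<bar> * z"
        using z by (metis abs_ge_minus_self abs_mult abs_of_nonneg)
      ultimately have "?V * ((\<Sum>i\<in>UNIV. a i * d i) - b * z) \<le> ?V * H"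
        unfolding H_def by (intro mult_left_mono) auto
      moreover have "(\<Sum>i\<in>UNIV. \<alpha> * C\<^sub>o * E i - \<alpha> * (\<nu> / t)) \<le> (\<Sum>i\<in>UNIV. \<alpha> * ?W * (a i * \<xi> i))"
      proof (rule sum_mono)
        fix i
        have "\<alpha> * C\<^sub>o * E i - \<alpha> * (\<nu> / t) \<le> \<alpha> * C\<^sub>o * E i - \<alpha> * (?W * C powr p i)"
          using w2[of i] \<alpha> by (intro diff_left_mono mult_left_mono) auto
        also have "\<dots> = \<alpha> * ?W * (C\<^sub>o * \<bar>\<xi> i\<bar> powr p i - C powr p i)" by (simp add: E_def algebra_simps)
        also have "\<dots> \<le> \<alpha> * ?W * (a i * \<xi> i)" using co[of i] \<alpha> z by (intro mult_left_mono) auto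
        finally show "\<alpha> * C\<^sub>o * E i - \<alpha> * (\<nu> / t) \<le> \<alpha> * ?W * (a i * \<xi> i)" .
      qed
      ultimately show ?thesis unfolding eq by linarith
    qed
    have VH: "\<nu> powr \<alpha> * w powr (- \<alpha>) * H \<le> (\<Sum>i\<in>UNIV. c * (\<epsilon> * E i
        + \<epsilon> powr (1 - p i) * (\<eta> * (w * z) + \<eta> powr (- (1 - \<alpha>) / (1 - (1 - \<alpha>))) * \<nu>) / t) + (M + 1) * \<nu> / t)"
    proof -
      have "\<nu> powr \<alpha> * w powr (- \<alpha>) * H \<le> \<nu> powr \<alpha> * w powr (- \<alpha>) * (\<Sum>i\<in>UNIV. c * X i + (M + 1) * \<nu> / t)"
        using H by (intro mult_left_mono) auto
      also have "\<dots> = (\<Sum>i\<in>UNIV. c * (\<nu> powr \<alpha> * w powr (- \<alpha>) * X i)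
          + \<nu> powr \<alpha> * w powr (- \<alpha>) * ((M + 1) * \<nu> / t))"
        by (simp add: sum_distrib_left algebra_simps)
      also have "\<dots> \<le> (\<Sum>i\<in>UNIV. c * (\<epsilon> * E i
        + \<epsilon> powr (1 - p i) * (\<eta> * (w * z) + \<eta> powr (- (1 - \<alpha>) / (1 - (1 - \<alpha>))) * \<nu>) / t) + 1 * ((M + 1) * \<nu> / t))"
        using cpos X2 w1 pos w by (intro sum_mono add_mono mult_left_mono mult_right_mono) auto
      finally show ?thesis by simp
    qed
    have "H - \<Lambda> * (\<nu> powr \<alpha> * P) \<le> (\<Sum>i\<in>UNIV. c * (E i + (\<eta> * (w * z) + \<eta> powr (- \<beta>f i / (1 - \<beta>f i)) * \<nu>) / t) + (M + 1) * \<nu> / t)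
       - \<Lambda> * ((\<Sum>i\<in>UNIV. \<alpha> * C\<^sub>o * E i - \<alpha> * (\<nu> / t)) - (\<Sum>i\<in>UNIV. c * (\<epsilon> * E i
        + \<epsilon> powr (1 - p i) * (\<eta> * (w * z) + \<eta> powr (- (1 - \<alpha>) / (1 - (1 - \<alpha>))) * \<nu>) / t) + (M + 1) * \<nu> / t))"
    proof (rule diff_mono)
      show "H \<le> (\<Sum>i\<in>UNIV. c * (E i + (\<eta> * (w * z) + \<eta> powr (- \<beta>f i / (1 - \<beta>f i)) * \<nu>) / t) + (M + 1) * \<nu> / t)"
        using X1 cpos by (intro order_trans[OF H] sum_mono add_mono mult_left_mono) auto
    qed (use P1 VH Lpos in \<open>intro mult_left_mono, auto\<close>)
    \<comment> \<open>Sorted by type of term. The coefficient of \<open>E i\<close> is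
      \<open>c + c - 2 * c = 0\<close>, so the gradient disappears from the estimate.\<close>
    also have "\<dots> = (\<Sum>i\<in>UNIV. (c + \<Lambda> * c * \<epsilon> - \<Lambda> * \<alpha> * C\<^sub>o) * E i + ((c + \<Lambda> * c * \<epsilon> powr (1 - p i)) * (\<eta> * (w * z))
        + (c * \<eta> powr (- \<beta>f i / (1 - \<beta>f i)) + (M + 1) + \<Lambda> * \<alpha>
      + \<Lambda> * c * \<epsilon> powr (1 - p i) * \<eta> powr (- (1 - \<alpha>) / (1 - (1 - \<alpha>))) + \<Lambda> * (M + 1)) * \<nu>) / t)"
      unfolding sum_distrib_left sum_subtractf[symmetric]
      by (intro sum.cong refl) (use w in \<open>simp add: field_simps\<close>)
    also have "\<dots> = (\<Sum>i\<in>UNIV. ((c + \<Lambda> * c * \<epsilon> powr (1 - p i)) * (\<eta> * (w * z))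
        + (c * \<eta> powr (- \<beta>f i / (1 - \<beta>f i)) + (M + 1) + \<Lambda> * \<alpha>
      + \<Lambda> * c * \<epsilon> powr (1 - p i) * \<eta> powr (- (1 - \<alpha>) / (1 - (1 - \<alpha>))) + \<Lambda> * (M + 1)) * \<nu>) / t)"
      unfolding \<Lambda>\<epsilon> by simp
    also have "\<dots> = ((\<Sum>i\<in>(UNIV :: 'n set). c + \<Lambda> * c * \<epsilon> powr (1 - p i)) * (\<eta> * (w * z)) + \<Gamma> * \<nu>) / t"
      unfolding \<Gamma>_def sum_divide_distrib[symmetric] sum.distrib[symmetric] sum_distrib_right ..
    also have "\<dots> = (\<delta> * (w * z) + \<Gamma> * \<nu>) / t"
      using spos unfolding \<eta>_def by simp
    finally have "H - \<Lambda> * (\<nu> powr \<alpha> * P) \<le> (\<delta> * (w * z) + \<Gamma> * \<nu>) / t" .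
    then show "(\<Sum>i\<in>UNIV. \<bar>a i\<bar> * \<bar>d i\<bar>) + \<bar>b\<bar> * z
        \<le> 2 * (C\<^sub>1 * M + 1) / (\<alpha> * C\<^sub>o) * \<nu> powr \<alpha> *
            (b * (w powr (- \<alpha>) * z)
             - (\<Sum>i\<in>UNIV. a i * (- \<alpha> * w powr (- \<alpha> - 1) * \<xi> i * z + w powr (- \<alpha>) * d i)))
          + (\<delta> * (w * z) + \<Gamma> * \<nu>) / t"
      unfolding H_def[symmetric] P_def[symmetric] c_def[symmetric] \<Lambda>_def[symmetric] by (simp add: mult.assoc)
  qed
qed

section \<open>Directional derivatives and the classes \<open>C\<^sup>k\<close>\<close>

lemma dir_deriv_eq: "(f has_derivative f') (at x) \<Longrightarrow> dir_deriv v f x = f' v"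
  unfolding dir_deriv_def using frechet_derivative_at by metis

lemma differentiable_has_derivative_dir:
  fixes f :: "'a::euclidean_space \<Rightarrow> real"
  assumes "f differentiable (at x)"
  shows "(f has_derivative (\<lambda>h. \<Sum>b\<in>Basis. (h \<bullet> b) * dir_deriv b f x)) (at x)"
proof -
  let ?f' = "frechet_derivative f (at x)"
  have d: "(f has_derivative ?f') (at x)" using assms frechet_derivative_works by blast
  then have "linear ?f'" by (rule has_derivative_linear)
  then have *: "?f' (\<Sum>b\<in>Basis. (h \<bullet> b) *\<^sub>R b) = (\<Sum>b\<in>Basis. (h \<bullet> b) * ?f' b)" for h
    by (simp add: linear_sum linear_scale)
  have "?f' = (\<lambda>h. \<Sum>b\<in>Basis. (h \<bullet> b) * ?f' b)"
    using * unfolding euclidean_representation by (rule ext)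
  then show ?thesis unfolding dir_deriv_def by (rule has_derivative_eq_rhs[OF d])
qed

lemma C_k_SucD: "C_k (Suc k) f \<Longrightarrow> C_k k f"
proof (induction k arbitrary: f)
  case 0
  then show ?case
    by (auto intro!: continuous_at_imp_continuous_on differentiable_imp_continuous_within)
next
  case (Suc k)
  then show ?case by auto
qed

lemma C_k_mono: "C_k k f \<Longrightarrow> j \<le> k \<Longrightarrow> C_k j f"
  by (induction k) (auto simp: le_Suc_eq simp del: C_k.simps dest: C_k_SucD)

lemma C_k_continuous: "C_k k f \<Longrightarrow> continuous_on UNIV f"
  using C_k_mono[of k f 0] by simp

lemma C_k_const: "C_k k (\<lambda>x. c)"
proof (induction k arbitrary: c)
  case (Suc k)
  have "dir_deriv b (\<lambda>x::'a. c) = (\<lambda>x. 0)" for b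
    by (intro ext dir_deriv_eq) auto
  then show ?case using Suc by simp
qed simp

lemma C_k_inner: "C_k k (\<lambda>x. x \<bullet> c)"
proof (cases k)
  case (Suc j)
  have "dir_deriv b (\<lambda>x. x \<bullet> c) = (\<lambda>x. b \<bullet> c)" for b
    by (intro ext dir_deriv_eq) (auto intro!: derivative_eq_intros)
  then show ?thesis using Suc by (auto simp: C_k_const intro!: derivative_intros)
qed (auto intro!: continuous_intros)

lemma C_k_add: "C_k k f \<Longrightarrow> C_k k g \<Longrightarrow> C_k k (\<lambda>x. f x + g x)"
proof (induction k arbitrary: f g)
  case (Suc k)
  have "dir_deriv b (\<lambda>x. f x + g x) = (\<lambda>x. dir_deriv b f x + dir_deriv b g x)" for b
  proof
    fix x
    show "dir_deriv b (\<lambda>x. f x + g x) x = dir_deriv b f x + dir_deriv b g x"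
      using Suc.prems by (intro dir_deriv_eq) (auto simp: dir_deriv_def frechet_derivative_works intro!: derivative_intros)
  qed
  then show ?case using Suc by (auto intro!: derivative_intros)
qed (auto intro!: continuous_intros)

lemma C_k_mult: "C_k k f \<Longrightarrow> C_k k g \<Longrightarrow> C_k k (\<lambda>x. f x * g x)"
proof (induction k arbitrary: f g)
  case (Suc k)
  have eq: "dir_deriv b (\<lambda>x. f x * g x) = (\<lambda>x. f x * dir_deriv b g x + dir_deriv b f x * g x)" for b
  proof
    fix x
    show "dir_deriv b (\<lambda>x. f x * g x) x = f x * dir_deriv b g x + dir_deriv b f x * g x"
      using Suc.prems by (intro dir_deriv_eq) (auto simp: dir_deriv_def frechet_derivative_works intro!: derivative_intros)
  qed
  have "C_k k f" "C_k k g" using Suc.prems C_k_SucD by blast+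
  then show ?case using Suc eq by (auto intro!: derivative_intros C_k_add)
qed (auto intro!: continuous_intros)

text \<open>Reflections are needed because the test function behind a mollification at
  \<open>x\<close> is \<open>mollifier r (x - y)\<close> as a function of \<open>y\<close>.\<close>

lemma has_derivative_reflect:
  assumes "f differentiable (at (x - y))"
  shows "((\<lambda>y. f (x - y)) has_derivative (\<lambda>h. frechet_derivative f (at (x - y)) (- h))) (at y)"
proof -
  have f: "(f has_derivative frechet_derivative f (at (x - y))) (at (x - y))"
    using assms frechet_derivative_works by blast
  have "((\<lambda>y. x - y) has_derivative (\<lambda>h. - h)) (at y)" by (auto intro!: derivative_eq_intros)
  from has_derivative_compose[OF this f] show ?thesis .
qed

lemma dir_deriv_reflect:
  assumes "f differentiable (at (x - y))"
  shows "dir_deriv b (\<lambda>y. f (x - y)) y = - dir_deriv b f (x - y)"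
proof -
  have "linear (frechet_derivative f (at (x - y)))"
    using assms frechet_derivative_works has_derivative_linear by blast
  then show ?thesis
    by (subst dir_deriv_eq[OF has_derivative_reflect[OF assms]]) (simp add: dir_deriv_def linear_neg)
qed

lemma C_k_reflect: "C_k k f \<Longrightarrow> C_k k (\<lambda>y. f (x - y))"
proof (induction k arbitrary: f)
  case 0
  then have "continuous_on UNIV (f \<circ> (\<lambda>y. x - y))"
    by (intro continuous_on_compose) (auto intro!: continuous_intros elim: continuous_on_subset)
  then show ?case by (simp add: o_def)
next
  case (Suc k)
  have "(\<lambda>y. f (x - y)) differentiable (at y)" for y
    using Suc.prems has_derivative_reflect[of f x y] by (auto simp: differentiable_def)
  moreover have "dir_deriv b (\<lambda>y. f (x - y)) = (\<lambda>y. (- 1) * dir_deriv b f (x - y))" for b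
    using Suc.prems dir_deriv_reflect by fastforce
  moreover have "C_k k (\<lambda>y. (- 1) * dir_deriv b f (x - y))" if "b \<in> Basis" for b
    using Suc that by (intro C_k_mult C_k_const) auto
  ultimately show ?case by simp
qed

text \<open>Closedness of \<open>S\<close> makes the function vanish in a whole neighbourhood of the
  point.\<close>

lemma dir_deriv_outside:
  fixes f :: "'a::euclidean_space \<Rightarrow> real"
  assumes "closed S" "\<And>x. x \<notin> S \<Longrightarrow> f x = 0" "x \<notin> S"
  shows "dir_deriv b f x = 0"
proof -
  have "((\<lambda>x. 0 :: real) has_derivative (\<lambda>h. 0)) (at x)" by simp
  then have "(f has_derivative (\<lambda>h. 0)) (at x)"
    by (rule has_derivative_transform_within_open[of _ _ _ _ "- S"]) (use assms in auto)
  then show ?thesis by (rule dir_deriv_eq)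
qed

section \<open>Mollifiers\<close>

text \<open>\<open>flat 0\<close> is the classical smooth function \<open>exp (- 1 / s)\<close>
  extended by zero. The powers of \<open>inverse s\<close> are included because the family is then
  closed under differentiation up to linear combinations, and smoothness follows by one induction
  over all \<open>m\<close>.\<close>

definition flat :: "nat \<Rightarrow> real \<Rightarrow> real" where
  "flat m s = (if 0 < s then inverse s ^ m * exp (- inverse s) else 0)"

text \<open>A single term of the exponential series at \<open>inverse s\<close> gives the decay.
  Order two suffices: divided by \<open>s\<close> it still tends to zero, which is what
  differentiability at the origin requires.\<close>

lemma flat_bound: "\<bar>flat m s\<bar> \<le> fact (m + 2) * s\<^sup>2"
proof (cases "0 < s")
  case True
  define y where "y = inverse s"
  have y: "0 < y" "s = inverse y" using True by (auto simp: y_def)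
  have "(\<Sum>n\<in>{m + 2}. y ^ n /\<^sub>R fact n) \<le> (\<Sum>n. y ^ n /\<^sub>R fact n)"
    using y exp_converges[of y] by (intro sum_le_suminf) (auto simp: sums_iff)
  then have "y ^ (m + 2) / fact (m + 2) \<le> exp y"
    using exp_converges[of y] by (simp add: sums_iff divide_inverse mult.commute)
  then have "y ^ (m + 2) \<le> exp y * fact (m + 2)"
    by (simp only: divide_le_eq fact_gt_zero if_True)
  then have "y ^ (m + 2) * exp (- y) \<le> exp y * fact (m + 2) * exp (- y)"
    by (rule mult_right_mono) simp
  also have "\<dots> = (exp y * exp (- y)) * fact (m + 2)" by (simp only: mult_ac)
  also have "\<dots> = fact (m + 2)" by (simp only: exp_minus_inverse mult_1)
  finally have "(y ^ (m + 2) * exp (- y)) * (inverse y)\<^sup>2 \<le> fact (m + 2) * (inverse y)\<^sup>2"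
    by (rule mult_right_mono) simp
  moreover have "(y ^ (m + 2) * exp (- y)) * (inverse y)\<^sup>2 = y ^ m * exp (- y)"
    using y by (simp only: power_add power_inverse) (simp add: mult_ac)
  ultimately have "y ^ m * exp (- y) \<le> fact (m + 2) * (inverse y)\<^sup>2" by (simp only:)
  then show ?thesis using y True by (simp add: flat_def)
qed (auto simp: flat_def)

lemma has_derivative_flat:
  "(flat m has_real_derivative (flat (m + 2) s - real m * flat (m + 1) s)) (at s)"
proof -
  consider "0 < s" | "s < 0" | "s = 0" by linarith
  then show ?thesis
  proof cases
    case 1
    have "((\<lambda>y. y ^ m * exp (- y)) has_real_derivative
        (real m * y ^ (m - 1) * exp (- y) - y ^ m * exp (- y))) (at y)" for y :: real
      by (auto intro!: derivative_eq_intros)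
    from DERIV_chain2[OF this DERIV_inverse[of s]]
    have "((\<lambda>s. inverse s ^ m * exp (- inverse s)) has_real_derivative
        (flat (m + 2) s - real m * flat (m + 1) s)) (at s)"
      using 1 by (cases m) (simp_all add: flat_def power2_eq_square algebra_simps)
    then show ?thesis
      by (rule has_field_derivative_transform_within_open[of _ _ _ "{0<..}"]) (use 1 in \<open>auto simp: flat_def\<close>)
  next
    case 2
    have "((\<lambda>s. 0) has_real_derivative (flat (m + 2) s - real m * flat (m + 1) s)) (at s)"
      using 2 by (auto simp: flat_def)
    then show ?thesis
      by (rule has_field_derivative_transform_within_open[of _ _ _ "{..<0}"]) (use 2 in \<open>auto simp: flat_def\<close>)
  next
    case 3
    \<comment> \<open>At the gluing point \<open>flat_bound\<close> makes the difference quotient at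
      most a multiple of \<open>\<bar>h\<bar>\<close>.\<close>
    have "((\<lambda>h. (flat m (0 + h) - flat m 0) / h) \<longlongrightarrow> 0) (at 0)"
    proof (rule tendsto_0_le[where K = "fact (m + 2)"])
      show "((\<lambda>h::real. h) \<longlongrightarrow> 0) (at 0)" by simp
      have *: "norm ((flat m (0 + h) - flat m 0) / h) \<le> norm h * fact (m + 2)" if "h \<noteq> 0" for h
      proof -
        have "\<bar>flat m h\<bar> \<le> fact (m + 2) * \<bar>h\<bar>\<^sup>2"
          using flat_bound[of m h] by (simp only: power2_abs)
        then have "\<bar>flat m h\<bar> \<le> (\<bar>h\<bar> * fact (m + 2)) * \<bar>h\<bar>"
          by (simp only: power2_eq_square mult_ac)
        moreover have "flat m 0 = 0" by (simp add: flat_def)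
        moreover have "0 < \<bar>h\<bar>" using that by simp
        ultimately show ?thesis
          by (simp only: real_norm_def abs_divide pos_divide_le_eq add_0 diff_zero)
      qed
      show "\<forall>\<^sub>F h in at 0. norm ((flat m (0 + h) - flat m 0) / h) \<le> norm h * fact (m + 2)"
        unfolding eventually_at_filter by (intro always_eventually allI impI *)
    qed
    then show ?thesis using 3 by (simp add: DERIV_def flat_def)
  qed
qed

text \<open>The derivative is a combination of functions of the same kind, with larger
  \<open>m\<close>, times a linear function; hence the induction leaves \<open>m\<close>
  free.\<close>

lemma C_k_flat: "C_k k (\<lambda>x::'a::euclidean_space. flat m (c - x \<bullet> x))"
proof (induction k arbitrary: m)
  case 0
  have "continuous_on UNIV (flat m)"
    using has_derivative_flat by (intro continuous_at_imp_continuous_on) (auto intro: DERIV_isCont)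
  then show ?case
    by (auto intro!: continuous_on_compose2[of UNIV "flat m"] continuous_intros)
next
  case (Suc k)
  have d: "((\<lambda>x. flat m (c - x \<bullet> x)) has_derivative
      (\<lambda>h. (flat (m + 2) (c - x \<bullet> x) - real m * flat (m + 1) (c - x \<bullet> x)) * (- 2 * (x \<bullet> h)))) (at x)" for x :: 'a
  proof -
    have "((\<lambda>x. c - x \<bullet> x) has_derivative (\<lambda>h. - 2 * (x \<bullet> h))) (at x)"
      by (auto intro!: derivative_eq_intros simp: inner_commute)
    from has_derivative_compose[OF this has_derivative_flat[unfolded has_field_derivative_def]]
    show ?thesis by simp
  qed
  have "dir_deriv b (\<lambda>x. flat m (c - x \<bullet> x)) = (\<lambda>x. (flat (m + 2) (c - x \<bullet> x)
      + (- real m) * flat (m + 1) (c - x \<bullet> x)) * (- 2 * (x \<bullet> b)))" for b :: 'a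
    by (intro ext, subst dir_deriv_eq[OF d]) (simp add: algebra_simps)
  moreover have "C_k k (\<lambda>x::'a. (flat (m + 2) (c - x \<bullet> x)
      + (- real m) * flat (m + 1) (c - x \<bullet> x)) * (- 2 * (x \<bullet> b)))" for b :: 'a
    by (intro C_k_mult C_k_add Suc C_k_const C_k_inner)
  ultimately show ?case using d by (auto simp: differentiable_def)
qed

text \<open>Normalised separately for each radius instead of by rescaling one bump, which avoids a
  change of variables.\<close>

definition mollifier :: "real \<Rightarrow> 'a::euclidean_space \<Rightarrow> real" where
  "mollifier r x = inverse (\<integral>y. flat 0 (r\<^sup>2 - y \<bullet> y) \<partial>(lborel :: 'a measure)) * flat 0 (r\<^sup>2 - x \<bullet> x)"

lemma C_k_mollifier: "C_k k (mollifier r)"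
  unfolding mollifier_def by (intro C_k_mult C_k_const C_k_flat)

lemma flat_nonneg: "0 \<le> flat m s"
  by (simp add: flat_def)

lemma mollifier_nonneg: "0 \<le> mollifier r x"
  unfolding mollifier_def by (intro mult_nonneg_nonneg flat_nonneg) (simp add: flat_nonneg)

lemma mollifier_outside: "0 < r \<Longrightarrow> r \<le> norm x \<Longrightarrow> mollifier r x = 0"
  using power_mono[of r "norm x" 2] by (simp add: mollifier_def flat_def power2_norm_eq_inner)

lemma integrable_compact_support:
  fixes f :: "'a::euclidean_space \<Rightarrow> real"
  assumes "continuous_on UNIV f" "\<And>x. R < norm x \<Longrightarrow> f x = 0"
  shows "integrable lborel f"
proof -
  have "integrable lborel (\<lambda>x. indicator (cball 0 R) x *\<^sub>R f x)"
    using assms by (intro borel_integrable_compact) (auto intro: continuous_on_subset)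
  also have "(\<lambda>x. indicator (cball 0 R) x *\<^sub>R f x) = f"
    using assms by (auto simp: fun_eq_iff indicator_def not_le)
  finally show ?thesis .
qed

lemma integral_mollifier:
  assumes "0 < r"
  shows "(\<integral>x. mollifier r x \<partial>(lborel :: 'a::euclidean_space measure)) = 1"
proof -
  let ?f = "\<lambda>x::'a. flat 0 (r\<^sup>2 - x \<bullet> x)"
  have cont: "continuous_on UNIV ?f" using C_k_flat C_k_continuous by blast
  have out: "?f x = 0" if "r < norm x" for x
    using power_mono[of r "norm x" 2] that assms by (simp add: flat_def power2_norm_eq_inner)
  have int: "integrable lborel ?f"
    using cont out by (rule integrable_compact_support)
  \<comment> \<open>A vanishing integral would make the nonnegative bump vanish almost everywhere,
    yet it is positive on a ball of positive measure.\<close>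
  have "(\<integral>x. ?f x \<partial>lborel) \<noteq> 0"
  proof
    assume "(\<integral>x. ?f x \<partial>lborel) = 0"
    then have "AE x in lborel. ?f x = 0"
      using int by (subst (asm) integral_nonneg_eq_0_iff_AE) (auto simp: flat_nonneg)
    then have "AE x in (lborel :: 'a measure). x \<notin> ball 0 r"
    proof eventually_elim
      case (elim x)
      then have "\<not> 0 < r\<^sup>2 - x \<bullet> x" unfolding flat_def by (metis exp_not_eq_zero mult_1 power_0)
      then have "r\<^sup>2 \<le> (norm x)\<^sup>2" unfolding power2_norm_eq_inner by linarith
      then have "r \<le> norm x" by (rule power2_le_imp_le) simp
      then show ?case by simp
    qed
    then have "emeasure lborel (ball (0::'a) r) = 0"
      by (subst (asm) AE_iff_measurable[of "ball 0 r"]) auto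
    then show False
      using content_ball_pos[OF assms, of "0::'a"] unfolding measure_def by (metis enn2real_0 less_irrefl)
  qed
  then show ?thesis unfolding mollifier_def by (subst integral_mult_right_zero) (rule left_inverse)
qed

section \<open>Continuity of translations in the mean\<close>

lemma nn_integral_lborel_translate:
  fixes f :: "'a::euclidean_space \<Rightarrow> ennreal"
  assumes [measurable]: "f \<in> borel_measurable borel"
  shows "(\<integral>\<^sup>+x. f (x + h) \<partial>lborel) = (\<integral>\<^sup>+x. f x \<partial>lborel)"
proof -
  have "(\<integral>\<^sup>+x. f x \<partial>lborel) = (\<integral>\<^sup>+x. f x \<partial>distr lborel borel ((+) h))"
    by (simp add: lborel_distr_plus)
  also have "\<dots> = (\<integral>\<^sup>+x. f (h + x) \<partial>lborel)"
    by (subst nn_integral_distr) auto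
  finally show ?thesis by (simp add: add.commute)
qed

lemma integral_lborel_translate:
  fixes f :: "'a::euclidean_space \<Rightarrow> real"
  assumes [measurable]: "f \<in> borel_measurable borel"
  shows "(\<integral>x. f (x + h) \<partial>lborel) = (\<integral>x. f x \<partial>lborel)"
proof -
  have "(\<integral>x. f x \<partial>lborel) = (\<integral>x. f x \<partial>distr lborel borel ((+) h))"
    by (simp add: lborel_distr_plus)
  also have "\<dots> = (\<integral>x. f (h + x) \<partial>lborel)"
    by (subst integral_distr) auto
  finally show ?thesis by (simp add: add.commute)
qed

text \<open>Inner regularity by closed sets becomes inner regularity by compact sets after
  intersection with growing balls; continuity of the measure from above applies because
  \<open>A\<close> has finite measure.\<close>

lemma inner_compact_borel:
  fixes A :: "'a::euclidean_space set"
  assumes A: "A \<in> sets borel" "emeasure lborel A < \<infinity>" and "0 < e"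
  obtains K where "compact K" "K \<subseteq> A" "emeasure lborel (A - K) < ennreal e"
proof -
  have "A \<in> sets lebesgue" using A by simp
  from sets_lebesgue_inner_closed[OF this \<open>0 < e\<close>] obtain T
    where T: "closed T" "T \<subseteq> A" "emeasure lebesgue (A - T) < ennreal e" by metis
  let ?D = "\<lambda>n. A - (T \<inter> cball 0 (real n))"
  have "(\<lambda>n. emeasure lborel (?D n)) \<longlonglongrightarrow> emeasure lborel (\<Inter>n. ?D n)"
  proof (rule Lim_emeasure_decseq)
    show "range ?D \<subseteq> sets lborel" using A T by (auto intro!: sets.Diff sets.Int simp: borel_closed)
    show "decseq ?D" by (auto simp: decseq_def)
    show "emeasure lborel (?D i) \<noteq> \<infinity>" for i
      using A emeasure_mono[of "?D i" A lborel] by (auto simp: top_unique)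
  qed
  also have "(\<Inter>n. ?D n) = A - T"
    using real_arch_simple by auto
  also have "emeasure lborel (A - T) = emeasure lebesgue (A - T)"
    using A T by (auto intro!: sets.Diff borel_closed)
  finally have "\<forall>\<^sub>F n in sequentially. emeasure lborel (?D n) < ennreal e"
    using T(3) by (rule order_tendstoD(2))
  then obtain n where "emeasure lborel (?D n) < ennreal e"
    using eventually_happens'[OF sequentially_bot] by metis
  then show ?thesis
    using T by (intro that[of "T \<inter> cball 0 (real n)"]) (auto simp: closed_Int_compact)
qed

text \<open>With \<open>K\<close> compact inside \<open>A\<close> and \<open>U\<close> open around
  it, a shift shorter than the distance from \<open>K\<close> to the complement of \<open>U\<close>
  changes the indicator only where \<open>x\<close> or \<open>x + h\<close> lies in the small set
  \<open>U - K\<close>.\<close>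

lemma L1_translation_indicator:
  fixes A :: "'a::euclidean_space set"
  assumes A: "A \<in> sets borel" "emeasure lborel A < \<infinity>" and "0 < e"
  shows "\<exists>d>0. \<forall>h. norm h < d \<longrightarrow>
    (\<integral>\<^sup>+x. ennreal \<bar>indicator A (x + h) - indicator A x\<bar> \<partial>lborel) \<le> ennreal e"
proof -
  obtain K where K: "compact K" "K \<subseteq> A" "emeasure lborel (A - K) < ennreal (e / 4)"
    using inner_compact_borel[OF A, of "e / 4"] \<open>0 < e\<close> by auto
  have "A \<in> sets lebesgue" using A by simp
  moreover have "0 < e / 4" using \<open>0 < e\<close> by simp
  ultimately obtain U
    where U: "open U" "A \<subseteq> U" "emeasure lebesgue (U - A) < ennreal (e / 4)"
    using sets_lebesgue_outer_open by metis
  have [measurable]: "A \<in> sets borel" "K \<in> sets borel" "U \<in> sets borel"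
    using A K U by (auto intro: borel_compact)
  have UK: "emeasure lborel (U - K) \<le> ennreal (e / 2)"
  proof -
    have "U - K = (U - A) \<union> (A - K)" using K U by auto
    then have "emeasure lborel (U - K) \<le> emeasure lborel (U - A) + emeasure lborel (A - K)"
      by (simp add: emeasure_subadditive)
    also have "\<dots> \<le> ennreal (e / 4) + ennreal (e / 4)"
      using K U by (intro add_mono) auto
    also have "\<dots> = ennreal (e / 2)"
      using \<open>0 < e\<close> by (subst ennreal_plus[symmetric]) auto
    finally show ?thesis .
  qed
  obtain d where d: "d > 0" "\<And>x y. x \<in> K \<Longrightarrow> y \<in> - U \<Longrightarrow> d \<le> dist x y"
  proof -
    have "closed (- U)" "K \<inter> - U = {}" using K U by auto
    from separate_compact_closed[OF K(1) this] show thesis using that by blast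
  qed
  have "(\<integral>\<^sup>+x. ennreal \<bar>indicator A (x + h) - indicator A x\<bar> \<partial>lborel) \<le> ennreal e" if h: "norm h < d" for h
  proof -
    have pt: "ennreal \<bar>indicator A (x + h) - indicator A x\<bar> \<le> indicator (U - K) (x + h) + indicator (U - K) x" for x
    proof -
      have 1: "x + h \<in> U" if "x \<in> K"
        using d(2)[OF that, of "x + h"] h by (force simp: dist_norm)
      have 2: "x \<in> U" if "x + h \<in> K"
        using d(2)[OF that, of x] h by (force simp: dist_norm)
      show ?thesis
        using 1 2 K U by (auto simp: indicator_def)
    qed
    have "(\<integral>\<^sup>+x. ennreal \<bar>indicator A (x + h) - indicator A x\<bar> \<partial>lborel)
        \<le> (\<integral>\<^sup>+x. indicator (U - K) (x + h) + indicator (U - K) x \<partial>lborel)"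
      by (intro nn_integral_mono pt)
    also have "\<dots> = (\<integral>\<^sup>+x. indicator (U - K) (x + h) \<partial>lborel) + (\<integral>\<^sup>+x. indicator (U - K) x \<partial>lborel)"
      by (subst nn_integral_add) auto
    also have "\<dots> = 2 * emeasure lborel (U - K)"
      by (subst nn_integral_lborel_translate) (auto simp: mult_2)
    also have "\<dots> \<le> 2 * ennreal (e / 2)" using UK by (intro mult_left_mono) auto
    also have "\<dots> = ennreal e" using \<open>0 < e\<close> by (simp add: mult_2 flip: ennreal_plus)
    finally show ?thesis .
  qed
  then show ?thesis using d(1) by blast
qed

text \<open>Induction over integrable functions: indicators, sums, and dominated limits. In the
  limit case translation invariance of the measure makes the error at \<open>x + h\<close> equal to
  the error at \<open>x\<close>.\<close>

lemma L1_translation_continuous: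
  fixes f :: "'a::euclidean_space \<Rightarrow> real"
  assumes "integrable lborel f" "0 < e"
  shows "\<exists>d>0. \<forall>h. norm h < d \<longrightarrow> (\<integral>\<^sup>+x. ennreal \<bar>f (x + h) - f x\<bar> \<partial>lborel) \<le> ennreal e"
  using assms
proof (induction f arbitrary: e)
  case (base A c)
  obtain d where d: "d > 0" "\<And>h. norm h < d \<Longrightarrow>
      (\<integral>\<^sup>+x. ennreal \<bar>indicator A (x + h) - indicator A x\<bar> \<partial>lborel) \<le> ennreal (e / (\<bar>c\<bar> + 1))"
    using L1_translation_indicator[of A "e / (\<bar>c\<bar> + 1)"] base by auto
  have [measurable]: "A \<in> sets borel" using base by simp
  have "(\<integral>\<^sup>+x. ennreal \<bar>indicator A (x + h) *\<^sub>R c - indicator A x *\<^sub>R c\<bar> \<partial>lborel) \<le> ennreal e"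
    if "norm h < d" for h
  proof -
    have "(\<integral>\<^sup>+x. ennreal \<bar>indicator A (x + h) *\<^sub>R c - indicator A x *\<^sub>R c\<bar> \<partial>lborel)
      = (\<integral>\<^sup>+x. ennreal \<bar>c\<bar> * ennreal \<bar>indicator A (x + h) - indicator A x\<bar> \<partial>lborel)"
      by (intro nn_integral_cong) (simp add: mult.commute flip: ennreal_mult abs_mult right_diff_distrib)
    also have "\<dots> = ennreal \<bar>c\<bar> * (\<integral>\<^sup>+x. ennreal \<bar>indicator A (x + h) - indicator A x\<bar> \<partial>lborel)"
      by (intro nn_integral_cmult) measurable
    also have "\<dots> \<le> ennreal \<bar>c\<bar> * ennreal (e / (\<bar>c\<bar> + 1))"
      using d(2)[OF that] by (intro mult_left_mono) auto
    also have "\<dots> \<le> ennreal e"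
      using base by (subst ennreal_mult[symmetric]) (auto intro!: ennreal_leI simp: field_simps)
    finally show ?thesis .
  qed
  then show ?case using d(1) by blast
next
  case (add f g)
  have [measurable]: "f \<in> borel_measurable borel" "g \<in> borel_measurable borel"
    using add by (auto dest: borel_measurable_integrable)
  obtain d1 where d1: "d1 > 0" "\<And>h. norm h < d1 \<Longrightarrow> (\<integral>\<^sup>+x. ennreal \<bar>f (x + h) - f x\<bar> \<partial>lborel) \<le> ennreal (e / 2)"
    using add.IH(1)[of "e / 2"] add.prems by auto
  obtain d2 where d2: "d2 > 0" "\<And>h. norm h < d2 \<Longrightarrow> (\<integral>\<^sup>+x. ennreal \<bar>g (x + h) - g x\<bar> \<partial>lborel) \<le> ennreal (e / 2)"
    using add.IH(2)[of "e / 2"] add.prems by auto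
  have "(\<integral>\<^sup>+x. ennreal \<bar>f (x + h) + g (x + h) - (f x + g x)\<bar> \<partial>lborel) \<le> ennreal e"
    if "norm h < min d1 d2" for h
  proof -
    have "(\<integral>\<^sup>+x. ennreal \<bar>f (x + h) + g (x + h) - (f x + g x)\<bar> \<partial>lborel)
      \<le> (\<integral>\<^sup>+x. ennreal \<bar>f (x + h) - f x\<bar> + ennreal \<bar>g (x + h) - g x\<bar> \<partial>lborel)"
      by (intro nn_integral_mono) (auto simp flip: ennreal_plus intro!: ennreal_leI)
    also have "\<dots> = (\<integral>\<^sup>+x. ennreal \<bar>f (x + h) - f x\<bar> \<partial>lborel) + (\<integral>\<^sup>+x. ennreal \<bar>g (x + h) - g x\<bar> \<partial>lborel)"
      by (intro nn_integral_add) measurable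
    also have "\<dots> \<le> ennreal (e / 2) + ennreal (e / 2)"
      using d1 d2 that by (intro add_mono) auto
    also have "\<dots> = ennreal e" using add.prems by (simp flip: ennreal_plus)
    finally show ?thesis .
  qed
  then show ?case using d1 d2 by (metis min_less_iff_conj)
next
  case (lim f s)
  have [measurable]: "f \<in> borel_measurable borel" "s i \<in> borel_measurable borel" for i
    using lim by (auto dest: borel_measurable_integrable)
  have "(\<lambda>i. \<integral>\<^sup>+x. norm (s i x - f x) \<partial>lborel) \<longlonglongrightarrow> (\<integral>\<^sup>+x. 0 \<partial>(lborel::'a measure))"
  \<comment> \<open>The approximants satisfy \<open>norm (s j x) \<le> 2 * norm (f x)\<close>, hence
    the factor three for the difference.\<close>
  proof (rule nn_integral_dominated_convergence[where w = "\<lambda>x. ennreal (3 * norm (f x))"])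
    show "AE x in lborel. norm (s j x - f x) \<le> ennreal (3 * norm (f x))" for j
    proof (intro AE_I2 ennreal_leI)
      fix x
      show "norm (s j x - f x) \<le> 3 * norm (f x)"
        using lim.hyps(3)[of x j] norm_triangle_ineq4[of "s j x" "f x"] by auto
    qed
    have "integrable lborel (\<lambda>x. 3 * norm (f x))" using lim by auto
    then show "(\<integral>\<^sup>+x. ennreal (3 * norm (f x)) \<partial>lborel) < \<infinity>"
      by (subst nn_integral_eq_integral) auto
    show "AE x in lborel. (\<lambda>i. ennreal (norm (s i x - f x))) \<longlonglongrightarrow> 0"
    proof (intro AE_I2)
      fix x :: 'a
      have "(\<lambda>i. norm (s i x - f x)) \<longlonglongrightarrow> 0"
        using lim.hyps(2)[of x] by (intro tendsto_norm_zero) (simp add: LIM_zero)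
      then show "(\<lambda>i. ennreal (norm (s i x - f x))) \<longlonglongrightarrow> 0"
        by (metis ennreal_0 tendsto_ennrealI)
    qed
  qed auto
  then have "\<forall>\<^sub>F i in sequentially. (\<integral>\<^sup>+x. norm (s i x - f x) \<partial>lborel) < ennreal (e / 3)"
    using lim.prems by (intro order_tendstoD(2)) auto
  then obtain i where i: "(\<integral>\<^sup>+x. norm (s i x - f x) \<partial>lborel) < ennreal (e / 3)"
    unfolding eventually_sequentially by blast
  obtain d where d: "d > 0" "\<And>h. norm h < d \<Longrightarrow> (\<integral>\<^sup>+x. ennreal \<bar>s i (x + h) - s i x\<bar> \<partial>lborel) \<le> ennreal (e / 3)"
    using lim.IH[of "e / 3" i] lim.prems by auto
  have "(\<integral>\<^sup>+x. ennreal \<bar>f (x + h) - f x\<bar> \<partial>lborel) \<le> ennreal e" if h: "norm h < d" for h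
  proof -
    have "(\<integral>\<^sup>+x. ennreal \<bar>f (x + h) - f x\<bar> \<partial>lborel)
      \<le> (\<integral>\<^sup>+x. ennreal (norm (s i (x + h) - f (x + h))) + (ennreal \<bar>s i (x + h) - s i x\<bar> + ennreal (norm (s i x - f x))) \<partial>lborel)"
      by (intro nn_integral_mono) (auto simp flip: ennreal_plus intro!: ennreal_leI)
    also have "\<dots> = (\<integral>\<^sup>+x. ennreal (norm (s i (x + h) - f (x + h))) \<partial>lborel)
        + ((\<integral>\<^sup>+x. ennreal \<bar>s i (x + h) - s i x\<bar> \<partial>lborel) + (\<integral>\<^sup>+x. ennreal (norm (s i x - f x)) \<partial>lborel))"
      by (simp add: nn_integral_add)
    also have "(\<integral>\<^sup>+x. ennreal (norm (s i (x + h) - f (x + h))) \<partial>lborel) = (\<integral>\<^sup>+x. ennreal (norm (s i x - f x)) \<partial>lborel)"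
      by (rule nn_integral_lborel_translate[of "\<lambda>x. ennreal (norm (s i x - f x))"]) measurable
    also have "(\<integral>\<^sup>+x. ennreal (norm (s i x - f x)) \<partial>lborel)
        + ((\<integral>\<^sup>+x. ennreal \<bar>s i (x + h) - s i x\<bar> \<partial>lborel) + (\<integral>\<^sup>+x. ennreal (norm (s i x - f x)) \<partial>lborel))
        \<le> ennreal (e / 3) + (ennreal (e / 3) + ennreal (e / 3))"
      using i d(2)[OF h] by (intro add_mono) auto
    also have "\<dots> = ennreal e" using lim.prems by (simp flip: ennreal_plus)
    finally show ?thesis .
  qed
  then show ?case using d(1) by blast
qed

section \<open>Convolution\<close>

text \<open>The ball is enlarged by one so that, for shifts shorter than one, either both points lie
  in a fixed compact ball or both lie outside the support.\<close>

lemma uniformly_continuous_compact_support: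
  fixes f :: "'a::euclidean_space \<Rightarrow> real"
  assumes "continuous_on UNIV f" "\<And>x. R < norm x \<Longrightarrow> f x = 0" "0 < e"
  shows "\<exists>d>0. \<forall>x h. norm h < d \<longrightarrow> \<bar>f (x + h) - f x\<bar> \<le> e"
proof -
  have "uniformly_continuous_on (cball 0 (R + 1)) f"
    using assms(1) by (intro compact_uniformly_continuous) (auto intro: continuous_on_subset)
  then obtain d where d: "d > 0" "\<And>x y. x \<in> cball 0 (R + 1) \<Longrightarrow> y \<in> cball 0 (R + 1) \<Longrightarrow> dist y x < d \<Longrightarrow> dist (f y) (f x) < e"
    using \<open>0 < e\<close> unfolding uniformly_continuous_on_def by metis
  have "\<bar>f (x + h) - f x\<bar> \<le> e" if h: "norm h < min d 1" for x h
  proof (cases "norm x \<le> R + 1 \<and> norm (x + h) \<le> R + 1")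
    case True
    then have "x \<in> cball 0 (R + 1)" "x + h \<in> cball 0 (R + 1)" by simp_all
    moreover have "dist (x + h) x < d" using h by (simp add: dist_norm)
    ultimately show ?thesis using d(2) by (fastforce simp: dist_real_def)
  next
    case False
    then have "R < norm x \<and> R < norm (x + h)"
      using h norm_triangle_ineq[of x h] norm_triangle_ineq4[of "x + h" h] by auto
    then show ?thesis using assms by simp
  qed
  then show ?thesis using d(1) by (metis min_less_iff_conj zero_less_one)
qed

text \<open>The mean value inequality on a ball in which each partial derivative varies by at most
  \<open>e / DIM('a)\<close>. Uniformity in \<open>x\<close> is what later permits differentiation
  under a convolution integral without dominated convergence.\<close>

lemma uniformly_differentiable_compact_support:
  fixes f :: "'a::euclidean_space \<Rightarrow> real"
  assumes f: "C_k 1 f" "\<And>x. R < norm x \<Longrightarrow> f x = 0" and "0 < e"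
  shows "\<exists>d>0. \<forall>x h. norm h < d \<longrightarrow>
    \<bar>f (x + h) - f x - (\<Sum>b\<in>Basis. (h \<bullet> b) * dir_deriv b f x)\<bar> \<le> e * norm h"
proof -
  have out: "dir_deriv b f x = 0" if "R < norm x" for b x
    using that f(2) by (intro dir_deriv_outside[of "cball 0 R"]) auto
  have "\<forall>b\<in>Basis. \<exists>d>0. \<forall>x h. norm h < d \<longrightarrow> \<bar>dir_deriv b f (x + h) - dir_deriv b f x\<bar> \<le> e / DIM('a)"
    using f \<open>0 < e\<close> by (intro ballI uniformly_continuous_compact_support[of _ R] out) auto
  then obtain D where D: "\<And>b. b \<in> Basis \<Longrightarrow> D b > 0"
    "\<And>b x h. b \<in> Basis \<Longrightarrow> norm h < D b \<Longrightarrow> \<bar>dir_deriv b f (x + h) - dir_deriv b f x\<bar> \<le> e / DIM('a)"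
    by metis
  define d where "d = Min (D ` Basis)"
  have "d > 0" using D(1) by (simp add: d_def)
  have dD: "d \<le> D b" if "b \<in> Basis" for b using that by (simp add: d_def)
  have "\<bar>f (x + h) - f x - (\<Sum>b\<in>Basis. (h \<bullet> b) * dir_deriv b f x)\<bar> \<le> e * norm h" if h: "norm h < d" for x h
  proof -
    let ?f' = "\<lambda>y k. \<Sum>b\<in>Basis. (k \<bullet> b) * dir_deriv b f y"
    have "norm (f (x + h) - f x - ?f' x (x + h - x)) \<le> norm (x + h - x) * e"
    proof (rule differentiable_bound_linearization[where S = "ball x d" and f' = ?f'])
      show "x + t *\<^sub>R (x + h - x) \<in> ball x d" if "t \<in> {0..1}" for t
        using that h mult_left_le_one_le[of "norm h" t] by (auto simp: dist_norm)
      show "(f has_derivative ?f' y) (at y within ball x d)" for y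
        by (rule has_derivative_at_withinI, rule differentiable_has_derivative_dir) (use f(1) in simp)
      show "onorm (?f' y - ?f' x) \<le> e" if y: "y \<in> ball x d" for y
      proof (rule onorm_le)
        fix k :: 'a
        have "norm ((?f' y - ?f' x) k) = \<bar>\<Sum>b\<in>Basis. (k \<bullet> b) * (dir_deriv b f y - dir_deriv b f x)\<bar>"
          by (simp add: right_diff_distrib sum_subtractf)
        also have "\<dots> \<le> (\<Sum>b\<in>(Basis::'a set). norm k * (e / DIM('a)))"
        proof (rule order_trans[OF sum_abs], rule sum_mono)
          fix b :: 'a assume b: "b \<in> Basis"
          have "norm (y - x) < D b" using y dD[OF b] by (simp add: dist_norm norm_minus_commute)
          then have "\<bar>dir_deriv b f y - dir_deriv b f x\<bar> \<le> e / DIM('a)"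
            using D(2)[OF b, of "y - x" x] by simp
          then show "\<bar>(k \<bullet> b) * (dir_deriv b f y - dir_deriv b f x)\<bar> \<le> norm k * (e / DIM('a))"
            using Basis_le_norm[OF b, of k] unfolding abs_mult by (intro mult_mono) auto
        qed
        also have "\<dots> = e * norm k" by simp
        finally show "norm ((?f' y - ?f' x) k) \<le> e * norm k" .
      qed
      show "x \<in> ball x d" using \<open>d > 0\<close> by simp
    qed
    then show ?thesis by (simp add: mult.commute)
  qed
  then show ?thesis using \<open>d > 0\<close> by blast
qed

definition conv :: "('a::euclidean_space \<Rightarrow> real) \<Rightarrow> ('a \<Rightarrow> real) \<Rightarrow> 'a \<Rightarrow> real" where
  "conv f g x = (\<integral>y. f y * g (x - y) \<partial>lborel)"

lemma bounded_compact_support: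
  fixes f :: "'a::euclidean_space \<Rightarrow> real"
  assumes "continuous_on UNIV f" "\<And>x. R < norm x \<Longrightarrow> f x = 0"
  obtains B where "0 < B" "\<And>x. \<bar>f x\<bar> \<le> B"
proof -
  have "bounded (f ` cball 0 R)"
    using assms by (intro compact_imp_bounded compact_continuous_image) (auto intro: continuous_on_subset)
  then obtain B where "\<forall>y\<in>f ` cball 0 R. norm y \<le> B"
    unfolding bounded_iff by blast
  then have B: "\<bar>f x\<bar> \<le> B" if "x \<in> cball 0 R" for x using that by auto
  show ?thesis
  proof (rule that[of "max B 1"])
    show "\<bar>f x\<bar> \<le> max B 1" for x
      using B[of x] assms(2)[of x] by (cases "norm x \<le> R") auto
  qed auto
qed

lemma integrable_conv:
  fixes f g :: "'a::euclidean_space \<Rightarrow> real"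
  assumes f: "integrable lborel f" and g: "continuous_on UNIV g" "\<And>x. R < norm x \<Longrightarrow> g x = 0"
  shows "integrable lborel (\<lambda>y. f y * g (x - y))"
proof -
  obtain B where B: "0 < B" "\<And>x. \<bar>g x\<bar> \<le> B" using bounded_compact_support[OF g] by metis
  have [measurable]: "f \<in> borel_measurable borel" "g \<in> borel_measurable borel"
    using f g by (auto dest: borel_measurable_integrable borel_measurable_continuous_onI)
  have "integrable lborel (\<lambda>y. B * f y)" using f by simp
  then show ?thesis
  proof (rule Bochner_Integration.integrable_bound)
    show "AE y in lborel. norm (f y * g (x - y)) \<le> norm (B * f y)"
    proof (rule AE_I2)
      fix y
      show "norm (f y * g (x - y)) \<le> norm (B * f y)"
        using mult_right_mono[OF B(2)[of "x - y"], of "\<bar>f y\<bar>"] B(1) by (simp add: abs_mult mult.commute)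
    qed
  qed measurable
qed

lemma continuous_conv:
  fixes f g :: "'a::euclidean_space \<Rightarrow> real"
  assumes f: "integrable lborel f" and g: "continuous_on UNIV g" "\<And>x. R < norm x \<Longrightarrow> g x = 0"
  shows "continuous_on UNIV (conv f g)"
proof -
  define I where "I = (\<integral>y. \<bar>f y\<bar> \<partial>lborel)"
  have I: "0 \<le> I" unfolding I_def by simp
  have "\<exists>d>0. \<forall>x'. dist x' x < d \<longrightarrow> dist (conv f g x') (conv f g x) < e" if "0 < e" for x e
  proof -
    obtain d where d: "d > 0" "\<And>x h. norm h < d \<Longrightarrow> \<bar>g (x + h) - g x\<bar> \<le> e / (2 * (I + 1))"
      using uniformly_continuous_compact_support[where f = g and R = R and e = "e / (2 * (I + 1))", OF g]
        \<open>0 < e\<close> I by (metis add_nonneg_pos divide_pos_pos mult_pos_pos zero_less_numeral zero_less_one)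
    have "dist (conv f g x') (conv f g x) < e" if x': "dist x' x < d" for x'
    proof -
      have "conv f g x' - conv f g x = (\<integral>y. f y * g (x' - y) - f y * g (x - y) \<partial>lborel)"
        unfolding conv_def by (intro Bochner_Integration.integral_diff[symmetric] integrable_conv[OF f g])
      also have "\<bar>\<dots>\<bar> \<le> (\<integral>y. \<bar>f y\<bar> * (e / (2 * (I + 1))) \<partial>lborel)"
      proof (rule order_trans[OF integral_abs_bound], rule integral_mono)
        show "integrable lborel (\<lambda>y. \<bar>f y * g (x' - y) - f y * g (x - y)\<bar>)"
          by (intro integrable_abs Bochner_Integration.integrable_diff integrable_conv[OF f g])
        show "integrable lborel (\<lambda>y. \<bar>f y\<bar> * (e / (2 * (I + 1))))" using f by simp
        fix y
        have "\<bar>g (x' - y) - g (x - y)\<bar> \<le> e / (2 * (I + 1))"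
          using d(2)[of "x' - x" "x - y"] x' by (simp add: dist_norm)
        then show "\<bar>f y * g (x' - y) - f y * g (x - y)\<bar> \<le> \<bar>f y\<bar> * (e / (2 * (I + 1)))"
          unfolding right_diff_distrib[symmetric] abs_mult by (rule mult_left_mono) simp
      qed
      also have "\<dots> = I * (e / (2 * (I + 1)))" unfolding I_def by simp
      also have "\<dots> < e" using I \<open>0 < e\<close> by (auto simp: field_simps intro!: add_nonneg_pos)
      finally show ?thesis by (simp add: dist_real_def)
    qed
    then show ?thesis using d(1) by blast
  qed
  then show ?thesis unfolding continuous_on_iff by simp
qed

text \<open>The first order remainder of \<open>g\<close> is uniformly at most
  \<open>e / (I + 1) * norm h\<close>, so integrating it against \<open>f\<close> costs only the L1
  norm \<open>I\<close>. The added one covers the case \<open>I = 0\<close>.\<close>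

lemma has_derivative_conv:
  fixes f g :: "'a::euclidean_space \<Rightarrow> real"
  assumes f: "integrable lborel f" and g: "C_k 1 g" "\<And>x. R < norm x \<Longrightarrow> g x = 0"
  shows "(conv f g has_derivative (\<lambda>h. \<Sum>b\<in>Basis. (h \<bullet> b) * conv f (dir_deriv b g) x)) (at x)"
proof -
  define I where "I = (\<integral>y. \<bar>f y\<bar> \<partial>lborel)"
  have I: "0 \<le> I" unfolding I_def by simp
  have out: "dir_deriv b g x = 0" if "R < norm x" for b x
    using that g(2) by (intro dir_deriv_outside[of "cball 0 R"]) auto
  have gc: "continuous_on UNIV g" using g(1) C_k_continuous by blast
  have g'c: "continuous_on UNIV (dir_deriv b g)" if "b \<in> Basis" for b using g(1) that by simp
  note ig = integrable_conv[OF f gc g(2)]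
  have ig': "integrable lborel (\<lambda>y. f y * dir_deriv b g (x - y))" if "b \<in> Basis" for b x
    using integrable_conv[OF f g'c[OF that] out] .
  show ?thesis
    unfolding has_derivative_at_alt
  proof (intro conjI allI impI)
    show "bounded_linear (\<lambda>h. \<Sum>b\<in>Basis. (h \<bullet> b) * conv f (dir_deriv b g) x)"
      by (intro bounded_linear_sum bounded_linear_mult_const bounded_linear_inner_left)
    fix e :: real assume "0 < e"
    obtain d where d: "d > 0" "\<And>x h. norm h < d \<Longrightarrow>
        \<bar>g (x + h) - g x - (\<Sum>b\<in>Basis. (h \<bullet> b) * dir_deriv b g x)\<bar> \<le> e / (I + 1) * norm h"
    proof -
      have "0 < e / (I + 1)" using \<open>0 < e\<close> I by simp
      from uniformly_differentiable_compact_support[where f = g and R = R, OF g this] show thesis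
        using that by blast
    qed
    have "norm (conv f g y - conv f g x - (\<Sum>b\<in>Basis. ((y - x) \<bullet> b) * conv f (dir_deriv b g) x)) \<le> e * norm (y - x)"
      if y: "norm (y - x) < d" for y
    proof -
      define h where "h = y - x"
      have eq: "conv f g y - conv f g x - (\<Sum>b\<in>Basis. (h \<bullet> b) * conv f (dir_deriv b g) x)
        = (\<integral>z. f z * g (y - z) - f z * g (x - z) - (\<Sum>b\<in>Basis. (h \<bullet> b) * (f z * dir_deriv b g (x - z))) \<partial>lborel)"
      proof -
        have "(\<integral>z. f z * g (y - z) - f z * g (x - z) - (\<Sum>b\<in>Basis. (h \<bullet> b) * (f z * dir_deriv b g (x - z))) \<partial>lborel)
          = (\<integral>z. f z * g (y - z) \<partial>lborel) - (\<integral>z. f z * g (x - z) \<partial>lborel)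
            - (\<integral>z. (\<Sum>b\<in>Basis. (h \<bullet> b) * (f z * dir_deriv b g (x - z))) \<partial>lborel)"
          using ig ig' by (subst Bochner_Integration.integral_diff Bochner_Integration.integral_diff; (intro Bochner_Integration.integrable_diff Bochner_Integration.integrable_sum integrable_mult_right)?; simp)+
        also have "(\<integral>z. (\<Sum>b\<in>Basis. (h \<bullet> b) * (f z * dir_deriv b g (x - z))) \<partial>lborel)
          = (\<Sum>b\<in>Basis. (h \<bullet> b) * (\<integral>z. f z * dir_deriv b g (x - z) \<partial>lborel))"
          using ig' by (subst Bochner_Integration.integral_sum) auto
        finally show ?thesis unfolding conv_def by simp
      qed
      have "\<bar>\<integral>z. f z * g (y - z) - f z * g (x - z) - (\<Sum>b\<in>Basis. (h \<bullet> b) * (f z * dir_deriv b g (x - z))) \<partial>lborel\<bar>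
        \<le> (\<integral>z. \<bar>f z\<bar> * (e / (I + 1) * norm h) \<partial>lborel)"
      proof (rule order_trans[OF integral_abs_bound], rule integral_mono)
        show "integrable lborel (\<lambda>z. \<bar>f z * g (y - z) - f z * g (x - z) - (\<Sum>b\<in>Basis. (h \<bullet> b) * (f z * dir_deriv b g (x - z)))\<bar>)"
          using ig ig' by (intro integrable_abs Bochner_Integration.integrable_diff Bochner_Integration.integrable_sum integrable_mult_right)
        show "integrable lborel (\<lambda>z. \<bar>f z\<bar> * (e / (I + 1) * norm h))" using f by simp
        fix z
        have "f z * g (y - z) - f z * g (x - z) - (\<Sum>b\<in>Basis. (h \<bullet> b) * (f z * dir_deriv b g (x - z)))
          = f z * (g (y - z) - g (x - z) - (\<Sum>b\<in>Basis. (h \<bullet> b) * dir_deriv b g (x - z)))"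
          by (simp add: right_diff_distrib sum_distrib_left mult.left_commute)
        moreover have "\<bar>g (y - z) - g (x - z) - (\<Sum>b\<in>Basis. (h \<bullet> b) * dir_deriv b g (x - z))\<bar> \<le> e / (I + 1) * norm h"
          using d(2)[of h "x - z"] y by (simp add: h_def)
        ultimately show "\<bar>f z * g (y - z) - f z * g (x - z) - (\<Sum>b\<in>Basis. (h \<bullet> b) * (f z * dir_deriv b g (x - z)))\<bar>
          \<le> \<bar>f z\<bar> * (e / (I + 1) * norm h)"
          by (simp only: abs_mult) (intro mult_left_mono, auto)
      qed
      also have "\<dots> = I * (e / (I + 1)) * norm h" unfolding I_def by simp
      also have "\<dots> \<le> e * norm h"
        using I \<open>0 < e\<close> by (intro mult_right_mono) (auto simp: field_simps)
      finally show ?thesis using eq unfolding h_def by simp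
    qed
    then show "\<exists>d>0. \<forall>y. norm (y - x) < d \<longrightarrow>
        norm (conv f g y - conv f g x - (\<Sum>b\<in>Basis. ((y - x) \<bullet> b) * conv f (dir_deriv b g) x)) \<le> e * norm (y - x)"
      using d(1) by blast
  qed
qed

lemma dir_deriv_conv:
  fixes f g :: "'a::euclidean_space \<Rightarrow> real"
  assumes "integrable lborel f" "C_k 1 g" "\<And>x. R < norm x \<Longrightarrow> g x = 0" "b \<in> Basis"
  shows "dir_deriv b (conv f g) x = conv f (dir_deriv b g) x"
proof -
  have "dir_deriv b (conv f g) x = (\<Sum>c\<in>Basis. (b \<bullet> c) * conv f (dir_deriv c g) x)"
    by (rule dir_deriv_eq[OF has_derivative_conv[OF assms(1-3)]])
  also have "\<dots> = (\<Sum>c\<in>Basis. if c = b then conv f (dir_deriv c g) x else 0)"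
    using assms(4) by (intro sum.cong) (auto simp: inner_Basis)
  finally show ?thesis using assms(4) by simp
qed

text \<open>Derivatives always fall on the kernel, so the convolution inherits the smoothness of
  \<open>g\<close> although \<open>f\<close> is merely integrable.\<close>

lemma C_k_conv:
  fixes f g :: "'a::euclidean_space \<Rightarrow> real"
  assumes "integrable lborel f"
  shows "C_k k g \<Longrightarrow> (\<And>x. R < norm x \<Longrightarrow> g x = 0) \<Longrightarrow> C_k k (conv f g)"
proof (induction k arbitrary: g)
  case 0
  then have "continuous_on UNIV (conv f g)"
    by (intro continuous_conv[OF assms, of g R]) simp_all
  then show ?case by simp
next
  case (Suc k)
  have C1: "C_k 1 g" using C_k_mono[OF Suc.prems(1), of 1] by simp
  have "C_k k (dir_deriv b (conv f g))" if b: "b \<in> Basis" for b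
  proof -
    have "dir_deriv b (conv f g) = conv f (dir_deriv b g)"
      by (rule ext, rule dir_deriv_conv[OF assms C1 Suc.prems(2) b])
    moreover have "dir_deriv b g x = 0" if "R < norm x" for x
      using that Suc.prems(2) by (intro dir_deriv_outside[of "cball 0 R"]) auto
    moreover have "C_k k (dir_deriv b g)" using Suc.prems(1) b by simp
    ultimately show ?thesis using Suc.IH[of "dir_deriv b g"] by presburger
  qed
  moreover have "conv f g differentiable (at x)" for x
    unfolding differentiable_def by (intro exI, rule has_derivative_conv[OF assms C1 Suc.prems(2)])
  ultimately show ?case by simp
qed

lemma conv_outside:
  assumes "\<And>y. y \<notin> S \<Longrightarrow> f y = 0" "\<And>z. r \<le> norm z \<Longrightarrow> g z = 0"
    and "\<And>y. y \<in> S \<Longrightarrow> r \<le> dist x y"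
  shows "conv f g x = 0"
proof -
  have "(\<lambda>y. f y * g (x - y)) = (\<lambda>y. 0)"
  proof
    fix y
    show "f y * g (x - y) = 0"
      using assms by (cases "y \<in> S") (auto simp: dist_norm)
  qed
  then show ?thesis by (simp add: conv_def)
qed

text \<open>Translation invariance gives \<open>f (x + s b) - f x\<close> the integral zero, and
  dividing by \<open>s\<close> leaves only the uniform first order error. No iterated integration
  along coordinate lines is involved.\<close>

lemma integral_dir_deriv_zero:
  fixes f :: "'a::euclidean_space \<Rightarrow> real"
  assumes f: "C_k 1 f" "\<And>x. R < norm x \<Longrightarrow> f x = 0" and b: "b \<in> Basis"
  shows "(\<integral>x. dir_deriv b f x \<partial>lborel) = 0"
proof -
  have f0: "integrable lborel f"
    using f C_k_continuous by (intro integrable_compact_support[of _ R]) blast+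
  have out: "dir_deriv b f x = 0" if "R < norm x" for x
    using that f(2) by (intro dir_deriv_outside[of "cball 0 R"]) auto
  have f1: "integrable lborel (dir_deriv b f)"
    using f b out by (intro integrable_compact_support[of _ R]) auto
  have [measurable]: "f \<in> borel_measurable borel" using f0 by (auto dest: borel_measurable_integrable)
  define V where "V = measure lborel (cball (0::'a) (\<bar>R\<bar> + 1))"
  have bound: "\<bar>\<integral>x. dir_deriv b f x \<partial>lborel\<bar> \<le> e * V" if "0 < e" for e
  proof -
    obtain d where d: "d > 0" "\<And>x h. norm h < d \<Longrightarrow>
        \<bar>f (x + h) - f x - (\<Sum>c\<in>Basis. (h \<bullet> c) * dir_deriv c f x)\<bar> \<le> e * norm h"
      using uniformly_differentiable_compact_support[where f = f and R = R, OF f \<open>0 < e\<close>] by metis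
    \<comment> \<open>Shifts of length at most one keep the integrand supported in the ball of
      radius \<open>\<bar>R\<bar> + 1\<close>, whose volume is \<open>V\<close>.\<close>
    define s where "s = min (d / 2) 1"
    have s: "0 < s" "s < d" "s \<le> 1" using d(1) by (auto simp: s_def)
    have pt: "\<bar>f (x + s *\<^sub>R b) - f x - s * dir_deriv b f x\<bar> \<le> e * s * indicator (cball (0::'a) (\<bar>R\<bar> + 1)) x" for x
    proof (cases "norm x \<le> \<bar>R\<bar> + 1")
      case True
      have "(\<Sum>c\<in>Basis. ((s *\<^sub>R b) \<bullet> c) * dir_deriv c f x) = (\<Sum>c\<in>Basis. if c = b then s * dir_deriv c f x else 0)"
        using b by (intro sum.cong) (auto simp: inner_Basis)
      then show ?thesis using d(2)[of "s *\<^sub>R b" x] s b True by simp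
    next
      case False
      have "norm (x + s *\<^sub>R b) \<ge> norm x - s"
        using norm_diff_ineq[of x "s *\<^sub>R b"] s b by simp
      then show ?thesis using False s f(2) out by (auto simp: indicator_def)
    qed
    have ish: "integrable lborel (\<lambda>x. f (x + s *\<^sub>R b))"
    proof (rule integrable_compact_support)
      show "continuous_on UNIV (\<lambda>x. f (x + s *\<^sub>R b))"
        by (intro continuous_on_compose2[OF C_k_continuous[OF f(1)]] continuous_intros) auto
      show "f (x + s *\<^sub>R b) = 0" if "\<bar>R\<bar> + 1 < norm x" for x
        using that norm_diff_ineq[of x "s *\<^sub>R b"] s b by (intro f(2)) simp
    qed
    have "(\<integral>x. f (x + s *\<^sub>R b) - f x - s * dir_deriv b f x \<partial>lborel) = - (s * (\<integral>x. dir_deriv b f x \<partial>lborel))"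
      using f0 f1 ish integral_lborel_translate[of f "s *\<^sub>R b"] by simp
    moreover have "\<bar>\<integral>x. f (x + s *\<^sub>R b) - f x - s * dir_deriv b f x \<partial>lborel\<bar>
        \<le> (\<integral>x. e * s * indicator (cball (0::'a) (\<bar>R\<bar> + 1)) x \<partial>lborel)"
    proof (rule order_trans[OF integral_abs_bound], rule integral_mono)
      show "integrable lborel (\<lambda>x. \<bar>f (x + s *\<^sub>R b) - f x - s * dir_deriv b f x\<bar>)"
        using f0 f1 ish by (intro integrable_abs Bochner_Integration.integrable_diff integrable_mult_right)
      show "integrable lborel (\<lambda>x. e * s * indicator (cball (0::'a) (\<bar>R\<bar> + 1)) x :: real)"
        using emeasure_lborel_cball_finite[of "0::'a" "\<bar>R\<bar> + 1"]
        by (intro integrable_mult_right integrable_real_indicator) auto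
    qed (rule pt)
    moreover have "(\<integral>x. e * s * indicator (cball (0::'a) (\<bar>R\<bar> + 1)) x \<partial>lborel) = s * (e * V)"
      by (simp add: V_def)
    ultimately have "s * \<bar>\<integral>x. dir_deriv b f x \<partial>lborel\<bar> \<le> s * (e * V)"
      using s(1) by (metis abs_minus_cancel abs_mult abs_of_pos)
    then show ?thesis using s by simp
  qed
  show ?thesis
  proof (rule ccontr)
    assume ne: "(\<integral>x. dir_deriv b f x \<partial>lborel) \<noteq> 0"
    have V: "V \<ge> 0" by (simp add: V_def)
    have "\<bar>\<integral>x. dir_deriv b f x \<partial>lborel\<bar> \<le> \<bar>\<integral>x. dir_deriv b f x \<partial>lborel\<bar> / (2 * (V + 1)) * V"
      using ne V by (intro bound) auto
    also have "\<dots> < \<bar>\<integral>x. dir_deriv b f x \<partial>lborel\<bar>"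
      using ne V by (auto simp: field_simps intro!: add_nonneg_pos)
    finally show False by simp
  qed
qed

lemma mollifier_minus: "mollifier r (- x) = mollifier r x"
  by (simp add: mollifier_def)

text \<open>Because the kernel has integral one, the difference is an average of translation
  differences. Tonelli's theorem brings the spatial integral inside, where only shifts shorter than
  \<open>r\<close> carry weight.\<close>

lemma conv_mollifier_L1:
  fixes f :: "'a::euclidean_space \<Rightarrow> real"
  assumes f: "integrable lborel f" and "0 < e"
  shows "\<exists>d>0. \<forall>r. 0 < r \<and> r < d \<longrightarrow>
    (\<integral>\<^sup>+x. ennreal \<bar>conv f (mollifier r) x - f x\<bar> \<partial>lborel) \<le> ennreal e"
proof -
  obtain d where d: "d > 0" "\<And>h. norm h < d \<Longrightarrow> (\<integral>\<^sup>+x. ennreal \<bar>f (x + h) - f x\<bar> \<partial>lborel) \<le> ennreal e"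
    using L1_translation_continuous[OF f \<open>0 < e\<close>] by auto
  have [measurable]: "f \<in> borel_measurable borel" using f by (auto dest: borel_measurable_integrable)
  have "(\<integral>\<^sup>+x. ennreal \<bar>conv f (mollifier r) x - f x\<bar> \<partial>lborel) \<le> ennreal e" if r: "0 < r" "r < d" for r
  proof -
    let ?m = "mollifier r :: 'a \<Rightarrow> real"
    have mc: "continuous_on UNIV ?m" using C_k_mollifier C_k_continuous by blast
    have [measurable]: "?m \<in> borel_measurable borel" using mc by (rule borel_measurable_continuous_onI)
    have m0: "?m x = 0" if "r < norm x" for x using mollifier_outside[of r x] r that by simp
    have mi: "integrable lborel ?m" using mc m0 by (rule integrable_compact_support)
    have even: "?m (x - y) = ?m (y - x)" for x y
      using mollifier_minus[of r "x - y"] by simp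
    have pt: "ennreal \<bar>conv f ?m x - f x\<bar> \<le> (\<integral>\<^sup>+z. ennreal (?m z) * ennreal \<bar>f (x + z) - f x\<bar> \<partial>lborel)" for x
    proof -
      have i1: "integrable lborel (\<lambda>y. f y * ?m (y - x))"
        using integrable_conv[OF f mc m0, of r x] even by simp
      have "integrable lborel (\<lambda>y. ?m (y - x))"
      proof (rule integrable_compact_support)
        show "continuous_on UNIV (\<lambda>y. ?m (y - x))"
          by (intro continuous_on_compose2[OF mc] continuous_intros) auto
        show "?m (y - x) = 0" if "r + norm x < norm y" for y
          using that norm_triangle_ineq2[of y x] by (intro m0) linarith
      qed
      then have i2: "integrable lborel (\<lambda>y. f x * ?m (y - x))" by simp
      have one: "(\<integral>y. ?m (y - x) \<partial>lborel) = 1"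
        using integral_lborel_translate[of ?m "- x"] integral_mollifier[OF r(1)] by simp
      have "conv f ?m x - f x = (\<integral>y. f y * ?m (y - x) \<partial>lborel) - (\<integral>y. f x * ?m (y - x) \<partial>lborel)"
        using one by (simp add: conv_def even[of x])
      also have "\<dots> = (\<integral>y. f y * ?m (y - x) - f x * ?m (y - x) \<partial>lborel)"
        using i1 i2 by (rule Bochner_Integration.integral_diff[symmetric])
      finally have "ennreal \<bar>conv f ?m x - f x\<bar> \<le> (\<integral>\<^sup>+y. ennreal (norm (f y * ?m (y - x) - f x * ?m (y - x))) \<partial>lborel)"
        using integral_norm_bound_ennreal[OF Bochner_Integration.integrable_diff[OF i1 i2]] by simp
      also have "\<dots> = (\<integral>\<^sup>+z. ennreal (norm (f (z + x) * ?m (z + x - x) - f x * ?m (z + x - x))) \<partial>lborel)"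
        by (rule nn_integral_lborel_translate[symmetric, of "\<lambda>y. ennreal (norm (f y * ?m (y - x) - f x * ?m (y - x)))"]) measurable
      also have "\<dots> = (\<integral>\<^sup>+z. ennreal (?m z) * ennreal \<bar>f (x + z) - f x\<bar> \<partial>lborel)"
      proof (rule nn_integral_cong)
        fix z
        have "\<bar>f (z + x) * ?m (z + x - x) - f x * ?m (z + x - x)\<bar> = \<bar>?m z * (f (x + z) - f x)\<bar>"
          by (simp add: algebra_simps)
        also have "\<dots> = ?m z * \<bar>f (x + z) - f x\<bar>"
          by (simp add: abs_mult mollifier_nonneg)
        finally show "ennreal (norm (f (z + x) * ?m (z + x - x) - f x * ?m (z + x - x))) = ennreal (?m z) * ennreal \<bar>f (x + z) - f x\<bar>"
          by (simp add: mollifier_nonneg flip: ennreal_mult)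
      qed
      finally show ?thesis .
    qed
    have "(\<integral>\<^sup>+x. ennreal \<bar>conv f ?m x - f x\<bar> \<partial>lborel)
        \<le> (\<integral>\<^sup>+x. (\<integral>\<^sup>+z. ennreal (?m z) * ennreal \<bar>f (x + z) - f x\<bar> \<partial>lborel) \<partial>lborel)"
      by (intro nn_integral_mono pt)
    also have "\<dots> = (\<integral>\<^sup>+z. (\<integral>\<^sup>+x. ennreal (?m z) * ennreal \<bar>f (x + z) - f x\<bar> \<partial>lborel) \<partial>lborel)"
      by (rule lborel_pair.Fubini') measurable
    also have "\<dots> = (\<integral>\<^sup>+z. ennreal (?m z) * (\<integral>\<^sup>+x. ennreal \<bar>f (x + z) - f x\<bar> \<partial>lborel) \<partial>lborel)"
      by (intro nn_integral_cong nn_integral_cmult) measurable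
    also have "\<dots> \<le> (\<integral>\<^sup>+z. ennreal (?m z) * ennreal e \<partial>lborel)"
    proof (rule nn_integral_mono)
      fix z :: 'a
      show "ennreal (?m z) * (\<integral>\<^sup>+x. ennreal \<bar>f (x + z) - f x\<bar> \<partial>lborel) \<le> ennreal (?m z) * ennreal e"
        using d(2)[of z] r mollifier_outside[of r z] by (cases "norm z < r") (auto intro!: mult_left_mono)
    qed
    also have "\<dots> = (\<integral>\<^sup>+z. ennreal (?m z) \<partial>lborel) * ennreal e"
      by (rule nn_integral_multc) measurable
    also have "(\<integral>\<^sup>+z. ennreal (?m z) \<partial>lborel) = 1"
      using mi integral_mollifier[OF r(1), where 'a = 'a] by (subst nn_integral_eq_integral) (auto simp: mollifier_nonneg)
    finally show ?thesis by simp
  qed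
  then show ?thesis using d(1) by blast
qed

section \<open>Weak derivatives and mollification\<close>

lemma axis_Basis [simp]: "axis i (1::real) \<in> Basis"
  by simp

lemma integral_lebesgue_lborel:
  fixes f :: "'a::euclidean_space \<Rightarrow> real"
  assumes "f \<in> borel_measurable borel"
  shows "(\<integral>x. f x \<partial>lebesgue) = (\<integral>x. f x \<partial>lborel)"
  using assms by (intro integral_completion) simp

lemma set_integral_le_nn_integral:
  fixes f :: "'a::euclidean_space \<Rightarrow> real"
  assumes [measurable]: "f \<in> borel_measurable borel" "K \<in> sets borel"
    and "(\<integral>\<^sup>+x. ennreal \<bar>f x\<bar> \<partial>lborel) \<le> ennreal e" "0 \<le> e"
  shows "(LINT x:K|lebesgue. \<bar>f x\<bar>) \<le> e"
proof -
  have "(LINT x:K|lebesgue. \<bar>f x\<bar>) = (\<integral>x. indicator K x *\<^sub>R \<bar>f x\<bar> \<partial>lborel)"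
    unfolding set_lebesgue_integral_def by (rule integral_lebesgue_lborel) measurable
  also have "\<dots> = enn2real (\<integral>\<^sup>+x. ennreal (indicator K x *\<^sub>R \<bar>f x\<bar>) \<partial>lborel)"
    by (rule integral_eq_nn_integral) auto
  also have "\<dots> \<le> enn2real (ennreal e)"
  proof (rule enn2real_mono)
    have "(\<integral>\<^sup>+x. ennreal (indicator K x *\<^sub>R \<bar>f x\<bar>) \<partial>lborel) \<le> (\<integral>\<^sup>+x. ennreal \<bar>f x\<bar> \<partial>lborel)"
      by (intro nn_integral_mono ennreal_leI) (auto simp: indicator_def)
    then show "(\<integral>\<^sup>+x. ennreal (indicator K x *\<^sub>R \<bar>f x\<bar>) \<partial>lborel) \<le> ennreal e"
      using assms(3) by order
  qed simp
  finally show ?thesis using assms(4) by simp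
qed

lemma Lp_on_1_borel:
  fixes f :: "'a::euclidean_space \<Rightarrow> real"
  assumes f: "integrable lborel f" and [measurable]: "K \<in> sets borel"
  shows "Lp_on 1 K f"
proof -
  have [measurable]: "f \<in> borel_measurable borel" using f by (auto dest: borel_measurable_integrable)
  have "integrable lborel (\<lambda>x. indicator K x *\<^sub>R \<bar>f x\<bar>)"
    using f by (intro integrable_mult_indicator integrable_abs) auto
  then have "integrable lebesgue (\<lambda>x. indicator K x *\<^sub>R \<bar>f x\<bar>)"
    by (subst integrable_completion) measurable
  moreover have "(\<lambda>x. indicator K x *\<^sub>R f x) \<in> borel_measurable lebesgue"
    by (intro measurable_completion) measurable
  ultimately show ?thesis
    by (simp add: Lp_on_def set_borel_measurable_def set_integrable_def)
qed

lemma C_c_inf_mollifier: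
  assumes "0 < r" "cball x r \<subseteq> \<Omega>"
  shows "C_c_inf \<Omega> (\<lambda>y. mollifier r (x - y))"
proof -
  have sub: "{y. mollifier r (x - y) \<noteq> 0} \<subseteq> cball x r"
    using mollifier_outside[OF assms(1)] by (force simp: dist_norm)
  then have "closure {y. mollifier r (x - y) \<noteq> 0} \<subseteq> cball x r"
    by (intro closure_minimal) auto
  moreover from this have "compact (closure {y. mollifier r (x - y) \<noteq> 0})"
    by (meson bounded_cball bounded_subset closed_closure compact_eq_bounded_closed)
  ultimately show ?thesis
    using assms(2) C_k_reflect[OF C_k_mollifier] unfolding C_c_inf_def by blast
qed

text \<open>This is completeness of \<open>lebesgue\<close>: measurability passes to any function
  that agrees almost everywhere.\<close>

lemma borel_measurable_lebesgue_cong_AE: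
  fixes f g :: "'a::euclidean_space \<Rightarrow> 'b::topological_space"
  assumes f: "f \<in> borel_measurable lebesgue" and eq: "AE x in lebesgue. f x = g x"
  shows "g \<in> borel_measurable lebesgue"
proof (rule measurableI)
  fix A :: "'b set" assume A: "A \<in> sets borel"
  have "f -` A \<in> sets lebesgue" using measurable_sets[OF f A] by simp
  moreover have "AE x in lebesgue. x \<in> f -` A \<longleftrightarrow> x \<in> g -` A"
    using eq by eventually_elim simp
  ultimately show "g -` A \<inter> space lebesgue \<in> sets lebesgue"
    using completion.in_sets_AE[where A = "f -` A" and B = "g -` A"] by simp
qed simp

lemma integral_lebesgue_cong_AE:
  fixes f g :: "'a::euclidean_space \<Rightarrow> real"
  assumes "f \<in> borel_measurable lebesgue" and "AE x in lebesgue. f x = g x"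
  shows "(\<integral>x. f x \<partial>lebesgue) = (\<integral>x. g x \<partial>lebesgue)"
  using assms borel_measurable_lebesgue_cong_AE[OF assms] by (intro integral_cong_AE)

lemma integral_lborel_eq_lebesgue_AE:
  fixes f g :: "'a::euclidean_space \<Rightarrow> real"
  assumes f: "f \<in> borel_measurable borel" and eq: "AE x in lebesgue. f x = g x"
  shows "(\<integral>x. g x \<partial>lebesgue) = (\<integral>x. f x \<partial>lborel)"
proof -
  have "f \<in> borel_measurable lebesgue" using f by (intro measurable_completion) simp
  then show ?thesis using integral_lebesgue_cong_AE[OF _ eq] integral_lebesgue_lborel[OF f] by simp
qed

text \<open>The weak derivative is tested with the reflected mollifier centred at \<open>x\<close>;
  the minus signs from the reflection and from integration by parts cancel. \<open>U\<close> and
  \<open>V\<close> need to agree with \<open>f\<close> and \<open>g\<close> only on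
  \<open>K\<close>, since the kernel vanishes outside \<open>cball x r\<close>. Weak spatial
  gradients are used below only through this pointwise identity.\<close>

lemma weak_deriv_conv:
  fixes U :: "'a::euclidean_space \<Rightarrow> real"
  assumes w: "weak_deriv b \<Omega> f g" and b: "b \<in> Basis"
    and r: "0 < r" "cball x r \<subseteq> K" and K: "K \<subseteq> \<Omega>"
    and [measurable]: "U \<in> borel_measurable borel" "V \<in> borel_measurable borel"
    and eq: "AE y in lborel. y \<in> K \<longrightarrow> U y = f y \<and> V y = g y"
  shows "conv U (dir_deriv b (mollifier r)) x = conv V (mollifier r) x"
proof -
  let ?m = "mollifier r :: 'a \<Rightarrow> real"
  have diff: "?m differentiable (at z)" for z using C_k_mollifier[of "Suc 0" r, where 'a = 'a] by simp
  have [measurable]: "?m \<in> borel_measurable borel"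
    using C_k_mollifier C_k_continuous by (intro borel_measurable_continuous_onI) blast
  have [measurable]: "dir_deriv b ?m \<in> borel_measurable borel"
    using C_k_mollifier[of "Suc 0" r, where 'a = 'a] b by (intro borel_measurable_continuous_onI) simp
  have out: "?m (x - y) = 0 \<and> dir_deriv b ?m (x - y) = 0" if "y \<notin> K" for y
  proof
    have n: "r < norm (x - y)" using that r by (auto simp: dist_norm not_le)
    then show "?m (x - y) = 0" using mollifier_outside[OF r(1), of "x - y"] by simp
    show "dir_deriv b ?m (x - y) = 0"
      using n mollifier_outside[OF r(1), where 'a = 'a] by (intro dir_deriv_outside[of "cball 0 r"]) auto
  qed
  have AEK: "AE y in lebesgue. y \<in> K \<longrightarrow> U y = f y \<and> V y = g y"
    using eq by (simp add: AE_completion_iff)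
  have "C_c_inf \<Omega> (\<lambda>y. ?m (x - y))"
    using r K by (intro C_c_inf_mollifier) auto
  then have "(LINT y:\<Omega>|lebesgue. f y * dir_deriv b (\<lambda>y. ?m (x - y)) y) = - (LINT y:\<Omega>|lebesgue. g y * ?m (x - y))"
    using w unfolding weak_deriv_def by blast
  moreover have "(LINT y:\<Omega>|lebesgue. f y * dir_deriv b (\<lambda>y. ?m (x - y)) y) = (\<integral>y. - (U y * dir_deriv b ?m (x - y)) \<partial>lborel)"
    unfolding set_lebesgue_integral_def
  proof (rule integral_lborel_eq_lebesgue_AE)
    show "AE y in lebesgue. - (U y * dir_deriv b ?m (x - y)) = indicator \<Omega> y *\<^sub>R (f y * dir_deriv b (\<lambda>y. ?m (x - y)) y)"
      using AEK
    proof eventually_elim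
      case (elim y)
      then show ?case using out[of y] K dir_deriv_reflect[OF diff, of b x y]
        by (cases "y \<in> K") (auto simp: indicator_def)
    qed
  qed measurable
  moreover have "(LINT y:\<Omega>|lebesgue. g y * ?m (x - y)) = (\<integral>y. V y * ?m (x - y) \<partial>lborel)"
    unfolding set_lebesgue_integral_def
  proof (rule integral_lborel_eq_lebesgue_AE)
    show "AE y in lebesgue. V y * ?m (x - y) = indicator \<Omega> y *\<^sub>R (g y * ?m (x - y))"
      using AEK
    proof eventually_elim
      case (elim y)
      then show ?case using out[of y] K by (cases "y \<in> K") (auto simp: indicator_def)
    qed
  qed measurable
  ultimately show ?thesis by (simp add: conv_def)
qed

lemma compact_enlarge_subset:
  fixes S U :: "'a::euclidean_space set"
  assumes "compact S" "open U" "S \<subseteq> U"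
  obtains d where "d > 0" "\<And>x. x \<in> S \<Longrightarrow> cball x d \<subseteq> U"
proof -
  have "closed (- U)" "S \<inter> - U = {}" using assms by auto
  from separate_compact_closed[OF assms(1) this] obtain d
    where d: "d > 0" "\<forall>x\<in>S. \<forall>y\<in>- U. d \<le> dist x y" by blast
  have "cball x (d / 2) \<subseteq> U" if "x \<in> S" for x
  proof
    fix y assume "y \<in> cball x (d / 2)"
    then have "dist x y < d" using d(1) by auto
    then show "y \<in> U" using d(2) that by (meson ComplI not_less)
  qed
  then show ?thesis using that[of "d / 2"] d(1) by simp
qed

text \<open>Both candidates are L1 limits of their mollifications, and these coincide at every point
  of \<open>S\<close> for small radii.\<close>

lemma weak_gradient_unique:
  fixes U :: "'a::euclidean_space \<Rightarrow> real"
  assumes V: "integrable lborel V" "integrable lborel W" and S: "S \<in> sets borel" and d: "d > 0"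
    and "\<And>r x. 0 < r \<Longrightarrow> r < d \<Longrightarrow> x \<in> S \<Longrightarrow>
      conv U (dir_deriv b (mollifier r)) x = conv V (mollifier r) x \<and>
      conv U (dir_deriv b (mollifier r)) x = conv W (mollifier r) x"
  shows "AE x in lborel. x \<in> S \<longrightarrow> V x = W x"
proof -
  have [measurable]: "V \<in> borel_measurable borel" "W \<in> borel_measurable borel" "S \<in> sets borel"
    using V S by (auto dest: borel_measurable_integrable)
  have *: "(\<integral>\<^sup>+x. ennreal (indicator S x * \<bar>V x - W x\<bar>) \<partial>lborel) \<le> ennreal e" if "0 < e" for e
  proof -
    obtain d1 where d1: "d1 > 0" "\<And>r. 0 < r \<and> r < d1 \<Longrightarrow> (\<integral>\<^sup>+x. ennreal \<bar>conv V (mollifier r) x - V x\<bar> \<partial>lborel) \<le> ennreal (e / 2)"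
      using conv_mollifier_L1[OF V(1), of "e / 2"] \<open>0 < e\<close> by (meson half_gt_zero)
    obtain d2 where d2: "d2 > 0" "\<And>r. 0 < r \<and> r < d2 \<Longrightarrow> (\<integral>\<^sup>+x. ennreal \<bar>conv W (mollifier r) x - W x\<bar> \<partial>lborel) \<le> ennreal (e / 2)"
      using conv_mollifier_L1[OF V(2), of "e / 2"] \<open>0 < e\<close> by (meson half_gt_zero)
    define r where "r = min d (min d1 d2) / 2"
    have r: "0 < r" "r < d" "r < d1" "r < d2" using d d1 d2 by (auto simp: r_def)
    have mc: "continuous_on UNIV (mollifier r :: 'a \<Rightarrow> real)" using C_k_mollifier C_k_continuous by blast
    have m0: "mollifier r x = 0" if "r < norm x" for x :: 'a using mollifier_outside[of r x] r that by simp
    have [measurable]: "conv V (mollifier r) \<in> borel_measurable borel" "conv W (mollifier r) \<in> borel_measurable borel"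
      using continuous_conv[OF V(1) mc m0] continuous_conv[OF V(2) mc m0] by (auto intro: borel_measurable_continuous_onI)
    have "(\<integral>\<^sup>+x. ennreal (indicator S x * \<bar>V x - W x\<bar>) \<partial>lborel)
      \<le> (\<integral>\<^sup>+x. ennreal \<bar>conv V (mollifier r) x - V x\<bar> + ennreal \<bar>conv W (mollifier r) x - W x\<bar> \<partial>lborel)"
    proof (rule nn_integral_mono)
      fix x
      have "conv V (mollifier r) x = conv W (mollifier r) x" if "x \<in> S" using assms(5)[of r x] r that by simp
      then show "ennreal (indicator S x * \<bar>V x - W x\<bar>) \<le> ennreal \<bar>conv V (mollifier r) x - V x\<bar> + ennreal \<bar>conv W (mollifier r) x - W x\<bar>"
        by (auto simp: indicator_def simp flip: ennreal_plus intro!: ennreal_leI)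
    qed
    also have "\<dots> = (\<integral>\<^sup>+x. ennreal \<bar>conv V (mollifier r) x - V x\<bar> \<partial>lborel) + (\<integral>\<^sup>+x. ennreal \<bar>conv W (mollifier r) x - W x\<bar> \<partial>lborel)"
      by (rule nn_integral_add) measurable
    also have "\<dots> \<le> ennreal (e / 2) + ennreal (e / 2)"
      using d1(2)[of r] d2(2)[of r] r by (intro add_mono) auto
    also have "\<dots> = ennreal e" using \<open>0 < e\<close> by (simp flip: ennreal_plus)
    finally show ?thesis .
  qed
  have "(\<integral>\<^sup>+x. ennreal (indicator S x * \<bar>V x - W x\<bar>) \<partial>lborel) \<le> 0"
  proof (rule ennreal_le_epsilon)
    fix e :: real assume "0 < e"
    then show "(\<integral>\<^sup>+x. ennreal (indicator S x * \<bar>V x - W x\<bar>) \<partial>lborel) \<le> 0 + ennreal e"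
      using *[of e] by (simp only: add_0)
  qed
  then have "AE x in lborel. ennreal (indicator S x * \<bar>V x - W x\<bar>) = 0"
    by (subst (asm) le_zero_eq, subst (asm) nn_integral_0_iff_AE) auto
  then show ?thesis
    by eventually_elim (auto simp: indicator_def ennreal_eq_0_iff)
qed

text \<open>The mollifications of \<open>f\<close> serve as smooth approximations; for radii below
  the margin \<open>d\<close> their supports stay in the interior of \<open>K\<close>. Their
  derivatives are the mollified components of \<open>g\<close>, so both limits are instances of L1
  convergence. The identity \<open>weak\<close> is assumed at all points and radii, which means that
  \<open>g\<close> is the gradient of \<open>f\<close> on the whole space, with \<open>f\<close>
  extended by zero.\<close>

lemma W11_o_weak_gradient:
  fixes f :: "real^'n \<Rightarrow> real" and g :: "real^'n \<Rightarrow> real^'n"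
  assumes f: "integrable lborel f" and g: "\<And>i. integrable lborel (\<lambda>x. g x $ i)"
    and K: "compact K" and S: "compact S" "S \<subseteq> interior K" and out: "\<And>x. x \<notin> S \<Longrightarrow> f x = 0"
    and weak: "\<And>i r x. 0 < r \<Longrightarrow>
      conv f (dir_deriv (axis i 1) (mollifier r)) x = conv (\<lambda>y. g y $ i) (mollifier r) x"
  shows "W11_o K f g"
proof -
  obtain d where d: "d > 0" "\<And>x. x \<in> S \<Longrightarrow> cball x d \<subseteq> interior K"
    using compact_enlarge_subset[OF S(1) open_interior S(2)] by blast
  have Kb: "K \<in> sets borel" using K by (rule borel_compact)
  have ex: "\<forall>n. \<exists>r. 0 < r \<and> r < d \<and> (\<integral>\<^sup>+x. ennreal \<bar>conv f (mollifier r) x - f x\<bar> \<partial>lborel) \<le> ennreal (inverse (real (Suc n)))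
      \<and> (\<forall>i. (\<integral>\<^sup>+x. ennreal \<bar>conv (\<lambda>y. g y $ i) (mollifier r) x - g x $ i\<bar> \<partial>lborel) \<le> ennreal (inverse (real (Suc n))))"
  proof
    fix n :: nat
    have e: "0 < inverse (real (Suc n))" by simp
    obtain d1 where d1: "d1 > 0" "\<And>r. 0 < r \<and> r < d1 \<Longrightarrow>
        (\<integral>\<^sup>+x. ennreal \<bar>conv f (mollifier r) x - f x\<bar> \<partial>lborel) \<le> ennreal (inverse (real (Suc n)))"
      using conv_mollifier_L1[OF f e] by blast
    have "\<forall>i. \<exists>d>0. \<forall>r. 0 < r \<and> r < d \<longrightarrow>
        (\<integral>\<^sup>+x. ennreal \<bar>conv (\<lambda>y. g y $ i) (mollifier r) x - g x $ i\<bar> \<partial>lborel) \<le> ennreal (inverse (real (Suc n)))"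
      by (intro allI conv_mollifier_L1[OF g e])
    from choice[OF this] obtain D where D: "\<And>i. D i > 0" "\<And>i r. 0 < r \<and> r < D i \<Longrightarrow>
        (\<integral>\<^sup>+x. ennreal \<bar>conv (\<lambda>y. g y $ i) (mollifier r) x - g x $ i\<bar> \<partial>lborel) \<le> ennreal (inverse (real (Suc n)))"
      by blast
    define D' where "D' = Min (range D)"
    have mp: "0 < D'" unfolding D'_def using D(1) by (subst Min_gr_iff) auto
    define r where "r = min d (min d1 D') / 2"
    have r: "0 < r" "r < d" "r < d1" "r < D'" using d(1) d1(1) mp by (auto simp: r_def)
    have "D' \<le> D i" for i unfolding D'_def by (intro Min_le) auto
    then have "r < D i" for i using r(4) by (rule less_le_trans[rotated])
    with r d1(2)[of r] D(2)[of r] show "\<exists>r. 0 < r \<and> r < d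
      \<and> (\<integral>\<^sup>+x. ennreal \<bar>conv f (mollifier r) x - f x\<bar> \<partial>lborel) \<le> ennreal (inverse (real (Suc n)))
      \<and> (\<forall>i. (\<integral>\<^sup>+x. ennreal \<bar>conv (\<lambda>y. g y $ i) (mollifier r) x - g x $ i\<bar> \<partial>lborel) \<le> ennreal (inverse (real (Suc n))))"
      by (intro exI[of _ r] conjI allI) simp_all
  qed
  from choice[OF ex] obtain r where r: "\<And>n. 0 < r n" "\<And>n. r n < d"
    "\<And>n. (\<integral>\<^sup>+x. ennreal \<bar>conv f (mollifier (r n)) x - f x\<bar> \<partial>lborel) \<le> ennreal (inverse (real (Suc n)))"
    "\<And>n i. (\<integral>\<^sup>+x. ennreal \<bar>conv (\<lambda>y. g y $ i) (mollifier (r n)) x - g x $ i\<bar> \<partial>lborel) \<le> ennreal (inverse (real (Suc n)))"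
    by blast
  define \<phi> where "\<phi> n = conv f (mollifier (r n))" for n
  have mc: "continuous_on UNIV (mollifier r :: real^'n \<Rightarrow> real)" for r using C_k_mollifier C_k_continuous by blast
  have m0: "mollifier (r n) x = 0" if "r n < norm x" for x :: "real^'n" and n
    using mollifier_outside[of "r n" x] r that by simp
  have m1: "C_k 1 (mollifier r)" for r by (rule C_k_mollifier)
  have D\<phi>: "dir_deriv (axis i 1) (\<phi> n) = conv (\<lambda>y. g y $ i) (mollifier (r n))" for i n
  proof
    fix x
    show "dir_deriv (axis i 1) (\<phi> n) x = conv (\<lambda>y. g y $ i) (mollifier (r n)) x"
      unfolding \<phi>_def weak[OF r(1)[of n], symmetric] by (rule dir_deriv_conv[OF f m1 m0]) simp_all
  qed
  have [measurable]: "f \<in> borel_measurable borel" "(\<lambda>x. g x $ i) \<in> borel_measurable borel" for i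
    using f g by (auto dest: borel_measurable_integrable)
  have meas: "\<phi> n \<in> borel_measurable borel" "dir_deriv (axis i 1) (\<phi> n) \<in> borel_measurable borel" for i n
    unfolding D\<phi> unfolding \<phi>_def
    using continuous_conv[OF f mc m0] continuous_conv[OF g mc m0] by (auto intro: borel_measurable_continuous_onI)
  have lim0: "(\<lambda>n. inverse (real (Suc n))) \<longlonglongrightarrow> 0"
    by (rule LIMSEQ_inverse_real_of_nat)
  show ?thesis
    unfolding W11_o_def
  proof (intro conjI allI exI[of _ \<phi>])
    show "Lp_on 1 K f" "Lp_on 1 K (\<lambda>x. g x $ i)" for i
      using f g Kb by (auto intro: Lp_on_1_borel)
    show "C_c_inf (interior K) (\<phi> n)" for n
    proof -
      \<comment> \<open>The support of a convolution lies in the sum of the supports, which is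
        compact.\<close>
      define S' where "S' = (\<Union>x\<in>S. \<Union>z\<in>cball 0 (r n). {x + z})"
      have cS: "compact S'" unfolding S'_def using S by (intro compact_sums') auto
      have "{x. \<phi> n x \<noteq> 0} \<subseteq> S'"
      proof (rule subsetI, rule ccontr)
        fix x assume "x \<in> {x. \<phi> n x \<noteq> 0}" and x: "x \<notin> S'"
        have "r n \<le> dist x y" if "y \<in> S" for y
        proof (rule ccontr)
          assume "\<not> r n \<le> dist x y"
          then have "x - y \<in> cball 0 (r n)" by (simp add: dist_norm norm_minus_commute)
          then have "x \<in> S'" unfolding S'_def using that by (intro UN_I[of y] UN_I[of "x - y"]) auto
          then show False using x by simp
        qed
        then have "\<phi> n x = 0"
          unfolding \<phi>_def using out mollifier_outside[OF r(1)[of n]] by (intro conv_outside[of S _ "r n"]) auto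
        then show False using \<open>x \<in> {x. \<phi> n x \<noteq> 0}\<close> by simp
      qed
      then have cl: "closure {x. \<phi> n x \<noteq> 0} \<subseteq> S'" using cS by (intro closure_minimal compact_imp_closed)
      moreover have "S' \<subseteq> interior K"
      proof
        fix y assume "y \<in> S'"
        then obtain x z where "x \<in> S" "norm z \<le> r n" "y = x + z" unfolding S'_def by auto
        then have "y \<in> cball x d" using r(2)[of n] by (simp add: dist_norm)
        then show "y \<in> interior K" using d(2)[OF \<open>x \<in> S\<close>] by blast
      qed
      moreover have "compact (closure {x. \<phi> n x \<noteq> 0})"
        using cl cS by (meson bounded_subset closed_closure compact_eq_bounded_closed)
      moreover have "C_k k (\<phi> n)" for k
        unfolding \<phi>_def by (rule C_k_conv[OF f C_k_mollifier m0])
      ultimately show ?thesis unfolding C_c_inf_def by blast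
    qed
    show "(\<lambda>n. LINT x:K|lebesgue. \<bar>f x - \<phi> n x\<bar>) \<longlonglongrightarrow> 0"
    proof (rule tendsto_sandwich[OF _ _ tendsto_const lim0]; intro always_eventually allI)
      fix n
      show "0 \<le> (LINT x:K|lebesgue. \<bar>f x - \<phi> n x\<bar>)" by (simp add: set_lebesgue_integral_def)
      show "(LINT x:K|lebesgue. \<bar>f x - \<phi> n x\<bar>) \<le> inverse (real (Suc n))"
        using meas Kb r(3)[of n] unfolding \<phi>_def[symmetric]
        by (intro set_integral_le_nn_integral) (auto simp: abs_minus_commute)
    qed
    show "(\<lambda>n. LINT x:K|lebesgue. \<bar>g x $ i - dir_deriv (axis i 1) (\<phi> n) x\<bar>) \<longlonglongrightarrow> 0" for i
    proof (rule tendsto_sandwich[OF _ _ tendsto_const lim0]; intro always_eventually allI)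
      fix n
      show "0 \<le> (LINT x:K|lebesgue. \<bar>g x $ i - dir_deriv (axis i 1) (\<phi> n) x\<bar>)" by (simp add: set_lebesgue_integral_def)
      show "(LINT x:K|lebesgue. \<bar>g x $ i - dir_deriv (axis i 1) (\<phi> n) x\<bar>) \<le> inverse (real (Suc n))"
        using meas Kb r(4)[of i n] unfolding D\<phi>[symmetric]
        by (intro set_integral_le_nn_integral) (auto simp: abs_minus_commute)
    qed
  qed
qed

section \<open>The chain rule for weak derivatives\<close>

lemma AE_tendsto_of_summable_L1:
  fixes f :: "nat \<Rightarrow> 'a \<Rightarrow> real"
  assumes [measurable]: "\<And>n. f n \<in> borel_measurable M"
    and b: "\<And>n. (\<integral>\<^sup>+x. ennreal \<bar>f n x\<bar> \<partial>M) \<le> ennreal ((1/2) ^ n)"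
  shows "AE x in M. (\<lambda>n. f n x) \<longlonglongrightarrow> 0"
proof -
  have "(\<integral>\<^sup>+x. (\<Sum>n. ennreal \<bar>f n x\<bar>) \<partial>M) = (\<Sum>n. \<integral>\<^sup>+x. ennreal \<bar>f n x\<bar> \<partial>M)"
    by (rule nn_integral_suminf) measurable
  also have "\<dots> \<le> (\<Sum>n. ennreal ((1/2) ^ n))"
    using b by (intro suminf_le) auto
  also have "\<dots> = ennreal 2"
    using geometric_sums[of "1/2 :: real"] by (subst suminf_ennreal_eq) auto
  finally have "(\<integral>\<^sup>+x. (\<Sum>n. ennreal \<bar>f n x\<bar>) \<partial>M) \<noteq> \<infinity>"
    by (auto simp: top_unique)
  \<comment> \<open>Where the series is finite its terms tend to zero; the geometric bound spares
    the passage to a subsequence.\<close>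
  then have "AE x in M. (\<Sum>n. ennreal \<bar>f n x\<bar>) \<noteq> \<infinity>"
    by (intro nn_integral_noteq_infinite) measurable
  then show ?thesis
  proof eventually_elim
    case (elim x)
    then have "summable (\<lambda>n. \<bar>f n x\<bar>)"
      by (intro summable_suminf_not_top) auto
    then have "(\<lambda>n. \<bar>f n x\<bar>) \<longlonglongrightarrow> 0" by (rule summable_LIMSEQ_zero)
    then show ?case by (rule tendsto_rabs_zero_cancel)
  qed
qed

text \<open>Both applications, the cutoff and the power of \<open>u + \<nu>\<close>, compose with
  nonnegative functions, so it is enough that \<open>F\<close> is differentiable at the points of
  the half line.\<close>

lemma C_k_1_compose:
  fixes u :: "'a::euclidean_space \<Rightarrow> real"
  assumes u: "C_k 1 u" "\<And>x. 0 \<le> u x"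
    and F: "\<And>s. 0 \<le> s \<Longrightarrow> (F has_real_derivative F' s) (at s)" "continuous_on {0..} F'"
  shows "C_k 1 (\<lambda>x. F (u x))" and "dir_deriv c (\<lambda>x. F (u x)) x = F' (u x) * dir_deriv c u x"
proof -
  have d: "((\<lambda>x. F (u x)) has_derivative (\<lambda>h. F' (u x) * frechet_derivative u (at x) h)) (at x)" for x
  proof -
    have "u differentiable at x" using u(1) by simp
    then have "(u has_derivative frechet_derivative u (at x)) (at x)" using frechet_derivative_works by blast
    from has_derivative_compose[OF this F(1)[OF u(2), unfolded has_field_derivative_def]] show ?thesis .
  qed
  show eq: "dir_deriv c (\<lambda>x. F (u x)) x = F' (u x) * dir_deriv c u x" for c x
    unfolding dir_deriv_eq[OF d] by (simp add: dir_deriv_def)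
  have uc: "continuous_on UNIV u" using u(1) C_k_continuous by blast
  have "continuous_on UNIV (\<lambda>x. F' (u x))"
    by (rule continuous_on_compose2[OF F(2) uc]) (use u(2) in auto)
  moreover have "continuous_on UNIV (dir_deriv c u)" if "c \<in> Basis" for c
    using u(1) that by simp
  moreover have "dir_deriv c (\<lambda>x. F (u x)) = (\<lambda>x. F' (u x) * dir_deriv c u x)" for c
    by (rule ext) (rule eq)
  ultimately have "continuous_on UNIV (dir_deriv c (\<lambda>x. F (u x)))" if "c \<in> Basis" for c
    using that by (simp add: continuous_on_mult)
  then show "C_k 1 (\<lambda>x. F (u x))" using d by (auto simp: differentiable_def)
qed

lemma mollifier_sequence:
  fixes U V :: "'a::euclidean_space \<Rightarrow> real"
  assumes "integrable lborel U" "integrable lborel V" "0 < d"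
  obtains r where "\<And>n::nat. 0 < r n" "\<And>n. r n < d"
    "\<And>n. (\<integral>\<^sup>+x. ennreal \<bar>conv U (mollifier (r n)) x - U x\<bar> \<partial>lborel) \<le> ennreal ((1/2) ^ n)"
    "\<And>n. (\<integral>\<^sup>+x. ennreal \<bar>conv V (mollifier (r n)) x - V x\<bar> \<partial>lborel) \<le> ennreal ((1/2) ^ n)"
proof -
  have "\<forall>n. \<exists>r. 0 < r \<and> r < d \<and> (\<integral>\<^sup>+x. ennreal \<bar>conv U (mollifier r) x - U x\<bar> \<partial>lborel) \<le> ennreal ((1/2) ^ n)
    \<and> (\<integral>\<^sup>+x. ennreal \<bar>conv V (mollifier r) x - V x\<bar> \<partial>lborel) \<le> ennreal ((1/2) ^ n)"
  proof
    fix n :: nat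
    have e: "(0::real) < (1/2) ^ n" by simp
    obtain d1 where d1: "d1 > 0" "\<And>r. 0 < r \<and> r < d1 \<Longrightarrow> (\<integral>\<^sup>+x. ennreal \<bar>conv U (mollifier r) x - U x\<bar> \<partial>lborel) \<le> ennreal ((1/2) ^ n)"
      using conv_mollifier_L1[OF assms(1) e] by blast
    obtain d2 where d2: "d2 > 0" "\<And>r. 0 < r \<and> r < d2 \<Longrightarrow> (\<integral>\<^sup>+x. ennreal \<bar>conv V (mollifier r) x - V x\<bar> \<partial>lborel) \<le> ennreal ((1/2) ^ n)"
      using conv_mollifier_L1[OF assms(2) e] by blast
    define r where "r = min d (min d1 d2) / 2"
    have "0 < r" "r < d" "r < d1" "r < d2" using assms(3) d1(1) d2(1) by (auto simp: r_def)
    with d1(2)[of r] d2(2)[of r] show "\<exists>r. 0 < r \<and> r < d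
      \<and> (\<integral>\<^sup>+x. ennreal \<bar>conv U (mollifier r) x - U x\<bar> \<partial>lborel) \<le> ennreal ((1/2) ^ n)
      \<and> (\<integral>\<^sup>+x. ennreal \<bar>conv V (mollifier r) x - V x\<bar> \<partial>lborel) \<le> ennreal ((1/2) ^ n)"
      by (intro exI[of _ r]) simp
  qed
  from choice[OF this] obtain r where "\<forall>n. 0 < r n \<and> r n < d
      \<and> (\<integral>\<^sup>+x. ennreal \<bar>conv U (mollifier (r n)) x - U x\<bar> \<partial>lborel) \<le> ennreal ((1/2) ^ n)
      \<and> (\<integral>\<^sup>+x. ennreal \<bar>conv V (mollifier (r n)) x - V x\<bar> \<partial>lborel) \<le> ennreal ((1/2) ^ n)" ..
  then show ?thesis by (intro that[of r]) simp_all
qed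

text \<open>For the mollified \<open>Uk\<close> the classical chain rule applies, and the derivative
  of a compactly supported function has integral zero; the limit gives the weak identity.
  \<open>Vk\<close> is known to be the derivative of \<open>Uk\<close> only on \<open>S\<close>,
  which is enough since \<zeta> vanishes outside. For this reason the conclusion holds for every
  \<open>x\<close> and every radius \<rho>, while the hypothesis concerns small radii and points of
  \<open>S\<close>.\<close>

lemma weak_chain_rule:
  fixes U V :: "'a::euclidean_space \<Rightarrow> real"
  assumes U: "integrable lborel U" "\<And>x. 0 \<le> U x" and V: "integrable lborel V" and b: "b \<in> Basis" and d: "0 < d"
    and UV: "\<And>r x. 0 < r \<Longrightarrow> r < d \<Longrightarrow> x \<in> S \<Longrightarrow> conv U (dir_deriv b (mollifier r)) x = conv V (mollifier r) x"
    and \<zeta>: "C_k 1 \<zeta>" "\<And>x. x \<notin> S \<Longrightarrow> \<zeta> x = 0" and S: "compact S"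
    and F: "\<And>s. 0 \<le> s \<Longrightarrow> (F has_real_derivative F' s) (at s)" "continuous_on {0..} F'"
    and B: "\<And>s. 0 \<le> s \<Longrightarrow> \<bar>F s\<bar> \<le> B" "\<And>s. 0 \<le> s \<Longrightarrow> \<bar>F' s\<bar> \<le> B"
    and \<rho>: "0 < \<rho>"
  shows "integrable lborel (\<lambda>y. F (U y) * \<zeta> y)"
    and "integrable lborel (\<lambda>y. F' (U y) * V y * \<zeta> y + F (U y) * dir_deriv b \<zeta> y)"
    and "conv (\<lambda>y. F (U y) * \<zeta> y) (dir_deriv b (mollifier \<rho>)) x
      = conv (\<lambda>y. F' (U y) * V y * \<zeta> y + F (U y) * dir_deriv b \<zeta> y) (mollifier \<rho>) x"
proof -
  obtain R where R: "\<And>x. x \<in> S \<Longrightarrow> norm x \<le> R"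
    using compact_imp_bounded[OF S] unfolding bounded_iff by blast
  have Sc: "closed S" using S by (rule compact_imp_closed)
  have \<zeta>0: "\<zeta> x = 0" if "R < norm x" for x using \<zeta>(2)[of x] R[of x] that by linarith
  have \<zeta>'S: "dir_deriv b \<zeta> x = 0" if "x \<notin> S" for x by (rule dir_deriv_outside[OF Sc \<zeta>(2) that])
  have \<zeta>'0: "dir_deriv b \<zeta> x = 0" if "R < norm x" for x using \<zeta>'S[of x] R[of x] that by linarith
  have \<zeta>c: "continuous_on UNIV \<zeta>" using \<zeta>(1) C_k_continuous by blast
  have \<zeta>'c: "continuous_on UNIV (dir_deriv b \<zeta>)" using \<zeta>(1) b by simp
  let ?m = "mollifier \<rho> :: 'a \<Rightarrow> real"
  have m1: "C_k 1 ?m" by (rule C_k_mollifier)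
  have mdiff: "?m differentiable (at z)" for z using m1 by simp
  have mc: "continuous_on UNIV (mollifier r :: 'a \<Rightarrow> real)" for r using C_k_mollifier C_k_continuous by blast
  have m'c: "continuous_on UNIV (dir_deriv b ?m)" using m1 b by simp
  \<comment> \<open>The kernel at the fixed point \<open>x\<close> as a test function; its
    derivative is \<open>- \<psi>'\<close> owing to the reflection.\<close>
  define \<psi> \<psi>' where "\<psi> y = ?m (x - y)" and "\<psi>' y = dir_deriv b ?m (x - y)" for y
  have \<psi>1: "C_k 1 \<psi>" unfolding \<psi>_def by (rule C_k_reflect[OF m1])
  have \<psi>d: "dir_deriv b \<psi> y = - \<psi>' y" for y unfolding \<psi>_def \<psi>'_def by (rule dir_deriv_reflect[OF mdiff])
  have \<psi>c: "continuous_on UNIV \<psi>" using \<psi>1 C_k_continuous by blast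
  have \<psi>'c: "continuous_on UNIV \<psi>'"
    unfolding \<psi>'_def by (intro continuous_on_compose2[OF m'c] continuous_intros) auto
  have Fc: "continuous_on {0..} F"
    using F(1) by (intro DERIV_continuous_on) (auto intro: has_field_derivative_at_within)
  have Fm: "(\<lambda>y. F (w y)) \<in> borel_measurable borel" "(\<lambda>y. F' (w y)) \<in> borel_measurable borel"
    if "w \<in> borel_measurable borel" "\<And>y. 0 \<le> w y" for w :: "'a \<Rightarrow> real"
  proof -
    have *: "(\<lambda>s. G (max 0 s)) \<in> borel_measurable borel" if "continuous_on {0..} G" for G :: "real \<Rightarrow> real"
      by (intro borel_measurable_continuous_onI continuous_on_compose2[OF that] continuous_intros) auto
    have "max 0 (w y) = w y" for y using that(2)[of y] by simp
    then show "(\<lambda>y. F (w y)) \<in> borel_measurable borel" "(\<lambda>y. F' (w y)) \<in> borel_measurable borel"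
      using measurable_compose[OF that(1) *[OF Fc]] measurable_compose[OF that(1) *[OF F(2)]] by simp_all
  qed
  have [measurable]: "U \<in> borel_measurable borel" "V \<in> borel_measurable borel" "\<zeta> \<in> borel_measurable borel"
    "dir_deriv b \<zeta> \<in> borel_measurable borel" "\<psi> \<in> borel_measurable borel" "\<psi>' \<in> borel_measurable borel"
    using U(1) V \<zeta>c \<zeta>'c \<psi>c \<psi>'c by (auto dest: borel_measurable_integrable intro: borel_measurable_continuous_onI)
  have [measurable]: "(\<lambda>y. F (U y)) \<in> borel_measurable borel" "(\<lambda>y. F' (U y)) \<in> borel_measurable borel"
    using Fm[of U] U(2) by simp_all
  have B0: "0 \<le> B" using B(1)[of 0] by simp
  have bm: "integrable lborel (\<lambda>y. f y * g y)"
    if "f \<in> borel_measurable borel" "\<And>y. \<bar>f y\<bar> \<le> B" "integrable lborel g" for f g :: "'a \<Rightarrow> real"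
  proof (rule Bochner_Integration.integrable_bound[of lborel "\<lambda>y. B * g y"])
    show "integrable lborel (\<lambda>y. B * g y)" using that by simp
    show "(\<lambda>y. f y * g y) \<in> borel_measurable lborel"
      using that by (auto dest: borel_measurable_integrable)
    show "AE y in lborel. norm (f y * g y) \<le> norm (B * g y)"
      using that(2) B0 by (intro AE_I2) (simp add: abs_mult mult_right_mono)
  qed
  have iz: "integrable lborel \<zeta>" by (rule integrable_compact_support[OF \<zeta>c \<zeta>0])
  have iz': "integrable lborel (dir_deriv b \<zeta>)" by (rule integrable_compact_support[OF \<zeta>'c \<zeta>'0])
  obtain Z where Z: "0 < Z" "\<And>x. \<bar>\<zeta> x\<bar> \<le> Z" using bounded_compact_support[OF \<zeta>c \<zeta>0] by metis
  have iV\<zeta>: "integrable lborel (\<lambda>y. V y * \<zeta> y)"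
  proof (rule Bochner_Integration.integrable_bound[of lborel "\<lambda>y. Z * V y"])
    show "AE y in lborel. norm (V y * \<zeta> y) \<le> norm (Z * V y)"
    proof (rule AE_I2)
      fix y show "norm (V y * \<zeta> y) \<le> norm (Z * V y)"
        using mult_right_mono[OF Z(2)[of y], of "\<bar>V y\<bar>"] Z(1) by (simp add: abs_mult mult.commute)
    qed
  qed (use V in auto)
  show i1: "integrable lborel (\<lambda>y. F (U y) * \<zeta> y)"
    using B(1) U(2) iz by (intro bm[of "\<lambda>y. F (U y)" \<zeta>]) auto
  have i2: "integrable lborel (\<lambda>y. F' (U y) * (V y * \<zeta> y))"
    using B(2) U(2) iV\<zeta> by (intro bm[of "\<lambda>y. F' (U y)" "\<lambda>y. V y * \<zeta> y"]) auto
  have i3: "integrable lborel (\<lambda>y. F (U y) * dir_deriv b \<zeta> y)"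
    using B(1) U(2) iz' by (intro bm[of "\<lambda>y. F (U y)" "dir_deriv b \<zeta>"]) auto
  show i4: "integrable lborel (\<lambda>y. F' (U y) * V y * \<zeta> y + F (U y) * dir_deriv b \<zeta> y)"
    using Bochner_Integration.integrable_add[OF i2 i3] by (simp add: mult.assoc)
  obtain r where r: "\<And>n. 0 < r n" "\<And>n. r n < d"
    "\<And>n. (\<integral>\<^sup>+x. ennreal \<bar>conv U (mollifier (r n)) x - U x\<bar> \<partial>lborel) \<le> ennreal ((1/2) ^ n)"
    "\<And>n. (\<integral>\<^sup>+x. ennreal \<bar>conv V (mollifier (r n)) x - V x\<bar> \<partial>lborel) \<le> ennreal ((1/2) ^ n)"
    by (rule mollifier_sequence[OF U(1) V d]) (rule that)
  define Uk Vk where "Uk n = conv U (mollifier (r n))" and "Vk n = conv V (mollifier (r n))" for n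
  have m0: "mollifier (r n) x = 0" if "r n < norm x" for x :: 'a and n
    using mollifier_outside[of "r n" x] r that by simp
  have Uk1: "C_k 1 (Uk n)" for n unfolding Uk_def by (rule C_k_conv[OF U(1) C_k_mollifier m0])
  have Ukc: "continuous_on UNIV (Uk n)" for n using Uk1 C_k_continuous by blast
  have Vkc: "continuous_on UNIV (Vk n)" for n unfolding Vk_def by (rule continuous_conv[OF V mc m0])
  have Uk0: "0 \<le> Uk n y" for n y
    unfolding Uk_def conv_def by (intro Bochner_Integration.integral_nonneg) (simp add: U(2) mollifier_nonneg)
  have UkD: "dir_deriv b (Uk n) y = Vk n y" if "y \<in> S" for n y
    unfolding Uk_def Vk_def UV[OF r(1) r(2) that, symmetric]
    by (rule dir_deriv_conv[OF U(1) C_k_mollifier m0 b])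
  have [measurable]: "Uk n \<in> borel_measurable borel" "Vk n \<in> borel_measurable borel" for n
    using Ukc Vkc by (auto intro: borel_measurable_continuous_onI)
  have [measurable]: "(\<lambda>y. F (Uk n y)) \<in> borel_measurable borel" "(\<lambda>y. F' (Uk n y)) \<in> borel_measurable borel" for n
    using Fm[of "Uk n"] Uk0 by simp_all
  have AEU: "AE y in lborel. (\<lambda>n. Uk n y) \<longlonglongrightarrow> U y"
  proof -
    have "AE y in lborel. (\<lambda>n. Uk n y - U y) \<longlonglongrightarrow> 0"
      using r(3) by (intro AE_tendsto_of_summable_L1) (auto simp: Uk_def[symmetric])
    then show ?thesis by eventually_elim (simp add: LIM_zero_iff)
  qed
  \<comment> \<open>\<open>G n\<close> is the derivative of
    \<open>F (Uk n) * \<zeta> * \<psi>\<close> and integrates to zero. \<open>P n\<close> has the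
    fixed \<open>V\<close> in place of \<open>Vk n\<close>, so that dominated convergence to
    \<open>P0\<close> works with one majorant \<open>W\<close>; no majorant for the sequence
    \<open>Vk\<close> is needed.\<close>
  define G where "G n y = - (F (Uk n y) * \<zeta> y * \<psi>' y) + (F (Uk n y) * dir_deriv b \<zeta> y + F' (Uk n y) * Vk n y * \<zeta> y) * \<psi> y" for n y
  define P where "P n y = - (F (Uk n y) * \<zeta> y * \<psi>' y) + (F (Uk n y) * dir_deriv b \<zeta> y + F' (Uk n y) * V y * \<zeta> y) * \<psi> y" for n y
  define P0 where "P0 y = - (F (U y) * \<zeta> y * \<psi>' y) + (F (U y) * dir_deriv b \<zeta> y + F' (U y) * V y * \<zeta> y) * \<psi> y" for y
  have Gint: "integrable lborel (G n)" "(\<integral>y. G n y \<partial>lborel) = 0" for n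
  proof -
    have cr: "C_k 1 (\<lambda>y. F (Uk n y))" "dir_deriv c (\<lambda>y. F (Uk n y)) y = F' (Uk n y) * dir_deriv c (Uk n) y" for c y
      by (rule C_k_1_compose[OF Uk1 Uk0 F]; assumption)+
    have C: "C_k 1 (\<lambda>y. F (Uk n y) * \<zeta> y * \<psi> y)" by (intro C_k_mult cr \<zeta>(1) \<psi>1)
    have "dir_deriv b (\<lambda>y. F (Uk n y) * \<zeta> y * \<psi> y) y = G n y" for y
    proof -
      have "((\<lambda>y. F (Uk n y)) has_derivative frechet_derivative (\<lambda>y. F (Uk n y)) (at y)) (at y)"
        "(\<zeta> has_derivative frechet_derivative \<zeta> (at y)) (at y)" "(\<psi> has_derivative frechet_derivative \<psi> (at y)) (at y)"
        by (rule frechet_derivative_works[THEN iffD1], use cr(1) \<zeta>(1) \<psi>1 in simp)+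
      then have "((\<lambda>y. F (Uk n y) * \<zeta> y * \<psi> y) has_derivative (\<lambda>h. F (Uk n y) * \<zeta> y * frechet_derivative \<psi> (at y) h +
          (F (Uk n y) * frechet_derivative \<zeta> (at y) h + frechet_derivative (\<lambda>y. F (Uk n y)) (at y) h * \<zeta> y) * \<psi> y)) (at y)"
        by (intro has_derivative_mult)
      then have "dir_deriv b (\<lambda>y. F (Uk n y) * \<zeta> y * \<psi> y) y = F (Uk n y) * \<zeta> y * dir_deriv b \<psi> y +
          (F (Uk n y) * dir_deriv b \<zeta> y + dir_deriv b (\<lambda>y. F (Uk n y)) y * \<zeta> y) * \<psi> y"
        unfolding dir_deriv_def[of _ \<psi>] dir_deriv_def[of _ \<zeta>] dir_deriv_def[of _ "\<lambda>y. F (Uk n y)"] by (rule dir_deriv_eq)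
      then show ?thesis
        using UkD[of y n] \<zeta>(2)[of y] unfolding cr(2) \<psi>d G_def by (cases "y \<in> S") simp_all
    qed
    then have eq: "dir_deriv b (\<lambda>y. F (Uk n y) * \<zeta> y * \<psi> y) = G n" by (rule ext)
    have out: "F (Uk n y) * \<zeta> y * \<psi> y = 0" if "R < norm y" for y using \<zeta>0[OF that] by simp
    show "(\<integral>y. G n y \<partial>lborel) = 0"
      using integral_dir_deriv_zero[OF C out b] unfolding eq .
    have Gc: "continuous_on UNIV (G n)" using C b unfolding eq[symmetric] by simp
    show "integrable lborel (G n)"
      by (rule integrable_compact_support[OF Gc, of R]) (simp add: G_def \<zeta>0 \<zeta>'0)
  qed
  have iz\<psi>': "integrable lborel (\<lambda>y. \<zeta> y * \<psi>' y)"
    by (rule integrable_compact_support[of _ R]) (auto intro!: continuous_intros \<zeta>c \<psi>'c simp: \<zeta>0)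
  have iz'\<psi>: "integrable lborel (\<lambda>y. dir_deriv b \<zeta> y * \<psi> y)"
    by (rule integrable_compact_support[of _ R]) (auto intro!: continuous_intros \<zeta>'c \<psi>c simp: \<zeta>'0)
  have z\<psi>c: "continuous_on UNIV (\<lambda>y. \<zeta> y * \<psi> y)" by (intro continuous_intros \<zeta>c \<psi>c)
  have z\<psi>0: "\<zeta> y * \<psi> y = 0" if "R < norm y" for y using \<zeta>0[OF that] by simp
  obtain Z' where Z': "0 < Z'" "\<And>y. \<bar>\<zeta> y * \<psi> y\<bar> \<le> Z'" using bounded_compact_support[OF z\<psi>c z\<psi>0] by metis
  have iV: "integrable lborel (\<lambda>y. V y * (\<zeta> y * \<psi> y))"
  proof (rule Bochner_Integration.integrable_bound[of lborel "\<lambda>y. Z' * V y"])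
    show "AE y in lborel. norm (V y * (\<zeta> y * \<psi> y)) \<le> norm (Z' * V y)"
    proof (rule AE_I2)
      fix y show "norm (V y * (\<zeta> y * \<psi> y)) \<le> norm (Z' * V y)"
        using mult_right_mono[OF Z'(2)[of y], of "\<bar>V y\<bar>"] Z'(1) by (simp add: abs_mult mult_ac)
    qed
  qed (use V in auto)
  define W where "W y = B * \<bar>\<zeta> y * \<psi>' y\<bar> + B * \<bar>dir_deriv b \<zeta> y * \<psi> y\<bar> + B * \<bar>V y * (\<zeta> y * \<psi> y)\<bar>" for y
  have PW: "\<bar>- (f * \<zeta> y * \<psi>' y) + (f * dir_deriv b \<zeta> y + f' * V y * \<zeta> y) * \<psi> y\<bar> \<le> W y"
    if "\<bar>f\<bar> \<le> B" "\<bar>f'\<bar> \<le> B" for f f' y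
  proof -
    have "\<bar>- (f * \<zeta> y * \<psi>' y) + (f * dir_deriv b \<zeta> y + f' * V y * \<zeta> y) * \<psi> y\<bar>
      = \<bar>- (f * (\<zeta> y * \<psi>' y)) + f * (dir_deriv b \<zeta> y * \<psi> y) + f' * (V y * (\<zeta> y * \<psi> y))\<bar>"
      by (simp add: algebra_simps)
    also have "\<dots> \<le> \<bar>f\<bar> * \<bar>\<zeta> y * \<psi>' y\<bar> + \<bar>f\<bar> * \<bar>dir_deriv b \<zeta> y * \<psi> y\<bar> + \<bar>f'\<bar> * \<bar>V y * (\<zeta> y * \<psi> y)\<bar>"
      unfolding abs_mult[symmetric] by linarith
    also have "\<dots> \<le> W y" unfolding W_def using that by (intro add_mono mult_right_mono) auto
    finally show ?thesis .
  qed
  have Wi: "integrable lborel W" unfolding W_def using iz\<psi>' iz'\<psi> iV by auto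
  have Pm [measurable]: "P n \<in> borel_measurable borel" for n unfolding P_def by measurable
  have P0m [measurable]: "P0 \<in> borel_measurable borel" unfolding P0_def by measurable
  have Pb: "\<bar>P n y\<bar> \<le> W y" for n y unfolding P_def by (intro PW B Uk0)
  have lim: "(\<lambda>n. \<integral>y. P n y \<partial>lborel) \<longlonglongrightarrow> (\<integral>y. P0 y \<partial>lborel)"
  proof (rule integral_dominated_convergence[where w = W])
    show "AE y in lborel. (\<lambda>n. P n y) \<longlonglongrightarrow> P0 y"
      using AEU
    proof eventually_elim
      case (elim y)
      have "(\<lambda>n. F (Uk n y)) \<longlonglongrightarrow> F (U y)"
        using Fc by (rule continuous_on_tendsto_compose[OF _ elim]) (auto simp: U(2) Uk0)
      moreover have "(\<lambda>n. F' (Uk n y)) \<longlonglongrightarrow> F' (U y)"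
        using F(2) by (rule continuous_on_tendsto_compose[OF _ elim]) (auto simp: U(2) Uk0)
      ultimately show ?case unfolding P_def P0_def by (intro tendsto_intros)
    qed
  qed (use Wi Pb in auto)
  have P_int: "integrable lborel (P n)" for n
  proof (rule Bochner_Integration.integrable_bound[OF Wi])
    show "AE y in lborel. norm (P n y) \<le> norm (W y)"
      by (rule AE_I2) (metis Pb abs_ge_self order_trans real_norm_def)
  qed measurable
  have P0b: "\<bar>P0 y\<bar> \<le> W y" for y unfolding P0_def by (intro PW B U(2))
  have P0_int: "integrable lborel P0"
  proof (rule Bochner_Integration.integrable_bound[OF Wi])
    show "AE y in lborel. norm (P0 y) \<le> norm (W y)"
      by (rule AE_I2) (metis P0b abs_ge_self order_trans real_norm_def)
  qed measurable
  \<comment> \<open>\<open>P n - G n\<close> contains \<open>V - Vk n\<close> with a bounded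
    coefficient, so the L1 rate of the mollifications controls it.\<close>
  have small: "\<bar>\<integral>y. P n y \<partial>lborel\<bar> \<le> B * Z' * (1/2) ^ n" for n
  proof -
    have iVn: "integrable lborel (\<lambda>y. Vk n y - V y)"
    proof (rule integrableI_bounded)
      show "(\<integral>\<^sup>+y. ennreal (norm (Vk n y - V y)) \<partial>lborel) < \<infinity>"
        using r(4)[of n] unfolding Vk_def[symmetric] by (simp add: order_le_less_trans)
    qed measurable
    have I1: "(\<integral>y. \<bar>Vk n y - V y\<bar> \<partial>lborel) \<le> (1/2) ^ n"
    proof -
      have "(\<integral>y. \<bar>Vk n y - V y\<bar> \<partial>lborel) = enn2real (\<integral>\<^sup>+y. ennreal \<bar>Vk n y - V y\<bar> \<partial>lborel)"
        by (rule integral_eq_nn_integral) auto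
      also have "\<dots> \<le> enn2real (ennreal ((1/2) ^ n))"
        using r(4)[of n] unfolding Vk_def[symmetric] by (intro enn2real_mono) auto
      finally show ?thesis by simp
    qed
    have "(\<integral>y. P n y \<partial>lborel) = (\<integral>y. P n y - G n y \<partial>lborel)"
      using Gint[of n] P_int[of n] by simp
    also have "\<bar>\<dots>\<bar> \<le> (\<integral>y. B * Z' * \<bar>Vk n y - V y\<bar> \<partial>lborel)"
    proof (rule order_trans[OF integral_abs_bound], rule integral_mono)
      show "integrable lborel (\<lambda>y. \<bar>P n y - G n y\<bar>)"
        by (intro integrable_abs Bochner_Integration.integrable_diff Gint P_int)
      show "integrable lborel (\<lambda>y. B * Z' * \<bar>Vk n y - V y\<bar>)"
        by (intro integrable_mult_right integrable_abs iVn)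
      fix y
      have "P n y - G n y = F' (Uk n y) * (\<zeta> y * \<psi> y) * (V y - Vk n y)"
        unfolding P_def G_def by (simp add: algebra_simps)
      also have "\<bar>\<dots>\<bar> = \<bar>F' (Uk n y)\<bar> * \<bar>\<zeta> y * \<psi> y\<bar> * \<bar>Vk n y - V y\<bar>"
        by (simp add: abs_mult abs_minus_commute)
      also have "\<dots> \<le> B * Z' * \<bar>Vk n y - V y\<bar>"
        using B(2)[OF Uk0] Z' B0 by (intro mult_right_mono mult_mono) auto
      finally show "\<bar>P n y - G n y\<bar> \<le> B * Z' * \<bar>Vk n y - V y\<bar>" .
    qed
    also have "\<dots> = B * Z' * (\<integral>y. \<bar>Vk n y - V y\<bar> \<partial>lborel)" by simp
    also have "\<dots> \<le> B * Z' * (1/2) ^ n" using I1 B0 Z' by (intro mult_left_mono) auto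
    finally show ?thesis .
  qed
  have "(\<lambda>n. \<integral>y. P n y \<partial>lborel) \<longlonglongrightarrow> 0"
  proof (rule tendsto_0_le[of "\<lambda>n. (1/2::real) ^ n" _ _ "B * Z'"])
    show "(\<lambda>n. (1/2::real) ^ n) \<longlonglongrightarrow> 0" by (rule LIMSEQ_power_zero) simp
    show "\<forall>\<^sub>F n in sequentially. norm (\<integral>y. P n y \<partial>lborel) \<le> norm ((1/2::real) ^ n) * (B * Z')"
      using small by (intro always_eventually allI) (simp add: mult.commute)
  qed
  then have zero: "(\<integral>y. P0 y \<partial>lborel) = 0" using lim LIMSEQ_unique by blast
  have j1: "integrable lborel (\<lambda>y. F (U y) * \<zeta> y * \<psi>' y)"
    using bm[of "\<lambda>y. F (U y)" "\<lambda>y. \<zeta> y * \<psi>' y"] iz\<psi>' B(1) U(2) by (simp add: mult.assoc)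
  have "(\<integral>y. (F' (U y) * V y * \<zeta> y + F (U y) * dir_deriv b \<zeta> y) * \<psi> y \<partial>lborel)
      = (\<integral>y. P0 y + F (U y) * \<zeta> y * \<psi>' y \<partial>lborel)"
    unfolding P0_def by (intro Bochner_Integration.integral_cong) (auto simp: algebra_simps)
  also have "\<dots> = (\<integral>y. F (U y) * \<zeta> y * \<psi>' y \<partial>lborel)"
    using P0_int j1 zero by simp
  finally show "conv (\<lambda>y. F (U y) * \<zeta> y) (dir_deriv b (mollifier \<rho>)) x
      = conv (\<lambda>y. F' (U y) * V y * \<zeta> y + F (U y) * dir_deriv b \<zeta> y) (mollifier \<rho>) x"
    unfolding conv_def \<psi>_def \<psi>'_def by simp
qed

section \<open>Cutoff functions\<close>

lemma C_k_power: "C_k k f \<Longrightarrow> C_k k (\<lambda>x. f x ^ n)"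
  by (induction n) (auto intro: C_k_const C_k_mult)

lemma C_k_sum: "finite I \<Longrightarrow> (\<And>i. i \<in> I \<Longrightarrow> C_k k (f i)) \<Longrightarrow> C_k k (\<lambda>x. \<Sum>i\<in>I. f i x)"
  by (induction I rule: finite_induct) (auto intro: C_k_const C_k_add)

text \<open>The condition on \<open>k\<close> matters at the gluing point \<open>s = 1\<close>,
  where the quotient is of order \<open>h ^ (k - 1)\<close>.\<close>

lemma has_derivative_pos_part_power:
  assumes "2 \<le> k"
  shows "((\<lambda>s::real. max 0 (1 - s) ^ k) has_real_derivative - real k * max 0 (1 - s) ^ (k - 1)) (at s)"
proof -
  consider "s < 1" | "s > 1" | "s = 1" by linarith
  then show ?thesis
  proof cases
    case 1
    have "((\<lambda>s::real. (1 - s) ^ k) has_real_derivative - real k * (1 - s) ^ (k - 1)) (at s)"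
      by (auto intro!: derivative_eq_intros)
    then have "((\<lambda>s::real. (1 - s) ^ k) has_real_derivative - real k * max 0 (1 - s) ^ (k - 1)) (at s)"
      using 1 by simp
    then show ?thesis
      by (rule has_field_derivative_transform_within_open[of _ _ _ "{..<1}"]) (use 1 in auto)
  next
    case 2
    have "((\<lambda>s::real. 0) has_real_derivative - real k * max 0 (1 - s) ^ (k - 1)) (at s)"
      using 2 assms by (simp add: power_0_left)
    then show ?thesis
      by (rule has_field_derivative_transform_within_open[of _ _ _ "{1<..}"]) (use 2 assms in auto)
  next
    case 3
    have "((\<lambda>h::real. (max 0 (1 - (1 + h)) ^ k - max 0 (1 - 1) ^ k) / h) \<longlongrightarrow> 0) (at 0)"
    proof (rule tendsto_0_le[where K = 1])
      have "((\<lambda>h::real. h ^ (k - 1)) \<longlongrightarrow> 0 ^ (k - 1)) (at 0)" by (intro tendsto_intros)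
      then show "((\<lambda>h::real. h ^ (k - 1)) \<longlongrightarrow> 0) (at 0)" using assms by simp
      have *: "norm ((max 0 (1 - (1 + h)) ^ k - max 0 (1 - 1) ^ k) / h) \<le> norm (h ^ (k - 1)) * 1" if "h \<noteq> 0" for h :: real
      proof -
        have "max 0 (- h) ^ k \<le> \<bar>h\<bar> ^ k" by (intro power_mono) auto
        also have "\<bar>h\<bar> ^ k = \<bar>h\<bar> ^ (k - 1) * \<bar>h\<bar>" using assms by (metis power_minus_mult not_numeral_le_zero gr0I)
        finally have "max 0 (- h) ^ k / \<bar>h\<bar> \<le> \<bar>h\<bar> ^ (k - 1)" using that by (simp add: divide_le_eq)
        moreover have "max 0 (- h) ^ k \<ge> 0" by simp
        ultimately show ?thesis using assms by (simp add: power_abs abs_divide power_0_left)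
      qed
      show "\<forall>\<^sub>F h in at (0::real). norm ((max 0 (1 - (1 + h)) ^ k - max 0 (1 - 1) ^ k) / h) \<le> norm (h ^ (k - 1)) * (1::real)"
        unfolding eventually_at_filter by (intro always_eventually allI impI *)
    qed
    then show ?thesis using 3 assms by (simp add: DERIV_def power_0_left)
  qed
qed

text \<open>The cutoff is the positive part of \<open>1 - \<Phi>\<close> to the power
  \<open>k\<close>, where \<Phi> averages the even powers \<open>(x $ i / L i) ^ (2 * m)\<close>,
  halved. Differentiating the outer power loses one factor out of \<open>k\<close>, hence the
  exponent \<open>1 - 1 / k\<close>. The coordinates enter only through \<open>x $ i / L i\<close>,
  so \<open>M\<close> depends on \<open>k\<close> and the dimension but not on the box.\<close>

lemma cutoff_exists:
  assumes k: "2 \<le> k"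
  obtains M :: real where "0 < M"
    "\<And>L :: 'n::finite \<Rightarrow> real. (\<And>i. 0 < L i) \<Longrightarrow> \<exists>\<zeta> :: real^'n \<Rightarrow> real. C_k 1 \<zeta> \<and> (\<forall>x. 0 \<le> \<zeta> x \<and> \<zeta> x \<le> 1)
      \<and> (\<forall>x. (\<forall>i. \<bar>x $ i\<bar> \<le> L i) \<longrightarrow> (1/2) ^ k \<le> \<zeta> x)
      \<and> (\<forall>x. \<not> (\<forall>i. \<bar>x $ i\<bar> \<le> 3/2 * L i) \<longrightarrow> \<zeta> x = 0)
      \<and> (\<forall>x i. \<bar>dir_deriv (axis i 1) \<zeta> x\<bar> \<le> M / L i * \<zeta> x powr (1 - 1 / real k))"
proof -
  define N where "N = real CARD('n)"
  have N: "N \<ge> 1" by (simp add: N_def Suc_leI)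
  \<comment> \<open>The exponent is so large that a single coordinate beyond
    \<open>3/2 * L i\<close> forces \<open>\<Phi> x > 1\<close>, in spite of the division by
    \<open>2 * N\<close> that keeps \<Phi> below one half on the inner box. The base is
    \<open>9/4\<close> because the power is even.\<close>
  obtain m0 where m0: "2 * N < (9/4 :: real) ^ m0" using real_arch_pow[of "9/4" "2 * N"] by auto
  define m where "m = Suc m0"
  have m: "0 < m" "2 * N < (3/2 :: real) ^ (2 * m)"
  proof -
    have "2 * N < (9/4 :: real) ^ m"
      by (rule less_le_trans[OF m0], rule power_increasing) (auto simp: m_def)
    then show "2 * N < (3/2 :: real) ^ (2 * m)" by (simp add: power_mult power2_eq_square)
  qed (simp add: m_def)
  define M where "M = real k * (2 * real m * (3/2) ^ (2 * m - 1) / (2 * N))"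
  show thesis
  proof (rule that[of M])
    show "0 < M" using k m N by (simp add: M_def)
    fix L :: "'n \<Rightarrow> real" assume L: "\<And>i. 0 < L i"
    define \<Phi> where "\<Phi> x = (\<Sum>i\<in>UNIV. ((x \<bullet> axis i 1) * (1 / L i)) ^ (2 * m)) * (1 / (2 * N))" for x :: "real^'n"
    define F F' where "F s = max 0 (1 - s) ^ k" and "F' s = - real k * max 0 (1 - s) ^ (k - 1)" for s :: real
    have \<Phi>C: "C_k j \<Phi>" for j
      unfolding \<Phi>_def by (intro C_k_mult C_k_sum C_k_power C_k_inner C_k_const) simp
    have \<Phi>0: "0 \<le> \<Phi> x" for x
      unfolding \<Phi>_def using N by (intro mult_nonneg_nonneg sum_nonneg) (auto simp: power_mult)
    have FD: "(F has_real_derivative F' s) (at s)" for s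
      unfolding F_def F'_def by (rule has_derivative_pos_part_power[OF k])
    have F'c: "continuous_on {0..} F'" unfolding F'_def by (intro continuous_intros)
    note cc = C_k_1_compose[OF \<Phi>C \<Phi>0 FD F'c]
    have \<Phi>d: "dir_deriv (axis i 1) \<Phi> x = 2 * real m * (x $ i / L i) ^ (2 * m - 1) / L i / (2 * N)" for x i
    proof -
      define D where "D h = (\<Sum>j\<in>UNIV. real (2 * m) * ((h \<bullet> axis j 1) * (1 / L j)) * ((x \<bullet> axis j 1) * (1 / L j)) ^ (2 * m - 1)) * (1 / (2 * N))" for h :: "real^'n"
      have "(\<Phi> has_derivative D) (at x)"
        unfolding \<Phi>_def D_def
        by (rule has_derivative_mult_left has_derivative_sum has_derivative_power has_derivative_inner_left has_derivative_ident)+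
      have ax: "(axis i 1 :: real^'n) \<bullet> axis j 1 = (if j = i then 1 else 0)" "x \<bullet> axis j 1 = x $ j" for j
        unfolding inner_axis by (auto simp: axis_def)
      from dir_deriv_eq[OF \<open>(\<Phi> has_derivative D) (at x)\<close>, of "axis i 1"] have "dir_deriv (axis i 1) \<Phi> x = D (axis i 1)" .
      also have "D (axis i 1) = (\<Sum>j\<in>UNIV. real (2 * m) * (((axis i 1 :: real^'n) \<bullet> axis j 1) * (1 / L j)) * ((x \<bullet> axis j 1) * (1 / L j)) ^ (2 * m - 1)) * (1 / (2 * N))"
        by (rule D_def)
      also have "\<dots> = (\<Sum>j\<in>UNIV. if j = i then real (2 * m) * (1 / L j) * (x $ j / L j) ^ (2 * m - 1) else 0) * (1 / (2 * N))"
        by (intro arg_cong2[where f = "(*)"] sum.cong) (auto simp: ax)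
      finally show ?thesis by (simp add: mult_ac)
    qed
    have comp: "\<bar>x $ i / L i\<bar> \<le> 3/2" if "\<Phi> x \<le> 1" for x i
    proof (rule ccontr)
      assume "\<not> \<bar>x $ i / L i\<bar> \<le> 3/2"
      then have "(3/2) ^ (2 * m) \<le> \<bar>x $ i / L i\<bar> ^ (2 * m)" by (intro power_mono) auto
      also have "\<dots> = ((x \<bullet> axis i 1) * (1 / L i)) ^ (2 * m)" by (simp add: power_even_abs inner_axis del: abs_divide)
      also have "\<dots> \<le> (\<Sum>i\<in>UNIV. ((x \<bullet> axis i 1) * (1 / L i)) ^ (2 * m))"
        by (intro member_le_sum) (auto simp: power_mult)
      also have "\<dots> = \<Phi> x * (2 * N)" using N by (simp add: \<Phi>_def)
      also have "\<dots> \<le> 1 * (2 * N)" using that N by (intro mult_right_mono) auto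
      finally show False using m by simp
    qed
    show "\<exists>\<zeta> :: real^'n \<Rightarrow> real. C_k 1 \<zeta> \<and> (\<forall>x. 0 \<le> \<zeta> x \<and> \<zeta> x \<le> 1)
      \<and> (\<forall>x. (\<forall>i. \<bar>x $ i\<bar> \<le> L i) \<longrightarrow> (1/2) ^ k \<le> \<zeta> x)
      \<and> (\<forall>x. \<not> (\<forall>i. \<bar>x $ i\<bar> \<le> 3/2 * L i) \<longrightarrow> \<zeta> x = 0)
      \<and> (\<forall>x i. \<bar>dir_deriv (axis i 1) \<zeta> x\<bar> \<le> M / L i * \<zeta> x powr (1 - 1 / real k))"
    proof (intro exI[of _ "\<lambda>x. F (\<Phi> x)"] conjI allI impI)
      show "C_k 1 (\<lambda>x. F (\<Phi> x))" by (rule cc)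
      fix x :: "real^'n"
      show "0 \<le> F (\<Phi> x)" by (simp add: F_def)
      show "F (\<Phi> x) \<le> 1" using \<Phi>0[of x] unfolding F_def by (intro power_le_one) auto
      show "(1/2) ^ k \<le> F (\<Phi> x)" if "\<forall>i. \<bar>x $ i\<bar> \<le> L i"
      proof -
        have "((x \<bullet> axis i 1) * (1 / L i)) ^ (2 * m) \<le> 1" for i
        proof -
          have "\<bar>x $ i / L i\<bar> \<le> 1" using that L[of i] by (simp add: abs_divide)
          then have "\<bar>x $ i / L i\<bar> ^ (2 * m) \<le> 1" by (intro power_le_one) auto
          then show ?thesis by (simp add: power_even_abs inner_axis del: abs_divide)
        qed
        then have "(\<Sum>i\<in>UNIV. ((x \<bullet> axis i 1) * (1 / L i)) ^ (2 * m)) \<le> (\<Sum>i\<in>(UNIV :: 'n set). 1)"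
          by (intro sum_mono)
        then have "\<Phi> x \<le> N * (1 / (2 * N))" unfolding \<Phi>_def using N by (intro mult_right_mono) (auto simp: N_def)
        then have "\<Phi> x \<le> 1/2" using N by simp
        then show ?thesis unfolding F_def by (intro power_mono) auto
      qed
      show "F (\<Phi> x) = 0" if out: "\<not> (\<forall>i. \<bar>x $ i\<bar> \<le> 3/2 * L i)"
      proof -
        obtain i where "3/2 * L i < \<bar>x $ i\<bar>" using out by (auto simp: not_le)
        then have "\<not> \<bar>x $ i / L i\<bar> \<le> 3/2" using L[of i] by (simp add: abs_divide divide_le_eq)
        then have "1 < \<Phi> x" using comp[of x i] by linarith
        then show ?thesis using k by (simp add: F_def)
      qed
      fix i
      show "\<bar>dir_deriv (axis i 1) (\<lambda>x. F (\<Phi> x)) x\<bar> \<le> M / L i * F (\<Phi> x) powr (1 - 1 / real k)"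
      proof (cases "\<Phi> x < 1")
        case True
        define y where "y = 1 - \<Phi> x"
        have y: "0 < y" "max 0 (1 - \<Phi> x) = y" using True by (auto simp: y_def)
        have "F (\<Phi> x) powr (1 - 1 / real k) = y powr (real k * (1 - 1 / real k))"
          using y k by (simp add: F_def powr_powr flip: powr_realpow)
        also have "real k * (1 - 1 / real k) = real (k - 1)" using k by (simp add: field_simps of_nat_diff)
        finally have F1: "F (\<Phi> x) powr (1 - 1 / real k) = y ^ (k - 1)" using y by (simp add: powr_realpow)
        have c: "\<bar>x $ i / L i\<bar> \<le> 3/2" using comp[of x i] True by simp
        have "\<bar>dir_deriv (axis i 1) (\<lambda>x. F (\<Phi> x)) x\<bar>
          = real k * y ^ (k - 1) * (2 * real m * \<bar>x $ i / L i\<bar> ^ (2 * m - 1) / L i / (2 * N))"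
          unfolding cc(2) \<Phi>d F'_def y(2) using y N L[of i] by (simp add: abs_mult power_abs abs_divide)
        also have "\<dots> \<le> real k * y ^ (k - 1) * (2 * real m * (3/2) ^ (2 * m - 1) / L i / (2 * N))"
          using y N L[of i] c by (intro mult_left_mono divide_right_mono power_mono) auto
        also have "\<dots> = M / L i * F (\<Phi> x) powr (1 - 1 / real k)"
          unfolding F1 M_def by (simp add: mult_ac)
        finally show ?thesis .
      next
        case False
        then have "F' (\<Phi> x) = 0" unfolding F'_def using k by (simp add: power_0_left)
        moreover have "0 \<le> M / L i * F (\<Phi> x) powr (1 - 1 / real k)"
          using k m N L[of i] by (simp add: M_def)
        ultimately show ?thesis unfolding cc(2) by simp
      qed
    qed
  qed
qed

section \<open>Passing to the limit in time averages\<close>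

lemma translation_product_bounded:
  fixes f W :: "'a::euclidean_space \<Rightarrow> real"
  assumes f: "integrable lborel f" and W: "\<And>x. \<bar>W x\<bar> \<le> k" and e: "0 < e"
  shows "\<exists>d>0. \<forall>h. norm h < d \<longrightarrow> (\<integral>\<^sup>+x. ennreal (\<bar>f (x + h) - f x\<bar> * \<bar>W x\<bar>) \<partial>lborel) \<le> ennreal e"
proof -
  have k: "0 \<le> k" using W[of 0] by simp
  have [measurable]: "f \<in> borel_measurable borel" using f by (auto dest: borel_measurable_integrable)
  have "0 < e / (k + 1)" using e k by simp
  from L1_translation_continuous[OF f this] obtain d where d: "d > 0"
    "\<And>h. norm h < d \<Longrightarrow> (\<integral>\<^sup>+x. ennreal \<bar>f (x + h) - f x\<bar> \<partial>lborel) \<le> ennreal (e / (k + 1))" by blast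
  have "(\<integral>\<^sup>+x. ennreal (\<bar>f (x + h) - f x\<bar> * \<bar>W x\<bar>) \<partial>lborel) \<le> ennreal e" if "norm h < d" for h
  proof -
    have "(\<integral>\<^sup>+x. ennreal (\<bar>f (x + h) - f x\<bar> * \<bar>W x\<bar>) \<partial>lborel) \<le> (\<integral>\<^sup>+x. ennreal k * ennreal \<bar>f (x + h) - f x\<bar> \<partial>lborel)"
      using W k by (intro nn_integral_mono) (auto simp: mult.commute simp flip: ennreal_mult intro!: ennreal_leI mult_right_mono)
    also have "\<dots> = ennreal k * (\<integral>\<^sup>+x. ennreal \<bar>f (x + h) - f x\<bar> \<partial>lborel)"
      by (intro nn_integral_cmult) measurable
    also have "\<dots> \<le> ennreal k * ennreal (e / (k + 1))" using d(2)[OF that] by (intro mult_left_mono) auto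
    also have "\<dots> \<le> ennreal e" using k e by (subst ennreal_mult[symmetric]) (auto intro!: ennreal_leI simp: field_simps)
    finally show ?thesis .
  qed
  then show ?thesis using d(1) by blast
qed

section \<open>Time translations paired with weights of the dual exponent\<close>

lemma conjugate_young:
  fixes f y \<epsilon> q :: real
  assumes "0 \<le> f" "0 \<le> y" "0 < \<epsilon>" "1 < q"
  shows "f * y \<le> \<epsilon> * f powr (q / (q - 1)) + \<epsilon> powr (1 - q) * y powr q"
  using powr_young[of "f powr (1 / (q - 1))" y \<epsilon> q] assms by (simp add: powr_powr)

lemma truncation_tendsto:
  fixes W :: "'a \<Rightarrow> real"
  assumes [measurable]: "W \<in> borel_measurable M" and W: "(\<integral>\<^sup>+x. ennreal (\<bar>W x\<bar> powr q) \<partial>M) < \<infinity>" and e: "0 < e"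
  shows "\<exists>k::nat. (\<integral>\<^sup>+x. ennreal (if \<bar>W x\<bar> \<le> real k then 0 else \<bar>W x\<bar> powr q) \<partial>M) \<le> ennreal e"
proof -
  have "(\<lambda>k. \<integral>\<^sup>+x. ennreal (if \<bar>W x\<bar> \<le> real k then 0 else \<bar>W x\<bar> powr q) \<partial>M) \<longlonglongrightarrow> (\<integral>\<^sup>+x. 0 \<partial>M)"
  proof (rule nn_integral_dominated_convergence[where w = "\<lambda>x. ennreal (\<bar>W x\<bar> powr q)"])
    show "AE x in M. (\<lambda>k. ennreal (if \<bar>W x\<bar> \<le> real k then 0 else \<bar>W x\<bar> powr q)) \<longlonglongrightarrow> 0"
    proof (rule AE_I2)
      fix x
      obtain k where "\<bar>W x\<bar> \<le> real k" using real_arch_simple by blast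
      then have "\<forall>\<^sub>F n in sequentially. ennreal (if \<bar>W x\<bar> \<le> real n then 0 else \<bar>W x\<bar> powr q) = 0"
        by (intro eventually_sequentiallyI[of k]) auto
      then show "(\<lambda>k. ennreal (if \<bar>W x\<bar> \<le> real k then 0 else \<bar>W x\<bar> powr q)) \<longlonglongrightarrow> 0"
        by (rule tendsto_eventually)
    qed
  qed (use W in auto)
  then have "\<forall>\<^sub>F k in sequentially. (\<integral>\<^sup>+x. ennreal (if \<bar>W x\<bar> \<le> real k then 0 else \<bar>W x\<bar> powr q) \<partial>M) < ennreal e"
    using e by (intro order_tendstoD(2)) auto
  then show ?thesis unfolding eventually_sequentially by (meson less_imp_le order_refl)
qed

text \<open>Only L1 continuity of translations is at hand, while the pairing is between dual
  exponents. The weight is therefore cut at height \<open>k\<close>: the bounded part is covered by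
  L1 continuity, the tail by Young's inequality uniformly in \<open>h\<close>, since translations
  preserve the integral of \<open>\<bar>f\<bar> powr (q / (q - 1))\<close>.\<close>

lemma translation_product_Lp:
  fixes f W :: "'a::euclidean_space \<Rightarrow> real"
  assumes f: "integrable lborel f" "(\<integral>\<^sup>+x. ennreal (\<bar>f x\<bar> powr (q / (q - 1))) \<partial>lborel) < \<infinity>"
    and W: "W \<in> borel_measurable borel" "(\<integral>\<^sup>+x. ennreal (\<bar>W x\<bar> powr q) \<partial>lborel) < \<infinity>"
    and q: "1 < q" and e: "0 < e"
  shows "\<exists>d>0. \<forall>h. norm h < d \<longrightarrow> (\<integral>\<^sup>+x. ennreal (\<bar>f (x + h) - f x\<bar> * \<bar>W x\<bar>) \<partial>lborel) \<le> ennreal e"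
proof -
  note [measurable] = W(1)
  have [measurable]: "f \<in> borel_measurable borel" using f by (auto dest: borel_measurable_integrable)
  obtain I where I: "0 \<le> I" "(\<integral>\<^sup>+x. ennreal (\<bar>f x\<bar> powr (q / (q - 1))) \<partial>lborel) = ennreal I"
    using f(2) by (cases "\<integral>\<^sup>+x. ennreal (\<bar>f x\<bar> powr (q / (q - 1))) \<partial>lborel") auto
  \<comment> \<open>Each of the two Young terms contributes \<open>e / 8\<close> to a tail, and the
    tail occurs twice, for \<open>f (x + h)\<close> and for \<open>f x\<close>; the other half of
    \<open>e\<close> is left to the bounded part.\<close>
  define \<epsilon> where "\<epsilon> = e / (8 * (I + 1))"
  have \<epsilon>: "0 < \<epsilon>" "\<epsilon> * I \<le> e / 8" using e I by (auto simp: \<epsilon>_def field_simps)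
  define c where "c = \<epsilon> powr (1 - q)"
  have c: "0 < c" using \<epsilon> by (simp add: c_def)
  have "0 < e / (8 * c)" using e c by simp
  from truncation_tendsto[of W lborel q, OF _ W(2) this] obtain k :: nat where
    k: "(\<integral>\<^sup>+x. ennreal (if \<bar>W x\<bar> \<le> real k then 0 else \<bar>W x\<bar> powr q) \<partial>lborel) \<le> ennreal (e / (8 * c))" by auto
  define V where "V x = (if \<bar>W x\<bar> \<le> real k then W x else 0)" for x
  define X where "X x = (if \<bar>W x\<bar> \<le> real k then 0 else \<bar>W x\<bar>)" for x
  have [measurable]: "V \<in> borel_measurable borel" "X \<in> borel_measurable borel" unfolding V_def X_def by measurable
  have WVX: "\<bar>W x\<bar> = \<bar>V x\<bar> + X x" for x by (simp add: V_def X_def)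
  have X0: "0 \<le> X x" for x by (simp add: X_def)
  have Xq: "X x powr q = (if \<bar>W x\<bar> \<le> real k then 0 else \<bar>W x\<bar> powr q)" for x by (simp add: X_def)
  have "0 < e / 2" using e by simp
  have "\<bar>V x\<bar> \<le> real k" for x by (simp add: V_def)
  from translation_product_bounded[OF f(1) this \<open>0 < e / 2\<close>] obtain d where d0: "d > 0 \<and> (\<forall>h. norm h < d \<longrightarrow>
    (\<integral>\<^sup>+x. ennreal (\<bar>f (x + h) - f x\<bar> * \<bar>V x\<bar>) \<partial>lborel) \<le> ennreal (e / 2))" ..
  have d: "d > 0" "\<And>h. norm h < d \<Longrightarrow> (\<integral>\<^sup>+x. ennreal (\<bar>f (x + h) - f x\<bar> * \<bar>V x\<bar>) \<partial>lborel) \<le> ennreal (e / 2)"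
    using d0 by simp_all
  have tail: "(\<integral>\<^sup>+x. ennreal (\<bar>f (x + h)\<bar> * X x) \<partial>lborel) \<le> ennreal (e / 4)" for h
  proof -
    have "(\<integral>\<^sup>+x. ennreal (\<bar>f (x + h)\<bar> * X x) \<partial>lborel)
      \<le> (\<integral>\<^sup>+x. ennreal \<epsilon> * ennreal (\<bar>f (x + h)\<bar> powr (q / (q - 1))) + ennreal c * ennreal (X x powr q) \<partial>lborel)"
    proof (rule nn_integral_mono)
      fix x
      have "\<bar>f (x + h)\<bar> * X x \<le> \<epsilon> * \<bar>f (x + h)\<bar> powr (q / (q - 1)) + c * X x powr q"
        unfolding c_def using X0 \<epsilon> q by (intro conjugate_young) auto
      then show "ennreal (\<bar>f (x + h)\<bar> * X x) \<le> ennreal \<epsilon> * ennreal (\<bar>f (x + h)\<bar> powr (q / (q - 1))) + ennreal c * ennreal (X x powr q)"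
        using \<epsilon> c by (simp add: ennreal_leI flip: ennreal_mult ennreal_plus)
    qed
    also have "\<dots> = ennreal \<epsilon> * (\<integral>\<^sup>+x. ennreal (\<bar>f (x + h)\<bar> powr (q / (q - 1))) \<partial>lborel) + ennreal c * (\<integral>\<^sup>+x. ennreal (X x powr q) \<partial>lborel)"
      by (subst nn_integral_add, measurable, subst nn_integral_cmult, measurable, subst nn_integral_cmult, measurable)
    also have "(\<integral>\<^sup>+x. ennreal (\<bar>f (x + h)\<bar> powr (q / (q - 1))) \<partial>lborel) = ennreal I"
      unfolding I(2)[symmetric] by (rule nn_integral_lborel_translate[of "\<lambda>x. ennreal (\<bar>f x\<bar> powr (q / (q - 1)))"]) measurable
    also have "ennreal \<epsilon> * ennreal I + ennreal c * (\<integral>\<^sup>+x. ennreal (X x powr q) \<partial>lborel) \<le> ennreal (e / 8) + ennreal c * ennreal (e / (8 * c))"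
      using k \<epsilon> I unfolding Xq[symmetric] by (intro add_mono mult_left_mono) (auto simp flip: ennreal_mult intro!: ennreal_leI)
    also have "\<dots> = ennreal (e / 4)" using c e by (simp flip: ennreal_mult ennreal_plus)
    finally show ?thesis .
  qed
  have "(\<integral>\<^sup>+x. ennreal (\<bar>f (x + h) - f x\<bar> * \<bar>W x\<bar>) \<partial>lborel) \<le> ennreal e" if "norm h < d" for h
  proof -
    have "(\<integral>\<^sup>+x. ennreal (\<bar>f (x + h) - f x\<bar> * \<bar>W x\<bar>) \<partial>lborel)
      \<le> (\<integral>\<^sup>+x. ennreal (\<bar>f (x + h) - f x\<bar> * \<bar>V x\<bar>) + (ennreal (\<bar>f (x + h)\<bar> * X x) + ennreal (\<bar>f (x + 0)\<bar> * X x)) \<partial>lborel)"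
    proof (rule nn_integral_mono)
      fix x
      have "\<bar>f (x + h) - f x\<bar> * X x \<le> (\<bar>f (x + h)\<bar> + \<bar>f x\<bar>) * X x"
        using X0 by (intro mult_right_mono) auto
      then have "\<bar>f (x + h) - f x\<bar> * \<bar>W x\<bar> \<le> \<bar>f (x + h) - f x\<bar> * \<bar>V x\<bar> + (\<bar>f (x + h)\<bar> * X x + \<bar>f (x + 0)\<bar> * X x)"
        unfolding WVX by (simp add: distrib_left distrib_right)
      then show "ennreal (\<bar>f (x + h) - f x\<bar> * \<bar>W x\<bar>) \<le> ennreal (\<bar>f (x + h) - f x\<bar> * \<bar>V x\<bar>) + (ennreal (\<bar>f (x + h)\<bar> * X x) + ennreal (\<bar>f (x + 0)\<bar> * X x))"
        using X0[of x] by (simp add: ennreal_leI flip: ennreal_plus)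
    qed
    also have "\<dots> = (\<integral>\<^sup>+x. ennreal (\<bar>f (x + h) - f x\<bar> * \<bar>V x\<bar>) \<partial>lborel)
        + ((\<integral>\<^sup>+x. ennreal (\<bar>f (x + h)\<bar> * X x) \<partial>lborel) + (\<integral>\<^sup>+x. ennreal (\<bar>f (x + 0)\<bar> * X x) \<partial>lborel))"
      by (subst nn_integral_add, measurable, subst nn_integral_add, measurable)
    also have "\<dots> \<le> ennreal (e / 2) + (ennreal (e / 4) + ennreal (e / 4))"
      by (intro add_mono d(2)[OF that] tail)
    also have "\<dots> = ennreal e" using e by (simp flip: ennreal_plus)
    finally show ?thesis .
  qed
  then show ?thesis using d(1) by blast
qed

lemma borel_measurable_fst_borel [measurable]:
  "fst \<in> borel_measurable (borel :: ('a::second_countable_topology \<times> 'b::second_countable_topology) measure)"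
  and borel_measurable_snd_borel [measurable]:
  "snd \<in> borel_measurable (borel :: ('a::second_countable_topology \<times> 'b::second_countable_topology) measure)"
  by (auto intro!: borel_measurable_continuous_onI continuous_intros)

lemma borel_measurable_nn_integral_lborel:
  fixes f :: "'b::euclidean_space \<Rightarrow> 'c::euclidean_space \<Rightarrow> ennreal"
  assumes "(\<lambda>q. f (fst q) (snd q)) \<in> borel_measurable borel"
  shows "(\<lambda>p. \<integral>\<^sup>+x. f p x \<partial>lborel) \<in> borel_measurable borel"
proof (rule lborel.borel_measurable_nn_integral)
  have "sets (borel \<Otimes>\<^sub>M lborel) = sets (borel :: ('b \<times> 'c) measure)"
    by (simp add: borel_prod[symmetric] cong: sets_pair_measure_cong)
  then show "case_prod f \<in> borel_measurable (borel \<Otimes>\<^sub>M lborel)"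
    using assms by (simp add: case_prod_unfold cong: measurable_cong_sets)
qed

lemma integrable_lborel_product:
  fixes f :: "'a::euclidean_space \<Rightarrow> real" and g :: "'b::euclidean_space \<Rightarrow> real"
  assumes f: "integrable lborel f" and g: "integrable lborel g"
  shows "integrable lborel (\<lambda>z. f (fst z) * g (snd z))"
    and "(\<integral>z. f (fst z) * g (snd z) \<partial>lborel) = (\<integral>x. f x \<partial>lborel) * (\<integral>y. g y \<partial>lborel)"
proof -
  have [measurable]: "f \<in> borel_measurable borel" "g \<in> borel_measurable borel"
    using f g by (auto dest: borel_measurable_integrable)
  have i: "integrable (lborel \<Otimes>\<^sub>M lborel) (\<lambda>z. f (fst z) * g (snd z))"
  proof (rule lborel_pair.Fubini_integrable)
    show "integrable lborel (\<lambda>x. \<integral>y. norm (f (fst (x, y)) * g (snd (x, y))) \<partial>lborel)"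
      using f by (simp add: abs_mult)
    show "AE x in lborel. integrable lborel (\<lambda>y. f (fst (x, y)) * g (snd (x, y)))"
      using g by simp
  qed measurable
  then show "integrable lborel (\<lambda>z. f (fst z) * g (snd z))" by (simp add: lborel_prod)
  have "(\<integral>z. f (fst z) * g (snd z) \<partial>(lborel \<Otimes>\<^sub>M lborel)) = (\<integral>x. \<integral>y. f x * g y \<partial>lborel \<partial>lborel)"
    using lborel_pair.integral_fst'[OF i] by simp
  then show "(\<integral>z. f (fst z) * g (snd z) \<partial>lborel) = (\<integral>x. f x \<partial>lborel) * (\<integral>y. g y \<partial>lborel)"
    by (simp add: lborel_prod)
qed

section \<open>Averages of backward differences in time\<close>

lemma nn_integral_reflect_translate:
  assumes [measurable]: "F \<in> borel_measurable borel"
  shows "(\<integral>\<^sup>+s. F s \<partial>lborel) = (\<integral>\<^sup>+r. F (\<tau> - r) \<partial>(lborel :: real measure))"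
  using nn_integral_real_affine[of F "-1" \<tau>] by simp

text \<open>The integral of a backward difference telescopes to the integrals of \<open>g\<close>
  over two intervals of length \<open>h\<close> at the ends, a discrete form of the fundamental
  theorem of calculus.\<close>

lemma integral_difference_quotient_bound:
  fixes g :: "real \<Rightarrow> real"
  assumes g: "continuous_on {s1 - h..s2} g" and h: "0 < h" "s1 < s2"
    and up: "\<And>\<tau>. s2 - h \<le> \<tau> \<Longrightarrow> \<tau> \<le> s2 \<Longrightarrow> g \<tau> \<le> a" and low: "\<And>\<tau>. s1 - h \<le> \<tau> \<Longrightarrow> \<tau> \<le> s1 \<Longrightarrow> b \<le> g \<tau>"
  shows "set_integrable lborel {s1..s2} (\<lambda>\<tau>. g \<tau> - g (\<tau> - h))"
    and "(LINT \<tau>:{s1..s2}|lborel. g \<tau> - g (\<tau> - h)) \<le> h * (a - b)"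
proof -
  have c1: "continuous_on {s1..s2} g" using g by (rule continuous_on_subset) (use h in auto)
  have c2: "continuous_on {s1..s2} (\<lambda>\<tau>. g (\<tau> - h))"
    by (rule continuous_on_compose2[OF g]) (use h in \<open>auto intro!: continuous_intros\<close>)
  have c3: "continuous_on {s1..s2} (\<lambda>\<tau>. g \<tau> - g (\<tau> - h))" by (intro continuous_intros c1 c2)
  show si: "set_integrable lborel {s1..s2} (\<lambda>\<tau>. g \<tau> - g (\<tau> - h))"
    unfolding set_integrable_def by (rule borel_integrable_compact[OF compact_Icc c3])
  have gi: "g integrable_on {x..y}" if "s1 - h \<le> x" "y \<le> s2" for x y
    by (rule integrable_continuous_real, rule continuous_on_subset[OF g]) (use that in auto)
  have "(LINT \<tau>:{s1..s2}|lborel. g \<tau> - g (\<tau> - h)) = integral {s1..s2} (\<lambda>\<tau>. g \<tau> - g (\<tau> - h))"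
    by (rule set_borel_integral_eq_integral(2)[OF si])
  also have "\<dots> = integral {s1..s2} g - integral {s1..s2} (\<lambda>\<tau>. g (\<tau> - h))"
    by (intro Henstock_Kurzweil_Integration.integral_diff integrable_continuous_real c1 c2)
  also have "integral {s1..s2} (\<lambda>\<tau>. g (\<tau> - h)) = integral {s1 - h..s2 - h} g"
  proof -
    have "continuous_on {s1 + - h..s2 + - h} g" using g by (rule continuous_on_subset) (use h in auto)
    from integral_shift[OF this] show ?thesis by (simp add: o_def)
  qed
  also have "integral {s1..s2} g - integral {s1 - h..s2 - h} g = integral {s2 - h..s2} g - integral {s1 - h..s1} g"
  proof -
    have "integral {s1 - h..s1} g + integral {s1..s2} g = integral {s1 - h..s2} g"
      using h by (intro Henstock_Kurzweil_Integration.integral_combine gi) auto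
    moreover have "integral {s1 - h..s2 - h} g + integral {s2 - h..s2} g = integral {s1 - h..s2} g"
      using h by (intro Henstock_Kurzweil_Integration.integral_combine gi) auto
    ultimately show ?thesis by linarith
  qed
  also have "integral {s2 - h..s2} g \<le> integral {s2 - h..s2} (\<lambda>_. a)"
    using h up by (intro integral_le gi) auto
  also have "integral {s2 - h..s2} (\<lambda>_. a) = h * a" using h by simp
  also have "integral {s1 - h..s1} (\<lambda>_. b) \<le> integral {s1 - h..s1} g"
    using h low by (intro integral_le gi) auto
  then have "h * b \<le> integral {s1 - h..s1} g" using h by simp
  then have "h * a - integral {s1 - h..s1} g \<le> h * (a - b)" by (simp add: right_diff_distrib)
  finally show "(LINT \<tau>:{s1..s2}|lborel. g \<tau> - g (\<tau> - h)) \<le> h * (a - b)" by simp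
qed

text \<open>In \<open>diff\<close> the weights are frozen at the final time \<tau> of a short
  interval, as happens with a time-independent test function. Integrating over \<tau> and replacing
  \<open>f\<close> at earlier times by its value at \<tau> produces \<open>h\<close> times the
  unfrozen integral; the replacement error is a time translation of \<open>f\<close>. All terms are
  proportional to \<open>h\<close>, which is divided out at the end.\<close>

lemma averaged_difference_step:
  fixes f W :: "'i::finite \<Rightarrow> 'a::euclidean_space \<times> real \<Rightarrow> real" and g :: "real \<Rightarrow> real"
  assumes times: "\<sigma> \<le> s1 - h" "s1 < s2" "0 < h"
    and g: "continuous_on {\<sigma>..s2} g"
    and fm: "\<And>j. f j \<in> borel_measurable borel" and Wm: "\<And>j. W j \<in> borel_measurable borel"
    and fW: "\<And>j. integrable lborel (\<lambda>z. f j z * W j z)"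
    and D: "\<And>j r. 0 \<le> r \<Longrightarrow> r \<le> h \<Longrightarrow> (\<integral>\<^sup>+z. ennreal (\<bar>f j (z + (0, - r)) - f j z\<bar> * \<bar>W j z\<bar>) \<partial>lborel) \<le> ennreal e"
    and e: "0 \<le> e"
    and diff: "AE \<tau> in lborel. \<sigma> \<le> \<tau> - h \<and> \<tau> \<le> s2 \<longrightarrow>
      (\<integral>z. indicator {\<tau> - h..\<tau>} (snd z) * (\<Sum>j\<in>UNIV. f j z * W j (fst z, \<tau>)) \<partial>lborel) \<le> g \<tau> - g (\<tau> - h)"
    and up: "\<And>\<tau>. s2 - h \<le> \<tau> \<Longrightarrow> \<tau> \<le> s2 \<Longrightarrow> g \<tau> \<le> a" and low: "\<And>\<tau>. s1 - h \<le> \<tau> \<Longrightarrow> \<tau> \<le> s1 \<Longrightarrow> b \<le> g \<tau>"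
  shows "(\<integral>z. indicator {s1..s2} (snd z) * (\<Sum>j\<in>UNIV. f j z * W j z) \<partial>lborel) \<le> a - b + real CARD('i) * e"
proof -
  note [measurable] = fm Wm
  have [measurable]: "(\<lambda>x. f j (x, \<tau>)) \<in> borel_measurable borel" "(\<lambda>x. W j (x, \<tau>)) \<in> borel_measurable borel" for j \<tau>
    using measurable_compose[OF _ fm[of j], of "\<lambda>x. (x, \<tau>)"] measurable_compose[OF _ Wm[of j], of "\<lambda>x. (x, \<tau>)"]
    by (simp_all add: borel_prod[symmetric])
  define S where "S z = (\<Sum>j\<in>UNIV. f j z * W j z)" for z
  have Si: "integrable lborel S" unfolding S_def by (intro Bochner_Integration.integrable_sum fW)
  then have Si2: "integrable (lborel \<Otimes>\<^sub>M lborel) (\<lambda>(x, y). S (x, y))" by (simp add: lborel_prod)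
  define \<psi> where "\<psi> \<tau> = (\<integral>x. S (x, \<tau>) \<partial>lborel)" for \<tau>
  have \<psi>i: "integrable lborel \<psi>" unfolding \<psi>_def using lborel_pair.integrable_snd[OF Si2] .
  have AES: "AE \<tau> in lborel. integrable lborel (\<lambda>x. S (x, \<tau>))" using lborel_pair.AE_integrable_snd[OF Si2] .
  define d where "d j z \<tau> = \<bar>f j z - f j (fst z, \<tau>)\<bar> * \<bar>W j (fst z, \<tau>)\<bar>" for j z \<tau>
  \<comment> \<open>\<open>E \<tau>\<close> measures the error of replacing \<open>f j z\<close> by
    its value at time \<tau>. It stays an extended integral until its finiteness for almost every
    \<tau> is known.\<close>
  define E where "E \<tau> = (\<integral>\<^sup>+z. indicator {\<tau> - h..\<tau>} (snd z) * (\<Sum>j\<in>UNIV. ennreal (d j z \<tau>)) \<partial>lborel)" for \<tau>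
  have Emeas [measurable]: "E \<in> borel_measurable borel"
  proof -
    define K where "K \<tau> z = (if \<tau> - h \<le> snd z \<and> snd z \<le> \<tau> then 1 else 0) * (\<Sum>j\<in>UNIV. ennreal (d j z \<tau>))" for \<tau> z
    have "(\<lambda>q. K (fst q) (snd q)) \<in> borel_measurable borel"
      unfolding K_def d_def by measurable
    from borel_measurable_nn_integral_lborel[OF this] have "(\<lambda>\<tau>. \<integral>\<^sup>+z. K \<tau> z \<partial>lborel) \<in> borel_measurable borel" .
    also have "(\<lambda>\<tau>. \<integral>\<^sup>+z. K \<tau> z \<partial>lborel) = E"
      by (simp add: E_def K_def indicator_def of_bool_def fun_eq_iff)
    finally show ?thesis .
  qed
  \<comment> \<open>The same error, written in terms of the lag \<open>r\<close> behind \<tau> so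
    that the order of integration can be exchanged.\<close>
  define H where "H \<tau> r x = indicator {0..h} r * (\<Sum>j\<in>UNIV. ennreal (d j (x, \<tau> - r) \<tau>))" for \<tau> r x
  have Hm1: "(\<lambda>q::(real \<times> real) \<times> 'a. H (fst (fst q)) (snd (fst q)) (snd q)) \<in> borel_measurable borel"
    unfolding H_def d_def by measurable
  have EH: "E \<tau> = (\<integral>\<^sup>+r. (\<integral>\<^sup>+x. H \<tau> r x \<partial>lborel) \<partial>lborel)" for \<tau>
  proof -
    define Q where "Q z = (if \<tau> - h \<le> snd z \<and> snd z \<le> \<tau> then 1 else 0) * (\<Sum>j\<in>UNIV. ennreal (d j z \<tau>))" for z :: "'a \<times> real"
    have Qm [measurable]: "Q \<in> borel_measurable borel" unfolding Q_def d_def by measurable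
    have "E \<tau> = (\<integral>\<^sup>+z. Q z \<partial>lborel)"
      unfolding E_def Q_def by (simp add: indicator_def of_bool_def)
    also have "\<dots> = (\<integral>\<^sup>+s. (\<integral>\<^sup>+x. Q (x, s) \<partial>lborel) \<partial>lborel)"
      using lborel_pair.nn_integral_snd[of Q] Qm by (simp add: lborel_prod)
    also have "\<dots> = (\<integral>\<^sup>+r. (\<integral>\<^sup>+x. Q (x, \<tau> - r) \<partial>lborel) \<partial>lborel)"
    proof (rule nn_integral_reflect_translate)
      have "(\<lambda>q::real \<times> 'a. Q (snd q, fst q)) \<in> borel_measurable borel" by measurable
      then show "(\<lambda>s. \<integral>\<^sup>+x. Q (x, s) \<partial>lborel) \<in> borel_measurable borel"
        by (intro borel_measurable_nn_integral_lborel) simp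
    qed
    also have "\<dots> = (\<integral>\<^sup>+r. (\<integral>\<^sup>+x. H \<tau> r x \<partial>lborel) \<partial>lborel)"
      unfolding Q_def H_def by (intro nn_integral_cong arg_cong2[where f = "(*)"]) (auto simp: indicator_def)
    finally show ?thesis .
  qed
  have Hm2: "(\<lambda>p::real \<times> real. \<integral>\<^sup>+x. H (fst p) (snd p) x \<partial>lborel) \<in> borel_measurable borel"
    by (rule borel_measurable_nn_integral_lborel) (rule Hm1)
  have Eint: "(\<integral>\<^sup>+\<tau>. indicator {s1..s2} \<tau> * E \<tau> \<partial>lborel) \<le> ennreal (h * (real CARD('i) * e))"
  proof -
    have "(\<integral>\<^sup>+\<tau>. indicator {s1..s2} \<tau> * E \<tau> \<partial>lborel) \<le> (\<integral>\<^sup>+\<tau>. E \<tau> \<partial>lborel)"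
      by (intro nn_integral_mono) (auto simp: indicator_def)
    also have "\<dots> = (\<integral>\<^sup>+r. (\<integral>\<^sup>+\<tau>. (\<integral>\<^sup>+x. H \<tau> r x \<partial>lborel) \<partial>lborel) \<partial>lborel)"
      using Hm2 unfolding EH by (intro lborel_pair.Fubini'[symmetric]) (simp add: lborel_prod case_prod_unfold)
    also have "\<dots> \<le> (\<integral>\<^sup>+r. ennreal (real CARD('i) * e) * indicator {0..h} r \<partial>lborel)"
    \<comment> \<open>For a fixed lag the integral over \<tau> and \<open>x\<close> is a pure time
      translation by \<open>- r\<close>, hence at most \<open>e\<close> for each index by
      \<open>D\<close>. The lags fill an interval of length \<open>h\<close>, the source of the
      factor \<open>h\<close>.\<close>
    proof (rule nn_integral_mono)
      fix r :: real
      show "(\<integral>\<^sup>+\<tau>. (\<integral>\<^sup>+x. H \<tau> r x \<partial>lborel) \<partial>lborel) \<le> ennreal (real CARD('i) * e) * indicator {0..h} r"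
      proof (cases "r \<in> {0..h}")
        case True
        define Q where "Q z = (\<Sum>j\<in>UNIV. ennreal (\<bar>f j (z + (0, - r)) - f j z\<bar> * \<bar>W j z\<bar>))" for z :: "'a \<times> real"
        have Qm [measurable]: "Q \<in> borel_measurable borel" unfolding Q_def by measurable
        have "(\<integral>\<^sup>+\<tau>. (\<integral>\<^sup>+x. H \<tau> r x \<partial>lborel) \<partial>lborel) = (\<integral>\<^sup>+\<tau>. (\<integral>\<^sup>+x. Q (x, \<tau>) \<partial>lborel) \<partial>lborel)"
          using True by (simp add: H_def Q_def d_def)
        also have "\<dots> = (\<integral>\<^sup>+z. Q z \<partial>lborel)"
          using lborel_pair.nn_integral_snd[of Q] Qm by (simp add: lborel_prod)
        also have "\<dots> = (\<Sum>j\<in>UNIV. \<integral>\<^sup>+z. ennreal (\<bar>f j (z + (0, - r)) - f j z\<bar> * \<bar>W j z\<bar>) \<partial>lborel)"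
          unfolding Q_def by (rule nn_integral_sum) measurable
        also have "\<dots> \<le> (\<Sum>j\<in>(UNIV :: 'i set). ennreal e)"
          using D True by (intro sum_mono) auto
        also have "\<dots> = ennreal (real CARD('i) * e)"
          using e by (simp add: ennreal_mult ennreal_of_nat_eq_real_of_nat)
        finally show ?thesis using True by simp
      next
        case False
        then show ?thesis by (simp add: H_def)
      qed
    qed
    also have "\<dots> = ennreal (real CARD('i) * e) * ennreal h"
      using times by (subst nn_integral_cmult_indicator) auto
    also have "\<dots> = ennreal (h * (real CARD('i) * e))"
      using times e by (simp add: mult.commute flip: ennreal_mult)
    finally show ?thesis .
  qed
  have Efin: "AE \<tau> in lborel. \<tau> \<in> {s1..s2} \<longrightarrow> E \<tau> < \<infinity>"
  proof -
    have "(\<integral>\<^sup>+\<tau>. indicator {s1..s2} \<tau> * E \<tau> \<partial>lborel) \<noteq> \<infinity>" using Eint by (auto simp: top_unique)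
    then have "AE \<tau> in lborel. indicator {s1..s2} \<tau> * E \<tau> \<noteq> \<infinity>"
      by (intro nn_integral_noteq_infinite) measurable
    then show ?thesis by eventually_elim (auto simp: indicator_def less_top)
  qed
  have Ei: "integrable lborel (\<lambda>\<tau>. indicator {s1..s2} \<tau> * enn2real (E \<tau>))"
    and Ei2: "(\<integral>\<tau>. indicator {s1..s2} \<tau> * enn2real (E \<tau>) \<partial>lborel) \<le> h * (real CARD('i) * e)"
  proof -
    have eq: "(\<integral>\<^sup>+\<tau>. ennreal (indicator {s1..s2} \<tau> * enn2real (E \<tau>)) \<partial>lborel) = (\<integral>\<^sup>+\<tau>. indicator {s1..s2} \<tau> * E \<tau> \<partial>lborel)"
      using Efin by (intro nn_integral_cong_AE) (auto simp: indicator_def elim!: eventually_mono)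
    show "integrable lborel (\<lambda>\<tau>. indicator {s1..s2} \<tau> * enn2real (E \<tau>))"
      using Eint eq by (intro integrableI_nonneg) (auto simp: le_less_trans)
    have "(\<integral>\<tau>. indicator {s1..s2} \<tau> * enn2real (E \<tau>) \<partial>lborel) = enn2real (\<integral>\<^sup>+\<tau>. ennreal (indicator {s1..s2} \<tau> * enn2real (E \<tau>)) \<partial>lborel)"
      by (rule integral_eq_nn_integral) auto
    also have "\<dots> \<le> enn2real (ennreal (h * (real CARD('i) * e)))"
      unfolding eq using Eint by (intro enn2real_mono) auto
    finally show "(\<integral>\<tau>. indicator {s1..s2} \<tau> * enn2real (E \<tau>) \<partial>lborel) \<le> h * (real CARD('i) * e)"
      using times e by simp
  qed
  have key: "AE \<tau> in lborel. \<tau> \<in> {s1..s2} \<longrightarrow> h * \<psi> \<tau> - enn2real (E \<tau>) \<le> g \<tau> - g (\<tau> - h)"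
    using Efin AES diff
  proof eventually_elim
    case (elim \<tau>)
    show ?case
    proof
      assume \<tau>: "\<tau> \<in> {s1..s2}"
      let ?I = "\<lambda>z. indicator {\<tau> - h..\<tau>} (snd z) :: real"
      have Ifin: "integrable lborel (indicator {\<tau> - h..\<tau>} :: real \<Rightarrow> real)"
        using emeasure_lborel_Icc_eq[of "\<tau> - h" \<tau>] by (intro integrable_real_indicator) auto
      have "integrable lborel (\<lambda>x. S (x, \<tau>))" using elim by simp
      note Y = integrable_lborel_product[OF this Ifin]
      have Yv: "(\<integral>z. S (fst z, \<tau>) * ?I z \<partial>lborel) = h * \<psi> \<tau>"
        unfolding Y(2) \<psi>_def using times by simp
      \<comment> \<open>\<open>\<Delta>\<close> is the signed error; added to
        \<open>S (fst z, \<tau>)\<close> on the short interval it restores the integrand of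
        \<open>diff\<close>.\<close>
      define \<Delta> where "\<Delta> z = ?I z * (\<Sum>j\<in>UNIV. (f j z - f j (fst z, \<tau>)) * W j (fst z, \<tau>))" for z
      have \<Delta>m [measurable]: "\<Delta> \<in> borel_measurable borel"
        unfolding \<Delta>_def by measurable
      have \<Delta>E: "(\<integral>\<^sup>+z. ennreal \<bar>\<Delta> z\<bar> \<partial>lborel) \<le> E \<tau>"
        unfolding E_def
      proof (rule nn_integral_mono)
        fix z
        have "\<bar>\<Sum>j\<in>UNIV. (f j z - f j (fst z, \<tau>)) * W j (fst z, \<tau>)\<bar> \<le> (\<Sum>j\<in>UNIV. d j z \<tau>)"
          by (rule order_trans[OF sum_abs]) (simp add: d_def abs_mult)
        then have "?I z * \<bar>\<Sum>j\<in>UNIV. (f j z - f j (fst z, \<tau>)) * W j (fst z, \<tau>)\<bar> \<le> ?I z * (\<Sum>j\<in>UNIV. d j z \<tau>)"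
          by (rule mult_left_mono) simp
        moreover have "\<bar>\<Delta> z\<bar> = ?I z * \<bar>\<Sum>j\<in>UNIV. (f j z - f j (fst z, \<tau>)) * W j (fst z, \<tau>)\<bar>"
          unfolding \<Delta>_def by (simp add: abs_mult)
        ultimately have "\<bar>\<Delta> z\<bar> \<le> ?I z * (\<Sum>j\<in>UNIV. d j z \<tau>)" by simp
        then have "ennreal \<bar>\<Delta> z\<bar> \<le> ennreal (?I z * (\<Sum>j\<in>UNIV. d j z \<tau>))" by (rule ennreal_leI)
        also have "\<dots> = indicator {\<tau> - h..\<tau>} (snd z) * (\<Sum>j\<in>UNIV. ennreal (d j z \<tau>))"
          by (auto simp: indicator_def d_def sum_ennreal)
        finally show "ennreal \<bar>\<Delta> z\<bar> \<le> indicator {\<tau> - h..\<tau>} (snd z) * (\<Sum>j\<in>UNIV. ennreal (d j z \<tau>))" .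
      qed
      have Et: "E \<tau> < \<infinity>" using elim \<tau> by simp
      have \<Delta>i: "integrable lborel \<Delta>"
        using \<Delta>E Et by (intro integrableI_bounded) auto
      have "\<bar>\<integral>z. \<Delta> z \<partial>lborel\<bar> \<le> enn2real (E \<tau>)"
      proof -
        have "ennreal \<bar>\<integral>z. \<Delta> z \<partial>lborel\<bar> \<le> (\<integral>\<^sup>+z. ennreal (norm (\<Delta> z)) \<partial>lborel)"
          using integral_norm_bound_ennreal[OF \<Delta>i] by simp
        also have "\<dots> \<le> E \<tau>" using \<Delta>E by simp
        finally have "enn2real (ennreal \<bar>\<integral>z. \<Delta> z \<partial>lborel\<bar>) \<le> enn2real (E \<tau>)"
          using Et by (intro enn2real_mono) auto
        then show ?thesis by simp
      qed
      then have "h * \<psi> \<tau> - enn2real (E \<tau>) \<le> (\<integral>z. S (fst z, \<tau>) * ?I z \<partial>lborel) + (\<integral>z. \<Delta> z \<partial>lborel)"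
        unfolding Yv by linarith
      also have "\<dots> = (\<integral>z. S (fst z, \<tau>) * ?I z + \<Delta> z \<partial>lborel)"
        by (rule Bochner_Integration.integral_add[symmetric, OF Y(1) \<Delta>i])
      also have "\<dots> = (\<integral>z. ?I z * (\<Sum>j\<in>UNIV. f j z * W j (fst z, \<tau>)) \<partial>lborel)"
        unfolding S_def \<Delta>_def
        by (intro Bochner_Integration.integral_cong refl) (simp add: left_diff_distrib sum_subtractf algebra_simps)
      also have "\<dots> \<le> g \<tau> - g (\<tau> - h)" using elim \<tau> times by auto
      finally show "h * \<psi> \<tau> - enn2real (E \<tau>) \<le> g \<tau> - g (\<tau> - h)" .
    qed
  qed
  have "continuous_on {s1 - h..s2} g" using g by (rule continuous_on_subset) (use times in auto)
  note G = integral_difference_quotient_bound[OF this times(3,2) up low]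
  have \<psi>1: "integrable lborel (\<lambda>\<tau>. indicator {s1..s2} \<tau> * \<psi> \<tau>)"
    using integrable_mult_indicator[OF _ \<psi>i, of "{s1..s2}"] by simp
  have R: "(\<integral>z. indicator {s1..s2} (snd z) * S z \<partial>lborel) = (\<integral>\<tau>. indicator {s1..s2} \<tau> * \<psi> \<tau> \<partial>lborel)"
  proof -
    have "integrable lborel (\<lambda>z. indicator (UNIV \<times> {s1..s2}) z *\<^sub>R S z)"
      by (intro integrable_mult_indicator Si) (auto simp: borel_prod[symmetric])
    also have "(\<lambda>z. indicator (UNIV \<times> {s1..s2}) z *\<^sub>R S z) = (\<lambda>z. indicator {s1..s2} (snd z) * S z)"
      by (auto simp: indicator_def fun_eq_iff)
    finally have "integrable (lborel \<Otimes>\<^sub>M lborel) (\<lambda>(x, y). indicator {s1..s2} y * S (x, y))"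
      by (simp add: lborel_prod case_prod_unfold)
    from lborel_pair.integral_snd[OF this] show ?thesis
      by (simp add: \<psi>_def lborel_prod case_prod_unfold)
  qed
  have "h * (\<integral>\<tau>. indicator {s1..s2} \<tau> * \<psi> \<tau> \<partial>lborel) - h * (real CARD('i) * e)
    \<le> h * (\<integral>\<tau>. indicator {s1..s2} \<tau> * \<psi> \<tau> \<partial>lborel) - (\<integral>\<tau>. indicator {s1..s2} \<tau> * enn2real (E \<tau>) \<partial>lborel)"
    using Ei2 by simp
  also have "\<dots> = (\<integral>\<tau>. h * (indicator {s1..s2} \<tau> * \<psi> \<tau>) - indicator {s1..s2} \<tau> * enn2real (E \<tau>) \<partial>lborel)"
    using \<psi>1 Ei by simp
  also have "\<dots> \<le> (LINT \<tau>:{s1..s2}|lborel. g \<tau> - g (\<tau> - h))"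
    unfolding set_lebesgue_integral_def
  proof (rule integral_mono_AE)
    show "integrable lborel (\<lambda>\<tau>. h * (indicator {s1..s2} \<tau> * \<psi> \<tau>) - indicator {s1..s2} \<tau> * enn2real (E \<tau>))"
      using \<psi>1 Ei by simp
    show "integrable lborel (\<lambda>\<tau>. indicator {s1..s2} \<tau> *\<^sub>R (g \<tau> - g (\<tau> - h)))"
      using G(1) unfolding set_integrable_def .
    show "AE \<tau> in lborel. h * (indicator {s1..s2} \<tau> * \<psi> \<tau>) - indicator {s1..s2} \<tau> * enn2real (E \<tau>)
        \<le> indicator {s1..s2} \<tau> *\<^sub>R (g \<tau> - g (\<tau> - h))"
      using key by eventually_elim (auto simp: indicator_def)
  qed
  also have "\<dots> \<le> h * (a - b)" by (rule G(2))
  finally have "h * (\<integral>\<tau>. indicator {s1..s2} \<tau> * \<psi> \<tau> \<partial>lborel) \<le> h * (a - b + real CARD('i) * e)"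
    by (simp add: distrib_left)
  then show ?thesis using times(3) unfolding S_def[symmetric] R by simp
qed

text \<open>The step above for small \<open>h\<close>. The amount \<open>e\<close> is spent
  \<open>CARD('i)\<close> times on translation errors and twice on the oscillation of
  \<open>g\<close> near \<open>s1\<close> and \<open>s2\<close>.\<close>

lemma averaged_difference:
  fixes f W :: "'i::finite \<Rightarrow> 'a::euclidean_space \<times> real \<Rightarrow> real" and g :: "real \<Rightarrow> real"
  assumes times: "\<sigma> < s1" "s1 < s2"
    and g: "continuous_on {\<sigma>..s2} g"
    and fm: "\<And>j. f j \<in> borel_measurable borel" and Wm: "\<And>j. W j \<in> borel_measurable borel"
    and fW: "\<And>j. integrable lborel (\<lambda>z. f j z * W j z)"
    and small: "\<And>j e. 0 < e \<Longrightarrow> \<exists>d>0. \<forall>h. norm h < d \<longrightarrow> (\<integral>\<^sup>+z. ennreal (\<bar>f j (z + h) - f j z\<bar> * \<bar>W j z\<bar>) \<partial>lborel) \<le> ennreal e"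
    and diff: "\<And>h. 0 < h \<Longrightarrow> AE \<tau> in lborel. \<sigma> \<le> \<tau> - h \<and> \<tau> \<le> s2 \<longrightarrow>
      (\<integral>z. indicator {\<tau> - h..\<tau>} (snd z) * (\<Sum>j\<in>UNIV. f j z * W j (fst z, \<tau>)) \<partial>lborel) \<le> g \<tau> - g (\<tau> - h)"
  shows "(\<integral>z. indicator {s1..s2} (snd z) * (\<Sum>j\<in>UNIV. f j z * W j z) \<partial>lborel) \<le> g s2 - g s1"
proof (rule field_le_epsilon)
  fix \<epsilon> :: real assume "0 < \<epsilon>"
  define e where "e = \<epsilon> / (real CARD('i) + 2)"
  have e: "0 < e" using \<open>0 < \<epsilon>\<close> by (simp add: e_def add_nonneg_pos)
  have e': "real CARD('i) * e + 2 * e = \<epsilon>"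
    unfolding distrib_right[symmetric] e_def by (simp add: add_nonneg_pos less_imp_neq[symmetric])
  have "\<forall>j. \<exists>d>0. \<forall>h. norm h < d \<longrightarrow> (\<integral>\<^sup>+z. ennreal (\<bar>f j (z + h) - f j z\<bar> * \<bar>W j z\<bar>) \<partial>lborel) \<le> ennreal e"
    using small[OF e] by (rule allI)
  from choice[OF this] obtain d where d0: "\<forall>j. 0 < d j \<and> (\<forall>h. norm h < d j \<longrightarrow> (\<integral>\<^sup>+z. ennreal (\<bar>f j (z + h) - f j z\<bar> * \<bar>W j z\<bar>) \<partial>lborel) \<le> ennreal e)" ..
  define d' where "d' = Min (range d)"
  have d': "0 < d'" "\<And>j. d' \<le> d j" using d0 by (auto simp: d'_def)
  have "uniformly_continuous_on {\<sigma>..s2} g" using g by (rule compact_uniformly_continuous) simp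
  then obtain \<delta> where \<delta>: "\<delta> > 0" "\<And>x y. x \<in> {\<sigma>..s2} \<Longrightarrow> y \<in> {\<sigma>..s2} \<Longrightarrow> dist y x < \<delta> \<Longrightarrow> dist (g y) (g x) < e"
    unfolding uniformly_continuous_on_def using e by metis
  define m where "m = min (min (s1 - \<sigma>) (s2 - \<sigma>)) (min d' \<delta>)"
  have m: "0 < m" "m \<le> s1 - \<sigma>" "m \<le> s2 - \<sigma>" "m \<le> d'" "m \<le> \<delta>"
    using times d'(1) \<delta>(1) by (auto simp: m_def)
  define h where "h = m / 2"
  have h: "0 < h" "\<sigma> \<le> s1 - h" "\<sigma> \<le> s2 - h" "h < d'" "h < \<delta>"
    using m unfolding h_def by linarith+
  have "(\<integral>z. indicator {s1..s2} (snd z) * (\<Sum>j\<in>UNIV. f j z * W j z) \<partial>lborel) \<le> (g s2 + e) - (g s1 - e) + real CARD('i) * e"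
  proof (rule averaged_difference_step[OF h(2) times(2) h(1) g fm Wm fW])
    show "(\<integral>\<^sup>+z. ennreal (\<bar>f j (z + (0, - r)) - f j z\<bar> * \<bar>W j z\<bar>) \<partial>lborel) \<le> ennreal e" if "0 \<le> r" "r \<le> h" for j r
    proof -
      have "norm (0 :: 'a, - r) < d j" using that h(4) d'(2)[of j] by (simp add: norm_Pair)
      then show ?thesis using d0 by blast
    qed
    show "0 \<le> e" using e by simp
    show "AE \<tau> in lborel. \<sigma> \<le> \<tau> - h \<and> \<tau> \<le> s2 \<longrightarrow>
      (\<integral>z. indicator {\<tau> - h..\<tau>} (snd z) * (\<Sum>j\<in>UNIV. f j z * W j (fst z, \<tau>)) \<partial>lborel) \<le> g \<tau> - g (\<tau> - h)"
      by (rule diff[OF h(1)])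
    show "g \<tau> \<le> g s2 + e" if "s2 - h \<le> \<tau>" "\<tau> \<le> s2" for \<tau>
    proof -
      have "dist (g \<tau>) (g s2) < e" using that h times by (intro \<delta>(2)) (auto simp: dist_real_def)
      then show ?thesis by (simp add: dist_real_def)
    qed
    show "g s1 - e \<le> g \<tau>" if "s1 - h \<le> \<tau>" "\<tau> \<le> s1" for \<tau>
    proof -
      have "dist (g \<tau>) (g s1) < e" using that h times by (intro \<delta>(2)) (auto simp: dist_real_def)
      then show ?thesis by (simp add: dist_real_def)
    qed
  qed
  then show "(\<integral>z. indicator {s1..s2} (snd z) * (\<Sum>j\<in>UNIV. f j z * W j z) \<partial>lborel) \<le> g s2 - g s1 + \<epsilon>"
    using e' by linarith
qed

section \<open>Measurability and Fubini\<close>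

text \<open>The predicate need not define a measurable set, so the exceptional set is first enclosed
  in a Borel null set, to which Tonelli's theorem applies.\<close>

lemma AE_lborel_snd:
  fixes P :: "'a::euclidean_space \<times> 'b::euclidean_space \<Rightarrow> bool"
  assumes "AE z in lborel. P z"
  shows "AE t in lborel. AE x in lborel. P (x, t)"
proof -
  obtain N where N': "{z \<in> space lborel. \<not> P z} \<subseteq> N" "emeasure lborel N = 0" "N \<in> sets lborel"
    using assms by (rule AE_E)
  then have N: "N \<in> null_sets lborel" "{z \<in> space lborel. \<not> P z} \<subseteq> N" by auto
  have [measurable]: "N \<in> sets borel" using N(1) by auto
  have m: "(indicator N :: 'a \<times> 'b \<Rightarrow> ennreal) \<in> borel_measurable (lborel \<Otimes>\<^sub>M lborel)"
    by (simp add: lborel_prod)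
  have "(\<integral>\<^sup>+t. (\<integral>\<^sup>+x. indicator N (x, t) \<partial>lborel) \<partial>lborel) = (\<integral>\<^sup>+z. indicator N z \<partial>(lborel :: ('a \<times> 'b) measure))"
    using lborel_pair.nn_integral_snd[OF m] by (simp add: lborel_prod)
  also have "\<dots> = 0" using N' by simp
  finally have *: "(\<integral>\<^sup>+t. (\<integral>\<^sup>+x. indicator N (x, t) \<partial>lborel) \<partial>lborel) = 0" .
  have sl: "(\<lambda>x. indicator N (x, t) :: ennreal) \<in> borel_measurable borel" for t
    by (intro measurable_compose[OF _ borel_measurable_indicator]) (auto intro!: borel_measurable_continuous_onI continuous_intros)
  have "(\<lambda>t. \<integral>\<^sup>+x. indicator N (x, t) \<partial>lborel) \<in> borel_measurable borel"
  proof -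
    have "(\<lambda>q::'b \<times> 'a. indicator N (snd q, fst q) :: ennreal) \<in> borel_measurable borel"
      by (intro measurable_compose[OF _ borel_measurable_indicator]) (auto intro!: borel_measurable_continuous_onI continuous_intros)
    then show ?thesis by (intro borel_measurable_nn_integral_lborel) simp
  qed
  then have "AE t in lborel. (\<integral>\<^sup>+x. indicator N (x, t) \<partial>lborel) = 0"
    using * by (subst (asm) nn_integral_0_iff_AE) auto
  then show ?thesis
  proof eventually_elim
    case (elim t)
    then have "AE x in lborel. indicator N (x, t) = (0::ennreal)"
      using sl by (subst (asm) nn_integral_0_iff_AE) auto
    then show ?case
      by eventually_elim (use N(2) in \<open>auto simp: indicator_def split: if_splits\<close>)
  qed
qed

text \<open>In this direction the exceptional set has to be Borel: null slices alone do not make a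
  set measurable.\<close>

lemma AE_lborel_sndI:
  fixes N :: "('a::euclidean_space \<times> 'b::euclidean_space) set"
  assumes [measurable]: "N \<in> sets borel" and "AE t in lborel. AE x in lborel. (x, t) \<notin> N"
  shows "AE z in lborel. z \<notin> N"
proof -
  have m: "(indicator N :: 'a \<times> 'b \<Rightarrow> ennreal) \<in> borel_measurable (lborel \<Otimes>\<^sub>M lborel)"
    by (simp add: lborel_prod)
  have "(\<integral>\<^sup>+z. indicator N z \<partial>(lborel :: ('a \<times> 'b) measure)) = (\<integral>\<^sup>+t. (\<integral>\<^sup>+x. indicator N (x, t) \<partial>lborel) \<partial>lborel)"
    using lborel_pair.nn_integral_snd[OF m] by (simp add: lborel_prod)
  also have "\<dots> = (\<integral>\<^sup>+t. 0 \<partial>(lborel :: 'b measure))"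
  proof (rule nn_integral_cong_AE)
    show "AE t in lborel. (\<integral>\<^sup>+x. indicator N (x, t) \<partial>lborel) = 0"
      using assms(2)
    proof eventually_elim
      case (elim t)
      then have "(\<integral>\<^sup>+x. indicator N (x, t) \<partial>lborel) = (\<integral>\<^sup>+x. 0 \<partial>(lborel :: 'a measure))"
        by (intro nn_integral_cong_AE) (auto simp: indicator_def elim!: eventually_mono)
      then show ?case by simp
    qed
  qed
  finally have "emeasure lborel N = 0" by simp
  then have "N \<in> null_sets lborel" by auto
  then show ?thesis by (rule AE_not_in)
qed

lemma borel_representative:
  fixes h :: "'a::euclidean_space \<Rightarrow> real"
  assumes "set_borel_measurable lebesgue C h" and [measurable]: "C \<in> sets borel"
  obtains h' where "h' \<in> borel_measurable borel" "\<And>z. z \<notin> C \<Longrightarrow> h' z = 0" "AE z in lborel. z \<in> C \<longrightarrow> h' z = h z"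
proof -
  from completion_ex_borel_measurable_real[OF assms(1)[unfolded set_borel_measurable_def]]
  obtain g where g: "g \<in> borel_measurable lborel" "AE z in lborel. indicator C z *\<^sub>R h z = g z" by blast
  have [measurable]: "g \<in> borel_measurable borel" using g(1) by simp
  show ?thesis
  proof (rule that[of "\<lambda>z. indicator C z * g z"])
    show "AE z in lborel. z \<in> C \<longrightarrow> indicator C z * g z = h z"
      using g(2) by eventually_elim (auto simp: indicator_def)
  qed auto
qed

text \<open>For a simple function the composition is a finite sum over its values; continuity in the
  second variable then allows the passage to the limit at almost every point, and completeness takes
  care of the remaining ones.\<close>

lemma caratheodory_compose_measurable:
  fixes G :: "'z::euclidean_space \<Rightarrow> 'w::euclidean_space \<Rightarrow> real" and w :: "'z \<Rightarrow> 'w"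
  assumes G: "\<And>y. (\<lambda>z. indicator Q z * G z y) \<in> borel_measurable lebesgue"
    and cont: "AE z in lebesgue. z \<in> Q \<longrightarrow> continuous_on UNIV (G z)"
    and w: "w \<in> borel_measurable lebesgue"
  shows "(\<lambda>z. indicator Q z * G z (w z)) \<in> borel_measurable lebesgue"
proof -
  from borel_measurable_implies_sequence_metric[OF w, of 0]
  obtain s where s: "\<And>i. simple_function lebesgue (s i)" "\<And>x. (\<lambda>i. s i x) \<longlonglongrightarrow> w x"
    by auto
  have sm: "(\<lambda>z. indicator Q z * G z (s i z)) \<in> borel_measurable lebesgue" for i
  proof -
    have fin: "finite (range (s i))" using simple_functionD(1)[OF s(1)[of i]] by simp
    have eq: "(\<lambda>z. indicator Q z * G z (s i z)) = (\<lambda>z. \<Sum>y\<in>range (s i). indicator (s i -` {y}) z * (indicator Q z * G z y))"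
    proof
      fix z
      have "(\<Sum>y\<in>range (s i). indicator (s i -` {y}) z * (indicator Q z * G z y))
        = (\<Sum>y\<in>range (s i). if y = s i z then indicator Q z * G z y else 0)"
        by (intro sum.cong) (auto simp: indicator_def)
      then show "indicator Q z * G z (s i z) = (\<Sum>y\<in>range (s i). indicator (s i -` {y}) z * (indicator Q z * G z y))"
        using fin by simp
    qed
    have "s i -` {y} \<in> sets lebesgue" for y
      using simple_functionD(2)[OF s(1)[of i], of "{y}"] by simp
    then show ?thesis
      unfolding eq by (intro borel_measurable_sum borel_measurable_times borel_measurable_indicator G)
  qed
  have "(\<lambda>z. lim (\<lambda>i. indicator Q z * G z (s i z))) \<in> borel_measurable lebesgue"
    by (intro borel_measurable_lim_metric sm)
  moreover have "AE z in lebesgue. lim (\<lambda>i. indicator Q z * G z (s i z)) = indicator Q z * G z (w z)"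
    using cont
  proof eventually_elim
    case (elim z)
    show ?case
    proof (cases "z \<in> Q")
      case True
      then have "(\<lambda>i. G z (s i z)) \<longlonglongrightarrow> G z (w z)"
        using elim s(2)[of z] by (intro continuous_on_tendsto_compose[of UNIV "G z"]) auto
      then show ?thesis using True by (simp add: limI)
    qed (simp add: limI)
  qed
  ultimately show ?thesis by (rule borel_measurable_lebesgue_cong_AE)
qed

section \<open>Time-independent test functions\<close>

lemma Lp_on_borelI:
  fixes f :: "'a::euclidean_space \<Rightarrow> real"
  assumes [measurable]: "f \<in> borel_measurable borel" "K \<in> sets borel"
    and "integrable lborel (\<lambda>x. indicator K x * \<bar>f x\<bar> powr q)"
  shows "Lp_on q K f"
proof -
  have "integrable lebesgue (\<lambda>x. indicator K x * \<bar>f x\<bar> powr q)"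
    using assms(3) by (subst integrable_completion) auto
  moreover have "(\<lambda>x. indicator K x *\<^sub>R f x) \<in> borel_measurable lebesgue"
    by (intro measurable_completion) measurable
  ultimately show ?thesis
    by (simp add: Lp_on_def set_borel_measurable_def set_integrable_def)
qed

lemma Lp_loc_space:
  fixes \<phi> :: "'a::euclidean_space \<Rightarrow> real"
  assumes [measurable]: "\<phi> \<in> borel_measurable borel" "K \<in> sets borel"
    and i: "integrable lborel (\<lambda>x. indicator K x * \<bar>\<phi> x\<bar> powr q)"
  shows "Lp_loc q (K \<times> {0<..<T::real}) (\<lambda>(x, t). \<phi> x)"
  unfolding Lp_loc_def
proof (intro allI impI)
  fix C assume C: "compact C \<and> C \<subseteq> K \<times> {0<..<T}"
  then have [measurable]: "C \<in> sets borel" by (auto intro: borel_compact)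
  have "integrable lborel (indicator {0..T} :: real \<Rightarrow> real)"
    using emeasure_lborel_Icc_eq[of 0 T] by (intro integrable_real_indicator) auto
  note P = integrable_lborel_product(1)[OF i this]
  show "Lp_on q C (\<lambda>(x, t). \<phi> x)"
  proof (rule Lp_on_borelI)
    show "(\<lambda>(x, t). \<phi> x) \<in> borel_measurable (borel :: ('a \<times> real) measure)"
      unfolding case_prod_unfold by measurable
    show "integrable lborel (\<lambda>z. indicator C z * \<bar>case z of (x, t) \<Rightarrow> \<phi> x\<bar> powr q)"
    proof (rule Bochner_Integration.integrable_bound[OF P])
      show "AE z in lborel. norm (indicator C z * \<bar>case z of (x, t) \<Rightarrow> \<phi> x\<bar> powr q)
          \<le> norm (indicator K (fst z) * \<bar>\<phi> (fst z)\<bar> powr q * indicator {0..T} (snd z))"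
        using C by (intro AE_I2) (auto simp: indicator_def case_prod_unfold)
    qed (simp add: case_prod_unfold)
  qed simp
qed

text \<open>Supplies the weak time derivative of a time-independent test function; it reduces to the
  vanishing integral of the derivative of a compactly supported function.\<close>

lemma weak_deriv_const:
  "weak_deriv 1 {0<..<T::real} (\<lambda>t. c) (\<lambda>t. 0)"
proof -
  have L: "Lp_loc 1 {0<..<T} (\<lambda>t. k)" for k :: real
    unfolding Lp_loc_def
  proof (intro allI impI)
    fix C :: "real set" assume C: "compact C \<and> C \<subseteq> {0<..<T}"
    then have [measurable]: "C \<in> sets borel" by (auto intro: borel_compact)
    have "integrable lborel (indicator C :: real \<Rightarrow> real)"
      using C emeasure_bounded_finite[of C] by (intro integrable_real_indicator) (auto simp: compact_imp_bounded)
    then show "Lp_on 1 C (\<lambda>t. k)" by (intro Lp_on_borelI) auto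
  qed
  have "(LINT x:{0<..<T}|lebesgue. c * dir_deriv 1 \<phi> x) = 0" if \<phi>: "C_c_inf {0<..<T} \<phi>" for \<phi>
  proof -
    have C1: "C_k 1 \<phi>" and cl: "closure {x. \<phi> x \<noteq> 0} \<subseteq> {0<..<T}" using \<phi> by (auto simp: C_c_inf_def)
    have out: "dir_deriv 1 \<phi> x = 0" if "x \<notin> {0<..<T}" for x
    proof (rule dir_deriv_outside[of "closure {x. \<phi> x \<noteq> 0}"])
      show "\<phi> y = 0" if "y \<notin> closure {x. \<phi> x \<noteq> 0}" for y
        using that closure_subset[of "{x. \<phi> x \<noteq> 0}"] by auto
    qed (use that cl in auto)
    have \<phi>0: "\<phi> x = 0" if "\<bar>T\<bar> < norm x" for x
    proof (rule ccontr)
      assume "\<phi> x \<noteq> 0"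
      then have "x \<in> {0<..<T}" using closure_subset[of "{x. \<phi> x \<noteq> 0}"] cl by blast
      then show False using that by simp
    qed
    have m [measurable]: "dir_deriv 1 \<phi> \<in> borel_measurable borel"
      using C1 by (intro borel_measurable_continuous_onI) simp
    have "(LINT x:{0<..<T}|lebesgue. c * dir_deriv 1 \<phi> x) = (\<integral>x. c * dir_deriv 1 \<phi> x \<partial>lebesgue)"
      unfolding set_lebesgue_integral_def using out
      by (intro Bochner_Integration.integral_cong) (auto simp: indicator_def)
    also have "\<dots> = (\<integral>x. c * dir_deriv 1 \<phi> x \<partial>lborel)"
      by (rule integral_lebesgue_lborel) measurable
    also have "\<dots> = c * (\<integral>x. dir_deriv 1 \<phi> x \<partial>lborel)" by simp
    also have "(\<integral>x. dir_deriv 1 \<phi> x \<partial>lborel) = 0"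
      by (rule integral_dir_deriv_zero[OF C1 \<phi>0]) simp_all
    finally show ?thesis by simp
  qed
  then show ?thesis using L unfolding weak_deriv_def by simp
qed

text \<open>For a profile constant in time the conditions on the time derivative and on continuity
  in time are automatic. What has to be supplied is spatial regularity and integrability of the flux
  and source terms.\<close>

lemma admissible_test_space:
  fixes \<phi> :: "real^'n \<Rightarrow> real" and D\<phi> :: "real^'n \<Rightarrow> real^'n"
  assumes K: "compact K"
    and \<phi>: "\<phi> \<in> borel_measurable borel" "\<And>x. 0 \<le> \<phi> x" "\<And>x. \<phi> x \<le> b"
    and D: "\<And>i. (\<lambda>x. D\<phi> x $ i) \<in> borel_measurable borel"
    and Dp: "\<And>i. integrable lborel (\<lambda>x. indicator K x * \<bar>D\<phi> x $ i\<bar> powr p i)"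
    and W: "W11_o K \<phi> D\<phi>"
    and A: "\<And>i. set_integrable lebesgue (K \<times> {t\<^sub>1..t\<^sub>2}) (\<lambda>(x, t). A x t (u x t) (Du x t) $ i * D\<phi> x $ i)"
    and B: "set_integrable lebesgue (K \<times> {t\<^sub>1..t\<^sub>2}) (\<lambda>(x, t). B x t (u x t) (Du x t) * \<phi> x)"
  shows "admissible_test p A B T u Du K t\<^sub>1 t\<^sub>2 (\<lambda>x t. \<phi> x) (\<lambda>x t. 0) (\<lambda>x t. D\<phi> x)"
proof -
  have Kb: "K \<in> sets borel" using K by (rule borel_compact)
  have b0: "0 \<le> b" using \<phi>(2,3)[of 0] by linarith
  have bint: "integrable lborel (\<lambda>x. indicator C x * \<bar>\<phi> x\<bar> powr q)" if "compact C" "0 < q" for C q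
  proof -
    have [measurable]: "C \<in> sets borel" "\<phi> \<in> borel_measurable borel" using that \<phi> by (auto intro: borel_compact)
    have "integrable lborel (indicator C :: real^'n \<Rightarrow> real)"
      using that emeasure_bounded_finite[of C] by (intro integrable_real_indicator) (auto simp: compact_imp_bounded)
    then have "integrable lborel (\<lambda>x. (b powr q) * indicator C x)" by simp
    then show ?thesis
    proof (rule Bochner_Integration.integrable_bound)
      have "\<bar>\<phi> x\<bar> powr q \<le> b powr q" for x using \<phi>(2,3)[of x] that by (intro powr_mono2) auto
      then show "AE x in lborel. norm (indicator C x * \<bar>\<phi> x\<bar> powr q) \<le> norm (b powr q * indicator C x)"
        by (intro AE_I2) (auto simp: indicator_def)
    qed measurable
  qed
  have D1: "integrable lborel (\<lambda>x. indicator K x * \<bar>D\<phi> x $ i\<bar> powr 1)" for i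
  proof -
    have "set_integrable lebesgue K (\<lambda>x. \<bar>D\<phi> x $ i\<bar> powr 1)" using W by (simp add: W11_o_def Lp_on_def)
    then have "integrable lebesgue (\<lambda>x. indicator K x * \<bar>D\<phi> x $ i\<bar> powr 1)" by (simp add: set_integrable_def)
    moreover have "(\<lambda>x. indicator K x * \<bar>D\<phi> x $ i\<bar> powr 1) \<in> borel_measurable lborel"
      using D[of i] Kb by measurable
    ultimately show ?thesis using integrable_completion by blast
  qed
  have Z: "Lp_loc 2 (K \<times> {0<..<T}) (\<lambda>(x, t). 0 :: real)"
    using Lp_loc_space[of "\<lambda>x. 0 :: real" K 2 T] Kb by simp
  have L: "Lp_loc q (K \<times> {0<..<T}) (\<lambda>(x, t). \<phi> x)" if "0 < q" for q
    using that K by (intro Lp_loc_space \<phi> Kb bint)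
  have "W12_L2_loc K T (\<lambda>x t. \<phi> x) (\<lambda>x t. 0)"
    unfolding W12_L2_loc_def using L[of 2] Z weak_deriv_const by simp
  moreover have "Lp_W1p_o p K T (\<lambda>x t. \<phi> x) (\<lambda>x t. D\<phi> x)"
    unfolding Lp_W1p_o_def using L[of 1] W Lp_loc_space[OF D Kb D1] Lp_loc_space[OF D Kb Dp] by simp
  moreover have "C_L2_loc {t\<^sub>1..t\<^sub>2} K (\<lambda>x t. \<phi> x)"
    unfolding C_L2_loc_def Lp_loc_def
    by (auto intro!: Lp_on_borelI \<phi> bint borel_compact simp: set_lebesgue_integral_def)
  ultimately show ?thesis
    unfolding admissible_test_def using \<phi>(2) A B by (simp add: set_integrable_def)
qed

section \<open>Time slices\<close>

lemma slice_measurable: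
  assumes "C_L2_loc I \<Omega> u" "compact K" "K \<subseteq> \<Omega>" "t \<in> I"
  shows "(\<lambda>x. indicator K x * u x t) \<in> borel_measurable lebesgue"
    and "integrable lebesgue (\<lambda>x. indicator K x * (u x t)\<^sup>2)"
proof -
  have "Lp_on 2 K (\<lambda>x. u x t)" using assms unfolding C_L2_loc_def Lp_loc_def by blast
  then show "(\<lambda>x. indicator K x * u x t) \<in> borel_measurable lebesgue"
    and "integrable lebesgue (\<lambda>x. indicator K x * (u x t)\<^sup>2)"
    by (auto simp: Lp_on_def set_borel_measurable_def set_integrable_def)
qed

lemma slice_diff_integrable:
  assumes "C_L2_loc I \<Omega> u" "compact K" "K \<subseteq> \<Omega>" "s \<in> I" "t \<in> I"
  shows "integrable lebesgue (\<lambda>x. indicator K x * (u x s - u x t)\<^sup>2)"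
proof (rule Bochner_Integration.integrable_bound)
  note s = slice_measurable[OF assms(1-4)] and t = slice_measurable[OF assms(1-3,5)]
  show "integrable lebesgue (\<lambda>x. 2 * (indicator K x * (u x s)\<^sup>2) + 2 * (indicator K x * (u x t)\<^sup>2))"
    using s(2) t(2) by simp
  have "(\<lambda>x. (indicator K x * u x s - indicator K x * u x t)\<^sup>2) \<in> borel_measurable lebesgue"
    using s(1) t(1) by measurable
  also have "(\<lambda>x. (indicator K x * u x s - indicator K x * u x t)\<^sup>2) = (\<lambda>x. indicator K x * (u x s - u x t)\<^sup>2)"
    by (auto simp: indicator_def fun_eq_iff)
  finally show "(\<lambda>x. indicator K x * (u x s - u x t)\<^sup>2) \<in> borel_measurable lebesgue" .
  have "(a - b)\<^sup>2 \<le> 2 * a\<^sup>2 + 2 * b\<^sup>2" for a b :: real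
    using sum_squares_bound[of a "- b"] by (simp add: power2_diff)
  then show "AE x in lebesgue. norm (indicator K x * (u x s - u x t)\<^sup>2)
      \<le> norm (2 * (indicator K x * (u x s)\<^sup>2) + 2 * (indicator K x * (u x t)\<^sup>2))"
    by (intro AE_I2) (auto simp: indicator_def)
qed

lemma integrable_indicator_compact:
  assumes "compact (K :: 'a::euclidean_space set)"
  shows "integrable lebesgue (indicator K :: 'a \<Rightarrow> real)"
proof -
  have [measurable]: "K \<in> sets borel" using assms by (rule borel_compact)
  have "integrable lborel (indicator K :: 'a \<Rightarrow> real)"
    using assms emeasure_bounded_finite[of K] by (intro integrable_real_indicator) (auto simp: compact_imp_bounded)
  then show ?thesis by (subst integrable_completion) auto
qed

text \<open>Serves the mass and the entropy alike. Continuity in L2 is converted into continuity of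
  the integral by \<open>\<bar>v\<bar> \<le> \<eta> + v\<^sup>2 / \<eta>\<close> in place of the
  Cauchy-Schwarz inequality.\<close>

lemma slice_Lipschitz:
  fixes \<Phi> :: "real \<Rightarrow> real" and u :: "real^'n \<Rightarrow> real \<Rightarrow> real"
  assumes u: "C_L2_loc I \<Omega> u" "compact K" "K \<subseteq> \<Omega>"
    and \<Phi>: "\<And>x y. \<bar>\<Phi> x - \<Phi> y\<bar> \<le> c * \<bar>x - y\<bar>"
    and \<zeta>: "\<zeta> \<in> borel_measurable borel" "\<And>x. \<bar>\<zeta> x\<bar> \<le> 1"
  shows "t \<in> I \<Longrightarrow> integrable lebesgue (\<lambda>x. indicator K x * (\<Phi> (u x t) * \<zeta> x))"
    and "continuous_on I (\<lambda>t. \<integral>x. indicator K x * (\<Phi> (u x t) * \<zeta> x) \<partial>lebesgue)"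
proof -
  have c: "0 \<le> c" using \<Phi>[of 1 0] by simp
  have Kb [measurable]: "K \<in> sets borel" using u(2) by (rule borel_compact)
  have \<zeta>m [measurable]: "\<zeta> \<in> borel_measurable lebesgue" using \<zeta>(1) by (intro measurable_completion) simp
  have \<Phi>c: "continuous_on UNIV \<Phi>"
    unfolding continuous_on_iff
  proof (intro ballI allI impI)
    fix x e :: real assume "0 < e"
    have "dist (\<Phi> y) (\<Phi> x) < e" if "dist y x < e / (c + 1)" for y
    proof -
      have "\<bar>\<Phi> y - \<Phi> x\<bar> \<le> c * \<bar>y - x\<bar>" by (rule \<Phi>)
      also have "\<dots> \<le> c * (e / (c + 1))" using that c by (intro mult_left_mono) (auto simp: dist_real_def)
      also have "\<dots> < e" using c \<open>0 < e\<close> by (simp add: field_simps)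
      finally show ?thesis by (simp add: dist_real_def)
    qed
    then show "\<exists>d>0. \<forall>x'\<in>UNIV. dist x' x < d \<longrightarrow> dist (\<Phi> x') (\<Phi> x) < e"
      using c \<open>0 < e\<close> by (intro exI[of _ "e / (c + 1)"]) auto
  qed
  then have \<Phi>m [measurable]: "\<Phi> \<in> borel_measurable borel" by (rule borel_measurable_continuous_onI)
  have Ki: "integrable lebesgue (indicator K :: real^'n \<Rightarrow> real)" by (rule integrable_indicator_compact[OF u(2)])
  have meas: "(\<lambda>x. indicator K x * (\<Phi> (u x t) * \<zeta> x)) \<in> borel_measurable lebesgue" if "t \<in> I" for t
  proof -
    have "(\<lambda>x. indicator K x * (\<Phi> (indicator K x * u x t) * \<zeta> x)) \<in> borel_measurable lebesgue"
      by (intro borel_measurable_times borel_measurable_indicator measurable_compose[OF slice_measurable(1)[OF u that] \<Phi>m] \<zeta>m) simp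
    also have "(\<lambda>x. indicator K x * (\<Phi> (indicator K x * u x t) * \<zeta> x)) = (\<lambda>x. indicator K x * (\<Phi> (u x t) * \<zeta> x))"
      by (auto simp: indicator_def fun_eq_iff)
    finally show ?thesis .
  qed
  have young: "\<bar>v\<bar> \<le> \<eta> + v\<^sup>2 / \<eta>" if "0 < \<eta>" for v \<eta> :: real
  proof (cases "\<bar>v\<bar> \<le> \<eta>")
    case True
    then show ?thesis using that by (smt (verit) divide_nonneg_pos zero_le_power2)
  next
    case False
    then have "\<bar>v\<bar> * \<eta> \<le> \<bar>v\<bar> * \<bar>v\<bar>" by (intro mult_left_mono) auto
    then have "\<bar>v\<bar> \<le> v\<^sup>2 / \<eta>" using that by (simp add: field_simps power2_eq_square)
    then show ?thesis using that by linarith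
  qed
  show int: "integrable lebesgue (\<lambda>x. indicator K x * (\<Phi> (u x t) * \<zeta> x))" if t: "t \<in> I" for t
  proof (rule Bochner_Integration.integrable_bound)
    show "integrable lebesgue (\<lambda>x. (\<bar>\<Phi> 0\<bar> + c) * indicator K x + c * (indicator K x * (u x t)\<^sup>2))"
      using slice_measurable(2)[OF u t] Ki by simp
    show "AE x in lebesgue. norm (indicator K x * (\<Phi> (u x t) * \<zeta> x))
        \<le> norm ((\<bar>\<Phi> 0\<bar> + c) * indicator K x + c * (indicator K x * (u x t)\<^sup>2))"
    proof (rule AE_I2)
      fix x
      have "\<bar>\<Phi> (u x t) * \<zeta> x\<bar> \<le> \<bar>\<Phi> (u x t)\<bar> * 1"
        unfolding abs_mult using \<zeta>(2)[of x] by (intro mult_left_mono) auto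
      also have "\<bar>\<Phi> (u x t)\<bar> \<le> \<bar>\<Phi> 0\<bar> + c * \<bar>u x t\<bar>" using \<Phi>[of "u x t" 0] by simp
      also have "c * \<bar>u x t\<bar> \<le> c * (1 + (u x t)\<^sup>2)" using young[of 1 "u x t"] c by (intro mult_left_mono) auto
      finally have "\<bar>\<Phi> (u x t) * \<zeta> x\<bar> \<le> \<bar>\<Phi> 0\<bar> + c + c * (u x t)\<^sup>2" by (simp add: distrib_left)
      then show "norm (indicator K x * (\<Phi> (u x t) * \<zeta> x))
        \<le> norm ((\<bar>\<Phi> 0\<bar> + c) * indicator K x + c * (indicator K x * (u x t)\<^sup>2))"
        using c by (auto simp: indicator_def)
    qed
  qed (rule meas[OF t])
  define m where "m t = (\<integral>x. indicator K x * (\<Phi> (u x t) * \<zeta> x) \<partial>lebesgue)" for t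
  define V where "V = (\<integral>x. indicator K x \<partial>(lebesgue :: (real^'n) measure) :: real)"
  have V: "0 \<le> V" unfolding V_def by simp
  have est: "\<bar>m s - m t\<bar> \<le> c * (\<eta> * V + (LINT x:K|lebesgue. (u x s - u x t)\<^sup>2) / \<eta>)" if "s \<in> I" "t \<in> I" "0 < \<eta>" for s t \<eta>
  proof -
    note di = slice_diff_integrable[OF u that(1,2)]
    have "m s - m t = (\<integral>x. indicator K x * (\<Phi> (u x s) * \<zeta> x) - indicator K x * (\<Phi> (u x t) * \<zeta> x) \<partial>lebesgue)"
      unfolding m_def by (intro Bochner_Integration.integral_diff[symmetric] int that)
    also have "\<bar>\<dots>\<bar> \<le> (\<integral>x. c * (\<eta> * indicator K x + (indicator K x * (u x s - u x t)\<^sup>2) / \<eta>) \<partial>lebesgue)"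
    proof (rule order_trans[OF integral_abs_bound], rule integral_mono)
      show "integrable lebesgue (\<lambda>x. \<bar>indicator K x * (\<Phi> (u x s) * \<zeta> x) - indicator K x * (\<Phi> (u x t) * \<zeta> x)\<bar>)"
        by (intro integrable_abs Bochner_Integration.integrable_diff int that)
      show "integrable lebesgue (\<lambda>x. c * (\<eta> * indicator K x + (indicator K x * (u x s - u x t)\<^sup>2) / \<eta>))"
        using Ki di by simp
      fix x
      have "\<bar>\<Phi> (u x s) * \<zeta> x - \<Phi> (u x t) * \<zeta> x\<bar> = \<bar>\<Phi> (u x s) - \<Phi> (u x t)\<bar> * \<bar>\<zeta> x\<bar>"
        by (simp add: left_diff_distrib[symmetric] abs_mult)
      also have "\<dots> \<le> (c * \<bar>u x s - u x t\<bar>) * 1"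
        using \<Phi> \<zeta>(2) c by (intro mult_mono) auto
      also have "\<dots> \<le> c * (\<eta> + (u x s - u x t)\<^sup>2 / \<eta>)"
        using young[OF that(3), of "u x s - u x t"] c by (auto intro: mult_left_mono)
      finally show "\<bar>indicator K x * (\<Phi> (u x s) * \<zeta> x) - indicator K x * (\<Phi> (u x t) * \<zeta> x)\<bar>
        \<le> c * (\<eta> * indicator K x + (indicator K x * (u x s - u x t)\<^sup>2) / \<eta>)"
        by (auto simp: indicator_def)
    qed
    also have "\<dots> = c * (\<eta> * V + (LINT x:K|lebesgue. (u x s - u x t)\<^sup>2) / \<eta>)"
    proof -
      have i1: "integrable lebesgue (\<lambda>x. \<eta> * (indicator K x :: real))" using Ki by simp
      have i2: "integrable lebesgue (\<lambda>x. (indicator K x * (u x s - u x t)\<^sup>2) / \<eta>)" using di by simp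
      show ?thesis
        unfolding integral_mult_right_zero Bochner_Integration.integral_add[OF i1 i2]
          integral_divide_zero V_def set_lebesgue_integral_def by simp
    qed
    finally show ?thesis .
  qed
  show "continuous_on I m"
    unfolding continuous_on_def
  proof
    fix t assume t: "t \<in> I"
    have lim: "((\<lambda>s. LINT x:K|lebesgue. (u x s - u x t)\<^sup>2) \<longlongrightarrow> 0) (at t within I)"
      using u t unfolding C_L2_loc_def by blast
    show "(m \<longlongrightarrow> m t) (at t within I)"
    proof (rule tendstoI)
      fix e :: real assume e: "0 < e"
      define D where "D = (c + 1) * (V + 1)"
      have D: "0 < D" using c V by (simp add: D_def)
      \<comment> \<open>\<open>\<eta>\<close> makes the contribution of the volume at most
        \<open>e / 2\<close>; only afterwards is the L2 distance taken small relative to it.\<close>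
      define \<eta> where "\<eta> = e / (2 * D)"
      have \<eta>: "0 < \<eta>" using e D by (simp add: \<eta>_def)
      have "c * (\<eta> * V) \<le> (c + 1) * (\<eta> * (V + 1))" using c V \<eta> by (intro mult_mono) auto
      also have "\<dots> = \<eta> * D" by (simp add: D_def)
      also have "\<dots> = e / 2" using D by (simp add: \<eta>_def)
      finally have h1: "c * (\<eta> * V) \<le> e / 2" .
      have "0 < e * \<eta> / (2 * (c + 1))" using e \<eta> c by simp
      with lim have "\<forall>\<^sub>F s in at t within I. (LINT x:K|lebesgue. (u x s - u x t)\<^sup>2) < e * \<eta> / (2 * (c + 1))"
        by (rule order_tendstoD(2))
      moreover have "\<forall>\<^sub>F s in at t within I. s \<in> I" by (simp add: eventually_at_filter)
      ultimately show "\<forall>\<^sub>F s in at t within I. dist (m s) (m t) < e"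
      proof eventually_elim
        case (elim s)
        let ?X = "LINT x:K|lebesgue. (u x s - u x t)\<^sup>2"
        have X0: "0 \<le> ?X" by (simp add: set_lebesgue_integral_def)
        have "\<bar>m s - m t\<bar> \<le> c * (\<eta> * V) + c * (?X / \<eta>)"
          using est[OF elim(2) t \<eta>] by (simp add: distrib_left)
        also have "c * (?X / \<eta>) \<le> (c + 1) * (?X / \<eta>)" using X0 \<eta> by (intro mult_right_mono) auto
        also have "(c + 1) * (?X / \<eta>) < e / 2" using elim(1) \<eta> c by (simp add: field_simps)
        finally show ?case using h1 by (simp add: dist_real_def)
      qed
    qed
  qed
qed

text \<open>Nonnegativity is given almost everywhere in space-time but needed at every time. The
  integral of the squared negative part at \<open>t\<close> is at most the squared L2 distance to
  any nonnegative slice; if it were positive, continuity would exclude nonnegative slices from a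
  whole interval of times near \<open>t\<close>.\<close>

lemma slice_nonneg:
  fixes u :: "real^'n \<Rightarrow> real \<Rightarrow> real"
  assumes u: "C_L2_loc {0..T} \<Omega> u" "compact K" "K \<subseteq> \<Omega>" and T: "0 < T"
    and pos: "AE (x, \<tau>) in lebesgue. (x, \<tau>) \<in> \<Omega> \<times> {0..T} \<longrightarrow> 0 \<le> u x \<tau>"
    and t: "t \<in> {0..T}"
  shows "AE x in lebesgue. x \<in> K \<longrightarrow> 0 \<le> u x t"
proof -
  have "AE z in lborel. case z of (x, \<tau>) \<Rightarrow> (x, \<tau>) \<in> \<Omega> \<times> {0..T} \<longrightarrow> 0 \<le> u x \<tau>"
    using pos unfolding AE_completion_iff .
  from AE_lborel_snd[OF this] have "AE \<tau> in lborel. AE x in lborel. (x, \<tau>) \<in> \<Omega> \<times> {0..T} \<longrightarrow> 0 \<le> u x \<tau>"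
    unfolding prod.case .
  then have good: "AE \<tau> in lborel. \<tau> \<in> {0..T} \<longrightarrow> (AE x in lebesgue. x \<in> K \<longrightarrow> 0 \<le> u x \<tau>)"
  proof eventually_elim
    case (elim \<tau>)
    then show ?case using u(3) by (auto simp: AE_completion_iff elim!: eventually_mono)
  qed
  let ?n = "\<lambda>x. indicator K x * (max 0 (- u x t))\<^sup>2"
  have nm: "?n \<in> borel_measurable lebesgue"
  proof -
    have [measurable]: "K \<in> sets borel" using u(2) by (rule borel_compact)
    have "(\<lambda>x. indicator K x * (max 0 (- (indicator K x * u x t)))\<^sup>2) \<in> borel_measurable lebesgue"
    proof (intro borel_measurable_times borel_measurable_indicator)
      have "(\<lambda>a::real. (max 0 (- a))\<^sup>2) \<in> borel_measurable borel" by measurable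
      from measurable_compose[OF slice_measurable(1)[OF u t] this]
      show "(\<lambda>x. (max 0 (- (indicator K x * u x t)))\<^sup>2) \<in> borel_measurable lebesgue" .
    qed simp
    also have "(\<lambda>x. indicator K x * (max 0 (- (indicator K x * u x t)))\<^sup>2) = ?n"
      by (auto simp: indicator_def fun_eq_iff)
    finally show ?thesis .
  qed
  have sq: "(max 0 (- a))\<^sup>2 \<le> a\<^sup>2" for a :: real by (cases "0 \<le> a") auto
  have ni: "integrable lebesgue ?n"
    by (rule Bochner_Integration.integrable_bound[OF slice_measurable(2)[OF u t] nm])
      (use sq in \<open>auto simp: indicator_def intro!: AE_I2\<close>)
  have le: "(\<integral>x. ?n x \<partial>lebesgue) \<le> (LINT x:K|lebesgue. (u x \<tau> - u x t)\<^sup>2)"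
    if \<tau>: "\<tau> \<in> {0..T}" "AE x in lebesgue. x \<in> K \<longrightarrow> 0 \<le> u x \<tau>" for \<tau>
    unfolding set_lebesgue_integral_def
  proof (rule integral_mono_AE[OF ni])
    show "integrable lebesgue (\<lambda>x. indicator K x *\<^sub>R (u x \<tau> - u x t)\<^sup>2)"
      using slice_diff_integrable[OF u \<tau>(1) t] by simp
    show "AE x in lebesgue. ?n x \<le> indicator K x *\<^sub>R (u x \<tau> - u x t)\<^sup>2"
      using \<tau>(2)
    proof eventually_elim
      case (elim x)
      then show ?case
        by (cases "0 \<le> u x t") (auto simp: indicator_def abs_le_square_iff[symmetric])
    qed
  qed
  have lim: "((\<lambda>s. LINT x:K|lebesgue. (u x s - u x t)\<^sup>2) \<longlongrightarrow> 0) (at t within {0..T})"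
    using u t unfolding C_L2_loc_def by blast
  have "(\<integral>x. ?n x \<partial>lebesgue) \<le> 0"
  proof (rule ccontr)
    assume "\<not> (\<integral>x. ?n x \<partial>lebesgue) \<le> 0"
    then have "\<forall>\<^sub>F s in at t within {0..T}. (LINT x:K|lebesgue. (u x s - u x t)\<^sup>2) < (\<integral>x. ?n x \<partial>lebesgue)"
      using order_tendstoD(2)[OF lim] by simp
    then obtain d where d: "d > 0" "\<And>s. s \<in> {0..T} \<Longrightarrow> s \<noteq> t \<Longrightarrow> dist s t < d \<Longrightarrow>
        (LINT x:K|lebesgue. (u x s - u x t)\<^sup>2) < (\<integral>x. ?n x \<partial>lebesgue)"
      unfolding eventually_at by blast
    \<comment> \<open>Cut to \<open>{0..T}\<close>, so that \<open>t\<close> may be an endpoint; the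
      interval still has positive length.\<close>
    define lo hi where "lo = max 0 (t - d / 2)" and "hi = min T (t + d / 2)"
    have lohi: "lo < hi" using d(1) t T by (auto simp: lo_def hi_def)
    have bad: "AE s in lborel. s \<notin> {lo<..<hi}"
      using good AE_lborel_singleton[of t]
    proof eventually_elim
      case (elim s)
      show ?case
      proof
        assume s: "s \<in> {lo<..<hi}"
        then have "s \<in> {0..T}" "dist s t < d" using t d(1) by (auto simp: lo_def hi_def dist_real_def)
        then show False using le[of s] d(2)[of s] elim by force
      qed
    qed
    then have "emeasure lborel {lo<..<hi} = 0"
      by (subst (asm) AE_iff_measurable[of "{lo<..<hi}"]) auto
    then show False using lohi by (simp add: ennreal_eq_0_iff)
  qed
  then have "(\<integral>x. ?n x \<partial>lebesgue) = 0"
    using Bochner_Integration.integral_nonneg[of lebesgue ?n] by fastforce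
  then have "AE x in lebesgue. ?n x = 0"
    using ni by (subst (asm) integral_nonneg_eq_0_iff_AE) auto
  then show ?thesis
    by eventually_elim (auto simp: indicator_def split: if_splits)
qed

section \<open>The equation in terms of Borel representatives\<close>

lemma powr_add_bound:
  fixes x y r :: real
  assumes "0 \<le> x" "0 \<le> y" "0 \<le> r"
  shows "(x + y) powr r \<le> 2 powr r * (x powr r + y powr r)"
proof -
  have "(x + y) powr r \<le> (2 * max x y) powr r" using assms by (intro powr_mono2) auto
  also have "\<dots> = 2 powr r * max x y powr r" using assms by (simp add: powr_mult)
  also have "\<dots> \<le> 2 powr r * (x powr r + y powr r)"
    by (intro mult_left_mono) (auto simp: max_def)
  finally show ?thesis .
qed

lemma borel_measurable_slice:
  fixes f :: "'a::euclidean_space \<times> real \<Rightarrow> real"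
  assumes "f \<in> borel_measurable borel"
  shows "(\<lambda>x. f (x, \<tau>)) \<in> borel_measurable borel"
  by (rule measurable_compose[OF _ assms]) (auto intro!: borel_measurable_continuous_onI continuous_intros)

lemma AE_integrable_slice:
  fixes f :: "'a::euclidean_space \<times> real \<Rightarrow> real"
  assumes "integrable lborel f"
  shows "AE \<tau> in lborel. integrable lborel (\<lambda>x. f (x, \<tau>))"
proof -
  have "integrable (lborel \<Otimes>\<^sub>M lborel) (\<lambda>(x, y). f (x, y))" using assms by (simp add: lborel_prod)
  from lborel_pair.AE_integrable_snd[OF this] show ?thesis .
qed

lemma integrable_lborel_of_lebesgue:
  fixes f :: "'a::euclidean_space \<Rightarrow> real"
  assumes "f \<in> borel_measurable borel" "integrable lebesgue g" "AE x in lebesgue. g x = f x"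
  shows "integrable lborel f"
proof -
  have "f \<in> borel_measurable lebesgue" using assms(1) by (intro measurable_completion) simp
  then have "integrable lebesgue f" by (rule integrable_cong_AE_imp[OF assms(2) _ assms(3)])
  then show ?thesis using assms(1) by (subst (asm) integrable_completion) auto
qed

text \<open>Sub- and supersolution come with a weak gradient each, \<open>Du'\<close> and \<open>Du\<close>; these agree
  almost everywhere.\<close>

locale cutoff_setting =
  fixes p :: "'n::finite \<Rightarrow> real" and C\<^sub>o C\<^sub>1 C T :: real and \<Omega> K K' S :: "(real^'n) set"
    and A :: "real^'n \<Rightarrow> real \<Rightarrow> real \<Rightarrow> real^'n \<Rightarrow> real^'n"
    and B :: "real^'n \<Rightarrow> real \<Rightarrow> real \<Rightarrow> real^'n \<Rightarrow> real"
    and u :: "real^'n \<Rightarrow> real \<Rightarrow> real" and Du Du' :: "real^'n \<Rightarrow> real \<Rightarrow> real^'n" and \<zeta> :: "real^'n \<Rightarrow> real"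
  assumes p: "\<And>i. 1 < p i" "\<And>i. p i < 2"
    and C: "0 \<le> C" "0 < C\<^sub>1" and T: "0 < T"
    and K': "compact K'" "K' \<subseteq> \<Omega>" and K: "compact K" "K \<subseteq> interior K'" and S: "compact S" "S \<subseteq> interior K"
    and carA: "caratheodory (\<Omega> \<times> {0..T}) A" and carB: "caratheodory (\<Omega> \<times> {0..T}) B"
    and str: "structure_conditions p C\<^sub>o C\<^sub>1 C (\<Omega> \<times> {0..T}) A B"
    and uC: "C_L2_loc {0..T} \<Omega> u"
    and upos: "AE (x, \<tau>) in lebesgue. (x, \<tau>) \<in> \<Omega> \<times> {0..T} \<longrightarrow> 0 \<le> u x \<tau>"
    and Du: "Lp_W1p_loc p \<Omega> T u Du" and Du': "Lp_W1p_loc p \<Omega> T u Du'"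
    and super: "\<And>K t\<^sub>1 t\<^sub>2 \<phi> \<phi>\<^sub>t D\<phi>. compact K \<Longrightarrow> K \<subseteq> \<Omega> \<Longrightarrow> 0 \<le> t\<^sub>1 \<Longrightarrow> t\<^sub>1 \<le> t\<^sub>2 \<Longrightarrow> t\<^sub>2 \<le> T \<Longrightarrow>
      admissible_test p A B T u Du K t\<^sub>1 t\<^sub>2 \<phi> \<phi>\<^sub>t D\<phi> \<Longrightarrow>
      weak_lhs A u Du K t\<^sub>1 t\<^sub>2 \<phi> \<phi>\<^sub>t D\<phi> \<ge> weak_rhs B u Du K t\<^sub>1 t\<^sub>2 \<phi>"
    and sub: "\<And>K t\<^sub>1 t\<^sub>2 \<phi> \<phi>\<^sub>t D\<phi>. compact K \<Longrightarrow> K \<subseteq> \<Omega> \<Longrightarrow> 0 \<le> t\<^sub>1 \<Longrightarrow> t\<^sub>1 \<le> t\<^sub>2 \<Longrightarrow> t\<^sub>2 \<le> T \<Longrightarrow>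
      admissible_test p A B T u Du' K t\<^sub>1 t\<^sub>2 \<phi> \<phi>\<^sub>t D\<phi> \<Longrightarrow>
      weak_lhs A u Du' K t\<^sub>1 t\<^sub>2 \<phi> \<phi>\<^sub>t D\<phi> \<le> weak_rhs B u Du' K t\<^sub>1 t\<^sub>2 \<phi>"
    and \<zeta>: "C_k 1 \<zeta>" "\<And>x. 0 \<le> \<zeta> x" "\<And>x. \<zeta> x \<le> 1" "\<And>x. x \<notin> S \<Longrightarrow> \<zeta> x = 0"
begin

text \<open>The nested compact sets provide two margins. \<open>S\<close> carries the cutoff and
  lies in the interior of \<open>K\<close>, so smooth approximations fit into the test domain
  \<open>K\<close>; the room between \<open>K\<close> and \<open>K'\<close> allows mollification at
  every point of \<open>K\<close>.\<close>

lemma KK': "K \<subseteq> K'" and K\<Omega>: "K \<subseteq> \<Omega>" and SK: "S \<subseteq> K"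
  using K(2) K'(2) S(2) interior_subset[of K'] interior_subset[of K] by blast+

lemma borel_sets [measurable]: "K \<in> sets borel" "K' \<in> sets borel" "S \<in> sets borel"
  using K K' S by (auto intro: borel_compact)

text \<open>The cylinder is compact in space and in the open time interval, where the local spaces
  give integrability. Taking \<open>max 0\<close> makes \<open>U\<close> nonnegative at every point,
  as the chain rule on slices requires.\<close>

lemma function_representative:
  assumes \<sigma>: "0 < \<sigma>" "\<sigma>' < T"
  obtains U where "U \<in> borel_measurable borel" "\<And>z. 0 \<le> U z"
    "AE z in lborel. z \<in> K' \<times> {\<sigma>..\<sigma>'} \<longrightarrow> U z = u (fst z) (snd z)" "integrable lborel U"
proof -
  let ?C = "K' \<times> {\<sigma>..\<sigma>'}"
  have cC: "compact ?C" using K' by (intro compact_Times) auto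
  have Cb [measurable]: "?C \<in> sets borel" using cC by (rule borel_compact)
  have sub: "?C \<subseteq> \<Omega> \<times> {0<..<T}" using K' \<sigma> by auto
  have L: "Lp_on 1 ?C (\<lambda>(x, t). u x t)"
    using Du cC sub unfolding Lp_W1p_loc_def Lp_loc_def by blast
  then have "set_borel_measurable lebesgue ?C (\<lambda>(x, t). u x t)" unfolding Lp_on_def by blast
  then obtain g where g: "g \<in> borel_measurable borel" "\<And>z. z \<notin> ?C \<Longrightarrow> g z = 0" "AE z in lborel. z \<in> ?C \<longrightarrow> g z = (case z of (x, t) \<Rightarrow> u x t)"
    by (rule borel_representative[OF _ Cb]) (rule that)
  have pos: "AE z in lborel. case z of (x, \<tau>) \<Rightarrow> (x, \<tau>) \<in> \<Omega> \<times> {0..T} \<longrightarrow> 0 \<le> u x \<tau>"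
    using upos unfolding AE_completion_iff .
  have eq: "AE z in lborel. z \<in> ?C \<longrightarrow> max 0 (g z) = u (fst z) (snd z)"
    using g(3) pos
  proof eventually_elim
    case (elim z)
    obtain x t where z: "z = (x, t)" by (cases z)
    show ?case
    proof
      assume C: "z \<in> ?C"
      then have "z \<in> \<Omega> \<times> {0..T}" using sub by auto
      then show "max 0 (g z) = u (fst z) (snd z)" using elim C unfolding z by simp
    qed
  qed
  have Um [measurable]: "(\<lambda>z. max 0 (g z)) \<in> borel_measurable borel" using g(1) by measurable
  have "integrable lborel (\<lambda>z. max 0 (g z))"
  proof (rule integrable_lborel_of_lebesgue[OF Um])
    show "integrable lebesgue (\<lambda>z. indicator ?C z *\<^sub>R \<bar>case z of (x, t) \<Rightarrow> u x t\<bar> powr 1)"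
      using L unfolding Lp_on_def set_integrable_def by blast
    have "AE z in lborel. indicator ?C z *\<^sub>R \<bar>case z of (x, t) \<Rightarrow> u x t\<bar> powr 1 = max 0 (g z)"
      using eq
    proof eventually_elim
      case (elim z)
      show ?case
      proof (cases "z \<in> ?C")
        case True
        then have "max 0 (g z) = u (fst z) (snd z)" using elim by simp
        moreover then have "0 \<le> u (fst z) (snd z)" by (metis max.cobounded1)
        ultimately show ?thesis using True by (simp add: case_prod_unfold)
      next
        case False
        then show ?thesis using g(2)[of z] by simp
      qed
    qed
    then show "AE z in lebesgue. indicator ?C z *\<^sub>R \<bar>case z of (x, t) \<Rightarrow> u x t\<bar> powr 1 = max 0 (g z)"
      unfolding AE_completion_iff .
  qed
  then show ?thesis by (intro that[OF Um _ eq]) simp_all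
qed

lemma gradient_representative:
  assumes \<sigma>: "0 < \<sigma>" "\<sigma>' < T" and G: "Lp_W1p_loc p \<Omega> T u G"
  obtains V where "\<And>i. V i \<in> borel_measurable borel" "\<And>i z. z \<notin> K' \<times> {\<sigma>..\<sigma>'} \<Longrightarrow> V i z = 0"
    "AE z in lborel. z \<in> K' \<times> {\<sigma>..\<sigma>'} \<longrightarrow> (\<forall>i. V i z = G (fst z) (snd z) $ i)"
    "\<And>i. integrable lborel (V i)" "\<And>i. integrable lborel (\<lambda>z. \<bar>V i z\<bar> powr p i)"
proof -
  let ?C = "K' \<times> {\<sigma>..\<sigma>'}"
  have cC: "compact ?C" using K' by (intro compact_Times) auto
  have Cb [measurable]: "?C \<in> sets borel" using cC by (rule borel_compact)
  have sub: "?C \<subseteq> \<Omega> \<times> {0<..<T}" using K' \<sigma> by auto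
  have L: "Lp_on 1 ?C (\<lambda>(x, t). G x t $ i)" "Lp_on (p i) ?C (\<lambda>(x, t). G x t $ i)" for i
    using G cC sub unfolding Lp_W1p_loc_def Lp_loc_def by blast+
  have "\<forall>i. \<exists>g. g \<in> borel_measurable borel \<and> (\<forall>z. z \<notin> ?C \<longrightarrow> g z = 0) \<and> (AE z in lborel. z \<in> ?C \<longrightarrow> g z = (case z of (x, t) \<Rightarrow> G x t $ i))"
  proof
    fix i
    have "set_borel_measurable lebesgue ?C (\<lambda>(x, t). G x t $ i)" using L(1)[of i] unfolding Lp_on_def by blast
    from borel_representative[OF this Cb]
    show "\<exists>g. g \<in> borel_measurable borel \<and> (\<forall>z. z \<notin> ?C \<longrightarrow> g z = 0) \<and> (AE z in lborel. z \<in> ?C \<longrightarrow> g z = (case z of (x, t) \<Rightarrow> G x t $ i))"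
      by blast
  qed
  from choice[OF this] obtain V where V: "\<forall>i. V i \<in> borel_measurable borel \<and> (\<forall>z. z \<notin> ?C \<longrightarrow> V i z = 0) \<and> (AE z in lborel. z \<in> ?C \<longrightarrow> V i z = (case z of (x, t) \<Rightarrow> G x t $ i))" ..
  then have Vm [measurable]: "V i \<in> borel_measurable borel" and V0: "z \<notin> ?C \<Longrightarrow> V i z = 0"
    and Ve: "AE z in lborel. z \<in> ?C \<longrightarrow> V i z = (case z of (x, t) \<Rightarrow> G x t $ i)" for i z by blast+
  have Vq: "integrable lborel (\<lambda>z. \<bar>V i z\<bar> powr q)" if "Lp_on q ?C (\<lambda>(x, t). G x t $ i)" for i q
  proof (rule integrable_lborel_of_lebesgue)
    show "integrable lebesgue (\<lambda>z. indicator ?C z *\<^sub>R \<bar>case z of (x, t) \<Rightarrow> G x t $ i\<bar> powr q)"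
      using that unfolding Lp_on_def set_integrable_def by blast
    have "AE z in lborel. indicator ?C z *\<^sub>R \<bar>case z of (x, t) \<Rightarrow> G x t $ i\<bar> powr q = \<bar>V i z\<bar> powr q"
      using Ve[of i]
    proof eventually_elim
      case (elim z)
      then show ?case using V0[of z i] by (cases "z \<in> ?C") auto
    qed
    then show "AE z in lebesgue. indicator ?C z *\<^sub>R \<bar>case z of (x, t) \<Rightarrow> G x t $ i\<bar> powr q = \<bar>V i z\<bar> powr q"
      unfolding AE_completion_iff .
  qed measurable
  have Vi: "integrable lborel (V i)" for i
  proof (rule Bochner_Integration.integrable_bound[OF Vq[OF L(1)[of i]]])
    show "AE z in lborel. norm (V i z) \<le> norm (\<bar>V i z\<bar> powr 1)" by simp
  qed simp
  have "AE z in lborel. \<forall>i. z \<in> ?C \<longrightarrow> V i z = (case z of (x, t) \<Rightarrow> G x t $ i)"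
    using Ve by (subst AE_all_countable) blast
  then have ae: "AE z in lborel. z \<in> ?C \<longrightarrow> (\<forall>i. V i z = G (fst z) (snd z) $ i)"
    by eventually_elim (auto simp: case_prod_unfold)
  show ?thesis by (rule that[of V]) (rule Vm V0 ae Vi Vq[OF L(2)] | assumption)+
qed

text \<open>The margin \<open>d\<close> comes from the room between \<open>K\<close> and
  \<open>K'\<close> and is therefore the same for all times; only the exceptional null set of times
  depends on the solution.\<close>

lemma slice_conv:
  assumes \<sigma>: "0 < \<sigma>" "\<sigma>' < T" and G: "Lp_W1p_loc p \<Omega> T u G"
    and U: "U \<in> borel_measurable borel" "AE z in lborel. z \<in> K' \<times> {\<sigma>..\<sigma>'} \<longrightarrow> U z = u (fst z) (snd z)"
    and V: "\<And>i. V i \<in> borel_measurable borel" "AE z in lborel. z \<in> K' \<times> {\<sigma>..\<sigma>'} \<longrightarrow> (\<forall>i. V i z = G (fst z) (snd z) $ i)"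
  obtains d where "0 < d" "AE \<tau> in lborel. \<tau> \<in> {\<sigma>..\<sigma>'} \<longrightarrow> (\<forall>i r x. 0 < r \<longrightarrow> r < d \<longrightarrow> x \<in> K \<longrightarrow>
      conv (\<lambda>x. U (x, \<tau>)) (dir_deriv (axis i 1) (mollifier r)) x = conv (\<lambda>x. V i (x, \<tau>)) (mollifier r) x)"
proof -
  obtain d where d: "0 < d" "\<And>x. x \<in> K \<Longrightarrow> cball x d \<subseteq> interior K'"
    using compact_enlarge_subset[OF K(1) open_interior K(2)] by blast
  have W: "AE \<tau> in lborel. \<tau> \<in> {0<..<T} \<longrightarrow> W11_loc \<Omega> (\<lambda>x. u x \<tau>) (\<lambda>x. G x \<tau>)"
    using G unfolding Lp_W1p_loc_def AE_completion_iff by blast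
  have "AE \<tau> in lborel. \<tau> \<in> {\<sigma>..\<sigma>'} \<longrightarrow> (\<forall>i r x. 0 < r \<longrightarrow> r < d \<longrightarrow> x \<in> K \<longrightarrow>
      conv (\<lambda>x. U (x, \<tau>)) (dir_deriv (axis i 1) (mollifier r)) x = conv (\<lambda>x. V i (x, \<tau>)) (mollifier r) x)"
    using W AE_lborel_snd[OF U(2)] AE_lborel_snd[OF V(2)]
  proof eventually_elim
    case (elim \<tau>)
    show ?case
    proof (intro impI allI)
      fix i r x assume \<tau>: "\<tau> \<in> {\<sigma>..\<sigma>'}" and r: "0 < r" "r < d" and x: "x \<in> K"
      show "conv (\<lambda>x. U (x, \<tau>)) (dir_deriv (axis i 1) (mollifier r)) x = conv (\<lambda>x. V i (x, \<tau>)) (mollifier r) x"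
      proof (rule weak_deriv_conv)
        show "weak_deriv (axis i 1) \<Omega> (\<lambda>x. u x \<tau>) (\<lambda>x. G x \<tau> $ i)"
          using elim(1) \<tau> \<sigma> unfolding W11_loc_def by auto
        show "cball x r \<subseteq> K'"
          using d(2)[OF x] r interior_subset[of K'] by (meson cball_subset_cball_iff less_imp_le order_trans subset_cball)
        show "AE y in lborel. y \<in> K' \<longrightarrow> U (y, \<tau>) = u y \<tau> \<and> V i (y, \<tau>) = G y \<tau> $ i"
          using elim(2,3)
        proof eventually_elim
          case (elim y)
          then show ?case using \<tau> by auto
        qed
      qed (use r K' U V in \<open>auto intro: borel_measurable_slice\<close>)
    qed
  qed
  then show ?thesis by (rule that[OF d(1)])
qed

text \<open>Each gradient mollifies to the derivative of the same mollified \<open>U\<close>. The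
  set \<open>N\<close> is formed from the Borel representatives because passing from slices back to
  space-time needs a measurable exceptional set.\<close>

lemma gradients_agree:
  assumes \<sigma>: "0 < \<sigma>" "\<sigma>' < T"
  shows "AE z in lborel. z \<in> K \<times> {\<sigma>..\<sigma>'} \<longrightarrow> Du' (fst z) (snd z) = Du (fst z) (snd z)"
proof -
  obtain U where U: "U \<in> borel_measurable borel" "\<And>z. 0 \<le> U z"
    "AE z in lborel. z \<in> K' \<times> {\<sigma>..\<sigma>'} \<longrightarrow> U z = u (fst z) (snd z)" "integrable lborel U"
    by (rule function_representative[OF \<sigma>]) (rule that)
  obtain V where V: "\<And>i. V i \<in> borel_measurable borel" "\<And>i z. z \<notin> K' \<times> {\<sigma>..\<sigma>'} \<Longrightarrow> V i z = 0"
    "AE z in lborel. z \<in> K' \<times> {\<sigma>..\<sigma>'} \<longrightarrow> (\<forall>i. V i z = Du (fst z) (snd z) $ i)"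
    "\<And>i. integrable lborel (V i)" "\<And>i. integrable lborel (\<lambda>z. \<bar>V i z\<bar> powr p i)"
    by (rule gradient_representative[OF \<sigma> Du]) (rule that)
  obtain V' where V': "\<And>i. V' i \<in> borel_measurable borel" "\<And>i z. z \<notin> K' \<times> {\<sigma>..\<sigma>'} \<Longrightarrow> V' i z = 0"
    "AE z in lborel. z \<in> K' \<times> {\<sigma>..\<sigma>'} \<longrightarrow> (\<forall>i. V' i z = Du' (fst z) (snd z) $ i)"
    "\<And>i. integrable lborel (V' i)" "\<And>i. integrable lborel (\<lambda>z. \<bar>V' i z\<bar> powr p i)"
    by (rule gradient_representative[OF \<sigma> Du']) (rule that)
  obtain d where d: "0 < d" "AE \<tau> in lborel. \<tau> \<in> {\<sigma>..\<sigma>'} \<longrightarrow> (\<forall>i r x. 0 < r \<longrightarrow> r < d \<longrightarrow> x \<in> K \<longrightarrow>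
      conv (\<lambda>x. U (x, \<tau>)) (dir_deriv (axis i 1) (mollifier r)) x = conv (\<lambda>x. V i (x, \<tau>)) (mollifier r) x)"
    by (rule slice_conv[OF \<sigma> Du U(1,3) V(1,3)]) (rule that)
  obtain d' where d': "0 < d'" "AE \<tau> in lborel. \<tau> \<in> {\<sigma>..\<sigma>'} \<longrightarrow> (\<forall>i r x. 0 < r \<longrightarrow> r < d' \<longrightarrow> x \<in> K \<longrightarrow>
      conv (\<lambda>x. U (x, \<tau>)) (dir_deriv (axis i 1) (mollifier r)) x = conv (\<lambda>x. V' i (x, \<tau>)) (mollifier r) x)"
    by (rule slice_conv[OF \<sigma> Du' U(1,3) V'(1,3)]) (rule that)
  note [measurable] = V(1) V'(1)
  have one: "AE z in lborel. z \<in> K \<times> {\<sigma>..\<sigma>'} \<longrightarrow> V i z = V' i z" for i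
  proof -
    define N where "N = {z \<in> space borel. fst z \<in> K \<and> \<sigma> \<le> snd z \<and> snd z \<le> \<sigma>' \<and> V i z \<noteq> V' i z}"
    have N: "N \<in> sets borel" unfolding N_def by measurable
    have "AE \<tau> in lborel. AE x in lborel. (x, \<tau>) \<notin> N"
      using d(2) d'(2) AE_integrable_slice[OF V(4)[of i]] AE_integrable_slice[OF V'(4)[of i]]
    proof eventually_elim
      case (elim \<tau>)
      show ?case
      proof (cases "\<tau> \<in> {\<sigma>..\<sigma>'}")
        case True
        have "AE x in lborel. x \<in> K \<longrightarrow> V i (x, \<tau>) = V' i (x, \<tau>)"
        proof (rule weak_gradient_unique[where U = "\<lambda>x. U (x, \<tau>)" and b = "axis i 1"])
          show "0 < min d d'" using d(1) d'(1) by simp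
          show "conv (\<lambda>x. U (x, \<tau>)) (dir_deriv (axis i 1) (mollifier r)) x = conv (\<lambda>x. V i (x, \<tau>)) (mollifier r) x \<and>
            conv (\<lambda>x. U (x, \<tau>)) (dir_deriv (axis i 1) (mollifier r)) x = conv (\<lambda>x. V' i (x, \<tau>)) (mollifier r) x"
            if "0 < r" "r < min d d'" "x \<in> K" for r x
            using elim(1)[THEN mp, OF True] elim(2)[THEN mp, OF True] that unfolding min_less_iff_conj by blast
          show "integrable lborel (\<lambda>x. V i (x, \<tau>))" "integrable lborel (\<lambda>x. V' i (x, \<tau>))"
            by (rule elim(3), rule elim(4))
        qed simp
        then show ?thesis by eventually_elim (simp add: N_def)
      next
        case False
        then have "(x, \<tau>) \<notin> N" for x by (auto simp: N_def)
        then show ?thesis by simp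
      qed
    qed
    from AE_lborel_sndI[OF N this] show ?thesis by eventually_elim (auto simp: N_def)
  qed
  have "AE z in lborel. \<forall>i. z \<in> K \<times> {\<sigma>..\<sigma>'} \<longrightarrow> V i z = V' i z"
    using one by (subst AE_all_countable) blast
  then show ?thesis using V(3) V'(3)
  proof eventually_elim
    case (elim z)
    then show ?case using KK' by (auto simp: vec_eq_iff)
  qed
qed

lemma composition_representative:
  fixes F :: "real^'n \<Rightarrow> real \<Rightarrow> real \<Rightarrow> real^'n \<Rightarrow> real"
  assumes \<sigma>: "0 < \<sigma>" "\<sigma>' < T"
    and F: "\<And>s \<xi>. set_borel_measurable lebesgue (\<Omega> \<times> {0..T}) (\<lambda>(x, t). F x t s \<xi>)"
      "AE (x, t) in lebesgue. (x, t) \<in> \<Omega> \<times> {0..T} \<longrightarrow> continuous_on UNIV (\<lambda>(s, \<xi>). F x t s \<xi>)"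
    and U: "U \<in> borel_measurable borel" "AE z in lborel. z \<in> K' \<times> {\<sigma>..\<sigma>'} \<longrightarrow> U z = u (fst z) (snd z)"
    and V: "\<And>i. V i \<in> borel_measurable borel" "AE z in lborel. z \<in> K' \<times> {\<sigma>..\<sigma>'} \<longrightarrow> (\<forall>i. V i z = Du (fst z) (snd z) $ i)"
  obtains a where "a \<in> borel_measurable borel" "\<And>z. z \<notin> K \<times> {\<sigma>..\<sigma>'} \<Longrightarrow> a z = 0"
    "AE z in lborel. z \<in> K \<times> {\<sigma>..\<sigma>'} \<longrightarrow> a z = F (fst z) (snd z) (u (fst z) (snd z)) (Du (fst z) (snd z))"
proof -
  let ?C = "K \<times> {\<sigma>..\<sigma>'}"
  have cC: "compact ?C" using K by (intro compact_Times) auto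
  have Cb: "?C \<in> sets borel" using cC by (rule borel_compact)
  have sub: "?C \<subseteq> \<Omega> \<times> {0..T}" "?C \<subseteq> K' \<times> {\<sigma>..\<sigma>'}" using K\<Omega> KK' \<sigma> by auto
  define G where "G z w = F (fst z) (snd z) (fst w) (snd w)" for z w
  define w where "w z = (U z, (\<chi> i. V i z))" for z
  have "(\<lambda>z. \<chi> i. V i z) \<in> borel_measurable borel"
  proof (subst borel_measurable_euclidean_space, intro ballI)
    fix e :: "real^'n" assume "e \<in> Basis"
    then obtain i where "e = axis i 1" by (auto simp: Basis_vec_def)
    then show "(\<lambda>z. (\<chi> i. V i z) \<bullet> e) \<in> borel_measurable borel" using V(1)[of i] by (simp add: inner_axis)
  qed
  then have "w \<in> borel_measurable borel" unfolding w_def using U(1) by measurable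
  then have wm: "w \<in> borel_measurable lebesgue" by (intro measurable_completion) simp
  have Gm: "(\<lambda>z. indicator ?C z * G z y) \<in> borel_measurable lebesgue" for y
  proof -
    have "(\<lambda>z. indicator (\<Omega> \<times> {0..T}) z *\<^sub>R (case z of (x, t) \<Rightarrow> F x t (fst y) (snd y))) \<in> borel_measurable lebesgue"
      using F(1)[of "fst y" "snd y"] unfolding set_borel_measurable_def .
    then have "(\<lambda>z. indicator ?C z * (indicator (\<Omega> \<times> {0..T}) z *\<^sub>R (case z of (x, t) \<Rightarrow> F x t (fst y) (snd y)))) \<in> borel_measurable lebesgue"
      using Cb by (intro borel_measurable_times borel_measurable_indicator) auto
    also have "(\<lambda>z. indicator ?C z * (indicator (\<Omega> \<times> {0..T}) z *\<^sub>R (case z of (x, t) \<Rightarrow> F x t (fst y) (snd y)))) = (\<lambda>z. indicator ?C z * G z y)"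
    proof
      fix z
      show "indicator ?C z * (indicator (\<Omega> \<times> {0..T}) z *\<^sub>R (case z of (x, t) \<Rightarrow> F x t (fst y) (snd y))) = indicator ?C z * G z y"
      proof (cases "z \<in> ?C")
        case True
        then have "z \<in> \<Omega> \<times> {0..T}" using sub(1) by (rule rev_subsetD)
        then show ?thesis by (simp add: G_def case_prod_unfold)
      qed simp
    qed
    finally show ?thesis .
  qed
  have cont: "AE z in lebesgue. z \<in> ?C \<longrightarrow> continuous_on UNIV (G z)"
    using F(2)
  proof eventually_elim
    case (elim z)
    show ?case
    proof
      assume "z \<in> ?C"
      then have z: "z \<in> \<Omega> \<times> {0..T}" using sub(1) by (rule rev_subsetD)
      have eq: "G z = (\<lambda>(s, \<xi>). F (fst z) (snd z) s \<xi>)" by (auto simp: G_def fun_eq_iff)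
      show "continuous_on UNIV (G z)" unfolding eq using elim z by (cases z) simp
    qed
  qed
  from caratheodory_compose_measurable[OF Gm cont wm]
  have "set_borel_measurable lebesgue ?C (\<lambda>z. G z (w z))" unfolding set_borel_measurable_def by simp
  then obtain a where a: "a \<in> borel_measurable borel" "\<And>z. z \<notin> ?C \<Longrightarrow> a z = 0" "AE z in lborel. z \<in> ?C \<longrightarrow> a z = G z (w z)"
    by (rule borel_representative[OF _ Cb]) (rule that)
  have ae: "AE z in lborel. z \<in> ?C \<longrightarrow> a z = F (fst z) (snd z) (u (fst z) (snd z)) (Du (fst z) (snd z))"
    using a(3) U(2) V(2)
  proof eventually_elim
    case (elim z)
    show ?case
    proof
      assume z: "z \<in> ?C"
      then have "z \<in> K' \<times> {\<sigma>..\<sigma>'}" using sub by blast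
      then have "w z = (u (fst z) (snd z), Du (fst z) (snd z))" using elim by (simp add: w_def vec_eq_iff)
      then show "a z = F (fst z) (snd z) (u (fst z) (snd z)) (Du (fst z) (snd z))" using elim z by (simp add: G_def)
    qed
  qed
  show ?thesis by (rule that[of a]) (rule a(1,2) ae | assumption)+
qed

end

section \<open>Replacing all data by Borel functions, and the tested equation\<close>

lemma integral_lebesgue_transfer:
  fixes f g :: "'a::euclidean_space \<Rightarrow> real"
  assumes f: "integrable lborel f" and eq: "AE x in lborel. f x = g x"
  shows "integrable lebesgue g" and "(\<integral>x. g x \<partial>lebesgue) = (\<integral>x. f x \<partial>lborel)"
proof -
  have fb: "f \<in> borel_measurable borel" using f by (auto dest: borel_measurable_integrable)
  then have fm: "f \<in> borel_measurable lebesgue" by (intro measurable_completion) simp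
  have fi: "integrable lebesgue f" using f fb by (subst integrable_completion) auto
  have eq': "AE x in lebesgue. f x = g x" using eq unfolding AE_completion_iff .
  show "integrable lebesgue g"
    using fi borel_measurable_lebesgue_cong_AE[OF fm eq'] eq' by (rule integrable_cong_AE_imp)
  show "(\<integral>x. g x \<partial>lebesgue) = (\<integral>x. f x \<partial>lborel)"
    by (rule integral_lborel_eq_lebesgue_AE[OF fb eq'])
qed

lemma integrable_product_young:
  fixes f g :: "'a::euclidean_space \<Rightarrow> real"
  assumes [measurable]: "f \<in> borel_measurable borel" "g \<in> borel_measurable borel" and q: "1 < q"
    and f: "integrable lborel (\<lambda>x. \<bar>f x\<bar> powr (q / (q - 1)))" and g: "integrable lborel (\<lambda>x. \<bar>g x\<bar> powr q)"
  shows "integrable lborel (\<lambda>x. f x * g x)"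
proof (rule Bochner_Integration.integrable_bound)
  show "integrable lborel (\<lambda>x. \<bar>f x\<bar> powr (q / (q - 1)) + \<bar>g x\<bar> powr q)" using f g by simp
  show "AE x in lborel. norm (f x * g x) \<le> norm (\<bar>f x\<bar> powr (q / (q - 1)) + \<bar>g x\<bar> powr q)"
  proof (rule AE_I2)
    fix x
    have "\<bar>f x\<bar> * \<bar>g x\<bar> \<le> 1 * \<bar>f x\<bar> powr (q / (q - 1)) + 1 powr (1 - q) * \<bar>g x\<bar> powr q"
      using q by (intro conjugate_young) auto
    then show "norm (f x * g x) \<le> norm (\<bar>f x\<bar> powr (q / (q - 1)) + \<bar>g x\<bar> powr q)"
      by (simp add: abs_mult)
  qed
qed measurable

text \<open>All data on the time interval from \<sigma> to \<sigma>' are replaced by Borel functions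
  on the whole space, so that Fubini and translation arguments can run in \<open>lborel\<close>.
  Extending \<open>a\<close> and \<open>b\<close> by zero makes them globally integrable.\<close>

locale represented_setting = cutoff_setting +
  fixes \<sigma> \<sigma>' d :: real and U :: "(real^'n) \<times> real \<Rightarrow> real" and V a :: "'n \<Rightarrow> (real^'n) \<times> real \<Rightarrow> real"
    and b :: "(real^'n) \<times> real \<Rightarrow> real"
  assumes \<sigma>: "0 < \<sigma>" "\<sigma> < \<sigma>'" "\<sigma>' < T"
    and U: "U \<in> borel_measurable borel" "\<And>z. 0 \<le> U z"
      "AE z in lborel. z \<in> K' \<times> {\<sigma>..\<sigma>'} \<longrightarrow> U z = u (fst z) (snd z)" "integrable lborel U"
    and V: "\<And>i. V i \<in> borel_measurable borel" "\<And>i z. z \<notin> K' \<times> {\<sigma>..\<sigma>'} \<Longrightarrow> V i z = 0"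
      "AE z in lborel. z \<in> K' \<times> {\<sigma>..\<sigma>'} \<longrightarrow> (\<forall>i. V i z = Du (fst z) (snd z) $ i)"
      "\<And>i. integrable lborel (V i)" "\<And>i. integrable lborel (\<lambda>z. \<bar>V i z\<bar> powr p i)"
    and a: "\<And>i. a i \<in> borel_measurable borel" "\<And>i z. z \<notin> K \<times> {\<sigma>..\<sigma>'} \<Longrightarrow> a i z = 0"
      "\<And>i. AE z in lborel. z \<in> K \<times> {\<sigma>..\<sigma>'} \<longrightarrow> a i z = A (fst z) (snd z) (u (fst z) (snd z)) (Du (fst z) (snd z)) $ i"
    and b: "b \<in> borel_measurable borel" "\<And>z. z \<notin> K \<times> {\<sigma>..\<sigma>'} \<Longrightarrow> b z = 0"
      "AE z in lborel. z \<in> K \<times> {\<sigma>..\<sigma>'} \<longrightarrow> b z = B (fst z) (snd z) (u (fst z) (snd z)) (Du (fst z) (snd z))"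
    and conv: "0 < d" "AE \<tau> in lborel. \<tau> \<in> {\<sigma>..\<sigma>'} \<longrightarrow> (\<forall>i r x. 0 < r \<longrightarrow> r < d \<longrightarrow> x \<in> K \<longrightarrow>
      conv (\<lambda>x. U (x, \<tau>)) (dir_deriv (axis i 1) (mollifier r)) x = conv (\<lambda>x. V i (x, \<tau>)) (mollifier r) x)"

lemma (in cutoff_setting) represented_exists:
  assumes \<sigma>: "0 < \<sigma>" "\<sigma> < \<sigma>'" "\<sigma>' < T"
  shows "\<exists>d U V a b. represented_setting p C\<^sub>o C\<^sub>1 C T \<Omega> K K' S A B u Du Du' \<zeta> \<sigma> \<sigma>' d U V a b"
proof -
  obtain U where U: "U \<in> borel_measurable borel" "\<And>z. 0 \<le> U z"
    "AE z in lborel. z \<in> K' \<times> {\<sigma>..\<sigma>'} \<longrightarrow> U z = u (fst z) (snd z)" "integrable lborel U"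
    by (rule function_representative[OF \<sigma>(1,3)]) (rule that)
  obtain V where V: "\<And>i. V i \<in> borel_measurable borel" "\<And>i z. z \<notin> K' \<times> {\<sigma>..\<sigma>'} \<Longrightarrow> V i z = 0"
    "AE z in lborel. z \<in> K' \<times> {\<sigma>..\<sigma>'} \<longrightarrow> (\<forall>i. V i z = Du (fst z) (snd z) $ i)"
    "\<And>i. integrable lborel (V i)" "\<And>i. integrable lborel (\<lambda>z. \<bar>V i z\<bar> powr p i)"
    by (rule gradient_representative[OF \<sigma>(1,3) Du]) (rule that)
  obtain d where d: "0 < d" "AE \<tau> in lborel. \<tau> \<in> {\<sigma>..\<sigma>'} \<longrightarrow> (\<forall>i r x. 0 < r \<longrightarrow> r < d \<longrightarrow> x \<in> K \<longrightarrow>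
      conv (\<lambda>x. U (x, \<tau>)) (dir_deriv (axis i 1) (mollifier r)) x = conv (\<lambda>x. V i (x, \<tau>)) (mollifier r) x)"
    by (rule slice_conv[OF \<sigma>(1,3) Du U(1,3) V(1,3)]) (rule that)
  have "\<forall>i. \<exists>a. a \<in> borel_measurable borel \<and> (\<forall>z. z \<notin> K \<times> {\<sigma>..\<sigma>'} \<longrightarrow> a z = 0) \<and>
    (AE z in lborel. z \<in> K \<times> {\<sigma>..\<sigma>'} \<longrightarrow> a z = A (fst z) (snd z) (u (fst z) (snd z)) (Du (fst z) (snd z)) $ i)"
  proof
    fix i
    show "\<exists>a. a \<in> borel_measurable borel \<and> (\<forall>z. z \<notin> K \<times> {\<sigma>..\<sigma>'} \<longrightarrow> a z = 0) \<and>
      (AE z in lborel. z \<in> K \<times> {\<sigma>..\<sigma>'} \<longrightarrow> a z = A (fst z) (snd z) (u (fst z) (snd z)) (Du (fst z) (snd z)) $ i)"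
    proof (rule composition_representative[OF \<sigma>(1,3) _ _ U(1,3) V(1,3), of "\<lambda>x t s \<xi>. A x t s \<xi> $ i"])
      fix s \<xi>
      have "set_borel_measurable lebesgue (\<Omega> \<times> {0..T}) (\<lambda>(x, t). A x t s \<xi>)"
        using carA unfolding caratheodory_def by blast
      then have "(\<lambda>z. (indicator (\<Omega> \<times> {0..T}) z *\<^sub>R (case z of (x, t) \<Rightarrow> A x t s \<xi>)) \<bullet> axis i 1) \<in> borel_measurable lebesgue"
        unfolding set_borel_measurable_def by (intro borel_measurable_inner) auto
      then show "set_borel_measurable lebesgue (\<Omega> \<times> {0..T}) (\<lambda>(x, t). A x t s \<xi> $ i)"
        unfolding set_borel_measurable_def by (simp add: inner_axis case_prod_unfold)
    next
      have "AE (x, t) in lebesgue. (x, t) \<in> \<Omega> \<times> {0..T} \<longrightarrow> continuous_on UNIV (\<lambda>(s, \<xi>). A x t s \<xi>)"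
        using carA unfolding caratheodory_def by blast
      then show "AE (x, t) in lebesgue. (x, t) \<in> \<Omega> \<times> {0..T} \<longrightarrow> continuous_on UNIV (\<lambda>(s, \<xi>). A x t s \<xi> $ i)"
      proof eventually_elim
        case (elim z)
        then show ?case by (cases z) (auto simp: case_prod_unfold intro: continuous_on_component)
      qed
    qed blast
  qed
  from choice[OF this] obtain a where a: "\<forall>i. a i \<in> borel_measurable borel \<and> (\<forall>z. z \<notin> K \<times> {\<sigma>..\<sigma>'} \<longrightarrow> a i z = 0) \<and>
    (AE z in lborel. z \<in> K \<times> {\<sigma>..\<sigma>'} \<longrightarrow> a i z = A (fst z) (snd z) (u (fst z) (snd z)) (Du (fst z) (snd z)) $ i)" ..
  obtain b where b: "b \<in> borel_measurable borel" "\<And>z. z \<notin> K \<times> {\<sigma>..\<sigma>'} \<Longrightarrow> b z = 0"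
    "AE z in lborel. z \<in> K \<times> {\<sigma>..\<sigma>'} \<longrightarrow> b z = B (fst z) (snd z) (u (fst z) (snd z)) (Du (fst z) (snd z))"
  proof (rule composition_representative[OF \<sigma>(1,3) _ _ U(1,3) V(1,3), of B])
    show "set_borel_measurable lebesgue (\<Omega> \<times> {0..T}) (\<lambda>(x, t). B x t s \<xi>)" for s \<xi>
      using carB unfolding caratheodory_def by blast
    show "AE (x, t) in lebesgue. (x, t) \<in> \<Omega> \<times> {0..T} \<longrightarrow> continuous_on UNIV (\<lambda>(s, \<xi>). B x t s \<xi>)"
      using carB unfolding caratheodory_def by blast
  qed (rule that)
  have "represented_setting_axioms p T K K' A B u Du \<sigma> \<sigma>' d U V a b"
    using a b d \<sigma> U V by (intro represented_setting_axioms.intro) blast+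
  then have "represented_setting p C\<^sub>o C\<^sub>1 C T \<Omega> K K' S A B u Du Du' \<zeta> \<sigma> \<sigma>' d U V a b"
    by (rule represented_setting.intro[OF cutoff_setting_axioms])
  then show ?thesis by blast
qed

context represented_setting
begin

lemma representatives_measurable [measurable]: "U \<in> borel_measurable borel" "V i \<in> borel_measurable borel"
  "a i \<in> borel_measurable borel" "b \<in> borel_measurable borel"
  by (rule U(1) V(1) a(1) b(1))+

lemma cylinder: "compact (K \<times> {\<sigma>..\<sigma>'})" "K \<times> {\<sigma>..\<sigma>'} \<in> sets borel" "K \<times> {\<sigma>..\<sigma>'} \<subseteq> K' \<times> {\<sigma>..\<sigma>'}"
  "K \<times> {\<sigma>..\<sigma>'} \<subseteq> \<Omega> \<times> {0..T}" "integrable lborel (indicator (K \<times> {\<sigma>..\<sigma>'}) :: _ \<Rightarrow> real)"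
proof -
  show c: "compact (K \<times> {\<sigma>..\<sigma>'})" using K by (intro compact_Times) auto
  then show b: "K \<times> {\<sigma>..\<sigma>'} \<in> sets borel" by (rule borel_compact)
  show "K \<times> {\<sigma>..\<sigma>'} \<subseteq> K' \<times> {\<sigma>..\<sigma>'}" using KK' by auto
  show "K \<times> {\<sigma>..\<sigma>'} \<subseteq> \<Omega> \<times> {0..T}" using K\<Omega> \<sigma> by auto
  show "integrable lborel (indicator (K \<times> {\<sigma>..\<sigma>'}) :: _ \<Rightarrow> real)"
    using b emeasure_bounded_finite[OF compact_imp_bounded[OF c]] by (intro integrable_real_indicator) auto
qed

lemma structure_AE:
  "AE z in lborel. z \<in> K \<times> {\<sigma>..\<sigma>'} \<longrightarrow>
    (\<forall>i. C\<^sub>o * \<bar>V i z\<bar> powr p i - C powr p i \<le> a i z * V i z) \<and>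
    (\<forall>i. \<bar>a i z\<bar> \<le> C\<^sub>1 * \<bar>V i z\<bar> powr (p i - 1) + C powr (p i - 1)) \<and>
    \<bar>b z\<bar> \<le> (\<Sum>i\<in>UNIV. C * (\<bar>V i z\<bar> powr (p i - 1) + C powr (p i - 1)))"
proof -
  have "AE z in lborel. \<forall>i. z \<in> K \<times> {\<sigma>..\<sigma>'} \<longrightarrow> a i z = A (fst z) (snd z) (u (fst z) (snd z)) (Du (fst z) (snd z)) $ i"
    using a(3) by (subst AE_all_countable) blast
  with str[unfolded structure_conditions_def AE_completion_iff] V(3) b(3) show ?thesis
  proof eventually_elim
    case (elim z)
    show ?case
    proof
      assume z: "z \<in> K \<times> {\<sigma>..\<sigma>'}"
      obtain x t where xt: "z = (x, t)" by (cases z)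
      have "(x, t) \<in> \<Omega> \<times> {0..T}" "z \<in> K' \<times> {\<sigma>..\<sigma>'}" using z cylinder xt by blast+
      then show "(\<forall>i. C\<^sub>o * \<bar>V i z\<bar> powr p i - C powr p i \<le> a i z * V i z) \<and>
        (\<forall>i. \<bar>a i z\<bar> \<le> C\<^sub>1 * \<bar>V i z\<bar> powr (p i - 1) + C powr (p i - 1)) \<and>
        \<bar>b z\<bar> \<le> (\<Sum>i\<in>UNIV. C * (\<bar>V i z\<bar> powr (p i - 1) + C powr (p i - 1)))"
        using elim z unfolding xt by simp
    qed
  qed
qed

text \<open>The growth condition puts the flux in the exponent dual to that of the gradient. On a
  cylinder of finite measure this includes L1, which the translation argument needs as well.\<close>

lemma flux_integrable: "integrable lborel (\<lambda>z. \<bar>a i z\<bar> powr (p i / (p i - 1)))" "integrable lborel (a i)"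
proof -
  let ?I = "indicator (K \<times> {\<sigma>..\<sigma>'}) :: _ \<Rightarrow> real"
  let ?q = "p i / (p i - 1)"
  have q: "1 < ?q" "0 < p i - 1" using p[of i] by (auto simp: less_divide_eq)
  show 1: "integrable lborel (\<lambda>z. \<bar>a i z\<bar> powr ?q)"
  proof (rule Bochner_Integration.integrable_bound)
    show "integrable lborel (\<lambda>z. 2 powr ?q * (C\<^sub>1 powr ?q * \<bar>V i z\<bar> powr p i + C powr p i * ?I z))"
      using V(5)[of i] cylinder(5) by simp
    show "AE z in lborel. norm (\<bar>a i z\<bar> powr ?q) \<le> norm (2 powr ?q * (C\<^sub>1 powr ?q * \<bar>V i z\<bar> powr p i + C powr p i * ?I z))"
      using structure_AE
    proof eventually_elim
      case (elim z)
      show ?case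
      proof (cases "z \<in> K \<times> {\<sigma>..\<sigma>'}")
        case True
        then have "\<bar>a i z\<bar> powr ?q \<le> (C\<^sub>1 * \<bar>V i z\<bar> powr (p i - 1) + C powr (p i - 1)) powr ?q"
          using elim q by (intro powr_mono2) auto
        also have "\<dots> \<le> 2 powr ?q * ((C\<^sub>1 * \<bar>V i z\<bar> powr (p i - 1)) powr ?q + (C powr (p i - 1)) powr ?q)"
          using C q by (intro powr_add_bound) auto
        also have "\<dots> = 2 powr ?q * (C\<^sub>1 powr ?q * \<bar>V i z\<bar> powr p i + C powr p i)"
          using C q by (simp add: powr_mult powr_powr)
        finally show ?thesis using True by simp
      next
        case False
        then show ?thesis using a(2)[of z i] by simp
      qed
    qed
  qed measurable
  show "integrable lborel (a i)"
  proof (rule Bochner_Integration.integrable_bound)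
    show "integrable lborel (\<lambda>z. ?I z + \<bar>a i z\<bar> powr ?q)" using 1 cylinder(5) by simp
    have "x \<le> 1 + x powr ?q" if "0 \<le> x" for x :: real
    proof (cases "x \<le> 1")
      case False
      then have "x powr 1 \<le> x powr ?q" using q by (intro powr_mono) auto
      then show ?thesis using False by simp
    qed (use that in \<open>simp add: add_increasing2\<close>)
    then show "AE z in lborel. norm (a i z) \<le> norm (?I z + \<bar>a i z\<bar> powr ?q)"
      using a(2)[of _ i] by (intro AE_I2) (auto simp: indicator_def)
  qed measurable
qed

text \<open>\<open>\<bar>V i z\<bar> powr (p i - 1)\<close> is dominated by
  \<open>1 + \<bar>V i z\<bar> powr p i\<close>. L1 suffices because the source is paired only with
  bounded weights.\<close>

lemma source_integrable: "integrable lborel b"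
proof (rule Bochner_Integration.integrable_bound)
  let ?I = "indicator (K \<times> {\<sigma>..\<sigma>'}) :: _ \<Rightarrow> real"
  show "integrable lborel (\<lambda>z. \<Sum>i\<in>UNIV. C * (?I z + \<bar>V i z\<bar> powr p i + C powr (p i - 1) * ?I z))"
    using V(5) cylinder(5) by (intro Bochner_Integration.integrable_sum) simp
  show "AE z in lborel. norm (b z) \<le> norm (\<Sum>i\<in>UNIV. C * (?I z + \<bar>V i z\<bar> powr p i + C powr (p i - 1) * ?I z))"
    using structure_AE
  proof eventually_elim
    case (elim z)
    show ?case
    proof (cases "z \<in> K \<times> {\<sigma>..\<sigma>'}")
      case True
      have le: "x powr (q - 1) \<le> 1 + x powr q" if "0 \<le> x" "1 < q" for x q :: real
      proof (cases "x \<le> 1")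
        case True
        then have "x powr (q - 1) \<le> 1" using that by (intro powr_le1) auto
        then show ?thesis by (simp add: add_increasing2)
      next
        case False
        then have "x powr (q - 1) \<le> x powr q" by (intro powr_mono) auto
        then show ?thesis by simp
      qed
      have "\<bar>b z\<bar> \<le> (\<Sum>i\<in>UNIV. C * (\<bar>V i z\<bar> powr (p i - 1) + C powr (p i - 1)))" using elim True by blast
      also have "\<dots> \<le> (\<Sum>i\<in>UNIV. C * (1 + \<bar>V i z\<bar> powr p i + C powr (p i - 1)))"
        using C p le by (intro sum_mono mult_left_mono add_mono) auto
      finally show ?thesis using True by simp
    next
      case False
      then show ?thesis using b(2)[of z] by simp
    qed
  qed
qed measurable

text \<open>The sub- and the supersolution inequality combine to an equality for time-independent
  tests. They come with different gradients, but these agree almost everywhere on the cylinder, so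
  both lead to the same integrals of \<open>a\<close> and \<open>b\<close>. The boundary terms keep
  \<open>u\<close> itself, since \<open>t\<^sub>1\<close> and \<open>t\<^sub>2\<close> are
  individual times at which a representative given almost everywhere says nothing.\<close>

lemma weak_identity:
  fixes \<phi> :: "real^'n \<Rightarrow> real" and D :: "'n \<Rightarrow> real^'n \<Rightarrow> real"
  assumes \<phi>: "\<phi> \<in> borel_measurable borel" "\<And>x. 0 \<le> \<phi> x" "\<And>x. \<phi> x \<le> c"
    and D: "\<And>i. D i \<in> borel_measurable borel" "\<And>i. integrable lborel (\<lambda>x. indicator K x * \<bar>D i x\<bar> powr p i)"
    and W: "W11_o K \<phi> (\<lambda>x. \<chi> i. D i x)"
    and t: "\<sigma> \<le> t\<^sub>1" "t\<^sub>1 \<le> t\<^sub>2" "t\<^sub>2 \<le> \<sigma>'"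
  shows "(\<integral>x. indicator K x * (u x t\<^sub>2 * \<phi> x) \<partial>lebesgue) - (\<integral>x. indicator K x * (u x t\<^sub>1 * \<phi> x) \<partial>lebesgue)
    = (\<integral>z. indicator {t\<^sub>1..t\<^sub>2} (snd z) * (b z * \<phi> (fst z) - (\<Sum>i\<in>UNIV. a i z * D i (fst z))) \<partial>lborel)"
proof -
  note [measurable] = \<phi>(1) D(1)
  let ?D = "\<lambda>x. \<chi> i. D i x"
  let ?Q = "K \<times> {t\<^sub>1..t\<^sub>2}"
  have Qsub: "?Q \<subseteq> K \<times> {\<sigma>..\<sigma>'}" using t by auto
  have c0: "0 \<le> c" using \<phi>(2,3)[of 0] by linarith
  let ?Ii = "\<lambda>z::(real^'n) \<times> real. indicator {t\<^sub>1..t\<^sub>2} (snd z) :: real"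
  have i1: "integrable lborel (\<lambda>z. ?Ii z * (a i z * D i (fst z)))" for i
  proof -
    have "integrable lborel (\<lambda>z. a i z * (indicator K (fst z) * D i (fst z) * indicator {\<sigma>..\<sigma>'} (snd z)))"
    proof (rule integrable_product_young[OF _ _ p(1)[of i] flux_integrable(1)])
      have "integrable lborel (indicator {\<sigma>..\<sigma>'} :: real \<Rightarrow> real)"
        using emeasure_lborel_Icc_eq[of \<sigma> \<sigma>'] by (intro integrable_real_indicator) auto
      note P = integrable_lborel_product(1)[OF D(2)[of i] this]
      also have "(\<lambda>z. indicator K (fst z) * \<bar>D i (fst z)\<bar> powr p i * indicator {\<sigma>..\<sigma>'} (snd z))
        = (\<lambda>z. \<bar>indicator K (fst z) * D i (fst z) * indicator {\<sigma>..\<sigma>'} (snd z)\<bar> powr p i)"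
        by (auto simp: indicator_def fun_eq_iff)
      finally show "integrable lborel (\<lambda>z. \<bar>indicator K (fst z) * D i (fst z) * indicator {\<sigma>..\<sigma>'} (snd z)\<bar> powr p i)" .
    qed measurable
    also have "(\<lambda>z. a i z * (indicator K (fst z) * D i (fst z) * indicator {\<sigma>..\<sigma>'} (snd z))) = (\<lambda>z. a i z * D i (fst z))"
    proof
      fix z show "a i z * (indicator K (fst z) * D i (fst z) * indicator {\<sigma>..\<sigma>'} (snd z)) = a i z * D i (fst z)"
        using a(2)[of z i] by (cases "z \<in> K \<times> {\<sigma>..\<sigma>'}") (auto simp: mem_Times_iff)
    qed
    finally have "integrable lborel (\<lambda>z. a i z * D i (fst z))" .
    from integrable_mult_indicator[OF _ this, of "UNIV \<times> {t\<^sub>1..t\<^sub>2}"]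
    have "integrable lborel (\<lambda>z. indicator (UNIV \<times> {t\<^sub>1..t\<^sub>2}) z *\<^sub>R (a i z * D i (fst z)))"
      by (simp add: borel_closed closed_Times)
    also have "(\<lambda>z. indicator (UNIV \<times> {t\<^sub>1..t\<^sub>2}) z *\<^sub>R (a i z * D i (fst z))) = (\<lambda>z. ?Ii z * (a i z * D i (fst z)))"
      by (auto simp: indicator_def fun_eq_iff)
    finally show ?thesis .
  qed
  have i2: "integrable lborel (\<lambda>z. ?Ii z * (b z * \<phi> (fst z)))"
  proof (rule Bochner_Integration.integrable_bound)
    show "integrable lborel (\<lambda>z. c * b z)" using source_integrable by simp
    show "AE z in lborel. norm (?Ii z * (b z * \<phi> (fst z))) \<le> norm (c * b z)"
    proof (rule AE_I2)
      fix z
      have "\<bar>b z\<bar> * \<phi> (fst z) \<le> \<bar>b z\<bar> * c" using \<phi> by (intro mult_left_mono) auto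
      then show "norm (?Ii z * (b z * \<phi> (fst z))) \<le> norm (c * b z)"
        using \<phi>(2) c0 by (auto simp: abs_mult indicator_def mult.commute)
    qed
  qed measurable
  \<comment> \<open>Stated for any \<open>G\<close> that agrees with \<open>Du\<close> almost
    everywhere, so that it applies to \<open>Du\<close> and \<open>Du'\<close> alike.\<close>
  have key: "set_integrable lebesgue ?Q (\<lambda>(x, t). A x t (u x t) (G x t) $ i * ?D x $ i)"
    "set_integrable lebesgue ?Q (\<lambda>(x, t). B x t (u x t) (G x t) * \<phi> x)"
    "weak_lhs A u G K t\<^sub>1 t\<^sub>2 (\<lambda>x t. \<phi> x) (\<lambda>x t. 0) (\<lambda>x t. ?D x)
      = (\<integral>x. indicator K x * (u x t\<^sub>2 * \<phi> x) \<partial>lebesgue) - (\<integral>x. indicator K x * (u x t\<^sub>1 * \<phi> x) \<partial>lebesgue)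
        + (\<integral>z. (\<Sum>i\<in>UNIV. ?Ii z * (a i z * D i (fst z))) \<partial>lborel)"
    "weak_rhs B u G K t\<^sub>1 t\<^sub>2 (\<lambda>x t. \<phi> x) = (\<integral>z. ?Ii z * (b z * \<phi> (fst z)) \<partial>lborel)"
    if G: "AE z in lborel. z \<in> K \<times> {\<sigma>..\<sigma>'} \<longrightarrow> G (fst z) (snd z) = Du (fst z) (snd z)" for G i
  proof -
    have "AE z in lborel. \<forall>i. z \<in> K \<times> {\<sigma>..\<sigma>'} \<longrightarrow> a i z = A (fst z) (snd z) (u (fst z) (snd z)) (Du (fst z) (snd z)) $ i"
      using a(3) by (subst AE_all_countable) blast
    with G b(3) have ae: "AE z in lborel. z \<in> K \<times> {\<sigma>..\<sigma>'} \<longrightarrow>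
      (\<forall>i. a i z = A (fst z) (snd z) (u (fst z) (snd z)) (G (fst z) (snd z)) $ i) \<and> b z = B (fst z) (snd z) (u (fst z) (snd z)) (G (fst z) (snd z))"
      by eventually_elim simp
    have e1: "AE z in lborel. ?Ii z * (a i z * D i (fst z)) = indicator ?Q z *\<^sub>R (case z of (x, t) \<Rightarrow> A x t (u x t) (G x t) $ i * ?D x $ i)" for i
      using ae
    proof eventually_elim
      case (elim z)
      show ?case
      proof (cases "z \<in> K \<times> {\<sigma>..\<sigma>'}")
        case True
        then show ?thesis using elim by (auto simp: case_prod_unfold indicator_def mem_Times_iff)
      next
        case False
        then have "z \<notin> ?Q" using Qsub by blast
        then show ?thesis using a(2)[OF False] by simp
      qed
    qed
    have e2: "AE z in lborel. ?Ii z * (b z * \<phi> (fst z)) = indicator ?Q z *\<^sub>R (case z of (x, t) \<Rightarrow> B x t (u x t) (G x t) * \<phi> x)"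
      using ae
    proof eventually_elim
      case (elim z)
      show ?case
      proof (cases "z \<in> K \<times> {\<sigma>..\<sigma>'}")
        case True
        then show ?thesis using elim by (auto simp: case_prod_unfold indicator_def mem_Times_iff)
      next
        case False
        then have "z \<notin> ?Q" using Qsub by blast
        then show ?thesis using b(2)[OF False] by simp
      qed
    qed
    show "set_integrable lebesgue ?Q (\<lambda>(x, t). A x t (u x t) (G x t) $ i * ?D x $ i)"
      unfolding set_integrable_def by (rule integral_lebesgue_transfer(1)[OF i1 e1])
    show "set_integrable lebesgue ?Q (\<lambda>(x, t). B x t (u x t) (G x t) * \<phi> x)"
      unfolding set_integrable_def by (rule integral_lebesgue_transfer(1)[OF i2 e2])
    show "weak_rhs B u G K t\<^sub>1 t\<^sub>2 (\<lambda>x t. \<phi> x) = (\<integral>z. ?Ii z * (b z * \<phi> (fst z)) \<partial>lborel)"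
      unfolding weak_rhs_def set_lebesgue_integral_def by (rule integral_lebesgue_transfer(2)[OF i2 e2])
    have i3: "integrable lborel (\<lambda>z. \<Sum>i\<in>UNIV. ?Ii z * (a i z * D i (fst z)))"
      by (intro Bochner_Integration.integrable_sum i1)
    have "AE z in lborel. \<forall>i. ?Ii z * (a i z * D i (fst z)) = indicator ?Q z *\<^sub>R (case z of (x, t) \<Rightarrow> A x t (u x t) (G x t) $ i * ?D x $ i)"
      using e1 by (subst AE_all_countable) blast
    then have e3: "AE z in lborel. (\<Sum>i\<in>UNIV. ?Ii z * (a i z * D i (fst z)))
        = indicator ?Q z *\<^sub>R (case z of (x, t) \<Rightarrow> - u x t * 0 + (\<Sum>i\<in>UNIV. A x t (u x t) (G x t) $ i * ?D x $ i))"
    proof eventually_elim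
      case (elim z)
      have "(\<Sum>i\<in>UNIV. ?Ii z * (a i z * D i (fst z)))
        = (\<Sum>i\<in>UNIV. indicator ?Q z *\<^sub>R (case z of (x, t) \<Rightarrow> A x t (u x t) (G x t) $ i * ?D x $ i))"
        by (rule sum.cong[OF refl elim[rule_format]])
      also have "\<dots> = indicator ?Q z *\<^sub>R (case z of (x, t) \<Rightarrow> - u x t * 0 + (\<Sum>i\<in>UNIV. A x t (u x t) (G x t) $ i * ?D x $ i))"
        by (cases z) (simp add: sum_distrib_left)
      finally show ?case .
    qed
    show "weak_lhs A u G K t\<^sub>1 t\<^sub>2 (\<lambda>x t. \<phi> x) (\<lambda>x t. 0) (\<lambda>x t. ?D x)
      = (\<integral>x. indicator K x * (u x t\<^sub>2 * \<phi> x) \<partial>lebesgue) - (\<integral>x. indicator K x * (u x t\<^sub>1 * \<phi> x) \<partial>lebesgue)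
        + (\<integral>z. (\<Sum>i\<in>UNIV. ?Ii z * (a i z * D i (fst z))) \<partial>lborel)"
      unfolding weak_lhs_def set_lebesgue_integral_def integral_lebesgue_transfer(2)[OF i3 e3] by simp
  qed
  have adm: "admissible_test p A B T u G K t\<^sub>1 t\<^sub>2 (\<lambda>x t. \<phi> x) (\<lambda>x t. 0) (\<lambda>x t. ?D x)"
    if "AE z in lborel. z \<in> K \<times> {\<sigma>..\<sigma>'} \<longrightarrow> G (fst z) (snd z) = Du (fst z) (snd z)" for G
    using key(1,2)[OF that] D by (intro admissible_test_space[where b = c] K W \<phi>) auto
  have ordt: "0 \<le> t\<^sub>1" "t\<^sub>1 \<le> t\<^sub>2" "t\<^sub>2 \<le> T" using t \<sigma> by auto
  have G1: "AE z in lborel. z \<in> K \<times> {\<sigma>..\<sigma>'} \<longrightarrow> Du (fst z) (snd z) = Du (fst z) (snd z)" by simp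
  have G2: "AE z in lborel. z \<in> K \<times> {\<sigma>..\<sigma>'} \<longrightarrow> Du' (fst z) (snd z) = Du (fst z) (snd z)"
    by (rule gradients_agree) (use \<sigma> in auto)
  have "(\<integral>x. indicator K x * (u x t\<^sub>2 * \<phi> x) \<partial>lebesgue) - (\<integral>x. indicator K x * (u x t\<^sub>1 * \<phi> x) \<partial>lebesgue)
        + (\<integral>z. (\<Sum>i\<in>UNIV. ?Ii z * (a i z * D i (fst z))) \<partial>lborel) = (\<integral>z. ?Ii z * (b z * \<phi> (fst z)) \<partial>lborel)"
  proof (rule antisym)
    show "(\<integral>z. ?Ii z * (b z * \<phi> (fst z)) \<partial>lborel) \<le> (\<integral>x. indicator K x * (u x t\<^sub>2 * \<phi> x) \<partial>lebesgue) - (\<integral>x. indicator K x * (u x t\<^sub>1 * \<phi> x) \<partial>lebesgue)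
        + (\<integral>z. (\<Sum>i\<in>UNIV. ?Ii z * (a i z * D i (fst z))) \<partial>lborel)"
      using super[OF K(1) K\<Omega> ordt adm[OF G1]] unfolding key(3,4)[OF G1] .
    show "(\<integral>x. indicator K x * (u x t\<^sub>2 * \<phi> x) \<partial>lebesgue) - (\<integral>x. indicator K x * (u x t\<^sub>1 * \<phi> x) \<partial>lebesgue)
        + (\<integral>z. (\<Sum>i\<in>UNIV. ?Ii z * (a i z * D i (fst z))) \<partial>lborel) \<le> (\<integral>z. ?Ii z * (b z * \<phi> (fst z)) \<partial>lborel)"
      using sub[OF K(1) K\<Omega> ordt adm[OF G2]] unfolding key(3,4)[OF G2] .
  qed
  moreover have "(\<integral>z. ?Ii z * (b z * \<phi> (fst z) - (\<Sum>i\<in>UNIV. a i z * D i (fst z))) \<partial>lborel)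
    = (\<integral>z. ?Ii z * (b z * \<phi> (fst z)) - (\<Sum>i\<in>UNIV. ?Ii z * (a i z * D i (fst z))) \<partial>lborel)"
    by (intro Bochner_Integration.integral_cong refl) (simp add: right_diff_distrib sum_distrib_left)
  moreover have "\<dots> = (\<integral>z. ?Ii z * (b z * \<phi> (fst z)) \<partial>lborel) - (\<integral>z. (\<Sum>i\<in>UNIV. ?Ii z * (a i z * D i (fst z))) \<partial>lborel)"
    by (intro Bochner_Integration.integral_diff i2 Bochner_Integration.integrable_sum i1)
  ultimately show ?thesis by linarith
qed

end

section \<open>Concave powers\<close>

lemma concave_powr_bound:
  fixes x y \<alpha> :: real
  assumes "0 < x" "0 < y" "0 < \<alpha>" "\<alpha> < 1"
  shows "x powr (1 - \<alpha>) / (1 - \<alpha>) - y powr (1 - \<alpha>) / (1 - \<alpha>) \<le> y powr (- \<alpha>) * (x - y)"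
proof -
  \<comment> \<open>The weighted arithmetic-geometric mean inequality; divided by
    \<open>y powr \<alpha>\<close> it says that the graph of a concave power lies below its tangent
    at \<open>y\<close>.\<close>
  have "x powr (1 - \<alpha>) * y powr \<alpha> \<le> (1 - \<alpha>) * x + \<alpha> * y"
    using assms by (intro Youngs_inequality_0) auto
  then have "(x powr (1 - \<alpha>) * y powr \<alpha>) * y powr (- \<alpha>) \<le> ((1 - \<alpha>) * x + \<alpha> * y) * y powr (- \<alpha>)"
    by (intro mult_right_mono) auto
  moreover have "y powr \<alpha> * y powr (- \<alpha>) = 1" "y * y powr (- \<alpha>) = y powr (1 - \<alpha>)"
    using assms powr_add[of y 1 "- \<alpha>"] by (auto simp flip: powr_add)
  moreover have "y powr \<alpha> * (y powr (- \<alpha>) * x powr (1 - \<alpha>)) = x powr (1 - \<alpha>)"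
    using calculation(2) by (simp flip: mult.assoc)
  ultimately have "x powr (1 - \<alpha>) - y powr (1 - \<alpha>) \<le> (1 - \<alpha>) * (y powr (- \<alpha>) * (x - y))"
    by (simp add: algebra_simps)
  then show ?thesis using assms by (simp add: pos_divide_le_eq mult.commute flip: diff_divide_distrib)
qed

text \<open>Truncating at \<open>0\<close> makes this globally Lipschitz, as required for the continuity of the entropy
  in time.\<close>

definition truncated_power :: "real \<Rightarrow> real \<Rightarrow> real \<Rightarrow> real" where
  "truncated_power \<nu> \<alpha> s = (max 0 s + \<nu>) powr (1 - \<alpha>) / (1 - \<alpha>)"

lemma truncated_power_bound:
  assumes "0 < \<nu>" "0 < \<alpha>" "\<alpha> < 1" "0 \<le> x" "0 \<le> y"
  shows "(y - x) * (y + \<nu>) powr (- \<alpha>) \<le> truncated_power \<nu> \<alpha> y - truncated_power \<nu> \<alpha> x"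
  using concave_powr_bound[of "x + \<nu>" "y + \<nu>" \<alpha>] assms
  by (simp add: truncated_power_def algebra_simps)

lemma truncated_power_Lipschitz:
  assumes "0 < \<nu>" "0 < \<alpha>" "\<alpha> < 1"
  shows "\<bar>truncated_power \<nu> \<alpha> x - truncated_power \<nu> \<alpha> y\<bar> \<le> \<nu> powr (- \<alpha>) * \<bar>x - y\<bar>"
proof -
  have *: "truncated_power \<nu> \<alpha> x - truncated_power \<nu> \<alpha> y \<le> \<nu> powr (- \<alpha>) * \<bar>x - y\<bar>" for x y
  proof -
    have "truncated_power \<nu> \<alpha> x - truncated_power \<nu> \<alpha> y \<le> (max 0 y + \<nu>) powr (- \<alpha>) * ((max 0 x + \<nu>) - (max 0 y + \<nu>))"
      unfolding truncated_power_def using assms by (intro concave_powr_bound) auto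
    also have "\<dots> \<le> (max 0 y + \<nu>) powr (- \<alpha>) * \<bar>x - y\<bar>" by (intro mult_left_mono) auto
    also have "\<dots> \<le> \<nu> powr (- \<alpha>) * \<bar>x - y\<bar>" using assms by (intro mult_right_mono powr_mono2') auto
    finally show ?thesis .
  qed
  show ?thesis using *[of x y] *[of y x] by (auto simp: abs_minus_commute)
qed

text \<open>The source and the flux components will form one family over \<open>'n option\<close>,
  with \<open>None\<close> for the source.\<close>

lemma sum_UNIV_option:
  fixes h :: "'a::finite option \<Rightarrow> real"
  shows "(\<Sum>j\<in>UNIV. h j) = h None + (\<Sum>i\<in>UNIV. h (Some i))"
  by (simp add: UNIV_option_conv sum.reindex)

lemma nn_integral_finite:
  fixes f :: "'a \<Rightarrow> real"
  assumes "integrable M f" "\<And>x. 0 \<le> f x"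
  shows "(\<integral>\<^sup>+x. ennreal (f x) \<partial>M) < \<infinity>"
  using assms by (subst nn_integral_eq_integral) auto

text \<open>Formed with \<open>u\<close> and not with a Borel representative, because the mass is
  needed at every time and not just at almost every one.\<close>

definition (in cutoff_setting) "mass \<tau> = (\<integral>x. indicator K x * (u x \<tau> * \<zeta> x) \<partial>lebesgue)"

section \<open>The cutoff as a test function, and the change of mass\<close>

context represented_setting
begin

abbreviation "\<zeta>' i \<equiv> dir_deriv (axis i 1) \<zeta>"

lemma cutoff_continuous: "continuous_on UNIV \<zeta>" "continuous_on UNIV (\<zeta>' i)"
  using \<zeta>(1) C_k_continuous[OF \<zeta>(1)] by auto

lemma cutoff_measurable [measurable]: "\<zeta> \<in> borel_measurable borel" "\<zeta>' i \<in> borel_measurable borel"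
  by (rule borel_measurable_continuous_onI, rule cutoff_continuous)+

lemma cutoff_deriv_outside: "x \<notin> S \<Longrightarrow> \<zeta>' i x = 0"
  using dir_deriv_outside[OF compact_imp_closed[OF S(1)], of \<zeta> x "axis i 1"] \<zeta>(4) by blast

lemma cutoff_deriv_bounded: "\<exists>Z. \<forall>i x. \<bar>\<zeta>' i x\<bar> \<le> Z"
proof -
  obtain R where R: "\<And>x. x \<in> S \<Longrightarrow> norm x \<le> R"
    using compact_imp_bounded[OF S(1)] unfolding bounded_iff by blast
  have "\<forall>i. \<exists>Z. \<forall>x. \<bar>\<zeta>' i x\<bar> \<le> Z"
  proof
    fix i
    have "\<zeta>' i x = 0" if "R < norm x" for x using cutoff_deriv_outside[of x i] R[of x] that by linarith
    from bounded_compact_support[OF cutoff_continuous(2) this] show "\<exists>Z. \<forall>x. \<bar>\<zeta>' i x\<bar> \<le> Z" by metis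
  qed
  from choice[OF this] obtain Z where Z: "\<forall>i x. \<bar>\<zeta>' i x\<bar> \<le> Z i" ..
  have "\<bar>\<zeta>' i x\<bar> \<le> Max (range Z)" for i x
    by (rule order_trans[of _ "Z i"]) (use Z in auto)
  then show ?thesis by blast
qed

lemma cutoff_deriv_powr_integrable: "integrable lborel (\<lambda>x. \<bar>\<zeta>' i x\<bar> powr p i)"
proof -
  obtain Z where Z: "\<And>i x. \<bar>\<zeta>' i x\<bar> \<le> Z" using cutoff_deriv_bounded by blast
  have "integrable lborel (indicator S :: real^'n \<Rightarrow> real)"
    using S(1) emeasure_bounded_finite[OF compact_imp_bounded[OF S(1)]] by (intro integrable_real_indicator) auto
  then have "integrable lborel (\<lambda>x. Z powr p i * indicator S x)" by simp
  then show ?thesis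
  proof (rule Bochner_Integration.integrable_bound)
    have "\<bar>\<zeta>' i x\<bar> powr p i \<le> Z powr p i * indicator S x" for x
      using Z[of i x] p(1)[of i] cutoff_deriv_outside[of x i] by (cases "x \<in> S") (auto intro: powr_mono2)
    then show "AE x in lborel. norm (\<bar>\<zeta>' i x\<bar> powr p i) \<le> norm (Z powr p i * indicator S x)" by simp
  qed measurable
qed

text \<open>The weak chain rule in all coordinate directions, combined with the fact that a function
  supported in \<open>S\<close> with an integrable weak gradient is a limit of smooth functions
  supported in the interior of \<open>K\<close>.\<close>

lemma chain_rule_W11:
  fixes w :: "real^'n \<Rightarrow> real" and v :: "'n \<Rightarrow> real^'n \<Rightarrow> real"
  assumes w: "integrable lborel w" "\<And>x. 0 \<le> w x" and v: "\<And>i. integrable lborel (v i)" and e: "0 < e"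
    and wv: "\<And>i r x. 0 < r \<Longrightarrow> r < e \<Longrightarrow> x \<in> S \<Longrightarrow> conv w (dir_deriv (axis i 1) (mollifier r)) x = conv (v i) (mollifier r) x"
    and F: "\<And>s. 0 \<le> s \<Longrightarrow> (F has_real_derivative F' s) (at s)" "continuous_on {0..} F'"
    and B: "\<And>s. 0 \<le> s \<Longrightarrow> \<bar>F s\<bar> \<le> M" "\<And>s. 0 \<le> s \<Longrightarrow> \<bar>F' s\<bar> \<le> M"
  shows "W11_o K (\<lambda>x. F (w x) * \<zeta> x) (\<lambda>x. \<chi> i. F' (w x) * v i x * \<zeta> x + F (w x) * \<zeta>' i x)"
proof -
  note wc = weak_chain_rule[OF w v axis_Basis e wv \<zeta>(1,4) S(1) F B]
  show ?thesis
  proof (rule W11_o_weak_gradient[OF _ _ K(1) S])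
    show "integrable lborel (\<lambda>x. F (w x) * \<zeta> x)" by (rule wc(1)[of 1]) simp_all
    show "integrable lborel (\<lambda>x. (\<chi> i. F' (w x) * v i x * \<zeta> x + F (w x) * \<zeta>' i x) $ i)" for i
      unfolding vec_lambda_beta by (rule wc(2)[of 1]) simp_all
    show "F (w x) * \<zeta> x = 0" if "x \<notin> S" for x using \<zeta>(4)[OF that] by simp
    show "conv (\<lambda>x. F (w x) * \<zeta> x) (dir_deriv (axis i 1) (mollifier r)) x
        = conv (\<lambda>y. (\<chi> i. F' (w y) * v i y * \<zeta> y + F (w y) * \<zeta>' i y) $ i) (mollifier r) x" if "0 < r" for i r x
      unfolding vec_lambda_beta using that by (intro wc(3)) simp_all
  qed
qed

text \<open>The case of a constant \<open>F\<close>. The cutoff is only known to be continuously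
  differentiable once, so it too has to be approximated by mollification.\<close>

lemma cutoff_W11: "W11_o K \<zeta> (\<lambda>x. \<chi> i. \<zeta>' i x)"
proof -
  have "W11_o K (\<lambda>x. 1 * \<zeta> x) (\<lambda>x. \<chi> i. 0 * 0 * \<zeta> x + 1 * \<zeta>' i x)"
    by (rule chain_rule_W11[where w = "\<lambda>x. 0" and v = "\<lambda>i x. 0" and F = "\<lambda>s. 1" and F' = "\<lambda>s. 0" and e = 1 and M = 1])
      (auto simp: conv_def)
  then show ?thesis by simp
qed

definition "flux z = (\<Sum>i\<in>UNIV. \<bar>a i z\<bar> * \<bar>\<zeta>' i (fst z)\<bar>) + \<bar>b z\<bar> * \<zeta> (fst z)"

lemma flux_measurable [measurable]: "flux \<in> borel_measurable borel"
  unfolding flux_def[abs_def] by measurable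

lemma integrable_time_indicator:
  fixes f :: "(real^'n) \<times> real \<Rightarrow> real"
  assumes "integrable lborel f"
  shows "integrable lborel (\<lambda>z. indicator {s..s'} (snd z) * f z)"
proof -
  from integrable_mult_indicator[OF _ assms, of "UNIV \<times> {s..s'}"]
  have "integrable lborel (\<lambda>z. indicator (UNIV \<times> {s..s'}) z *\<^sub>R f z)"
    by (simp add: borel_closed closed_Times)
  also have "(\<lambda>z. indicator (UNIV \<times> {s..s'}) z *\<^sub>R f z) = (\<lambda>z. indicator {s..s'} (snd z) * f z)"
    by (auto simp: indicator_def fun_eq_iff)
  finally show ?thesis .
qed

lemma flux_term_integrable:
  "integrable lborel (\<lambda>z. a i z * \<zeta>' i (fst z))" "integrable lborel (\<lambda>z. b z * \<zeta> (fst z))" "integrable lborel flux"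
proof -
  obtain Z where Z: "\<And>i x. \<bar>\<zeta>' i x\<bar> \<le> Z" using cutoff_deriv_bounded by blast
  have Z0: "0 \<le> Z" using Z[of undefined 0] by linarith
  show 1: "integrable lborel (\<lambda>z. a i z * \<zeta>' i (fst z))" for i
  proof (rule Bochner_Integration.integrable_bound)
    show "integrable lborel (\<lambda>z. Z * a i z)" using flux_integrable(2) by simp
    show "AE z in lborel. norm (a i z * \<zeta>' i (fst z)) \<le> norm (Z * a i z)"
    proof (rule AE_I2)
      fix z
      show "norm (a i z * \<zeta>' i (fst z)) \<le> norm (Z * a i z)"
        using mult_left_mono[OF Z[of i "fst z"], of "\<bar>a i z\<bar>"] Z0 by (simp add: abs_mult mult.commute)
    qed
  qed measurable
  show 2: "integrable lborel (\<lambda>z. b z * \<zeta> (fst z))"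
  proof (rule Bochner_Integration.integrable_bound[OF source_integrable])
    show "AE z in lborel. norm (b z * \<zeta> (fst z)) \<le> norm (b z)"
    proof (rule AE_I2)
      fix z
      show "norm (b z * \<zeta> (fst z)) \<le> norm (b z)"
        using mult_left_mono[OF \<zeta>(3)[of "fst z"], of "\<bar>b z\<bar>"] \<zeta>(2)[of "fst z"] by (simp add: abs_mult)
    qed
  qed measurable
  have "integrable lborel (\<lambda>z. (\<Sum>i\<in>UNIV. \<bar>a i z * \<zeta>' i (fst z)\<bar>) + \<bar>b z * \<zeta> (fst z)\<bar>)"
    by (intro Bochner_Integration.integrable_add Bochner_Integration.integrable_sum integrable_abs 1 2)
  then show "integrable lborel flux"
    using \<zeta>(2) by (simp add: flux_def[abs_def] abs_mult)
qed

lemma mass_oscillation: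
  assumes t: "\<sigma> \<le> t\<^sub>1" "t\<^sub>1 \<le> t\<^sub>2" "t\<^sub>2 \<le> \<sigma>'"
  shows "\<bar>mass t\<^sub>2 - mass t\<^sub>1\<bar> \<le> (\<integral>z. indicator {t\<^sub>1..t\<^sub>2} (snd z) * flux z \<partial>lborel)"
proof -
  have Dp: "integrable lborel (\<lambda>x. indicator K x * \<bar>\<zeta>' i x\<bar> powr p i)" for i
    using integrable_mult_indicator[OF _ cutoff_deriv_powr_integrable[of i], of K] by simp
  have "mass t\<^sub>2 - mass t\<^sub>1
    = (\<integral>z. indicator {t\<^sub>1..t\<^sub>2} (snd z) * (b z * \<zeta> (fst z) - (\<Sum>i\<in>UNIV. a i z * \<zeta>' i (fst z))) \<partial>lborel)"
    unfolding mass_def by (rule weak_identity[OF _ \<zeta>(2,3) _ Dp cutoff_W11 t]) measurable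
  also have "\<bar>\<dots>\<bar> \<le> (\<integral>z. indicator {t\<^sub>1..t\<^sub>2} (snd z) * flux z \<partial>lborel)"
  proof (rule order_trans[OF integral_abs_bound], rule integral_mono)
    show "integrable lborel (\<lambda>z. \<bar>indicator {t\<^sub>1..t\<^sub>2} (snd z) * (b z * \<zeta> (fst z) - (\<Sum>i\<in>UNIV. a i z * \<zeta>' i (fst z)))\<bar>)"
      by (intro integrable_abs integrable_time_indicator Bochner_Integration.integrable_diff
          Bochner_Integration.integrable_sum flux_term_integrable)
    show "integrable lborel (\<lambda>z. indicator {t\<^sub>1..t\<^sub>2} (snd z) * flux z)"
      by (intro integrable_time_indicator flux_term_integrable)
    fix z
    have "\<bar>b z * \<zeta> (fst z) - (\<Sum>i\<in>UNIV. a i z * \<zeta>' i (fst z))\<bar> \<le> \<bar>b z * \<zeta> (fst z)\<bar> + \<bar>\<Sum>i\<in>UNIV. a i z * \<zeta>' i (fst z)\<bar>"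
      by (rule abs_triangle_ineq4)
    also have "\<bar>\<Sum>i\<in>UNIV. a i z * \<zeta>' i (fst z)\<bar> \<le> (\<Sum>i\<in>UNIV. \<bar>a i z * \<zeta>' i (fst z)\<bar>)" by (rule sum_abs)
    finally have "\<bar>b z * \<zeta> (fst z) - (\<Sum>i\<in>UNIV. a i z * \<zeta>' i (fst z))\<bar> \<le> flux z"
      using \<zeta>(2) by (simp add: flux_def abs_mult)
    then show "\<bar>indicator {t\<^sub>1..t\<^sub>2} (snd z) * (b z * \<zeta> (fst z) - (\<Sum>i\<in>UNIV. a i z * \<zeta>' i (fst z)))\<bar> \<le> indicator {t\<^sub>1..t\<^sub>2} (snd z) * flux z"
      by (auto simp: indicator_def)
  qed
  finally show ?thesis .
qed

end

section \<open>The energy inequality\<close>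

locale energy_setting = represented_setting +
  fixes \<nu> \<alpha> :: real
  assumes \<nu>: "0 < \<nu>" and \<alpha>: "0 < \<alpha>" "\<alpha> < 1"
begin

definition "test z = (U z + \<nu>) powr (- \<alpha>) * \<zeta> (fst z)"

definition "test_grad i z = - \<alpha> * (U z + \<nu>) powr (- \<alpha> - 1) * V i z * \<zeta> (fst z) + (U z + \<nu>) powr (- \<alpha>) * \<zeta>' i (fst z)"

text \<open>The integrand is a primitive of \<open>(s + \<nu>) powr (- \<alpha>)\<close> for
  nonnegative \<open>s\<close>, so formally the time derivative of the entropy is that of
  \<open>u\<close> tested with \<open>test\<close>. As for the mass, \<open>u\<close> is used so
  that individual times make sense.\<close>

definition "entropy \<tau> = (\<integral>x. indicator K x * (truncated_power \<nu> \<alpha> (u x \<tau>) * \<zeta> x) \<partial>lebesgue)"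

lemma test_measurable [measurable]: "test \<in> borel_measurable borel" "test_grad i \<in> borel_measurable borel"
  unfolding test_def[abs_def] test_grad_def[abs_def] by measurable

lemma power_derivative:
  assumes "0 \<le> s"
  shows "((\<lambda>s. (s + \<nu>) powr (- \<alpha>)) has_real_derivative - \<alpha> * (s + \<nu>) powr (- \<alpha> - 1)) (at s)"
  using assms \<nu> by (auto intro!: derivative_eq_intros)

lemma power_bounds:
  assumes "0 \<le> s"
  shows "(s + \<nu>) powr (- \<alpha>) \<le> \<nu> powr (- \<alpha>)" "(s + \<nu>) powr (- \<alpha> - 1) \<le> \<nu> powr (- \<alpha> - 1)"
  using assms \<nu> \<alpha> by (auto intro!: powr_mono2')

lemma test_bounds: "0 \<le> test z" "test z \<le> \<nu> powr (- \<alpha>)"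
proof -
  show "0 \<le> test z" using \<zeta>(2) by (simp add: test_def)
  have "test z \<le> (U z + \<nu>) powr (- \<alpha>) * 1" unfolding test_def using \<zeta>(3) by (intro mult_left_mono) auto
  then show "test z \<le> \<nu> powr (- \<alpha>)" using power_bounds(1)[OF U(2)[of z]] by linarith
qed

lemma test_grad_bound: "\<bar>test_grad i z\<bar> powr p i \<le> 2 powr p i * ((\<alpha> * \<nu> powr (- \<alpha> - 1)) powr p i * \<bar>V i z\<bar> powr p i
    + (\<nu> powr (- \<alpha>)) powr p i * \<bar>\<zeta>' i (fst z)\<bar> powr p i)"
proof -
  have "\<bar>test_grad i z\<bar> \<le> \<bar>\<alpha> * (U z + \<nu>) powr (- \<alpha> - 1) * V i z * \<zeta> (fst z)\<bar> + \<bar>(U z + \<nu>) powr (- \<alpha>) * \<zeta>' i (fst z)\<bar>"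
    unfolding test_grad_def by simp
  also have "\<bar>\<alpha> * (U z + \<nu>) powr (- \<alpha> - 1) * V i z * \<zeta> (fst z)\<bar> \<le> \<alpha> * \<nu> powr (- \<alpha> - 1) * \<bar>V i z\<bar> * 1"
    unfolding abs_mult using \<alpha> \<zeta>(2,3) power_bounds(2)[OF U(2)[of z]] by (intro mult_mono) auto
  also have "\<bar>(U z + \<nu>) powr (- \<alpha>) * \<zeta>' i (fst z)\<bar> \<le> \<nu> powr (- \<alpha>) * \<bar>\<zeta>' i (fst z)\<bar>"
    unfolding abs_mult using power_bounds(1)[OF U(2)[of z]] by (intro mult_right_mono) auto
  finally have "\<bar>test_grad i z\<bar> \<le> \<alpha> * \<nu> powr (- \<alpha> - 1) * \<bar>V i z\<bar> + \<nu> powr (- \<alpha>) * \<bar>\<zeta>' i (fst z)\<bar>" by simp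
  then have "\<bar>test_grad i z\<bar> powr p i \<le> (\<alpha> * \<nu> powr (- \<alpha> - 1) * \<bar>V i z\<bar> + \<nu> powr (- \<alpha>) * \<bar>\<zeta>' i (fst z)\<bar>) powr p i"
    using p(1)[of i] by (intro powr_mono2) auto
  also have "\<dots> \<le> 2 powr p i * ((\<alpha> * \<nu> powr (- \<alpha> - 1) * \<bar>V i z\<bar>) powr p i + (\<nu> powr (- \<alpha>) * \<bar>\<zeta>' i (fst z)\<bar>) powr p i)"
    using \<alpha> p(1)[of i] by (intro powr_add_bound) auto
  finally show ?thesis using \<alpha> by (simp add: powr_mult)
qed

lemma test_grad_integrable:
  "integrable lborel (\<lambda>z. \<bar>indicator {\<sigma>..\<sigma>'} (snd z) * test_grad i z\<bar> powr p i)"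
proof (rule Bochner_Integration.integrable_bound)
  have "integrable lborel (indicator {\<sigma>..\<sigma>'} :: real \<Rightarrow> real)"
    using emeasure_lborel_Icc_eq[of \<sigma> \<sigma>'] by (intro integrable_real_indicator) auto
  note P = integrable_lborel_product(1)[OF cutoff_deriv_powr_integrable[of i] this]
  show "integrable lborel (\<lambda>z. 2 powr p i * ((\<alpha> * \<nu> powr (- \<alpha> - 1)) powr p i * \<bar>V i z\<bar> powr p i
    + (\<nu> powr (- \<alpha>)) powr p i * (\<bar>\<zeta>' i (fst z)\<bar> powr p i * indicator {\<sigma>..\<sigma>'} (snd z))))"
    by (intro integrable_mult_right Bochner_Integration.integrable_add V(5) P)
  show "AE z in lborel. norm (\<bar>indicator {\<sigma>..\<sigma>'} (snd z) * test_grad i z\<bar> powr p i)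
    \<le> norm (2 powr p i * ((\<alpha> * \<nu> powr (- \<alpha> - 1)) powr p i * \<bar>V i z\<bar> powr p i
    + (\<nu> powr (- \<alpha>)) powr p i * (\<bar>\<zeta>' i (fst z)\<bar> powr p i * indicator {\<sigma>..\<sigma>'} (snd z))))"
    using test_grad_bound[of i] by (intro AE_I2) (auto simp: indicator_def)
qed measurable

lemma test_W11:
  "AE \<tau> in lborel. \<tau> \<in> {\<sigma>..\<sigma>'} \<longrightarrow> W11_o K (\<lambda>x. test (x, \<tau>)) (\<lambda>x. \<chi> i. test_grad i (x, \<tau>))"
proof -
  have "AE \<tau> in lborel. \<forall>i. integrable lborel (\<lambda>x. V i (x, \<tau>))"
    using AE_integrable_slice[OF V(4)] by (subst AE_all_countable) blast
  with conv(2) AE_integrable_slice[OF U(4)] show ?thesis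
  proof eventually_elim
    case (elim \<tau>)
    show ?case
    proof
      assume \<tau>: "\<tau> \<in> {\<sigma>..\<sigma>'}"
      \<comment> \<open>The shift by \<nu> > 0 bounds the power and its derivative on the half line,
        as the chain rule requires.\<close>
      define M where "M = \<nu> powr (- \<alpha>) + \<alpha> * \<nu> powr (- \<alpha> - 1)"
      have "W11_o K (\<lambda>x. (U (x, \<tau>) + \<nu>) powr (- \<alpha>) * \<zeta> x)
        (\<lambda>x. \<chi> i. - \<alpha> * (U (x, \<tau>) + \<nu>) powr (- \<alpha> - 1) * V i (x, \<tau>) * \<zeta> x + (U (x, \<tau>) + \<nu>) powr (- \<alpha>) * \<zeta>' i x)"
      proof (rule chain_rule_W11[where F = "\<lambda>s. (s + \<nu>) powr (- \<alpha>)" and F' = "\<lambda>s. - \<alpha> * (s + \<nu>) powr (- \<alpha> - 1)" and e = d and M = M])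
        show "integrable lborel (\<lambda>x. U (x, \<tau>))" "\<And>x. 0 \<le> U (x, \<tau>)" "\<And>i. integrable lborel (\<lambda>x. V i (x, \<tau>))" "0 < d"
          using elim U(2) conv(1) by auto
        show "conv (\<lambda>x. U (x, \<tau>)) (dir_deriv (axis i 1) (mollifier r)) x = conv (\<lambda>x. V i (x, \<tau>)) (mollifier r) x"
          if "0 < r" "r < d" "x \<in> S" for i r x
          using elim(1)[THEN mp, OF \<tau>] that SK by blast
        show "((\<lambda>s. (s + \<nu>) powr (- \<alpha>)) has_real_derivative - \<alpha> * (s + \<nu>) powr (- \<alpha> - 1)) (at s)" if "0 \<le> s" for s
          by (rule power_derivative[OF that])
        show "continuous_on {0..} (\<lambda>s. - \<alpha> * (s + \<nu>) powr (- \<alpha> - 1))"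
          using \<nu> by (intro continuous_intros) auto
        show "\<bar>(s + \<nu>) powr (- \<alpha>)\<bar> \<le> M" if "0 \<le> s" for s
          using power_bounds(1)[OF that] \<alpha> by (simp add: M_def add_increasing2)
        show "\<bar>- \<alpha> * (s + \<nu>) powr (- \<alpha> - 1)\<bar> \<le> M" if "0 \<le> s" for s
          using mult_left_mono[OF power_bounds(2)[OF that], of \<alpha>] \<alpha> by (simp add: M_def abs_mult add_increasing)
      qed
      then show "W11_o K (\<lambda>x. test (x, \<tau>)) (\<lambda>x. \<chi> i. test_grad i (x, \<tau>))"
        by (simp add: test_def test_grad_def)
    qed
  qed
qed

lemma entropy_continuous: "continuous_on {0..T} entropy"
  unfolding entropy_def[abs_def]
  by (rule slice_Lipschitz(2)[OF uC K(1) K\<Omega> truncated_power_Lipschitz[OF \<nu> \<alpha>] cutoff_measurable(1)])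
    (use \<zeta>(2,3) in simp)

text \<open>Concavity: the function \<open>test\<close> frozen at the later time underestimates the increment.\<close>

lemma entropy_increment:
  assumes h: "0 < h"
  shows "AE \<tau> in lborel. \<sigma> \<le> \<tau> - h \<and> \<tau> \<le> \<sigma>' \<longrightarrow>
    (\<integral>z. indicator {\<tau> - h..\<tau>} (snd z) * (b z * test (fst z, \<tau>) - (\<Sum>i\<in>UNIV. a i z * test_grad i (fst z, \<tau>))) \<partial>lborel)
      \<le> entropy \<tau> - entropy (\<tau> - h)"
proof -
  have "AE \<tau> in lborel. \<forall>i. integrable lborel (\<lambda>x. \<bar>V i (x, \<tau>)\<bar> powr p i)"
    using AE_integrable_slice[OF V(5)] by (subst AE_all_countable) blast
  with test_W11 AE_lborel_snd[OF U(3)] show ?thesis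
  proof eventually_elim
    case (elim \<tau>)
    show ?case
    proof
      assume \<tau>: "\<sigma> \<le> \<tau> - h \<and> \<tau> \<le> \<sigma>'"
      then have \<tau>J: "\<tau> \<in> {\<sigma>..\<sigma>'}" and \<tau>T: "\<tau> \<in> {0..T}" "\<tau> - h \<in> {0..T}" using h \<sigma> by auto
      let ?\<phi> = "\<lambda>x. test (x, \<tau>)"
      have \<phi>m [measurable]: "?\<phi> \<in> borel_measurable borel" by (rule borel_measurable_slice) measurable
      have Dm [measurable]: "(\<lambda>x. test_grad i (x, \<tau>)) \<in> borel_measurable borel" for i by (rule borel_measurable_slice) measurable
      have Dp: "integrable lborel (\<lambda>x. indicator K x * \<bar>test_grad i (x, \<tau>)\<bar> powr p i)" for i
      proof (rule Bochner_Integration.integrable_bound)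
        show "integrable lborel (\<lambda>x. 2 powr p i * ((\<alpha> * \<nu> powr (- \<alpha> - 1)) powr p i * \<bar>V i (x, \<tau>)\<bar> powr p i
          + (\<nu> powr (- \<alpha>)) powr p i * \<bar>\<zeta>' i x\<bar> powr p i))"
          using elim(3) by (intro integrable_mult_right Bochner_Integration.integrable_add cutoff_deriv_powr_integrable) auto
        show "AE x in lborel. norm (indicator K x * \<bar>test_grad i (x, \<tau>)\<bar> powr p i)
          \<le> norm (2 powr p i * ((\<alpha> * \<nu> powr (- \<alpha> - 1)) powr p i * \<bar>V i (x, \<tau>)\<bar> powr p i
          + (\<nu> powr (- \<alpha>)) powr p i * \<bar>\<zeta>' i x\<bar> powr p i))"
          using test_grad_bound[of i "(_, \<tau>)"] by (intro AE_I2) (auto simp: indicator_def)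
      qed measurable
      have \<phi>l: "?\<phi> \<in> borel_measurable lebesgue" using \<phi>m by (intro measurable_completion) simp
      have ui: "integrable lebesgue (\<lambda>x. indicator K x * (u x t * ?\<phi> x))" if "t \<in> {0..T}" for t
      proof (rule Bochner_Integration.integrable_bound)
        have "integrable lebesgue (\<lambda>x. indicator K x * (u x t * 1))"
          using slice_Lipschitz(1)[OF uC K(1) K\<Omega>, of "\<lambda>s. s" 1 "\<lambda>x. 1" t] that by simp
        then show "integrable lebesgue (\<lambda>x. \<nu> powr (- \<alpha>) * (indicator K x * u x t))" by simp
        have "(\<lambda>x. (indicator K x * u x t) * ?\<phi> x) \<in> borel_measurable lebesgue"
          by (intro borel_measurable_times slice_measurable(1)[OF uC K(1) K\<Omega> that] \<phi>l)
        then show "(\<lambda>x. indicator K x * (u x t * ?\<phi> x)) \<in> borel_measurable lebesgue" by (simp add: mult.assoc)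
        show "AE x in lebesgue. norm (indicator K x * (u x t * ?\<phi> x)) \<le> norm (\<nu> powr (- \<alpha>) * (indicator K x * u x t))"
        proof (rule AE_I2)
          fix x
          have "\<bar>u x t\<bar> * ?\<phi> x \<le> \<bar>u x t\<bar> * \<nu> powr (- \<alpha>)" by (intro mult_left_mono test_bounds) auto
          then show "norm (indicator K x * (u x t * ?\<phi> x)) \<le> norm (\<nu> powr (- \<alpha>) * (indicator K x * u x t))"
            using test_bounds(1)[of "(x, \<tau>)"] by (auto simp: abs_mult indicator_def mult.commute)
        qed
      qed
      have gi: "integrable lebesgue (\<lambda>x. indicator K x * (truncated_power \<nu> \<alpha> (u x t) * \<zeta> x))" if "t \<in> {0..T}" for t
        by (rule slice_Lipschitz(1)[OF uC K(1) K\<Omega> truncated_power_Lipschitz[OF \<nu> \<alpha>] cutoff_measurable(1) _ that])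
          (use \<zeta>(2,3) in simp)
      have "(\<integral>z. indicator {\<tau> - h..\<tau>} (snd z) * (b z * test (fst z, \<tau>) - (\<Sum>i\<in>UNIV. a i z * test_grad i (fst z, \<tau>))) \<partial>lborel)
        = (\<integral>x. indicator K x * (u x \<tau> * ?\<phi> x) \<partial>lebesgue) - (\<integral>x. indicator K x * (u x (\<tau> - h) * ?\<phi> x) \<partial>lebesgue)"
        by (rule weak_identity[symmetric, OF \<phi>m test_bounds(1) test_bounds(2) Dm Dp]) (use elim(1) \<tau>J \<tau> h in auto)
      also have "\<dots> = (\<integral>x. indicator K x * (u x \<tau> * ?\<phi> x) - indicator K x * (u x (\<tau> - h) * ?\<phi> x) \<partial>lebesgue)"
        by (intro Bochner_Integration.integral_diff[symmetric] ui \<tau>T)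
      also have "\<dots> \<le> (\<integral>x. indicator K x * (truncated_power \<nu> \<alpha> (u x \<tau>) * \<zeta> x) - indicator K x * (truncated_power \<nu> \<alpha> (u x (\<tau> - h)) * \<zeta> x) \<partial>lebesgue)"
      proof (rule integral_mono_AE)
        show "integrable lebesgue (\<lambda>x. indicator K x * (u x \<tau> * ?\<phi> x) - indicator K x * (u x (\<tau> - h) * ?\<phi> x))"
          by (intro Bochner_Integration.integrable_diff ui \<tau>T)
        show "integrable lebesgue (\<lambda>x. indicator K x * (truncated_power \<nu> \<alpha> (u x \<tau>) * \<zeta> x) - indicator K x * (truncated_power \<nu> \<alpha> (u x (\<tau> - h)) * \<zeta> x))"
          by (intro Bochner_Integration.integrable_diff gi \<tau>T)
        \<comment> \<open>At time \<tau> the representative equals \<open>u\<close> for almost every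
          \<open>x\<close>, by the choice of \<tau>. At \<open>\<tau> - h\<close> this is not known,
          and nonnegativity is taken from continuity in time.\<close>
        have "AE x in lebesgue. (x, \<tau>) \<in> K' \<times> {\<sigma>..\<sigma>'} \<longrightarrow> U (x, \<tau>) = u x \<tau>"
          using elim(2) unfolding AE_completion_iff by simp
        with slice_nonneg[OF uC K(1) K\<Omega> T upos \<tau>T(2)]
        show "AE x in lebesgue. indicator K x * (u x \<tau> * ?\<phi> x) - indicator K x * (u x (\<tau> - h) * ?\<phi> x)
          \<le> indicator K x * (truncated_power \<nu> \<alpha> (u x \<tau>) * \<zeta> x) - indicator K x * (truncated_power \<nu> \<alpha> (u x (\<tau> - h)) * \<zeta> x)"
        proof eventually_elim
          case (elim x)
          show ?case
          proof (cases "x \<in> K")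
            case True
            then have "(x, \<tau>) \<in> K' \<times> {\<sigma>..\<sigma>'}" using KK' \<tau>J by auto
            then have Uu: "U (x, \<tau>) = u x \<tau>" using elim(2) by blast
            have "(u x \<tau> - u x (\<tau> - h)) * (u x \<tau> + \<nu>) powr (- \<alpha>) \<le> truncated_power \<nu> \<alpha> (u x \<tau>) - truncated_power \<nu> \<alpha> (u x (\<tau> - h))"
              using elim(1) True U(2)[of "(x, \<tau>)"] Uu by (intro truncated_power_bound[OF \<nu> \<alpha>]) auto
            from mult_right_mono[OF this \<zeta>(2)[of x]] show ?thesis
              using True by (simp add: test_def Uu algebra_simps)
          qed simp
        qed
      qed
      also have "(\<integral>x. indicator K x * (truncated_power \<nu> \<alpha> (u x \<tau>) * \<zeta> x) - indicator K x * (truncated_power \<nu> \<alpha> (u x (\<tau> - h)) * \<zeta> x) \<partial>lebesgue)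
        = entropy \<tau> - entropy (\<tau> - h)"
        unfolding entropy_def
        by (intro Bochner_Integration.integral_diff slice_Lipschitz(1)[OF uC K(1) K\<Omega> truncated_power_Lipschitz[OF \<nu> \<alpha>] cutoff_measurable(1)] \<tau>T)
          (use \<zeta>(2,3) in simp_all)
      finally show "(\<integral>z. indicator {\<tau> - h..\<tau>} (snd z) * (b z * test (fst z, \<tau>) - (\<Sum>i\<in>UNIV. a i z * test_grad i (fst z, \<tau>))) \<partial>lborel)
        \<le> entropy \<tau> - entropy (\<tau> - h)" .
    qed
  qed
qed

lemma energy_terms_integrable:
  "integrable lborel (\<lambda>z. b z * (indicator {\<sigma>..\<sigma>'} (snd z) * test z))"
  "integrable lborel (\<lambda>z. a i z * (indicator {\<sigma>..\<sigma>'} (snd z) * test_grad i z))"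
proof -
  show "integrable lborel (\<lambda>z. a i z * (indicator {\<sigma>..\<sigma>'} (snd z) * test_grad i z))"
    by (rule integrable_product_young[OF _ _ p(1)[of i] flux_integrable(1) test_grad_integrable]) measurable
  show "integrable lborel (\<lambda>z. b z * (indicator {\<sigma>..\<sigma>'} (snd z) * test z))"
  proof (rule Bochner_Integration.integrable_bound)
    show "integrable lborel (\<lambda>z. \<nu> powr (- \<alpha>) * b z)" using source_integrable by simp
    show "AE z in lborel. norm (b z * (indicator {\<sigma>..\<sigma>'} (snd z) * test z)) \<le> norm (\<nu> powr (- \<alpha>) * b z)"
    proof (rule AE_I2)
      fix z
      have "\<bar>b z\<bar> * test z \<le> \<bar>b z\<bar> * \<nu> powr (- \<alpha>)" by (intro mult_left_mono test_bounds) auto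
      then show "norm (b z * (indicator {\<sigma>..\<sigma>'} (snd z) * test z)) \<le> norm (\<nu> powr (- \<alpha>) * b z)"
        using test_bounds(1)[of z] by (auto simp: abs_mult indicator_def mult.commute)
    qed
  qed measurable
qed

lemma energy_inequality:
  assumes s: "\<sigma> < s\<^sub>1" "s\<^sub>1 < s\<^sub>2" "s\<^sub>2 \<le> \<sigma>'"
  shows "(\<integral>z. indicator {s\<^sub>1..s\<^sub>2} (snd z) * (b z * test z - (\<Sum>i\<in>UNIV. a i z * test_grad i z)) \<partial>lborel) \<le> entropy s\<^sub>2 - entropy s\<^sub>1"
proof -
  \<comment> \<open>One family for all terms of the equation: the source with weight
    \<open>test\<close>, the flux components with weights \<open>- test_grad i\<close>.\<close>
  define f where "f j = (case j of None \<Rightarrow> b | Some i \<Rightarrow> a i)" for j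
  define W where "W j z = indicator {\<sigma>..\<sigma>'} (snd z) * (case j of None \<Rightarrow> test z | Some i \<Rightarrow> - test_grad i z)" for j z
  have "(\<integral>z. indicator {s\<^sub>1..s\<^sub>2} (snd z) * (\<Sum>j\<in>UNIV. f j z * W j z) \<partial>lborel) \<le> entropy s\<^sub>2 - entropy s\<^sub>1"
  proof (rule averaged_difference[OF s(1,2)])
    show "continuous_on {\<sigma>..s\<^sub>2} entropy"
      by (rule continuous_on_subset[OF entropy_continuous]) (use s \<sigma> in auto)
    show fm: "f j \<in> borel_measurable borel" and Wm: "W j \<in> borel_measurable borel" for j
      unfolding f_def W_def[abs_def] by (cases j; simp)+
    show "integrable lborel (\<lambda>z. f j z * W j z)" for j
      using energy_terms_integrable by (cases j) (simp_all add: f_def W_def)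
    \<comment> \<open>For the source the weight is bounded, so L1 translations are enough. A flux
      component and its weight lie in dual exponents.\<close>
    show "\<exists>d>0. \<forall>h. norm h < d \<longrightarrow> (\<integral>\<^sup>+z. ennreal (\<bar>f j (z + h) - f j z\<bar> * \<bar>W j z\<bar>) \<partial>lborel) \<le> ennreal e" if "0 < e" for j e
    proof (cases j)
      case None
      have "\<bar>W None z\<bar> \<le> \<nu> powr (- \<alpha>)" for z
        using test_bounds[of z] by (auto simp: W_def indicator_def)
      from translation_product_bounded[OF source_integrable this that] show ?thesis unfolding None by (simp add: f_def)
    next
      case (Some i)
      have f1: "integrable lborel (f j)" unfolding Some f_def using flux_integrable(2) by simp
      have f2: "(\<integral>\<^sup>+z. ennreal (\<bar>f j z\<bar> powr (p i / (p i - 1))) \<partial>lborel) < \<infinity>"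
        unfolding Some f_def option.case by (rule nn_integral_finite[OF flux_integrable(1)]) simp
      have f3: "(\<integral>\<^sup>+z. ennreal (\<bar>W j z\<bar> powr p i) \<partial>lborel) < \<infinity>"
      proof -
        have "\<bar>W j z\<bar> powr p i = \<bar>indicator {\<sigma>..\<sigma>'} (snd z) * test_grad i z\<bar> powr p i" for z
          unfolding Some W_def by simp
        then show ?thesis using nn_integral_finite[OF test_grad_integrable[of i]] by simp
      qed
      show ?thesis by (rule translation_product_Lp[OF f1 f2 Wm f3 p(1)[of i] that])
    qed
    show "AE \<tau> in lborel. \<sigma> \<le> \<tau> - h \<and> \<tau> \<le> s\<^sub>2 \<longrightarrow>
      (\<integral>z. indicator {\<tau> - h..\<tau>} (snd z) * (\<Sum>j\<in>UNIV. f j z * W j (fst z, \<tau>)) \<partial>lborel) \<le> entropy \<tau> - entropy (\<tau> - h)"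
      if h: "0 < h" for h
      using entropy_increment[OF h]
    proof eventually_elim
      case (elim \<tau>)
      show ?case
      proof
        assume \<tau>: "\<sigma> \<le> \<tau> - h \<and> \<tau> \<le> s\<^sub>2"
        then have "\<tau> \<in> {\<sigma>..\<sigma>'}" using h s by auto
        then have "(\<Sum>j\<in>UNIV. f j z * W j (fst z, \<tau>)) = b z * test (fst z, \<tau>) - (\<Sum>i\<in>UNIV. a i z * test_grad i (fst z, \<tau>))" for z
          by (simp add: sum_UNIV_option f_def W_def sum_negf)
        then show "(\<integral>z. indicator {\<tau> - h..\<tau>} (snd z) * (\<Sum>j\<in>UNIV. f j z * W j (fst z, \<tau>)) \<partial>lborel) \<le> entropy \<tau> - entropy (\<tau> - h)"
          using elim \<tau> s by simp
      qed
    qed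
  qed
  also have "(\<lambda>z. indicator {s\<^sub>1..s\<^sub>2} (snd z) * (\<Sum>j\<in>UNIV. f j z * W j z))
    = (\<lambda>z. indicator {s\<^sub>1..s\<^sub>2} (snd z) * (b z * test z - (\<Sum>i\<in>UNIV. a i z * test_grad i z)))"
    using s by (auto simp: fun_eq_iff sum_UNIV_option f_def W_def sum_negf indicator_def)
  finally show ?thesis .
qed

end

section \<open>Oscillation of the mass\<close>

context cutoff_setting
begin

abbreviation "vol \<equiv> measure lborel K"

lemma cutoff_abs_le_1: "\<bar>\<zeta> x\<bar> \<le> 1"
  using \<zeta>(2,3)[of x] by simp

lemma cutoff_measurable_lborel: "\<zeta> \<in> borel_measurable borel"
  using C_k_continuous[OF \<zeta>(1)] by (intro borel_measurable_continuous_onI) auto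

lemma mass_integrable:
  assumes "\<tau> \<in> {0..T}"
  shows "integrable lebesgue (\<lambda>x. indicator K x * (u x \<tau> * \<zeta> x))"
  by (rule slice_Lipschitz(1)[OF uC K(1) K\<Omega>, of "\<lambda>s. s" 1, OF _ cutoff_measurable_lborel cutoff_abs_le_1 assms]) simp

lemma mass_continuous: "continuous_on {0..T} mass"
  unfolding mass_def[abs_def]
  by (rule slice_Lipschitz(2)[OF uC K(1) K\<Omega>, of "\<lambda>s. s" 1, OF _ cutoff_measurable_lborel cutoff_abs_le_1]) simp

lemma mass_AE_nonneg:
  assumes "\<tau> \<in> {0..T}"
  shows "AE x in lebesgue. 0 \<le> indicator K x * (u x \<tau> * \<zeta> x)"
  using slice_nonneg[OF uC K(1) K\<Omega> T upos assms] by eventually_elim (auto simp: indicator_def \<zeta>(2))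

lemma mass_nonneg: "\<tau> \<in> {0..T} \<Longrightarrow> 0 \<le> mass \<tau>"
  unfolding mass_def by (rule integral_nonneg_AE) (rule mass_AE_nonneg)

lemma integral_indicator_volume: "(\<integral>x. indicator K x \<partial>lebesgue) = vol"
  by (subst integral_completion) simp_all

end

text \<open>By Fubini, since at almost every time the slice of \<open>U\<close> times the cutoff
  integrates to the mass.\<close>

lemma (in represented_setting) mass_time_integral:
  assumes s: "\<sigma> \<le> s\<^sub>1" "s\<^sub>1 \<le> s\<^sub>2" "s\<^sub>2 \<le> \<sigma>'" and m: "\<And>\<tau>. \<tau> \<in> {\<sigma>..\<sigma>'} \<Longrightarrow> mass \<tau> \<le> m"
  shows "integrable lborel (\<lambda>z. U z * \<zeta> (fst z))"
    and "(\<integral>z. indicator {s\<^sub>1..s\<^sub>2} (snd z) * (U z * \<zeta> (fst z)) \<partial>lborel) \<le> (s\<^sub>2 - s\<^sub>1) * m"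
proof -
  note [measurable] = U(1)
  show 1: "integrable lborel (\<lambda>z. U z * \<zeta> (fst z))"
  proof (rule Bochner_Integration.integrable_bound[OF U(4)])
    show "AE z in lborel. norm (U z * \<zeta> (fst z)) \<le> norm (U z)"
      using U(2) \<zeta>(2,3) by (intro AE_I2) (auto simp: abs_mult intro: mult_left_le)
  qed measurable
  let ?f = "\<lambda>z. indicator {s\<^sub>1..s\<^sub>2} (snd z) * (U z * \<zeta> (fst z)) :: real"
  have "integrable lborel ?f" by (rule integrable_time_indicator[OF 1])
  then have i: "integrable (lborel \<Otimes>\<^sub>M lborel) (\<lambda>(x, y). ?f (x, y))" by (simp only: lborel_prod case_prod_unfold prod.collapse fst_conv snd_conv)
  have "(\<integral>z. ?f z \<partial>lborel) = (\<integral>y. (\<integral>x. ?f (x, y) \<partial>lborel) \<partial>lborel)"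
    using lborel_pair.integral_snd[OF i] by (simp only: lborel_prod case_prod_unfold prod.collapse fst_conv snd_conv)
  also have "\<dots> \<le> (\<integral>y. indicator {s\<^sub>1..s\<^sub>2} y * m \<partial>lborel)"
  proof (rule integral_mono_AE)
    show "integrable lborel (\<lambda>y. \<integral>x. ?f (x, y) \<partial>lborel)" by (rule lborel_pair.integrable_snd[OF i])
    have "integrable lborel (indicator {s\<^sub>1..s\<^sub>2} :: real \<Rightarrow> real)"
      using emeasure_lborel_Icc_eq[of s\<^sub>1 s\<^sub>2] by (intro integrable_real_indicator) auto
    then show "integrable lborel (\<lambda>y. indicator {s\<^sub>1..s\<^sub>2} y * m :: real)" by simp
    show "AE y in lborel. (\<integral>x. ?f (x, y) \<partial>lborel) \<le> indicator {s\<^sub>1..s\<^sub>2} y * m"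
      using AE_lborel_snd[OF U(3)]
    proof eventually_elim
      case (elim y)
      show ?case
      proof (cases "y \<in> {s\<^sub>1..s\<^sub>2}")
        case True
        then have y: "y \<in> {\<sigma>..\<sigma>'}" using s by auto
        have Um: "(\<lambda>x. U (x, y) * \<zeta> x) \<in> borel_measurable borel" using borel_measurable_slice[OF U(1)] by measurable
        have "(\<integral>x. ?f (x, y) \<partial>lborel) = (\<integral>x. U (x, y) * \<zeta> x \<partial>lebesgue)"
          using True Um by (subst integral_completion) auto
        also have "\<dots> = mass y"
          unfolding mass_def
        proof (rule integral_cong_AE)
          show "(\<lambda>x. U (x, y) * \<zeta> x) \<in> borel_measurable lebesgue" using Um by (intro measurable_completion) simp
          show "(\<lambda>x. indicator K x * (u x y * \<zeta> x)) \<in> borel_measurable lebesgue"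
            using mass_integrable[of y] y \<sigma> by (auto dest: borel_measurable_integrable)
          have "AE x in lebesgue. (x, y) \<in> K' \<times> {\<sigma>..\<sigma>'} \<longrightarrow> U (x, y) = u x y"
            using elim unfolding AE_completion_iff by simp
          then show "AE x in lebesgue. U (x, y) * \<zeta> x = indicator K x * (u x y * \<zeta> x)"
          proof eventually_elim
            case (elim x)
            then show ?case using y KK' SK \<zeta>(4)[of x] by (cases "x \<in> K") auto
          qed
        qed
        also have "\<dots> \<le> m" by (rule m[OF y])
        finally show ?thesis using True by simp
      qed simp
    qed
  qed
  also have "\<dots> = (s\<^sub>2 - s\<^sub>1) * m" using s by simp
  finally show "(\<integral>z. ?f z \<partial>lborel) \<le> (s\<^sub>2 - s\<^sub>1) * m" .
qed

context energy_setting
begin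

lemma entropy_nonneg: "0 \<le> entropy \<tau>"
  unfolding entropy_def
  by (intro Bochner_Integration.integral_nonneg) (use \<alpha> \<zeta>(2) in \<open>simp add: truncated_power_def\<close>)

text \<open>Interpolating \<open>(u + \<nu>) powr (1 - \<alpha>)\<close> between
  \<open>u + \<nu>\<close> and \<nu> expresses its sublinear growth: the coefficient of the mass can
  be as small as desired, at the price of a larger multiple of \<nu>.\<close>

lemma entropy_bound:
  assumes \<tau>: "\<tau> \<in> {0..T}" and \<eta>: "0 < \<eta>"
  shows "\<nu> powr \<alpha> * entropy \<tau> \<le> (\<eta> * mass \<tau> + (\<eta> + \<eta> powr (- (1 - \<alpha>) / \<alpha>)) * \<nu> * vol) / (1 - \<alpha>)"
proof -
  define D where "D = \<eta> powr (- (1 - \<alpha>) / \<alpha>)"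
  have "\<nu> powr \<alpha> * entropy \<tau> = (\<integral>x. \<nu> powr \<alpha> * (indicator K x * (truncated_power \<nu> \<alpha> (u x \<tau>) * \<zeta> x)) \<partial>lebesgue)"
    unfolding entropy_def by simp
  also have "\<dots> \<le> (\<integral>x. (\<eta> * (indicator K x * (u x \<tau> * \<zeta> x)) + (\<eta> + D) * \<nu> * indicator K x) / (1 - \<alpha>) \<partial>lebesgue)"
  proof (rule integral_mono_AE)
    show "integrable lebesgue (\<lambda>x. \<nu> powr \<alpha> * (indicator K x * (truncated_power \<nu> \<alpha> (u x \<tau>) * \<zeta> x)))"
      by (intro integrable_mult_right
          slice_Lipschitz(1)[OF uC K(1) K\<Omega> truncated_power_Lipschitz[OF \<nu> \<alpha>] cutoff_measurable(1) cutoff_abs_le_1 \<tau>])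
    show "integrable lebesgue (\<lambda>x. (\<eta> * (indicator K x * (u x \<tau> * \<zeta> x)) + (\<eta> + D) * \<nu> * indicator K x) / (1 - \<alpha>))"
      by (intro integrable_divide Bochner_Integration.integrable_add integrable_mult_right mass_integrable[OF \<tau>]
          integrable_indicator_compact[OF K(1)])
    show "AE x in lebesgue. \<nu> powr \<alpha> * (indicator K x * (truncated_power \<nu> \<alpha> (u x \<tau>) * \<zeta> x))
      \<le> (\<eta> * (indicator K x * (u x \<tau> * \<zeta> x)) + (\<eta> + D) * \<nu> * indicator K x) / (1 - \<alpha>)"
      using slice_nonneg[OF uC K(1) K\<Omega> T upos \<tau>]
    proof eventually_elim
      case (elim x)
      show ?case
      proof (cases "x \<in> K")
        case True
        then have u0: "0 \<le> u x \<tau>" using elim by blast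
        have "(u x \<tau> + \<nu>) powr (1 - \<alpha>) * \<nu> powr (1 - (1 - \<alpha>)) \<le> \<eta> * (u x \<tau> + \<nu>) + \<eta> powr (- (1 - \<alpha>) / (1 - (1 - \<alpha>))) * \<nu>"
          using u0 \<nu> \<eta> \<alpha> by (intro powr_interpolation) auto
        then have le: "\<nu> powr \<alpha> * (u x \<tau> + \<nu>) powr (1 - \<alpha>) \<le> \<eta> * u x \<tau> + (\<eta> + D) * \<nu>"
          by (simp add: D_def algebra_simps)
        have "\<nu> powr \<alpha> * (u x \<tau> + \<nu>) powr (1 - \<alpha>) * \<zeta> x \<le> (\<eta> * u x \<tau> + (\<eta> + D) * \<nu>) * \<zeta> x"
          by (rule mult_right_mono[OF le \<zeta>(2)])
        also have "\<dots> \<le> \<eta> * (u x \<tau> * \<zeta> x) + (\<eta> + D) * \<nu> * 1"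
        proof -
          have "(\<eta> + D) * \<nu> * \<zeta> x \<le> (\<eta> + D) * \<nu> * 1"
            using \<eta> \<nu> \<zeta>(3) by (intro mult_left_mono) (auto simp: D_def)
          then show ?thesis by (simp add: algebra_simps)
        qed
        finally have "\<nu> powr \<alpha> * (u x \<tau> + \<nu>) powr (1 - \<alpha>) * \<zeta> x / (1 - \<alpha>) \<le> (\<eta> * (u x \<tau> * \<zeta> x) + (\<eta> + D) * \<nu>) / (1 - \<alpha>)"
          using \<alpha> by (intro divide_right_mono) auto
        then show ?thesis using True u0 by (simp add: truncated_power_def max_def)
      qed simp
    qed
  qed
  also have "\<dots> = (\<eta> * mass \<tau> + (\<eta> + D) * \<nu> * vol) / (1 - \<alpha>)"
    unfolding mass_def integral_indicator_volume[symmetric]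
    using mass_integrable[OF \<tau>] integrable_indicator_compact[OF K(1)] by simp
  finally show ?thesis unfolding D_def .
qed

text \<open>The energy of the gradient is never estimated on its own: the whole tested expression is
  replaced by the increment of the entropy, and the entropy at \<open>s\<^sub>1\<close> is dropped
  by its sign. Division by \<open>t\<close> compensates the length of the time interval.\<close>

lemma oscillation_bound:
  assumes flux: "AE z in lborel. z \<in> K \<times> {\<sigma>..\<sigma>'} \<longrightarrow>
      flux z \<le> \<Lambda> * (b z * test z - (\<Sum>i\<in>UNIV. a i z * test_grad i z)) + (\<delta> * ((U z + \<nu>) * \<zeta> (fst z)) + \<Gamma> * \<nu>) / t"
    and m: "0 \<le> m" "\<And>\<tau>. \<tau> \<in> {\<sigma>..\<sigma>'} \<Longrightarrow> mass \<tau> \<le> m"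
    and nonneg: "0 \<le> \<Lambda>" "0 \<le> \<delta>" "0 \<le> \<Gamma>" "0 < t"
    and s: "\<sigma> < s\<^sub>1" "s\<^sub>1 < s\<^sub>2" "s\<^sub>2 \<le> \<sigma>'" "s\<^sub>2 - s\<^sub>1 \<le> t"
  shows "\<bar>mass s\<^sub>2 - mass s\<^sub>1\<bar> \<le> \<Lambda> * entropy s\<^sub>2 + \<delta> * m + (\<delta> + \<Gamma>) * \<nu> * vol"
proof -
  let ?I = "\<lambda>z :: _ \<times> real. indicator {s\<^sub>1..s\<^sub>2} (snd z) :: real"
  let ?E = "\<lambda>z. b z * test z - (\<Sum>i\<in>UNIV. a i z * test_grad i z)"
  define c where "c = (\<delta> + \<Gamma>) * \<nu>"
  have c0: "0 \<le> c" unfolding c_def using nonneg \<nu> by simp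
  note m1 = mass_time_integral[of s\<^sub>1 s\<^sub>2 m, OF less_imp_le[OF s(1)] less_imp_le[OF s(2)] s(3) m(2)]
  have Ki: "integrable lborel (indicator K :: _ \<Rightarrow> real)"
    using emeasure_bounded_finite[OF compact_imp_bounded[OF K(1)]] by (intro integrable_real_indicator) auto
  have Ji: "integrable lborel (indicator {s\<^sub>1..s\<^sub>2} :: real \<Rightarrow> real)"
    using emeasure_lborel_Icc_eq[of s\<^sub>1 s\<^sub>2] by (intro integrable_real_indicator) auto
  note P = integrable_lborel_product[OF Ki Ji]
  have Ei: "integrable lborel (\<lambda>z. ?I z * ?E z)"
  proof -
    have "integrable lborel (\<lambda>z. ?I z * (b z * (indicator {\<sigma>..\<sigma>'} (snd z) * test z)
      - (\<Sum>i\<in>UNIV. a i z * (indicator {\<sigma>..\<sigma>'} (snd z) * test_grad i z))))"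
      by (intro integrable_time_indicator Bochner_Integration.integrable_diff Bochner_Integration.integrable_sum energy_terms_integrable)
    also have "(\<lambda>z. ?I z * (b z * (indicator {\<sigma>..\<sigma>'} (snd z) * test z)
      - (\<Sum>i\<in>UNIV. a i z * (indicator {\<sigma>..\<sigma>'} (snd z) * test_grad i z)))) = (\<lambda>z. ?I z * ?E z)"
      using s by (auto simp: fun_eq_iff indicator_def)
    finally show ?thesis .
  qed
  have Ui: "integrable lborel (\<lambda>z. ?I z * (U z * \<zeta> (fst z)))" by (rule integrable_time_indicator[OF m1(1)])
  have "\<bar>mass s\<^sub>2 - mass s\<^sub>1\<bar> \<le> (\<integral>z. ?I z * flux z \<partial>lborel)"
    using s by (intro mass_oscillation) auto
  also have "\<dots> \<le> (\<integral>z. \<Lambda> * (?I z * ?E z) + (\<delta> * (?I z * (U z * \<zeta> (fst z))) + c * (indicator K (fst z) * indicator {s\<^sub>1..s\<^sub>2} (snd z))) / t \<partial>lborel)"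
  proof (rule integral_mono_AE)
    show "integrable lborel (\<lambda>z. ?I z * flux z)" by (rule integrable_time_indicator[OF flux_term_integrable(3)])
    show "integrable lborel (\<lambda>z. \<Lambda> * (?I z * ?E z) + (\<delta> * (?I z * (U z * \<zeta> (fst z))) + c * (indicator K (fst z) * indicator {s\<^sub>1..s\<^sub>2} (snd z))) / t)"
      by (intro Bochner_Integration.integrable_add integrable_divide integrable_mult_right Ei Ui P(1))
    show "AE z in lborel. ?I z * flux z \<le> \<Lambda> * (?I z * ?E z) + (\<delta> * (?I z * (U z * \<zeta> (fst z))) + c * (indicator K (fst z) * indicator {s\<^sub>1..s\<^sub>2} (snd z))) / t"
      using flux
    proof eventually_elim
      case (elim z)
      show ?case
      proof (cases "snd z \<in> {s\<^sub>1..s\<^sub>2}")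
        case True
        show ?thesis
        proof (cases "fst z \<in> K")
          case xK: True
          with True s have "z \<in> K \<times> {\<sigma>..\<sigma>'}" by (cases z) auto
          then have "flux z \<le> \<Lambda> * ?E z + (\<delta> * ((U z + \<nu>) * \<zeta> (fst z)) + \<Gamma> * \<nu>) / t" using elim by (rule rev_mp)
          also have "\<dots> \<le> \<Lambda> * ?E z + (\<delta> * (U z * \<zeta> (fst z)) + c) / t"
          proof -
            have "\<delta> * \<nu> * \<zeta> (fst z) \<le> \<delta> * \<nu> * 1" using nonneg \<nu> \<zeta>(3) by (intro mult_left_mono) auto
            then show ?thesis using nonneg by (intro add_left_mono divide_right_mono) (auto simp: c_def algebra_simps)
          qed
          finally show ?thesis using True xK by simp
        next
          case False
          then have "z \<notin> K \<times> {\<sigma>..\<sigma>'}" by (cases z) auto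
          then have "flux z = 0" "?E z = 0" using a(2) b(2) by (simp_all add: flux_def)
          then show ?thesis using nonneg U(2)[of z] \<zeta>(2)[of "fst z"] True False by simp
        qed
      qed simp
    qed
  qed
  also have "\<dots> = \<Lambda> * (\<integral>z. ?I z * ?E z \<partial>lborel) + (\<delta> * (\<integral>z. ?I z * (U z * \<zeta> (fst z)) \<partial>lborel)
      + c * (\<integral>z. indicator K (fst z) * indicator {s\<^sub>1..s\<^sub>2} (snd z) \<partial>lborel)) / t"
    using Ei Ui P(1) by simp
  also have "\<dots> \<le> \<Lambda> * (entropy s\<^sub>2 - entropy s\<^sub>1) + (\<delta> * ((s\<^sub>2 - s\<^sub>1) * m) + c * ((s\<^sub>2 - s\<^sub>1) * vol)) / t"
  proof (intro add_mono mult_left_mono divide_right_mono nonneg c0)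
    show "(\<integral>z. ?I z * ?E z \<partial>lborel) \<le> entropy s\<^sub>2 - entropy s\<^sub>1" by (rule energy_inequality[OF s(1-3)])
    show "(\<integral>z. ?I z * (U z * \<zeta> (fst z)) \<partial>lborel) \<le> (s\<^sub>2 - s\<^sub>1) * m" by (rule m1(2))
    show "(\<integral>z. indicator K (fst z) * indicator {s\<^sub>1..s\<^sub>2} (snd z) \<partial>lborel) \<le> (s\<^sub>2 - s\<^sub>1) * vol"
      unfolding P(2) using s by simp
    show "0 \<le> t" using nonneg by simp
  qed
  also have "\<dots> \<le> \<Lambda> * entropy s\<^sub>2 + (\<delta> * m + c * vol)"
  proof (rule add_mono)
    show "\<Lambda> * (entropy s\<^sub>2 - entropy s\<^sub>1) \<le> \<Lambda> * entropy s\<^sub>2"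
      using nonneg entropy_nonneg[of s\<^sub>1] by (intro mult_left_mono) auto
    have "(\<delta> * m + c * vol) * (s\<^sub>2 - s\<^sub>1) \<le> (\<delta> * m + c * vol) * t"
      using s nonneg c0 m by (intro mult_left_mono) auto
    then show "(\<delta> * ((s\<^sub>2 - s\<^sub>1) * m) + c * ((s\<^sub>2 - s\<^sub>1) * vol)) / t \<le> \<delta> * m + c * vol"
      using nonneg by (simp add: pos_divide_le_eq algebra_simps)
  qed
  finally show ?thesis by (simp add: c_def)
qed

end

text \<open>Let \<open>m\<close> be the maximal mass. The condition \<open>small\<close> leaves half
  of it in the oscillation, so the mass at \<open>\<tau>\<^sub>2\<close> is at least
  \<open>m / 2 - D * \<nu> * vol\<close>. The pointwise estimate is a hypothesis so that its
  constants can be fixed before any solution is considered.\<close>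

lemma (in cutoff_setting) mass_harnack:
  fixes \<nu> \<alpha> \<kappa> \<eta> \<delta> \<Lambda> \<Gamma> M t :: real and L :: "'n \<Rightarrow> real"
  assumes pos: "0 < \<nu>" "0 < \<alpha>" "\<alpha> < 1" "0 < \<eta>" "0 \<le> \<delta>" "0 \<le> \<Lambda>" "0 \<le> \<Gamma>" "0 < t" "t \<le> T"
    and pointwise: "\<And>z w b (a :: 'n \<Rightarrow> real) d \<xi>.
      \<lbrakk> 0 \<le> z; z \<le> 1; \<nu> \<le> w;
        \<And>i. C\<^sub>o * \<bar>\<xi> i\<bar> powr p i - C powr p i \<le> a i * \<xi> i;
        \<And>i. \<bar>a i\<bar> \<le> C\<^sub>1 * \<bar>\<xi> i\<bar> powr (p i - 1) + C powr (p i - 1);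
        \<bar>b\<bar> \<le> (\<Sum>i\<in>UNIV. C * (\<bar>\<xi> i\<bar> powr (p i - 1) + C powr (p i - 1)));
        \<And>i. \<bar>d i\<bar> \<le> M / L i * z powr (1 - \<kappa>) \<rbrakk>
      \<Longrightarrow> (\<Sum>i\<in>UNIV. \<bar>a i\<bar> * \<bar>d i\<bar>) + \<bar>b\<bar> * z
        \<le> \<Lambda> * \<nu> powr \<alpha> *
            (b * (w powr (- \<alpha>) * z)
             - (\<Sum>i\<in>UNIV. a i * (- \<alpha> * w powr (- \<alpha> - 1) * \<xi> i * z + w powr (- \<alpha>) * d i)))
          + (\<delta> * (w * z) + \<Gamma> * \<nu>) / t"
    and d\<zeta>: "\<And>i x. \<bar>dir_deriv (axis i 1) \<zeta> x\<bar> \<le> M / L i * \<zeta> x powr (1 - \<kappa>)"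
    and small: "\<Lambda> * \<eta> / (1 - \<alpha>) + \<delta> \<le> 1 / 2"
    and \<tau>: "\<tau>\<^sub>1 \<in> {0..t}" "\<tau>\<^sub>2 \<in> {0..t}"
  shows "mass \<tau>\<^sub>1 \<le> 2 * mass \<tau>\<^sub>2 + 2 * (\<Lambda> * (\<eta> + \<eta> powr (- (1 - \<alpha>) / \<alpha>)) / (1 - \<alpha>) + \<delta> + \<Gamma>) * \<nu> * vol"
proof -
  define D where "D = \<Lambda> * (\<eta> + \<eta> powr (- (1 - \<alpha>) / \<alpha>)) / (1 - \<alpha>) + \<delta> + \<Gamma>"
  have D0: "0 \<le> D" unfolding D_def using pos by (intro add_nonneg_nonneg divide_nonneg_nonneg mult_nonneg_nonneg) auto
  have cont: "continuous_on {0..t} mass" by (rule continuous_on_subset[OF mass_continuous]) (use pos in auto)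
  obtain \<tau> where \<tau>m: "\<tau> \<in> {0..t}" "\<And>s. s \<in> {0..t} \<Longrightarrow> mass s \<le> mass \<tau>"
    using continuous_attains_sup[OF compact_Icc _ cont] pos by fastforce
  define m where "m = mass \<tau>"
  have m0: "0 \<le> m" unfolding m_def using \<tau>m pos by (intro mass_nonneg) auto
  define c where "c = m / 2 + D * \<nu> * vol"
  have c0: "0 \<le> c" unfolding c_def using m0 D0 pos by simp
  have osc: "\<bar>mass s\<^sub>2 - mass s\<^sub>1\<bar> \<le> c" if s: "0 < s\<^sub>1" "s\<^sub>1 < s\<^sub>2" "s\<^sub>2 < t" for s\<^sub>1 s\<^sub>2
  proof -
    \<comment> \<open>Starting at \<open>s\<^sub>1 / 2\<close> keeps the time interval compact in
      the open interval and leaves room for backward differences before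
      \<open>s\<^sub>1\<close>.\<close>
    obtain d U V a b where R: "represented_setting p C\<^sub>o C\<^sub>1 C T \<Omega> K K' S A B u Du Du' \<zeta> (s\<^sub>1 / 2) s\<^sub>2 d U V a b"
      using represented_exists[of "s\<^sub>1 / 2" s\<^sub>2] s pos by auto
    interpret energy_setting p C\<^sub>o C\<^sub>1 C T \<Omega> K K' S A B u Du Du' \<zeta> "s\<^sub>1 / 2" s\<^sub>2 d U V a b \<nu> \<alpha>
      by (rule energy_setting.intro[OF R energy_setting_axioms.intro[OF pos(1-3)]])
    have "\<bar>mass s\<^sub>2 - mass s\<^sub>1\<bar> \<le> \<Lambda> * \<nu> powr \<alpha> * entropy s\<^sub>2 + \<delta> * m + (\<delta> + \<Gamma>) * \<nu> * vol"
    proof (rule oscillation_bound[where t = t])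
      show "AE z in lborel. z \<in> K \<times> {s\<^sub>1 / 2..s\<^sub>2} \<longrightarrow> flux z \<le> \<Lambda> * \<nu> powr \<alpha> * (b z * test z - (\<Sum>i\<in>UNIV. a i z * test_grad i z))
        + (\<delta> * ((U z + \<nu>) * \<zeta> (fst z)) + \<Gamma> * \<nu>) / t"
        using structure_AE
      proof eventually_elim
        case (elim z)
        show ?case
        proof
          assume "z \<in> K \<times> {s\<^sub>1 / 2..s\<^sub>2}"
          with elim have E: "\<forall>i. C\<^sub>o * \<bar>V i z\<bar> powr p i - C powr p i \<le> a i z * V i z"
            "\<forall>i. \<bar>a i z\<bar> \<le> C\<^sub>1 * \<bar>V i z\<bar> powr (p i - 1) + C powr (p i - 1)"
            "\<bar>b z\<bar> \<le> (\<Sum>i\<in>UNIV. C * (\<bar>V i z\<bar> powr (p i - 1) + C powr (p i - 1)))" by blast+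
          show "flux z \<le> \<Lambda> * \<nu> powr \<alpha> * (b z * test z - (\<Sum>i\<in>UNIV. a i z * test_grad i z))
            + (\<delta> * ((U z + \<nu>) * \<zeta> (fst z)) + \<Gamma> * \<nu>) / t"
            unfolding flux_def test_def test_grad_def
            by (rule pointwise) (use E \<zeta>(2,3) U(2)[of z] d\<zeta> in auto)
        qed
      qed
      show "mass r \<le> m" if "r \<in> {s\<^sub>1 / 2..s\<^sub>2}" for r
        unfolding m_def using that s by (intro \<tau>m(2)) auto
    qed (use pos m0 s in auto)
    also have "\<Lambda> * \<nu> powr \<alpha> * entropy s\<^sub>2 \<le> \<Lambda> * ((\<eta> * m + (\<eta> + \<eta> powr (- (1 - \<alpha>) / \<alpha>)) * \<nu> * vol) / (1 - \<alpha>))"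
    proof -
      have "\<nu> powr \<alpha> * entropy s\<^sub>2 \<le> (\<eta> * mass s\<^sub>2 + (\<eta> + \<eta> powr (- (1 - \<alpha>) / \<alpha>)) * \<nu> * vol) / (1 - \<alpha>)"
        using s pos by (intro entropy_bound) auto
      also have "\<dots> \<le> (\<eta> * m + (\<eta> + \<eta> powr (- (1 - \<alpha>) / \<alpha>)) * \<nu> * vol) / (1 - \<alpha>)"
        unfolding m_def using s pos by (intro divide_right_mono add_right_mono mult_left_mono \<tau>m(2)) auto
      finally show ?thesis unfolding mult.assoc[of \<Lambda>] by (rule mult_left_mono[OF _ pos(6)])
    qed
    also have "\<Lambda> * ((\<eta> * m + (\<eta> + \<eta> powr (- (1 - \<alpha>) / \<alpha>)) * \<nu> * vol) / (1 - \<alpha>)) + \<delta> * m + (\<delta> + \<Gamma>) * \<nu> * vol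
      = (\<Lambda> * \<eta> / (1 - \<alpha>) + \<delta>) * m + D * \<nu> * vol"
      unfolding D_def by (simp add: add_divide_distrib distrib_left distrib_right mult_ac)
    also have "\<dots> \<le> c" unfolding c_def using mult_right_mono[OF small m0] by simp
    finally show ?thesis by simp
  qed
  have osc': "\<bar>mass s\<^sub>2 - mass s\<^sub>1\<bar> \<le> c" if "s\<^sub>1 \<in> {0<..<t}" "s\<^sub>2 \<in> {0<..<t}" for s\<^sub>1 s\<^sub>2
    using osc[of s\<^sub>1 s\<^sub>2] osc[of s\<^sub>2 s\<^sub>1] that c0 by (cases s\<^sub>1 s\<^sub>2 rule: linorder_cases) (auto simp: abs_minus_commute)
  \<comment> \<open>The endpoints are reached by continuity of the mass, in one variable after the
    other.\<close>
  have cl: "closure {0<..<t} = {0..t}" using pos by simp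
  have osc1: "\<bar>mass s\<^sub>2 - mass s\<^sub>1\<bar> \<le> c" if "s\<^sub>1 \<in> {0..t}" "s\<^sub>2 \<in> {0<..<t}" for s\<^sub>1 s\<^sub>2
    by (rule continuous_le_on_closure[of "{0<..<t}" "\<lambda>r. \<bar>mass s\<^sub>2 - mass r\<bar>"])
      (use that osc' in \<open>auto simp only: cl intro!: continuous_intros cont\<close>)
  have "\<bar>mass \<tau> - mass \<tau>\<^sub>2\<bar> \<le> c"
    by (rule continuous_le_on_closure[of "{0<..<t}" "\<lambda>r. \<bar>mass r - mass \<tau>\<^sub>2\<bar>"])
      (use osc1 \<tau> \<tau>m(1) in \<open>auto simp only: cl intro!: continuous_intros cont\<close>)
  then have "m \<le> 2 * mass \<tau>\<^sub>2 + 2 * D * \<nu> * vol" unfolding c_def m_def by simp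
  then show ?thesis using \<tau>m(2)[OF \<tau>(1)] unfolding D_def m_def by simp
qed

section \<open>Intrinsic geometry\<close>

definition intrinsic_side :: "('n::finite \<Rightarrow> real) \<Rightarrow> real \<Rightarrow> real \<Rightarrow> 'n \<Rightarrow> real" where
  "intrinsic_side p \<rho> t i = \<rho> powr (hmean p * (2 - p i) / (p i * (2 - hmean p))) * t powr ((p i - hmean p) / ((2 - hmean p) * p i))"

lemma intrinsic_cube_side: "intrinsic_cube p a \<rho> t = {x. \<forall>i. \<bar>x $ i\<bar> < a * intrinsic_side p \<rho> t i}"
  by (simp add: intrinsic_cube_def intrinsic_side_def mult.assoc)

lemma hmean_bounds:
  fixes p :: "'n::finite \<Rightarrow> real"
  assumes p: "\<And>i. 1 < p i" "\<And>i. p i < 2"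
  shows "0 < hmean p" "hmean p < 2" "(\<Sum>i\<in>UNIV. 1 / p i) = real CARD('n) / hmean p"
proof -
  have "(\<Sum>i\<in>(UNIV :: 'n set). 1 / 2) < (\<Sum>i\<in>UNIV. 1 / p i)"
    using p less_trans[OF zero_less_one p(1)] by (intro sum_strict_mono) (auto intro!: divide_strict_left_mono)
  then have s: "real CARD('n) < 2 * (\<Sum>i\<in>UNIV. 1 / p i)" by simp
  moreover have c: "0 < real CARD('n)" by simp
  ultimately have pos: "0 < (\<Sum>i\<in>UNIV. 1 / p i)" by linarith
  show "0 < hmean p" "hmean p < 2" using s pos c by (auto simp: hmean_def pos_divide_less_eq)
  show "(\<Sum>i\<in>UNIV. 1 / p i) = real CARD('n) / hmean p" using pos c by (simp add: hmean_def)
qed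

text \<open>In the variables \<open>ln t\<close> and \<open>ln \<rho>\<close> every quantity is the
  exponential of a linear form, so each identity is a comparison of exponents. The product of the
  sides is where the harmonic mean enters.\<close>

lemma intrinsic_scaling:
  fixes p :: "'n::finite \<Rightarrow> real"
  assumes p: "\<And>i. 1 < p i" "\<And>i. p i < 2" and t: "0 < t" "0 < \<rho>"
  defines "\<nu> \<equiv> (t / \<rho> powr hmean p) powr (1 / (2 - hmean p))"
  shows "0 < intrinsic_side p \<rho> t i"
    and "intrinsic_side p \<rho> t i powr p i = \<rho> powr hmean p * \<nu> powr (p i - hmean p)"
    and "intrinsic_side p \<rho> t i powr (- p i) = \<nu> powr (2 - p i) / t"
    and "(\<Prod>i\<in>UNIV. intrinsic_side p \<rho> t i) = \<rho> powr real CARD('n)"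
    and "(t / \<rho> powr (real CARD('n) * (hmean p - 2) + hmean p)) powr (1 / (2 - hmean p)) = \<nu> * \<rho> powr real CARD('n)"
proof -
  define h where "h = hmean p"
  define lt l\<rho> where "lt = ln t" and "l\<rho> = ln \<rho>"
  have h: "0 < h" "h < 2" "(\<Sum>i\<in>UNIV. 1 / p i) = real CARD('n) / h"
    using hmean_bounds[where p = p, OF p] by (simp_all add: h_def)
  define g where "g = 2 - h"
  have g: "g \<noteq> 0" "h = 2 - g" using h by (simp_all add: g_def)
  have te: "t = exp lt" "\<rho> = exp l\<rho>" using t by (simp_all add: lt_def l\<rho>_def)
  have pe: "exp x powr y = exp (y * x)" for x y :: real by (simp add: powr_def)
  have \<nu>e: "\<nu> = exp ((lt - h * l\<rho>) / g)"
    unfolding \<nu>_def h_def[symmetric] g_def[symmetric] te pe exp_diff[symmetric] by simp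
  have pj: "p j \<noteq> 0" for j using p(1)[of j] by simp
  have se: "intrinsic_side p \<rho> t j = exp ((h * (2 - p j) * l\<rho> + (p j - h) * lt) / (g * p j))" for j
  proof -
    have "intrinsic_side p \<rho> t j = exp (h * (2 - p j) / (p j * g) * l\<rho> + (p j - h) / (g * p j) * lt)"
      unfolding intrinsic_side_def h_def[symmetric] g_def[symmetric] te pe exp_add[symmetric] by simp
    also have "h * (2 - p j) / (p j * g) * l\<rho> + (p j - h) / (g * p j) * lt = (h * (2 - p j) * l\<rho> + (p j - h) * lt) / (g * p j)"
      by (simp add: add_divide_distrib mult.commute)
    finally show ?thesis .
  qed
  show "0 < intrinsic_side p \<rho> t i" unfolding se by simp
  have "p i * ((h * (2 - p i) * l\<rho> + (p i - h) * lt) / (g * p i)) = h * l\<rho> + (p i - h) * ((lt - h * l\<rho>) / g)"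
    unfolding g(2) using g(1) pj[of i] by (simp add: field_simps)
  then show "intrinsic_side p \<rho> t i powr p i = \<rho> powr hmean p * \<nu> powr (p i - hmean p)"
    unfolding se \<nu>e h_def[symmetric] unfolding te pe exp_add[symmetric] by simp
  have "- p i * ((h * (2 - p i) * l\<rho> + (p i - h) * lt) / (g * p i)) = (2 - p i) * ((lt - h * l\<rho>) / g) - lt"
    unfolding g(2) using g(1) pj[of i] by (simp add: field_simps)
  then show "intrinsic_side p \<rho> t i powr (- p i) = \<nu> powr (2 - p i) / t"
    unfolding se \<nu>e unfolding te pe exp_diff[symmetric] by simp
  have "1 / g * (lt - (real CARD('n) * (h - 2) + h) * l\<rho>) = (lt - h * l\<rho>) / g + real CARD('n) * l\<rho>"
    unfolding g(2) using g(1) by (simp add: field_simps)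
  then show "(t / \<rho> powr (real CARD('n) * (hmean p - 2) + hmean p)) powr (1 / (2 - hmean p)) = \<nu> * \<rho> powr real CARD('n)"
    unfolding \<nu>e h_def[symmetric] g_def[symmetric] te pe exp_diff[symmetric] exp_add[symmetric] by simp
  have e: "(h * (2 - p j) * l\<rho> + (p j - h) * lt) / (g * p j) = h * (2 * l\<rho> - lt) / g * (1 / p j) + (lt - h * l\<rho>) / g" for j
    using g(1) pj[of j] by (simp add: field_simps)
  have "(\<Sum>j\<in>UNIV. (h * (2 - p j) * l\<rho> + (p j - h) * lt) / (g * p j))
      = h * (2 * l\<rho> - lt) / g * (real CARD('n) / h) + real CARD('n) * ((lt - h * l\<rho>) / g)"
    unfolding e sum.distrib sum_distrib_left[symmetric] h(3) by simp
  also have "\<dots> = real CARD('n) * ((2 * l\<rho> - lt) / g + (lt - h * l\<rho>) / g)" using h(1) by (simp add: algebra_simps)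
  also have "(2 * l\<rho> - lt) / g + (lt - h * l\<rho>) / g = l\<rho>"
    unfolding g(2) using g(1) by (simp add: field_simps)
  finally have "exp (\<Sum>j\<in>UNIV. (h * (2 - p j) * l\<rho> + (p j - h) * lt) / (g * p j)) = exp (real CARD('n) * l\<rho>)" by simp
  then show "(\<Prod>i\<in>UNIV. intrinsic_side p \<rho> t i) = \<rho> powr real CARD('n)"
    unfolding se exp_sum[OF finite] unfolding te pe .
qed

text \<open>After raising to the power \<open>p i\<close>, the quantity becomes
  \<open>C powr p i * \<rho> powr hmean p\<close> times \<open>\<nu> powr (p i - hmean p)\<close>,
  and the powers of \<nu> in the minimum give \<open>1\<close> and
  \<open>\<nu> powr p i\<close>.\<close>

lemma lower_order_scaling:
  fixes p :: "'n::finite \<Rightarrow> real"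
  assumes p: "\<And>i. 1 < p i" "\<And>i. p i < 2" and t: "0 < t" "0 < \<rho>" and C: "0 \<le> C"
  defines "\<nu> \<equiv> (t / \<rho> powr hmean p) powr (1 / (2 - hmean p))"
  assumes small: "C powr p i * \<rho> powr hmean p \<le> Min {1, \<nu> powr (hmean p - p i), \<nu> powr hmean p}"
  shows "C * intrinsic_side p \<rho> t i \<le> 1" "C * intrinsic_side p \<rho> t i \<le> \<nu>"
proof -
  note sc = intrinsic_scaling[where p = p, OF p t, folded \<nu>_def]
  have pi: "0 < p i" using p(1)[of i] by simp
  have \<nu>0: "0 < \<nu>" using t by (simp add: \<nu>_def)
  have le: "C powr p i * \<rho> powr hmean p \<le> \<nu> powr (hmean p - p i)" "C powr p i * \<rho> powr hmean p \<le> \<nu> powr hmean p"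
    using small by simp_all
  have eq: "(C * intrinsic_side p \<rho> t i) powr p i = (C powr p i * \<rho> powr hmean p) * \<nu> powr (p i - hmean p)"
    using C sc(1)[of i] by (simp add: powr_mult sc(2))
  have nn: "0 \<le> C * intrinsic_side p \<rho> t i" using C sc(1)[of i] by simp
  have "(C * intrinsic_side p \<rho> t i) powr p i \<le> \<nu> powr (hmean p - p i) * \<nu> powr (p i - hmean p)"
    unfolding eq using le(1) by (rule mult_right_mono) simp
  also have "\<dots> = 1 powr p i" using \<nu>0 by (simp flip: powr_add)
  finally show "C * intrinsic_side p \<rho> t i \<le> 1" using nn pi powr_less_mono2[of "p i" 1 "C * intrinsic_side p \<rho> t i"] by fastforce
  have "(C * intrinsic_side p \<rho> t i) powr p i \<le> \<nu> powr hmean p * \<nu> powr (p i - hmean p)"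
    unfolding eq using le(2) by (rule mult_right_mono) simp
  also have "\<dots> = \<nu> powr p i" by (simp flip: powr_add)
  finally show "C * intrinsic_side p \<rho> t i \<le> \<nu>" using nn pi \<nu>0 powr_less_mono2[of "p i" \<nu> "C * intrinsic_side p \<rho> t i"] by fastforce
qed

text \<open>With \<alpha> half the distance of the largest exponent from two,
  \<open>p i - 1 \<le> 1 - 2 * \<alpha>\<close>, and
  \<open>(1 + \<alpha>) * (1 - 2 * \<alpha>) \<le> 1 - \<alpha>\<close> leaves room for
  \<open>2 / k \<le> \<alpha>\<close>.\<close>

lemma exponents_exist:
  fixes p :: "'n::finite \<Rightarrow> real"
  assumes p: "\<And>i. 1 < p i" "\<And>i. p i < 2"
  obtains \<alpha> k where "0 < \<alpha>" "\<alpha> < 1" "2 \<le> k" "2 * (1 / real k) \<le> \<alpha>" "\<And>i. (1 + \<alpha>) * (p i - 1) \<le> 1 - 2 * (1 / real k)"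
proof -
  define \<alpha> where "\<alpha> = (2 - Max (range p)) / 2"
  have "Max (range p) \<in> range p" by (rule Max_in) auto
  then obtain j where "Max (range p) = p j" by blast
  then have M: "1 < Max (range p)" "Max (range p) < 2" using p by simp_all
  then have \<alpha>: "0 < \<alpha>" "\<alpha> < 1 / 2" by (simp_all add: \<alpha>_def)
  obtain k where k: "2 / \<alpha> < real k" using reals_Archimedean2 by blast
  have "4 < 2 / \<alpha>" using \<alpha> by (simp add: field_simps)
  then have k4: "4 < real k" using k by linarith
  have k\<alpha>: "2 * (1 / real k) \<le> \<alpha>" using k k4 \<alpha> by (simp add: field_simps)
  have "(1 + \<alpha>) * (p i - 1) \<le> 1 - 2 * (1 / real k)" for i
  proof -
    have "p i \<le> Max (range p)" by simp
    then have "p i - 1 \<le> 1 - 2 * \<alpha>" by (simp add: \<alpha>_def field_simps)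
    then have "(1 + \<alpha>) * (p i - 1) \<le> (1 + \<alpha>) * (1 - 2 * \<alpha>)" using \<alpha> by (intro mult_left_mono) auto
    also have "\<dots> = 1 - \<alpha> - 2 * \<alpha> * \<alpha>" by (simp add: algebra_simps)
    also have "\<dots> \<le> 1 - \<alpha>" using \<alpha> by simp
    finally show ?thesis using k\<alpha> by linarith
  qed
  then show ?thesis using that[of \<alpha> k] \<alpha> k4 k\<alpha> by simp
qed

text \<open>\<open>P\<close> stands for the small cube, where the cutoff is at least
  \<open>c\<close>, and \<open>Q\<close> for the large one. This passes between the extended
  integrals of the final statement and the real-valued mass; nonnegativity of slices keeps
  \<open>ennreal\<close> from truncating.\<close>

lemma (in cutoff_setting) integral_comparison:
  assumes \<tau>: "\<tau> \<in> {0..T}" and Q: "K \<subseteq> Q" and low: "0 < c" "\<And>x. x \<in> P \<Longrightarrow> x \<in> K \<and> c \<le> \<zeta> x"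
  shows "(\<integral>\<^sup>+x\<in>P. ennreal (u x \<tau>) \<partial>lebesgue) \<le> ennreal (mass \<tau> / c)"
    and "ennreal (mass \<tau>) \<le> (\<integral>\<^sup>+x\<in>Q. ennreal (u x \<tau>) \<partial>lebesgue)"
proof -
  note pos = slice_nonneg[OF uC K(1) K\<Omega> T upos \<tau>]
  have eq: "(\<integral>\<^sup>+x. ennreal (indicator K x * (u x \<tau> * \<zeta> x)) \<partial>lebesgue) = ennreal (mass \<tau>)"
    unfolding mass_def by (rule nn_integral_eq_integral[OF mass_integrable[OF \<tau>] mass_AE_nonneg[OF \<tau>]])
  have "(\<integral>\<^sup>+x\<in>P. ennreal (u x \<tau>) \<partial>lebesgue) \<le> (\<integral>\<^sup>+x. ennreal (indicator K x * (u x \<tau> * \<zeta> x) / c) \<partial>lebesgue)"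
  proof (rule nn_integral_mono_AE)
    show "AE x in lebesgue. ennreal (u x \<tau>) * indicator P x \<le> ennreal (indicator K x * (u x \<tau> * \<zeta> x) / c)"
      using pos
    proof eventually_elim
      case (elim x)
      show ?case
      proof (cases "x \<in> P")
        case True
        then have x: "x \<in> K" "c \<le> \<zeta> x" using low(2) by auto
        then have "u x \<tau> * c \<le> u x \<tau> * \<zeta> x" using elim by (intro mult_left_mono) auto
        then have "u x \<tau> \<le> u x \<tau> * \<zeta> x / c" using low(1) by (simp add: pos_le_divide_eq)
        then show ?thesis using True x by (simp add: ennreal_leI)
      qed simp
    qed
  qed
  also have "\<dots> = ennreal ((\<integral>x. indicator K x * (u x \<tau> * \<zeta> x) / c \<partial>lebesgue))"
  proof (rule nn_integral_eq_integral)
    show "integrable lebesgue (\<lambda>x. indicator K x * (u x \<tau> * \<zeta> x) / c)" by (intro integrable_divide mass_integrable[OF \<tau>])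
    show "AE x in lebesgue. 0 \<le> indicator K x * (u x \<tau> * \<zeta> x) / c"
      using mass_AE_nonneg[OF \<tau>] by eventually_elim (use low in \<open>simp add: divide_nonneg_pos\<close>)
  qed
  finally show "(\<integral>\<^sup>+x\<in>P. ennreal (u x \<tau>) \<partial>lebesgue) \<le> ennreal (mass \<tau> / c)" by (simp add: mass_def)
  show "ennreal (mass \<tau>) \<le> (\<integral>\<^sup>+x\<in>Q. ennreal (u x \<tau>) \<partial>lebesgue)"
    unfolding eq[symmetric]
  proof (rule nn_integral_mono_AE)
    show "AE x in lebesgue. ennreal (indicator K x * (u x \<tau> * \<zeta> x)) \<le> ennreal (u x \<tau>) * indicator Q x"
      using pos
    proof eventually_elim
      case (elim x)
      show ?case
      proof (cases "x \<in> K")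
        case True
        then have "u x \<tau> * \<zeta> x \<le> u x \<tau> * 1" using elim \<zeta>(3) by (intro mult_left_mono) auto
        then show ?thesis using True Q by (auto simp: ennreal_leI)
      qed simp
    qed
  qed
qed

section \<open>Nested boxes and the final choice of constants\<close>

definition symmetric_box :: "real \<Rightarrow> ('n::finite \<Rightarrow> real) \<Rightarrow> (real^'n) set" where
  "symmetric_box c L = cbox (\<chi> i. - c * L i) (\<chi> i. c * L i)"

lemma mem_symmetric_box: "x \<in> symmetric_box c L \<longleftrightarrow> (\<forall>i. \<bar>x $ i\<bar> \<le> c * L i)"
  by (auto simp: symmetric_box_def mem_box_cart abs_le_iff) (metis minus_le_iff mult_minus_left)+

lemma symmetric_box_interior:
  assumes "c < c'" "\<And>i. 0 < L i"
  shows "symmetric_box c L \<subseteq> interior (symmetric_box c' L)"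
proof
  fix x assume x: "x \<in> symmetric_box c L"
  have "\<bar>x $ i\<bar> < c' * L i" for i
  proof -
    have "\<bar>x $ i\<bar> \<le> c * L i" using x by (simp add: mem_symmetric_box)
    also have "\<dots> < c' * L i" using assms by simp
    finally show ?thesis .
  qed
  then show "x \<in> interior (symmetric_box c' L)"
    by (simp add: symmetric_box_def interior_cbox mem_box_cart abs_less_iff minus_less_iff)
qed

lemma measure_symmetric_box:
  assumes "0 \<le> c" "\<And>i. 0 < L i"
  shows "measure lborel (symmetric_box c (L :: 'n::finite \<Rightarrow> real)) = (2 * c) ^ CARD('n) * (\<Prod>i\<in>UNIV. L i)"
proof -
  have "- c * L i \<le> c * L i" for i using assms by (simp add: mult_nonneg_nonneg less_imp_le)
  then have "cbox (\<chi> i. - c * L i) (\<chi> i. c * L i) \<noteq> {}" by (auto simp: interval_ne_empty_cart)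
  then have "measure lborel (symmetric_box c L) = (\<Prod>i\<in>UNIV. 2 * c * L i)"
    unfolding symmetric_box_def by (subst content_cbox_cart) (auto intro!: prod.cong)
  then show ?thesis by (simp add: prod.distrib)
qed

theorem theorem2p1:
  fixes p :: "'n::{finite,linorder} \<Rightarrow> real" and C\<^sub>o C\<^sub>1 :: real
  assumes "\<And>i. 1 < p i" and "\<And>i. p i < 2" and "mono p"
    and "hmean p < real CARD('n)"
    and "C\<^sub>o > 0" and "C\<^sub>1 > 0"
  shows "\<exists>\<gamma>>0. \<forall>(\<Omega> :: (real, 'n) vec set) T C
      (A :: (real, 'n) vec \<Rightarrow> real \<Rightarrow> real \<Rightarrow> (real, 'n) vec \<Rightarrow> (real, 'n) vec)
      (B :: (real, 'n) vec \<Rightarrow> real \<Rightarrow> real \<Rightarrow> (real, 'n) vec \<Rightarrow> real)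
      (u :: (real, 'n) vec \<Rightarrow> real \<Rightarrow> real) t \<rho>.
    open \<Omega> \<and> bounded \<Omega> \<and> T > 0 \<and> C \<ge> 0 \<and>
    caratheodory (\<Omega> \<times> {0..T}) A \<and> caratheodory (\<Omega> \<times> {0..T}) B \<and>
    structure_conditions p C\<^sub>o C\<^sub>1 C (\<Omega> \<times> {0..T}) A B \<and>
    local_weak_solution p A B \<Omega> T u \<and>
    (AE (x, \<tau>) in lebesgue. (x, \<tau>) \<in> \<Omega> \<times> {0..T} \<longrightarrow> 0 \<le> u x \<tau>) \<and>
    t > 0 \<and> \<rho> > 0 \<and> intrinsic_cube p 2 \<rho> t \<times> {0..t} \<subseteq> \<Omega> \<times> {0..T} \<longrightarrow>
    (let \<nu> = (t / \<rho> powr hmean p) powr (1 / (2 - hmean p));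
         lam = real CARD('n) * (hmean p - 2) + hmean p
     in (\<exists>i. C powr p i * \<rho> powr hmean p > Min {1, \<nu> powr (hmean p - p i), \<nu> powr hmean p}) \<or>
        (SUP \<tau>\<in>{0..t}. \<integral>\<^sup>+x\<in>intrinsic_cube p 1 \<rho> t. ennreal (u x \<tau>) \<partial>lebesgue)
          \<le> ennreal \<gamma> * (INF \<tau>\<in>{0..t}. \<integral>\<^sup>+x\<in>intrinsic_cube p 2 \<rho> t. ennreal (u x \<tau>) \<partial>lebesgue)
            + ennreal (\<gamma> * (t / \<rho> powr lam) powr (1 / (2 - hmean p))))"
proof -
  note p = assms(1,2)
  obtain \<alpha> k where \<alpha>: "0 < \<alpha>" "\<alpha> < 1" and k: "2 \<le> k" "2 * (1 / real k) \<le> \<alpha>"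
    and \<beta>: "\<And>i. (1 + \<alpha>) * (p i - 1) \<le> 1 - 2 * (1 / real k)"
    by (rule exponents_exist[where p = p, OF p]) (rule that)
  have \<kappa>: "0 < 1 / real k" using k(1) by simp
  show ?thesis
  proof (rule cutoff_exists[OF k(1), where ?'n = 'n])
    fix M :: real assume M: "0 < M" and cutoff: "\<And>L :: 'n \<Rightarrow> real. (\<And>i. 0 < L i) \<Longrightarrow> \<exists>\<zeta> :: (real, 'n) vec \<Rightarrow> real. C_k 1 \<zeta>
        \<and> (\<forall>x. 0 \<le> \<zeta> x \<and> \<zeta> x \<le> 1)
        \<and> (\<forall>x. (\<forall>i. \<bar>x $ i\<bar> \<le> L i) \<longrightarrow> (1/2) ^ k \<le> \<zeta> x)
        \<and> (\<forall>x. \<not> (\<forall>i. \<bar>x $ i\<bar> \<le> 3/2 * L i) \<longrightarrow> \<zeta> x = 0)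
        \<and> (\<forall>x i. \<bar>dir_deriv (axis i 1) \<zeta> x\<bar> \<le> M / L i * \<zeta> x powr (1 - 1 / real k))"
    \<comment> \<open>The half allowed by \<open>mass_harnack\<close> is split evenly:
      \<open>1 / 4\<close> for \<delta> here, and \<open>1 / 4\<close> for
      \<open>\<Lambda> * \<eta> / (1 - \<alpha>)\<close> below.\<close>
    have d4: "(0::real) < 1 / 4" by simp
    define \<Lambda> where "\<Lambda> = 2 * (C\<^sub>1 * M + 1) / (\<alpha> * C\<^sub>o)"
    have \<Lambda>: "0 < \<Lambda>" unfolding \<Lambda>_def using M \<alpha> assms(5,6) by (simp add: add_pos_pos)
    show ?thesis
    proof (rule coercivity_bound[where p = p, OF p \<alpha> \<kappa> k(2) \<beta> assms(5,6) M d4, folded \<Lambda>_def])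
      fix \<Gamma> :: real assume \<Gamma>: "0 < \<Gamma>" and bound: "\<And>z w \<nu> t C b (L :: 'n \<Rightarrow> real) a d \<xi>.
          \<lbrakk> 0 \<le> z; z \<le> 1; \<nu> \<le> w; 0 < \<nu>; 0 < t; \<And>i. 0 < L i;
            \<And>i. L i powr (- p i) = \<nu> powr (2 - p i) / t;
            0 \<le> C; \<And>i. C * L i \<le> 1; \<And>i. C * L i \<le> \<nu>;
            \<And>i. C\<^sub>o * \<bar>\<xi> i\<bar> powr p i - C powr p i \<le> a i * \<xi> i;
            \<And>i. \<bar>a i\<bar> \<le> C\<^sub>1 * \<bar>\<xi> i\<bar> powr (p i - 1) + C powr (p i - 1);
            \<bar>b\<bar> \<le> (\<Sum>i\<in>UNIV. C * (\<bar>\<xi> i\<bar> powr (p i - 1) + C powr (p i - 1)));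
            \<And>i. \<bar>d i\<bar> \<le> M / L i * z powr (1 - 1 / real k) \<rbrakk>
          \<Longrightarrow> (\<Sum>i\<in>UNIV. \<bar>a i\<bar> * \<bar>d i\<bar>) + \<bar>b\<bar> * z
            \<le> \<Lambda> * \<nu> powr \<alpha> *
                (b * (w powr (- \<alpha>) * z)
                 - (\<Sum>i\<in>UNIV. a i * (- \<alpha> * w powr (- \<alpha> - 1) * \<xi> i * z + w powr (- \<alpha>) * d i)))
              + (1 / 4 * (w * z) + \<Gamma> * \<nu>) / t"
      define \<eta> where "\<eta> = (1 - \<alpha>) / (4 * \<Lambda>)"
      have "\<Lambda> * \<eta> = 1 / 4 * (1 - \<alpha>)" using \<Lambda> by (simp add: \<eta>_def)
      then have "\<Lambda> * \<eta> / (1 - \<alpha>) = 1 / 4" using \<alpha> by (simp only: nonzero_mult_div_cancel_right)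
      then have \<eta>: "\<Lambda> * \<eta> / (1 - \<alpha>) + 1 / 4 \<le> 1 / 2" by linarith
      have \<eta>0: "0 < \<eta>" using \<Lambda> \<alpha> by (simp add: \<eta>_def)
      define D where "D = 2 * (\<Lambda> * (\<eta> + \<eta> powr (- (1 - \<alpha>) / \<alpha>)) / (1 - \<alpha>) + 1 / 4 + \<Gamma>)"
      have D: "0 < D" unfolding D_def using \<Lambda> \<Gamma> \<eta>0 \<alpha>
        by (intro mult_pos_pos add_nonneg_pos add_pos_pos add_nonneg_nonneg divide_nonneg_nonneg mult_nonneg_nonneg) auto
      \<comment> \<open>\<open>2 ^ k\<close> compensates the lower bound \<open>(1/2) ^ k\<close> of
        the cutoff on the small cube, the \<open>2\<close> and \<open>D\<close> come from
        \<open>mass_harnack\<close>, and \<open>(7/2) ^ CARD('n)\<close> is the volume factor of the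
        box with half-sides \<open>7/4 * L i\<close>.\<close>
      define \<gamma> where "\<gamma> = 2 ^ k * (2 + D * (7/2) ^ CARD('n))"
      have "2 ^ k * 2 \<le> \<gamma>" "2 ^ k * (D * (7/2) ^ CARD('n)) \<le> \<gamma>" using D by (simp_all add: \<gamma>_def)
      note \<gamma> = this
      have \<gamma>0: "0 < \<gamma>" unfolding \<gamma>_def using D by (simp add: add_pos_pos)
      show ?thesis
        unfolding Let_def
      proof (intro exI[of _ \<gamma>] conjI \<gamma>0 allI impI disjCI)
        fix \<Omega> :: "((real, 'n) vec) set" and T C A B u t \<rho>
        let ?\<nu> = "(t / \<rho> powr hmean p) powr (1 / (2 - hmean p))"
        assume H: "open \<Omega> \<and> bounded \<Omega> \<and> T > 0 \<and> C \<ge> 0 \<and>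
          caratheodory (\<Omega> \<times> {0..T}) A \<and> caratheodory (\<Omega> \<times> {0..T}) B \<and>
          structure_conditions p C\<^sub>o C\<^sub>1 C (\<Omega> \<times> {0..T}) A B \<and>
          local_weak_solution p A B \<Omega> T u \<and>
          (AE (x, \<tau>) in lebesgue. (x, \<tau>) \<in> \<Omega> \<times> {0..T} \<longrightarrow> 0 \<le> u x \<tau>) \<and>
          t > 0 \<and> \<rho> > 0 \<and> intrinsic_cube p 2 \<rho> t \<times> {0..t} \<subseteq> \<Omega> \<times> {0..T}"
        let ?S = "SUP \<tau>\<in>{0..t}. \<integral>\<^sup>+x\<in>intrinsic_cube p 1 \<rho> t. ennreal (u x \<tau>) \<partial>lebesgue"
        let ?I = "INF \<tau>\<in>{0..t}. \<integral>\<^sup>+x\<in>intrinsic_cube p 2 \<rho> t. ennreal (u x \<tau>) \<partial>lebesgue"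
        assume "\<not> ?S \<le> ennreal \<gamma> * ?I
          + ennreal (\<gamma> * (t / \<rho> powr (real CARD('n) * (hmean p - 2) + hmean p)) powr (1 / (2 - hmean p)))"
        moreover have "?S \<le> ennreal \<gamma> * ?I
          + ennreal (\<gamma> * (t / \<rho> powr (real CARD('n) * (hmean p - 2) + hmean p)) powr (1 / (2 - hmean p)))"
          if small: "\<And>i. C powr p i * \<rho> powr hmean p \<le> Min {1, ?\<nu> powr (hmean p - p i), ?\<nu> powr hmean p}"
        proof -
          have T: "0 < T" and C: "0 \<le> C" and t: "0 < t" "0 < \<rho>" using H by blast+
          define L where "L = intrinsic_side p \<rho> t"
          define \<nu> where "\<nu> = ?\<nu>"
          note scale = intrinsic_scaling[where p = p, OF p t, folded L_def \<nu>_def]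
          have \<nu>0: "0 < \<nu>" using t by (simp add: \<nu>_def)
          have CL: "C * L i \<le> 1" "C * L i \<le> \<nu>" for i
            using lower_order_scaling[where p = p, OF p t C small, of i] by (simp_all add: L_def \<nu>_def)
          have cube: "intrinsic_cube p c \<rho> t = {x. \<forall>i. \<bar>x $ i\<bar> < c * L i}" for c by (simp add: intrinsic_cube_side L_def)
          \<comment> \<open>A nonempty cube is needed to split the inclusion of products into one
            for space and one for time.\<close>
          have "0 \<in> intrinsic_cube p 2 \<rho> t" unfolding cube using scale(1) by simp
          moreover have "intrinsic_cube p 2 \<rho> t \<times> {0..t} \<subseteq> \<Omega> \<times> {0..T}" using H by blast
          ultimately have "intrinsic_cube p 2 \<rho> t \<subseteq> \<Omega> \<and> {0..t} \<subseteq> {0..T}" using t unfolding times_subset_iff by auto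
          then have \<Omega>: "intrinsic_cube p 2 \<rho> t \<subseteq> \<Omega>" and tT: "t \<le> T" using t by auto
          obtain \<zeta> :: "(real, 'n) vec \<Rightarrow> real" where cut: "C_k 1 \<zeta>" "\<And>x. 0 \<le> \<zeta> x" "\<And>x. \<zeta> x \<le> 1"
            "\<And>x. (\<forall>i. \<bar>x $ i\<bar> \<le> L i) \<Longrightarrow> (1/2) ^ k \<le> \<zeta> x" "\<And>x. \<not> (\<forall>i. \<bar>x $ i\<bar> \<le> 3/2 * L i) \<Longrightarrow> \<zeta> x = 0"
            "\<And>x i. \<bar>dir_deriv (axis i 1) \<zeta> x\<bar> \<le> M / L i * \<zeta> x powr (1 - 1 / real k)"
            using cutoff[of L, OF scale(1)] by blast
          have "local_weak_supersolution p A B \<Omega> T u" "local_weak_subsolution p A B \<Omega> T u"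
            using H unfolding local_weak_solution_def by blast+
          then obtain Du Du' where uC: "C_L2_loc {0..T} \<Omega> u" and Du: "Lp_W1p_loc p \<Omega> T u Du" "Lp_W1p_loc p \<Omega> T u Du'"
            and super: "\<And>K t\<^sub>1 t\<^sub>2 \<phi> \<phi>\<^sub>t D\<phi>. compact K \<and> K \<subseteq> \<Omega> \<and> 0 \<le> t\<^sub>1 \<and> t\<^sub>1 \<le> t\<^sub>2 \<and> t\<^sub>2 \<le> T \<and>
              admissible_test p A B T u Du K t\<^sub>1 t\<^sub>2 \<phi> \<phi>\<^sub>t D\<phi> \<longrightarrow>
              weak_lhs A u Du K t\<^sub>1 t\<^sub>2 \<phi> \<phi>\<^sub>t D\<phi> \<ge> weak_rhs B u Du K t\<^sub>1 t\<^sub>2 \<phi>"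
            and sub: "\<And>K t\<^sub>1 t\<^sub>2 \<phi> \<phi>\<^sub>t D\<phi>. compact K \<and> K \<subseteq> \<Omega> \<and> 0 \<le> t\<^sub>1 \<and> t\<^sub>1 \<le> t\<^sub>2 \<and> t\<^sub>2 \<le> T \<and>
              admissible_test p A B T u Du' K t\<^sub>1 t\<^sub>2 \<phi> \<phi>\<^sub>t D\<phi> \<longrightarrow>
              weak_lhs A u Du' K t\<^sub>1 t\<^sub>2 \<phi> \<phi>\<^sub>t D\<phi> \<le> weak_rhs B u Du' K t\<^sub>1 t\<^sub>2 \<phi>"
            unfolding local_weak_supersolution_def local_weak_subsolution_def by auto
          have sub2: "symmetric_box c L \<subseteq> intrinsic_cube p 2 \<rho> t" if "c < 2" for c
            using symmetric_box_interior[of c 2 L, OF that scale(1)]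
            by (auto simp: cube symmetric_box_def interior_cbox mem_box_cart abs_less_iff minus_less_iff)
          \<comment> \<open>The factors \<open>3/2 < 7/4 < 15/8 < 2\<close> fit the support of the
            cutoff, the test domain and the room for mollification strictly inside the open cube,
            whose closure need not lie in \<Omega>.\<close>
          interpret cutoff_setting p C\<^sub>o C\<^sub>1 C T \<Omega> "symmetric_box (7/4) L" "symmetric_box (15/8) L" "symmetric_box (3/2) L" A B u Du Du' \<zeta>
          proof
            show "1 < p i" "p i < 2" for i by (rule p)+
            show "0 \<le> C" "0 < C\<^sub>1" "0 < T" by (rule C assms(6) T)+
            show "compact (symmetric_box (15/8) L)" "compact (symmetric_box (7/4) L)" "compact (symmetric_box (3/2) L)"
              by (simp_all add: symmetric_box_def compact_cbox)
            show "symmetric_box (15/8) L \<subseteq> \<Omega>" using sub2[of "15/8"] \<Omega> by simp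
            show "symmetric_box (7/4) L \<subseteq> interior (symmetric_box (15/8) L)" "symmetric_box (3/2) L \<subseteq> interior (symmetric_box (7/4) L)"
              by (intro symmetric_box_interior scale(1); simp)+
            show "caratheodory (\<Omega> \<times> {0..T}) A" "caratheodory (\<Omega> \<times> {0..T}) B" "structure_conditions p C\<^sub>o C\<^sub>1 C (\<Omega> \<times> {0..T}) A B"
              "AE (x, \<tau>) in lebesgue. (x, \<tau>) \<in> \<Omega> \<times> {0..T} \<longrightarrow> 0 \<le> u x \<tau>" using H by blast+
            show "C_L2_loc {0..T} \<Omega> u" "Lp_W1p_loc p \<Omega> T u Du" "Lp_W1p_loc p \<Omega> T u Du'" by (rule uC Du)+
            show "weak_lhs A u Du K t\<^sub>1 t\<^sub>2 \<phi> \<phi>\<^sub>t D\<phi> \<ge> weak_rhs B u Du K t\<^sub>1 t\<^sub>2 \<phi>"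
              if "compact K" "K \<subseteq> \<Omega>" "0 \<le> t\<^sub>1" "t\<^sub>1 \<le> t\<^sub>2" "t\<^sub>2 \<le> T" "admissible_test p A B T u Du K t\<^sub>1 t\<^sub>2 \<phi> \<phi>\<^sub>t D\<phi>"
              for K t\<^sub>1 t\<^sub>2 \<phi> \<phi>\<^sub>t D\<phi> by (rule super[rule_format]) (intro conjI that)
            show "weak_lhs A u Du' K t\<^sub>1 t\<^sub>2 \<phi> \<phi>\<^sub>t D\<phi> \<le> weak_rhs B u Du' K t\<^sub>1 t\<^sub>2 \<phi>"
              if "compact K" "K \<subseteq> \<Omega>" "0 \<le> t\<^sub>1" "t\<^sub>1 \<le> t\<^sub>2" "t\<^sub>2 \<le> T" "admissible_test p A B T u Du' K t\<^sub>1 t\<^sub>2 \<phi> \<phi>\<^sub>t D\<phi>"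
              for K t\<^sub>1 t\<^sub>2 \<phi> \<phi>\<^sub>t D\<phi> by (rule sub[rule_format]) (intro conjI that)
            show "C_k 1 \<zeta>" "0 \<le> \<zeta> x" "\<zeta> x \<le> 1" for x by (rule cut)+
            show "\<zeta> x = 0" if "x \<notin> symmetric_box (3/2) L" for x using that by (intro cut(5)) (simp add: mem_symmetric_box)
          qed
          have vol: "vol = (7/2) ^ CARD('n) * \<rho> powr real CARD('n)"
            by (subst measure_symmetric_box) (simp_all add: scale(1,4))
          \<comment> \<open>The least mass bounds the integral over the large cube from below at all
            times simultaneously, hence also the infimum.\<close>
          obtain \<tau>\<^sub>2 where \<tau>\<^sub>2: "\<tau>\<^sub>2 \<in> {0..t}" "\<And>s. s \<in> {0..t} \<Longrightarrow> mass \<tau>\<^sub>2 \<le> mass s"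
            using continuous_attains_inf[OF compact_Icc _ continuous_on_subset[OF mass_continuous], of 0 t] t tT by fastforce
          have harnack: "mass \<tau> \<le> 2 * mass \<tau>\<^sub>2 + D * \<nu> * vol" if \<tau>: "\<tau> \<in> {0..t}" for \<tau>
            unfolding D_def
          proof (rule mass_harnack[where L = L, OF \<nu>0 \<alpha> \<eta>0 _ _ _ t(1) tT _ cut(6) \<eta> \<tau> \<tau>\<^sub>2(1)])
            show "0 \<le> \<Lambda>" "0 \<le> \<Gamma>" "(0::real) \<le> 1 / 4" using \<Lambda> \<Gamma> by simp_all
          next
            fix z w b :: real and a d \<xi> :: "'n \<Rightarrow> real"
            assume "0 \<le> z" "z \<le> 1" "\<nu> \<le> w"
              and 1: "\<And>i. C\<^sub>o * \<bar>\<xi> i\<bar> powr p i - C powr p i \<le> a i * \<xi> i"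
                "\<And>i. \<bar>a i\<bar> \<le> C\<^sub>1 * \<bar>\<xi> i\<bar> powr (p i - 1) + C powr (p i - 1)"
                "\<bar>b\<bar> \<le> (\<Sum>i\<in>UNIV. C * (\<bar>\<xi> i\<bar> powr (p i - 1) + C powr (p i - 1)))"
                "\<And>i. \<bar>d i\<bar> \<le> M / L i * z powr (1 - 1 / real k)"
            from bound[where L = L and a = a and d = d and \<xi> = \<xi>, OF this(1-3) \<nu>0 t(1) scale(1) scale(3) C(1) CL 1]
            show "(\<Sum>i\<in>UNIV. \<bar>a i\<bar> * \<bar>d i\<bar>) + \<bar>b\<bar> * z
              \<le> \<Lambda> * \<nu> powr \<alpha> *
                (b * (w powr (- \<alpha>) * z)
                 - (\<Sum>i\<in>UNIV. a i * (- \<alpha> * w powr (- \<alpha> - 1) * \<xi> i * z + w powr (- \<alpha>) * d i)))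
              + (1 / 4 * (w * z) + \<Gamma> * \<nu>) / t" .
          qed
          have comp: "(\<integral>\<^sup>+x\<in>intrinsic_cube p 1 \<rho> t. ennreal (u x \<tau>) \<partial>lebesgue) \<le> ennreal (mass \<tau> / (1/2) ^ k)"
            "ennreal (mass \<tau>) \<le> (\<integral>\<^sup>+x\<in>intrinsic_cube p 2 \<rho> t. ennreal (u x \<tau>) \<partial>lebesgue)" if \<tau>: "\<tau> \<in> {0..t}" for \<tau>
          proof -
            have low: "x \<in> symmetric_box (7/4) L \<and> (1/2) ^ k \<le> \<zeta> x" if "x \<in> intrinsic_cube p 1 \<rho> t" for x
            proof
              have x: "\<bar>x $ i\<bar> \<le> L i" for i using that by (auto simp: cube less_imp_le)
              then show "(1/2) ^ k \<le> \<zeta> x" by (intro cut(4)) simp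
              have "\<bar>x $ i\<bar> \<le> 7/4 * L i" for i using x[of i] scale(1)[of i] by linarith
              then show "x \<in> symmetric_box (7/4) L" by (simp add: mem_symmetric_box)
            qed
            have \<tau>T: "\<tau> \<in> {0..T}" using \<tau> tT by auto
            have half: "(0::real) < (1/2) ^ k" by simp
            note cmp = integral_comparison[OF \<tau>T sub2[of "7/4"] half low]
            show "(\<integral>\<^sup>+x\<in>intrinsic_cube p 1 \<rho> t. ennreal (u x \<tau>) \<partial>lebesgue) \<le> ennreal (mass \<tau> / (1/2) ^ k)" by (rule cmp(1)) simp_all
            show "ennreal (mass \<tau>) \<le> (\<integral>\<^sup>+x\<in>intrinsic_cube p 2 \<rho> t. ennreal (u x \<tau>) \<partial>lebesgue)" by (rule cmp(2)) simp_all
          qed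
          have inf: "ennreal (mass \<tau>\<^sub>2) \<le> ?I"
            by (rule INF_greatest) (rule order_trans[OF ennreal_leI[OF \<tau>\<^sub>2(2)] comp(2)])
          have m0: "0 \<le> mass \<tau>\<^sub>2" using \<tau>\<^sub>2(1) tT by (intro mass_nonneg) auto
          have last: "mass \<tau> / (1/2) ^ k \<le> \<gamma> * mass \<tau>\<^sub>2 + \<gamma> * (\<nu> * \<rho> powr real CARD('n))" if \<tau>: "\<tau> \<in> {0..t}" for \<tau>
          proof -
            have "mass \<tau> / (1/2) ^ k = 2 ^ k * mass \<tau>" by (simp add: power_divide)
            also have "\<dots> \<le> 2 ^ k * (2 * mass \<tau>\<^sub>2 + D * \<nu> * vol)" using harnack[OF \<tau>] by (intro mult_left_mono) auto
            also have "\<dots> = (2 ^ k * 2) * mass \<tau>\<^sub>2 + (2 ^ k * (D * (7/2) ^ CARD('n))) * (\<nu> * \<rho> powr real CARD('n))"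
              unfolding vol by (simp add: algebra_simps)
            also have "\<dots> \<le> \<gamma> * mass \<tau>\<^sub>2 + \<gamma> * (\<nu> * \<rho> powr real CARD('n))"
              using m0 \<nu>0 by (intro add_mono mult_right_mono \<gamma>) auto
            finally show ?thesis .
          qed
          have "?S \<le> ennreal (\<gamma> * mass \<tau>\<^sub>2 + \<gamma> * (\<nu> * \<rho> powr real CARD('n)))"
            by (rule SUP_least) (rule order_trans[OF comp(1) ennreal_leI[OF last]])
          also have "\<dots> = ennreal \<gamma> * ennreal (mass \<tau>\<^sub>2) + ennreal (\<gamma> * (\<nu> * \<rho> powr real CARD('n)))"
            using \<gamma>0 m0 \<nu>0 by (simp add: ennreal_plus ennreal_mult)
          also have "\<dots> \<le> ennreal \<gamma> * ?I + ennreal (\<gamma> * (\<nu> * \<rho> powr real CARD('n)))"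
            by (intro add_right_mono mult_left_mono inf) simp
          finally show ?thesis unfolding scale(5) .
        qed
        ultimately show "\<exists>i. C powr p i * \<rho> powr hmean p > Min {1, ?\<nu> powr (hmean p - p i), ?\<nu> powr hmean p}"
          using not_less by blast
      qed
    qed
  qed
qed

end
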